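(* Let $G$ be a locally compact group. Suppose that $G$ contains a nondiscrete free subgroup $F$ of finite rank $r>1$. Then $G$ has a subgroup $\Gamma$ containing $F$ such that $\Gamma$ is isomorphic to the fundamental group of a closed oriented surface of genus $2r$. In particular, if a nondiscrete locally compact group $G$ has a dense free subgroup of finite rank, then $G$ has a dense subgroup which is a surface group.
   Context: Topological groups are assumed to be Hausdorff. A free group means a nonabelian free group, i.e. a free group on at least two generators. A surface group is a group isomorphic to the fundamental group of a closed oriented surface of genus at least $2$. A subgroup $F\le G$ is nondiscrete if the subspace topology induced on $F$ by $G$ is not the discrete topology. Subgroups are abstract subgroups (not necessarily closed). *)

theory Defs
  imports "HOL-Analysis.Analysis" "HOL-Algebra.Group"
begin

section \<open>Topological groups\<close>

text \<open>Topological groups are Hausdorff by convention.\<close>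

locale topological_group = group G for G (structure) +
  fixes T :: "'a topology"
  assumes topspace_eq_carrier: "topspace T = carrier G"
    and continuous_mult: "continuous_map (prod_topology T T) T (\<lambda>(x, y). x \<otimes> y)"
    and continuous_inv: "continuous_map T T (\<lambda>x. inv x)"
    and Hausdorff: "Hausdorff_space T"

abbreviation discrete_subset :: "'a topology \<Rightarrow> 'a set \<Rightarrow> bool"
  where "discrete_subset T S \<equiv> subtopology T S = discrete_topology S"

abbreviation dense_subset :: "'a topology \<Rightarrow> 'a set \<Rightarrow> bool"
  where "dense_subset T S \<equiv> T closure_of S = topspace T"

abbreviation subgroup_monoid :: "('a, 'b) monoid_scheme \<Rightarrow> 'a set \<Rightarrow> ('a, 'b) monoid_scheme"
  where "subgroup_monoid G H \<equiv> G\<lparr>carrier := H\<rparr>"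


section \<open>Free groups\<close>

text \<open>The letter \<open>(a, True)\<close> stands for the generator \<open>a\<close> and \<open>(a, False)\<close> for its formal inverse.\<close>

type_synonym 'a letter = "'a \<times> bool"

definition inv_letter :: "'a letter \<Rightarrow> 'a letter"
  where "inv_letter x = (fst x, \<not> snd x)"

fun reduced :: "'a letter list \<Rightarrow> bool" where
  "reduced [] \<longleftrightarrow> True"
| "reduced [x] \<longleftrightarrow> True"
| "reduced (x # y # w) \<longleftrightarrow> y \<noteq> inv_letter x \<and> reduced (y # w)"

fun cancel_cons :: "'a letter \<Rightarrow> 'a letter list \<Rightarrow> 'a letter list" where
  "cancel_cons x [] = [x]"
| "cancel_cons x (y # w) = (if y = inv_letter x then w else x # y # w)"

text \<open>For a reduced word \<open>v\<close>, the word \<open>foldr cancel_cons u v\<close> is the reduced form of the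
  concatenation \<open>u @ v\<close>.\<close>

definition free_group :: "'a set \<Rightarrow> 'a letter list monoid"
  where "free_group S =
    \<lparr>carrier = {w. reduced w \<and> set w \<subseteq> S \<times> UNIV}, mult = foldr cancel_cons, one = []\<rparr>"

definition free_of_rank :: "nat \<Rightarrow> ('a, 'b) monoid_scheme \<Rightarrow> bool"
  where "free_of_rank r F \<longleftrightarrow> F \<cong> free_group {..<r}"

lemma inv_letter_inv_letter [simp]: "inv_letter (inv_letter x) = x"
  by (simp add: inv_letter_def)

lemma reduced_Cons: "reduced (x # w) \<longleftrightarrow> (w = [] \<or> hd w \<noteq> inv_letter x) \<and> reduced w"
  by (cases w) auto

lemma reduced_cancel_cons: "reduced w \<Longrightarrow> reduced (cancel_cons x w)"
  by (cases w) (auto simp: reduced_Cons)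

lemma cancel_cons_inverse: "reduced w \<Longrightarrow> cancel_cons x (cancel_cons (inv_letter x) w) = w"
  by (cases w; cases "tl w") auto

lemma reduced_foldr_cancel_cons: "reduced v \<Longrightarrow> reduced (foldr cancel_cons u v)"
  by (induction u) (auto simp: reduced_cancel_cons)

lemma foldr_cancel_cons_assoc:
  assumes "reduced w"
  shows "foldr cancel_cons (foldr cancel_cons u v) w = foldr cancel_cons u (foldr cancel_cons v w)"
proof (induction u)
  case (Cons x u)
  define z where "z = foldr cancel_cons u v"
  have "foldr cancel_cons (cancel_cons x z) w = cancel_cons x (foldr cancel_cons z w)"
    using assms
    by (cases z) (auto simp: cancel_cons_inverse reduced_foldr_cancel_cons)
  then show ?case
    using Cons by (simp add: z_def)
qed simp

lemma foldr_cancel_cons_Nil: "reduced w \<Longrightarrow> foldr cancel_cons w [] = w"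
proof (induction w)
  case (Cons x w)
  then show ?case
    by (cases w) auto
qed simp

lemma set_cancel_cons: "set (cancel_cons x w) \<subseteq> insert x (set w)"
  by (cases w) auto

lemma set_foldr_cancel_cons: "set (foldr cancel_cons u v) \<subseteq> set u \<union> set v"
proof (induction u)
  case (Cons x u)
  then show ?case
    using set_cancel_cons[of x "foldr cancel_cons u v"] by auto
qed simp

lemma foldr_cancel_cons_left_inverse:
  "reduced w \<Longrightarrow> foldr cancel_cons (rev (map inv_letter u)) (foldr cancel_cons u w) = w"
proof (induction u)
  case (Cons x u)
  then show ?case
    using cancel_cons_inverse[of "foldr cancel_cons u w" "inv_letter x"]
    by (simp add: reduced_foldr_cancel_cons)
qed simp

lemma group_free_group: "group (free_group S)"
proof (rule groupI)
  fix x assume x: "x \<in> carrier (free_group S)"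
  define y where "y = foldr cancel_cons (rev (map inv_letter x)) []"
  have "set (rev (map inv_letter x)) \<subseteq> S \<times> UNIV"
    using x by (auto simp: free_group_def inv_letter_def)
  then have "y \<in> carrier (free_group S)"
    using set_foldr_cancel_cons[of "rev (map inv_letter x)" "[]"]
    by (auto simp: free_group_def y_def reduced_foldr_cancel_cons)
  moreover have "foldr cancel_cons y x = []"
    using x foldr_cancel_cons_left_inverse[of "[]" x]
    by (simp add: y_def free_group_def foldr_cancel_cons_assoc foldr_cancel_cons_Nil)
  ultimately show "\<exists>y\<in>carrier (free_group S). y \<otimes>\<^bsub>free_group S\<^esub> x = \<one>\<^bsub>free_group S\<^esub>"
    by (auto simp: free_group_def)
next
  fix x y assume "x \<in> carrier (free_group S)" "y \<in> carrier (free_group S)"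
  then show "x \<otimes>\<^bsub>free_group S\<^esub> y \<in> carrier (free_group S)"
    using set_foldr_cancel_cons[of x y]
    by (auto simp: free_group_def reduced_foldr_cancel_cons)
qed (auto simp: free_group_def foldr_cancel_cons_assoc)


section \<open>The fundamental group of a topological space\<close>

definition loops_at :: "'a topology \<Rightarrow> 'a \<Rightarrow> (real \<Rightarrow> 'a) set"
  where "loops_at X x = {p. pathin X p \<and> p 0 = x \<and> p 1 = x}"

text \<open>Homotopy relative to the end points.  Two functions that agree on \<open>{0..1}\<close> are homotopic, so
  the values of a loop outside the unit interval are irrelevant.\<close>

definition loop_homotopy :: "'a topology \<Rightarrow> 'a \<Rightarrow> ((real \<Rightarrow> 'a) \<times> (real \<Rightarrow> 'a)) set"
  where "loop_homotopy X x =
    {(p, q). homotopic_with (\<lambda>h. h 0 = x \<and> h 1 = x) (top_of_set {0..1}) X p q}"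

definition loop_join :: "(real \<Rightarrow> 'a) \<Rightarrow> (real \<Rightarrow> 'a) \<Rightarrow> real \<Rightarrow> 'a"
  where "loop_join p q = (\<lambda>t. if t \<le> 1/2 then p (2 * t) else q (2 * t - 1))"

definition fundamental_group :: "'a topology \<Rightarrow> 'a \<Rightarrow> (real \<Rightarrow> 'a) set monoid"
  where "fundamental_group X x =
    \<lparr>carrier = loops_at X x // loop_homotopy X x,
     mult = (\<lambda>A B. \<Union>p\<in>A. \<Union>q\<in>B. loop_homotopy X x `` {loop_join p q}),
     one = loop_homotopy X x `` {\<lambda>_. x}\<rparr>"

lemma loop_homotopyD: "(p, q) \<in> loop_homotopy X x \<Longrightarrow> p \<in> loops_at X x \<and> q \<in> loops_at X x"
  using homotopic_with_imp_continuous_maps[of "\<lambda>h. h 0 = x \<and> h 1 = x" "top_of_set {0..1}" X p q]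
    homotopic_with_imp_property[of "\<lambda>h. h 0 = x \<and> h 1 = x" "top_of_set {0..1}" X p q]
  by (simp add: loop_homotopy_def loops_at_def pathin_def)

lemma equiv_loop_homotopy: "equiv (loops_at X x) (loop_homotopy X x)"
proof (rule equivI)
  show "loop_homotopy X x \<subseteq> loops_at X x \<times> loops_at X x"
    using loop_homotopyD by fast
  show "refl_on (loops_at X x) (loop_homotopy X x)"
    by (auto simp: refl_on_def loop_homotopy_def loops_at_def pathin_def)
  show "sym (loop_homotopy X x)"
    by (auto simp: sym_def loop_homotopy_def homotopic_with_sym)
  show "trans (loop_homotopy X x)"
    unfolding trans_def loop_homotopy_def by (blast intro: homotopic_with_trans)
qed

text \<open>Paths with the same end points in a real interval are homotopic, and this is carried over to
  \<open>X\<close> by continuous maps; the group laws are instances.\<close>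

lemma loop_homotopy_interval:
  fixes u v :: "real \<Rightarrow> real"
  assumes f: "continuous_map (top_of_set {a..b}) X f"
    and u: "continuous_on {0..1} u" "u ` {0..1} \<subseteq> {a..b}"
    and v: "continuous_on {0..1} v" "v ` {0..1} \<subseteq> {a..b}"
    and ends: "u 0 = v 0" "u 1 = v 1" "f (u 0) = x" "f (u 1) = x"
    and p: "\<And>t. t \<in> {0..1} \<Longrightarrow> p t = f (u t)"
    and q: "\<And>t. t \<in> {0..1} \<Longrightarrow> q t = f (v t)"
  shows "(p, q) \<in> loop_homotopy X x"
proof -
  have "homotopic_paths {a..b} u v"
  proof (rule homotopic_paths_linear)
    show "closed_segment (u t) (v t) \<subseteq> {a..b}" if "t \<in> {0..1}" for t
      using that u(2) v(2) by (intro closed_segment_subset) (auto simp: image_subset_iff)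
  qed (use u v ends in \<open>auto simp: path_def pathstart_def pathfinish_def\<close>)
  then have "homotopic_with (\<lambda>h. h 0 = x \<and> h 1 = x) (top_of_set {0..1}) X (f \<circ> u) (f \<circ> v)"
    unfolding homotopic_paths_def
    by (rule homotopic_with_compose_continuous_map_left[OF _ f])
       (use ends in \<open>auto simp: pathstart_def pathfinish_def\<close>)
  then have "homotopic_with (\<lambda>h. h 0 = x \<and> h 1 = x) (top_of_set {0..1}) X p q"
    by (rule homotopic_with_eq) (auto simp: p q)
  then show ?thesis
    by (simp add: loop_homotopy_def)
qed

lemma loop_homotopy_join:
  assumes "(p, p') \<in> loop_homotopy X x" "(q, q') \<in> loop_homotopy X x"
  shows "(loop_join p q, loop_join p' q') \<in> loop_homotopy X x"
proof -
  let ?I = "top_of_set {0..1::real}"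
  obtain h where h: "continuous_map (prod_topology ?I ?I) X h"
      "\<And>s. h (0, s) = p s" "\<And>s. h (1, s) = p' s"
      "\<And>t. t \<in> {0..1} \<Longrightarrow> h (t, 0) = x \<and> h (t, 1) = x"
    using assms(1) unfolding loop_homotopy_def homotopic_with_def by auto
  obtain k where k: "continuous_map (prod_topology ?I ?I) X k"
      "\<And>s. k (0, s) = q s" "\<And>s. k (1, s) = q' s"
      "\<And>t. t \<in> {0..1} \<Longrightarrow> k (t, 0) = x \<and> k (t, 1) = x"
    using assms(2) unfolding loop_homotopy_def homotopic_with_def by auto
  define H where "H = (\<lambda>z. if snd z \<le> (1/2::real) then h (fst z, 2 * snd z)
                                else k (fst z :: real, 2 * snd z - 1))"
  have prod: "prod_topology ?I ?I = top_of_set ({0..1} \<times> {0..1})"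
    by (simp add: prod_topology_subtopology_eu)
  have "continuous_map (prod_topology ?I ?I) X H"
    unfolding H_def
  proof (rule continuous_map_cases_le)
    show "continuous_map (prod_topology ?I ?I) euclideanreal snd"
      by (simp add: continuous_map_snd_of prod continuous_on_snd)
    show "continuous_map (subtopology (prod_topology ?I ?I)
        {z \<in> topspace (prod_topology ?I ?I). snd z \<le> 1 / 2}) X (\<lambda>z. h (fst z, 2 * snd z))"
      by (rule continuous_map_compose[OF _ h(1), unfolded o_def, where f = "\<lambda>z. (fst z, 2 * snd z)"])
         (auto simp: prod subtopology_subtopology intro!: continuous_intros)
    show "continuous_map (subtopology (prod_topology ?I ?I)
        {z \<in> topspace (prod_topology ?I ?I). 1 / 2 \<le> snd z}) X (\<lambda>z. k (fst z, 2 * snd z - 1))"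
      by (rule continuous_map_compose[OF _ k(1), unfolded o_def, where f = "\<lambda>z. (fst z, 2 * snd z - 1)"])
         (auto simp: prod subtopology_subtopology intro!: continuous_intros)
    show "h (fst z, 2 * snd z) = k (fst z, 2 * snd z - 1)"
      if "z \<in> topspace (prod_topology ?I ?I)" "snd z = 1 / 2" for z
    proof -
      have "2 * snd z = 1" "fst z \<in> {0..1}"
        using that by auto
      then show ?thesis
        using h(4) k(4) by simp
    qed
  qed simp
  then show ?thesis
    using h k unfolding loop_homotopy_def homotopic_with_def
    by (auto simp: H_def loop_join_def intro!: exI[of _ H])
qed

lemma loop_join_loops_at:
  assumes "p \<in> loops_at X x" "q \<in> loops_at X x"
  shows "loop_join p q \<in> loops_at X x"
proof -
  have "(p, p) \<in> loop_homotopy X x" "(q, q) \<in> loop_homotopy X x"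
    using equiv_loop_homotopy[of X x] assms by (auto simp: equiv_def refl_on_def)
  from loop_homotopyD[OF loop_homotopy_join[OF this]] show ?thesis
    by simp
qed

lemma mult_fundamental_group:
  assumes "p \<in> loops_at X x" "q \<in> loops_at X x"
  shows "loop_homotopy X x `` {p} \<otimes>\<^bsub>fundamental_group X x\<^esub> loop_homotopy X x `` {q} =
    loop_homotopy X x `` {loop_join p q}"
proof -
  have "congruent2 (loop_homotopy X x) (loop_homotopy X x)
      (\<lambda>p q. loop_homotopy X x `` {loop_join p q})"
    unfolding congruent2_def
    by clarify (intro equiv_class_eq[OF equiv_loop_homotopy] loop_homotopy_join)
  from UN_equiv_class2[OF equiv_loop_homotopy equiv_loop_homotopy this assms] show ?thesis
    by (simp add: fundamental_group_def)
qed

lemma group_fundamental_group: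
  assumes x: "x \<in> topspace X"
  shows "group (fundamental_group X x)"
proof -
  let ?R = "loop_homotopy X x" and ?G = "fundamental_group X x"
  note eqv = equiv_loop_homotopy[of X x]
  have carrier: "carrier ?G = loops_at X x // ?R" and one: "\<one>\<^bsub>?G\<^esub> = ?R `` {\<lambda>_. x}"
    by (simp_all add: fundamental_group_def)
  have const: "(\<lambda>_. x) \<in> loops_at X x"
    using x by (simp add: loops_at_def pathin_def)
  have eqI: "?R `` {p} = ?R `` {q}" if "(p, q) \<in> ?R" for p q
    by (rule equiv_class_eq[OF eqv that])
  show ?thesis
  proof (rule groupI)
    show "\<one>\<^bsub>?G\<^esub> \<in> carrier ?G"
      by (simp add: carrier one const quotientI)
  next
    fix A B assume "A \<in> carrier ?G" "B \<in> carrier ?G"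
    then show "A \<otimes>\<^bsub>?G\<^esub> B \<in> carrier ?G"
      unfolding carrier
      by (auto elim!: quotientE simp: mult_fundamental_group intro!: quotientI loop_join_loops_at)
  next
    fix A assume "A \<in> carrier ?G"
    then obtain p where A: "A = ?R `` {p}" and p: "p \<in> loops_at X x"
      unfolding carrier by (auto elim!: quotientE)
    have cp: "continuous_map (top_of_set {0..1}) X p" and ends: "p 0 = x" "p 1 = x"
      using p by (auto simp: loops_at_def pathin_def)
    have "(loop_join (\<lambda>_. x) p, p) \<in> ?R"
    proof (rule loop_homotopy_interval[OF cp, where u = "\<lambda>t. max 0 (2 * t - 1)" and v = "\<lambda>t. t"])
      show "loop_join (\<lambda>_. x) p t = p (max 0 (2 * t - 1))" for t
        using ends by (cases "2 * t = 1") (auto simp: loop_join_def max_def)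
    qed (intro continuous_intros | force simp: ends)+
    then show "\<one>\<^bsub>?G\<^esub> \<otimes>\<^bsub>?G\<^esub> A = A"
      by (simp add: A one mult_fundamental_group const p eqI)
    define q where "q = (\<lambda>t. p (1 - t))"
    have q: "q \<in> loops_at X x"
      using continuous_map_compose[OF _ cp, of "top_of_set {0..1}" "\<lambda>t. 1 - t"] ends
      by (auto simp: q_def loops_at_def pathin_def o_def continuous_on_diff)
    have "(loop_join q p, \<lambda>_. x) \<in> ?R"
    proof (rule loop_homotopy_interval[OF cp, where u = "\<lambda>t. \<bar>2 * t - 1\<bar>" and v = "\<lambda>t. 1"])
      show "loop_join q p t = p \<bar>2 * t - 1\<bar>" for t
        using ends by (cases "2 * t = 1") (auto simp: loop_join_def q_def abs_if)
    qed (intro continuous_intros | force simp: ends)+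
    then have "?R `` {q} \<otimes>\<^bsub>?G\<^esub> A = \<one>\<^bsub>?G\<^esub>"
      by (simp add: A one mult_fundamental_group q p eqI)
    then show "\<exists>B\<in>carrier ?G. B \<otimes>\<^bsub>?G\<^esub> A = \<one>\<^bsub>?G\<^esub>"
      using q by (auto simp: carrier intro!: quotientI)
  next
    fix A B C assume "A \<in> carrier ?G" "B \<in> carrier ?G" "C \<in> carrier ?G"
    then obtain p q r where ABC: "A = ?R `` {p}" "B = ?R `` {q}" "C = ?R `` {r}"
      and pqr: "p \<in> loops_at X x" "q \<in> loops_at X x" "r \<in> loops_at X x"
      unfolding carrier by (auto elim!: quotientE)
    have w: "loop_join (loop_join p q) r \<in> loops_at X x"
      by (intro loop_join_loops_at pqr)
    then have cw: "continuous_map (top_of_set {0..1}) X (loop_join (loop_join p q) r)"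
      by (simp add: loops_at_def pathin_def)
    have "(loop_join (loop_join p q) r, loop_join p (loop_join q r)) \<in> ?R"
    proof (rule loop_homotopy_interval[OF cw, where u = "\<lambda>t. t"
          and v = "\<lambda>t. max (max (t / 2) (t - 1/4)) (2 * t - 1)"])
      fix t :: real assume "t \<in> {0..1}"
      consider "t \<le> 1/2" | "1/2 < t" "t \<le> 3/4" | "3/4 < t" by linarith
      then show "loop_join p (loop_join q r) t =
          loop_join (loop_join p q) r (max (max (t / 2) (t - 1/4)) (2 * t - 1))"
      proof cases
        case 1
        then have "max (max (t / 2) (t - 1/4)) (2 * t - 1) = t / 2" by simp
        with 1 show ?thesis by (simp add: loop_join_def)
      next
        case 2
        then have "max (max (t / 2) (t - 1/4)) (2 * t - 1) = t - 1/4" by simp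
        with 2 show ?thesis by (simp add: loop_join_def algebra_simps)
      next
        case 3
        then have "max (max (t / 2) (t - 1/4)) (2 * t - 1) = 2 * t - 1" by simp
        with 3 show ?thesis by (simp add: loop_join_def)
      qed
    qed (intro continuous_intros | use w in \<open>force simp: loops_at_def\<close>)+
    then show "A \<otimes>\<^bsub>?G\<^esub> B \<otimes>\<^bsub>?G\<^esub> C = A \<otimes>\<^bsub>?G\<^esub> (B \<otimes>\<^bsub>?G\<^esub> C)"
      by (simp add: ABC mult_fundamental_group pqr loop_join_loops_at eqI)
  qed
qed


section \<open>Closed oriented surfaces\<close>

definition quotient_topology :: "'a topology \<Rightarrow> ('a \<times> 'a) set \<Rightarrow> 'a set topology"
  where "quotient_topology X R =
    topology (\<lambda>U. U \<subseteq> topspace X // R \<and> openin X {x \<in> topspace X. R `` {x} \<in> U})"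

lemma openin_quotient_topology:
  "openin (quotient_topology X R) U \<longleftrightarrow>
    U \<subseteq> topspace X // R \<and> openin X {x \<in> topspace X. R `` {x} \<in> U}"
proof -
  let ?P = "\<lambda>U. {x \<in> topspace X. R `` {x} \<in> U}"
  have "?P (U \<inter> V) = ?P U \<inter> ?P V" "?P (\<Union>\<K>) = (\<Union>U\<in>\<K>. ?P U)" for U V \<K>
    by auto
  then have "istopology (\<lambda>U. U \<subseteq> topspace X // R \<and> openin X (?P U))"
    unfolding istopology_def by (auto intro!: openin_Int openin_Union)
  then show ?thesis
    by (simp add: quotient_topology_def topology_inverse')
qed

lemma topspace_quotient_topology: "topspace (quotient_topology X R) = topspace X // R"
proof -
  have "{x \<in> topspace X. R `` {x} \<in> topspace X // R} = topspace X"
    by (auto simp: quotientI)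
  then have "openin (quotient_topology X R) (topspace X // R)"
    by (simp add: openin_quotient_topology)
  then show ?thesis
    by (meson openin_quotient_topology openin_subset openin_topspace subset_antisym)
qed

lemma quotient_map_quotient_topology:
  "quotient_map X (quotient_topology X R) (\<lambda>x. R `` {x})"
  unfolding quotient_map_def
  by (auto simp: topspace_quotient_topology openin_quotient_topology quotient_def)

text \<open>The closed oriented surface of genus \<open>g \<ge> 1\<close> is obtained from a polygon with \<open>4 * g\<close> sides by
  identifying its sides in pairs according to the word
  \<open>a\<^sub>1 b\<^sub>1 a\<^sub>1\<inverse> b\<^sub>1\<inverse> \<dots> a\<^sub>g b\<^sub>g a\<^sub>g\<inverse> b\<^sub>g\<inverse>\<close>.  The polygon is realised as the closed unit disc, with the unit circle
  divided into \<open>4 * g\<close> arcs of equal length; the arcs with indices \<open>4 * j, \<dots>, 4 * j + 3\<close> carry the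
  labels \<open>a, b, a\<inverse>, b\<inverse>\<close> of one handle, so each of the first two arcs of such a block is glued to the
  second arc after it, with the direction reversed.\<close>

definition side :: "nat \<Rightarrow> nat \<Rightarrow> real \<Rightarrow> complex"
  where "side g k t = cis (2 * pi * (real k + t) / real (4 * g))"

definition side_pairing :: "nat \<Rightarrow> (complex \<times> complex) set"
  where "side_pairing g =
    {(side g k t, side g (k + 2) (1 - t)) | k t. k < 4 * g \<and> k mod 4 < 2 \<and> t \<in> {0..1}}"

definition gluing :: "nat \<Rightarrow> (complex \<times> complex) set"
  where "gluing g = (side_pairing g \<union> (side_pairing g)\<inverse>)\<^sup>* \<inter> cball 0 1 \<times> cball 0 1"

definition closed_oriented_surface :: "nat \<Rightarrow> complex set topology"
  where "closed_oriented_surface g = quotient_topology (top_of_set (cball 0 1)) (gluing g)"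

lemma equiv_gluing: "equiv (cball 0 1) (gluing g)"
proof (rule equivI)
  have "sym ((side_pairing g \<union> (side_pairing g)\<inverse>)\<^sup>*)"
    by (intro sym_rtrancl sym_Un_converse)
  then show "sym (gluing g)"
    unfolding gluing_def sym_def by blast
  show "trans (gluing g)"
    unfolding gluing_def trans_def by (blast intro: rtrancl_trans)
  show "refl_on (cball 0 1) (gluing g)"
    by (simp add: gluing_def refl_on_def)
  show "gluing g \<subseteq> cball 0 1 \<times> cball 0 1"
    unfolding gluing_def by (rule Int_lower2)
qed

text \<open>The surface is path connected, so the choice of the base point is immaterial.\<close>

definition surface_group_of_genus :: "nat \<Rightarrow> ('a, 'b) monoid_scheme \<Rightarrow> bool"
  where "surface_group_of_genus g H \<longleftrightarrow>
    (\<exists>x \<in> topspace (closed_oriented_surface g).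
        H \<cong> fundamental_group (closed_oriented_surface g) x)"

definition surface_group :: "('a, 'b) monoid_scheme \<Rightarrow> bool"
  where "surface_group H \<longleftrightarrow> (\<exists>g \<ge> 2. surface_group_of_genus g H)"

end

theory Submission imports Defs begin

text \<open>The surface of genus \<open>2 r\<close> is the double of a surface of genus \<open>r\<close> with one boundary circle, so by
  van Kampen its fundamental group \<open>P\<close> is the double of a free group of rank \<open>2 r\<close> along a cyclic group.
  Folding the two halves and killing half of the generators retracts \<open>P\<close> onto \<open>F\<close>.  Precompose this map
  with injective endomorphisms of \<open>P\<close> that fix the generators of \<open>F\<close> and let \<open>X\<close> be the closure of the
  resulting homomorphisms in a finite power of \<open>G\<close>; it is locally compact, hence a Baire space.  For
  \<open>a \<noteq> 1\<close> in \<open>P\<close> the closed set of \<open>\<psi> \<in> X\<close> with \<open>\<psi> a = 1\<close> has empty interior: a high power of the Dehn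
  twist along the separating curve keeps the image of \<open>a\<close> visible after folding, and then the killed
  generators can be moved to nontrivial elements of \<open>F\<close> arbitrarily close to 1, in such a position that
  the word \<open>a\<close> does not become trivial.  A point of \<open>X\<close> outside these countably many sets is a faithful
  representation of \<open>P\<close> whose image contains \<open>F\<close>.\<close>

text \<open>The retraction kills the separating curve, so twisting along it, however often, does not
  move the corresponding point of \<open>X\<close>; it only turns \<open>a\<close> into an element
  whose folded image is a nontrivial reduced word \<open>e\<close> in kept and killed generators.
  But \<open>e\<close> is nontrivial in a free group on both kinds of letters, whereas the
  perturbation may use only elements of \<open>F\<close> near 1, and nothing is known about the
  shape of these. Hence the killed generators are sent to products of conjugates of one small
  element \<open>v\<close> by long words taken from a list that depends on \<open>e\<close> alone:
  the conjugators prevent cancellation whatever \<open>v\<close> is, and the products tend to 1 with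
  \<open>v\<close>. Since \<open>e\<close> is computed under folding, the perturbation has to move
  both halves in the same way; this is the purpose of the slides, which involve both halves and are
  corrected by a twist in one handle. The presentation of \<open>P\<close> is derived from the
  polygon itself: homomorphisms out of \<open>P\<close> are holonomies of locally constant
  labellings, and generation follows by closing up initial pieces of a loop along radii of the
  polygon.\<close>

section \<open>Reduced forms and inverses of words\<close>

definition red :: "'l letter list \<Rightarrow> 'l letter list"
  where "red w = foldr cancel_cons w []"

definition inv_word :: "'l letter list \<Rightarrow> 'l letter list"
  where "inv_word w = rev (map inv_letter w)"

lemma reduced_red: "reduced (red w)"
  by (simp add: red_def reduced_foldr_cancel_cons)

lemma red_reduced: "reduced w \<Longrightarrow> red w = w"
  by (simp add: red_def foldr_cancel_cons_Nil)

lemma red_Nil [simp]: "red [] = []"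
  by (simp add: red_def)

lemma red_append: "red (u @ v) = foldr cancel_cons u (red v)"
  by (simp add: red_def)

lemma red_append_red2: "red (u @ red v) = red (u @ v)"
  by (simp add: red_append red_reduced reduced_red)

lemma red_append_red1: "red (red u @ v) = red (u @ v)"
  using foldr_cancel_cons_assoc[OF reduced_red[of v], of u "[]"]
  by (simp add: red_append) (simp add: red_def)

lemma red_append_cong: "red u = red u' \<Longrightarrow> red v = red v' \<Longrightarrow> red (u @ v) = red (u' @ v')"
  by (metis red_append_red1 red_append_red2)

lemma inv_letter_inj [simp]: "inv_letter x = inv_letter y \<longleftrightarrow> x = y"
  by (metis inv_letter_inv_letter)

lemma inv_letter_neq [simp]: "inv_letter x \<noteq> x" "x \<noteq> inv_letter x"
  by (cases x; simp add: inv_letter_def)+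

lemma fst_inv_letter [simp]: "fst (inv_letter x) = fst x"
  by (simp add: inv_letter_def)

lemma inv_word_simps [simp]:
  "inv_word [] = []" "inv_word (x # w) = inv_word w @ [inv_letter x]"
  "inv_word (u @ v) = inv_word v @ inv_word u" "inv_word (inv_word w) = w"
  "length (inv_word w) = length w" "inv_word w = [] \<longleftrightarrow> w = []"
  by (auto simp: inv_word_def rev_map o_def)

lemma hd_inv_word: "w \<noteq> [] \<Longrightarrow> hd (inv_word w) = inv_letter (last w)"
  by (simp add: inv_word_def hd_rev last_map)

lemma last_inv_word: "w \<noteq> [] \<Longrightarrow> last (inv_word w) = inv_letter (hd w)"
  by (simp add: inv_word_def last_rev hd_map)

lemma reduced_append:
  "reduced (u @ v) \<longleftrightarrow> reduced u \<and> reduced v \<and> (u = [] \<or> v = [] \<or> hd v \<noteq> inv_letter (last u))"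
  by (induction u) (auto simp: reduced_Cons)

lemma reduced_inv_word [simp]: "reduced (inv_word w) \<longleftrightarrow> reduced w"
proof -
  have *: "reduced (inv_word w)" if "reduced w" for w :: "'a letter list"
    using that
  proof (induction w)
    case (Cons x w)
    then show ?case
      by (auto simp: reduced_append reduced_Cons last_inv_word)
  qed simp
  show ?thesis
    using *[of w] *[of "inv_word w"] by auto
qed

lemma red_inv_word_left: "red (inv_word u @ u @ v) = red v"
  using foldr_cancel_cons_left_inverse[OF reduced_red, of u v]
  by (simp add: red_append inv_word_def)

lemma red_inv_word_right: "red (u @ inv_word u @ v) = red v"
  using red_inv_word_left[of "inv_word u" v] by simp

lemma red_eq_Nil_conj: "red (inv_word u @ w @ u) = [] \<longleftrightarrow> red w = []"
proof
  assume "red (inv_word u @ w @ u) = []"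
  then have "red (u @ (inv_word u @ w @ u) @ inv_word u) = red (u @ [] @ inv_word u)"
    by (intro red_append_cong refl) simp
  then show "red w = []"
    using red_inv_word_right[of u "w @ u @ inv_word u"] red_inv_word_right[of u "[]"]
      red_append_cong[OF refl red_inv_word_right[of u "[]"], of w] by simp
next
  assume "red w = []"
  then have "red (inv_word u @ w @ u) = red (inv_word u @ [] @ u)"
    by (intro red_append_cong refl) simp
  then show "red (inv_word u @ w @ u) = []"
    using red_inv_word_left[of u "[]"] by simp
qed

section \<open>Conjugation by high powers of a cyclically reduced word\<close>

fun word_power :: "'l letter list \<Rightarrow> nat \<Rightarrow> 'l letter list" where
  "word_power w 0 = []"
| "word_power w (Suc n) = w @ word_power w n"

lemma length_word_power [simp]: "length (word_power w n) = n * length w"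
  by (induction n) auto

lemma word_power_add: "word_power w (m + n) = word_power w m @ word_power w n"
  by (induction m) auto

lemma word_power_Suc2: "word_power w (Suc n) = word_power w n @ w"
  using word_power_add[of w n 1] by simp

lemma word_power_nth: "i < n * length w \<Longrightarrow> word_power w n ! i = w ! (i mod length w)"
proof (induction n arbitrary: i)
  case (Suc n)
  show ?case
  proof (cases "i < length w")
    case False
    then have "word_power w (Suc n) ! i = w ! ((i - length w) mod length w)"
      using Suc by (simp add: nth_append)
    then show ?thesis
      using False by (simp add: le_mod_geq)
  qed (simp add: nth_append)
qed simp

lemma inv_word_power: "inv_word (word_power w n) = word_power (inv_word w) n"
  by (induction n) (simp_all add: word_power_Suc2[symmetric])

text \<open>\<open>reduced (w @ w)\<close> makes \<open>w\<close> cyclically reduced, so that its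
  powers are reduced. Distinctness of the letters lets a single letter of a power of
  \<open>w\<close> reveal its position modulo \<open>length w\<close>; this is how
  \<open>sandwich_power\<close> recognises powers of \<open>w\<close>.\<close>

definition distinct_cyclic :: "'l letter list \<Rightarrow> bool"
  where "distinct_cyclic w \<longleftrightarrow> w \<noteq> [] \<and> distinct w \<and> reduced (w @ w)"

lemma distinct_cyclic_inv_word: "distinct_cyclic w \<Longrightarrow> distinct_cyclic (inv_word w)"
proof -
  assume w: "distinct_cyclic w"
  then have "reduced (inv_word (w @ w))"
    by (simp add: distinct_cyclic_def del: inv_word_simps(3))
  then show ?thesis
    using w by (auto simp: distinct_cyclic_def inv_word_def distinct_map inj_on_def)
qed

lemma reduced_word_power: "distinct_cyclic w \<Longrightarrow> reduced (word_power w n)"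
proof (induction n)
  case (Suc n)
  then have "word_power w n = [] \<or> hd (word_power w n) = hd w"
    by (cases n) (auto simp: distinct_cyclic_def)
  with Suc show ?case
    by (auto simp: distinct_cyclic_def reduced_append)
qed simp

definition in_cyclic :: "'l letter list \<Rightarrow> 'l letter list \<Rightarrow> bool"
  where "in_cyclic w g \<longleftrightarrow> (\<exists>n. red g = red (word_power w n) \<or> red g = red (word_power (inv_word w) n))"

text \<open>A power of \<open>w\<close> is periodic, so two prefixes whose lengths agree modulo the
  period differ by whole copies of \<open>w\<close> put in front.\<close>

lemma take_word_power_mod:
  assumes "w \<noteq> []" "a \<le> n * length w" "b \<le> n * length w" "a mod length w = b mod length w" "b \<le> a"
  shows "take a (word_power w n) = word_power w ((a - b) div length w) @ take b (word_power w n)"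
proof (rule nth_equalityI)
  let ?l = "length w" and ?d = "(a - b) div length w"
  have d: "?d * ?l = a - b"
    using assms(4,5) by (metis dvd_div_mult_self mod_eq_dvd_iff_nat)
  show "length (take a (word_power w n)) = length (word_power w ?d @ take b (word_power w n))"
    using assms d by simp
  fix i assume "i < length (take a (word_power w n))"
  then have i: "i < a" by simp
  show "take a (word_power w n) ! i = (word_power w ?d @ take b (word_power w n)) ! i"
  proof (cases "i < a - b")
    case True
    then show ?thesis
      using i assms d by (simp add: nth_append word_power_nth)
  next
    case False
    have "(i - (a - b)) mod ?l = i mod ?l"
      by (metis False d mod_mult_self2 le_add_diff_inverse2 linorder_not_less mult.commute)
    then show ?thesis
      using i assms d False by (simp add: nth_append word_power_nth)
  qed
qed

text \<open>The power is longer than \<open>g\<close>, so cancellation against \<open>g\<close>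
  cannot consume it and its outer ends survive on both sides. The two remainders of the power could
  cancel against each other only if \<open>g\<close> were swallowed entirely, and then
  \<open>g\<close> would be a power of \<open>w\<close>.\<close>

lemma sandwich_power:
  assumes w: "distinct_cyclic w" and g: "\<not> in_cyclic w g" and N: "N > length g"
  obtains c where "red (inv_word (word_power w N) @ g @ word_power w N) = c" "c \<noteq> []"
    "hd c = inv_letter (last w)" "last c = last w"
proof -
  let ?p = "word_power w N"
  define g' where "g' = red g"
  have wne: "w \<noteq> []" and dw: "distinct w" using w by (auto simp: distinct_cyclic_def)
  have "length (red u) \<le> length u" for u :: "'a letter list"
  proof (induction u)
    case (Cons x u)
    have "length (cancel_cons x v) \<le> Suc (length v)" for v by (cases v) auto
    then show ?case
      using Cons by (simp add: red_def) (meson Suc_le_mono order_trans)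
  qed simp
  then have lg: "length g' \<le> length g" by (simp add: g'_def)
  have rg: "reduced g'" by (simp add: g'_def reduced_red)
  have rp: "reduced ?p" by (rule reduced_word_power[OF w])
  have lp: "length ?p > length g'"
    using N lg wne mult_le_mono2[of 1 "length w" N] by (cases w) auto
  \<comment> \<open>What \<open>g'\<close> cancels against the power on its right is the common
    prefix \<open>ps\<close> of \<open>inv_word g'\<close> and the power; maximality of the prefix
    rules out any further cancellation there.\<close>
  obtain ps xs ys where 1: "inv_word g' = ps @ xs" "?p = ps @ ys" "xs = [] \<or> ys = [] \<or> hd xs \<noteq> hd ys"
    using longest_common_prefix by blast
  have g'1: "g' = inv_word xs @ inv_word ps"
    using arg_cong[OF 1(1), of inv_word] by simp
  have yne: "ys \<noteq> []"
    using lp 1(2) g'1 by (auto)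
  \<comment> \<open>The same on the left, with what is left of \<open>g'\<close>: the prefix
    \<open>qs\<close> cancels against the inverse power and \<open>us\<close> is the surviving
    core.\<close>
  obtain qs us zs where 2: "inv_word xs = qs @ us" "?p = qs @ zs" "us = [] \<or> zs = [] \<or> hd us \<noteq> hd zs"
    using longest_common_prefix by blast
  have zne: "zs \<noteq> []"
    using lp 2(2) g'1 2(1) by (auto)
  have lasts: "last ys = last w" "last zs = last w"
  proof -
    have "N > 0" using N by simp
    then have "last ?p = last w"
      using wne by (cases N) (auto simp del: word_power.simps(2) simp: word_power_Suc2)
    then show "last ys = last w" "last zs = last w"
      using arg_cong[OF 1(2), of last] arg_cong[OF 2(2), of last] yne zne by simp_all
  qed
  define c where "c = inv_word zs @ us @ ys"
  have "red (inv_word ?p @ g @ ?p) = red (inv_word ?p @ g' @ ?p)"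
    by (intro red_append_cong refl) (simp add: g'_def red_reduced reduced_red)
  also have "\<dots> = red (inv_word zs @ inv_word qs @ (qs @ us) @ inv_word ps @ ps @ ys)"
    by (subst (1) 2(2), subst 1(2), simp add: g'1 2(1))
  also have "\<dots> = red c"
    unfolding c_def
    using red_append_cong[OF refl red_append_cong[OF refl red_inv_word_left[of ps ys], of us], of "inv_word zs"]
      red_append_cong[OF refl red_inv_word_left[of qs "us @ inv_word ps @ ps @ ys"], of "inv_word zs"]
    by simp
  finally have c: "red (inv_word ?p @ g @ ?p) = red c" .
  have rus: "reduced us" "reduced (inv_word zs)" "reduced ys"
    using rg[unfolded g'1 2(1)] rp[unfolded 2(2)] rp[unfolded 1(2)] by (simp_all add: reduced_append)
  have "reduced c"
  proof (cases "us = []")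
    case False
    have "hd ys \<noteq> inv_letter (last us)"
    proof -
      have "xs \<noteq> []" using 2 False by auto
      then have "hd xs \<noteq> hd ys" using 1 yne by auto
      moreover have "last (inv_word xs) = last us" using 2 False by simp
      ultimately show ?thesis
        using \<open>xs \<noteq> []\<close> by (metis last_inv_word inv_letter_inv_letter)
    qed
    moreover have "hd us \<noteq> inv_letter (last (inv_word zs))"
      using 2 False zne by (simp add: last_inv_word)
    ultimately show ?thesis
      using rus False yne zne by (auto simp: c_def reduced_append)
  next
    case True
    \<comment> \<open>Without a core the two remainders meet directly. Equal first letters would put
      their starting positions into the same residue class, since the letters of \<open>w\<close>
      are distinct; then \<open>qs\<close> and \<open>ps\<close> differ by a power of
      \<open>w\<close>, and so \<open>g\<close> is such a power.\<close>
    have "hd ys \<noteq> hd zs"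
    proof
      assume h: "hd ys = hd zs"
      let ?a = "length qs" and ?b = "length ps"
      have ab: "?a < length ?p" "?b < length ?p"
        using arg_cong[OF 1(2), of length] arg_cong[OF 2(2), of length] yne zne by (cases ys; cases zs; simp)+
      have "hd zs = ?p ! ?a" "hd ys = ?p ! ?b"
        using arg_cong[OF 2(2), of "\<lambda>l. l ! ?a"] arg_cong[OF 1(2), of "\<lambda>l. l ! ?b"] yne zne
        by (simp_all add: nth_append hd_conv_nth)
      then have "w ! (?a mod length w) = w ! (?b mod length w)"
        using h ab by (simp add: word_power_nth)
      then have m: "?a mod length w = ?b mod length w"
        using dw wne by (simp add: nth_eq_iff_index_eq)
      have g'2: "g' = qs @ inv_word ps" using g'1 2(1) True by simp
      have t: "qs = take ?a ?p" "ps = take ?b ?p"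
        using 1(2) 2(2) by (metis append_eq_conv_conj)+
      have "in_cyclic w g"
      proof (cases "?b \<le> ?a")
        case True
        from take_word_power_mod[OF wne _ _ m True, of N] ab
        obtain k where "qs = word_power w k @ ps"
          using t by (metis length_word_power less_imp_le_nat)
        then have "red g' = red (word_power w k)"
          using red_append_cong[OF refl red_inv_word_right[of ps "[]"]] g'2 by simp
        then show ?thesis by (auto simp: in_cyclic_def g'_def red_reduced reduced_red)
      next
        case False
        then have "?a \<le> ?b" by simp
        from take_word_power_mod[OF wne _ _ m[symmetric] this, of N] ab
        obtain k where k: "ps = word_power w k @ qs"
          using t by (metis length_word_power less_imp_le_nat)
        have "red g' = red (word_power (inv_word w) k)"
          using red_inv_word_right[of qs "inv_word (word_power w k)"] g'2
          by (simp add: k inv_word_power)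
        then show ?thesis by (auto simp: in_cyclic_def g'_def red_reduced reduced_red)
      qed
      then show False using g by simp
    qed
    then show ?thesis
      using rus True yne zne by (auto simp: c_def reduced_append last_inv_word)
  qed
  then have "red (inv_word ?p @ g @ ?p) = c" using c by (simp add: red_reduced)
  moreover have "c \<noteq> []" "hd c = inv_letter (last w)" "last c = last w"
    using yne zne lasts by (simp_all add: c_def hd_append hd_inv_word)
  ultimately show ?thesis using that by blast
qed

lemma in_cyclic_inv_word: "in_cyclic (inv_word w) g \<longleftrightarrow> in_cyclic w g"
  by (auto simp: in_cyclic_def)

text \<open>Consecutive factors end up separated by the power of \<open>w\<close> with exponent
  \<open>2 * N\<close> and by its inverse in turn. Up to an outer conjugation this is what a twist
  with exponent \<open>2 * N\<close>, followed by folding the halves, makes of an alternating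
  product.\<close>

fun alternating_chunks :: "'l letter list \<Rightarrow> nat \<Rightarrow> bool \<Rightarrow> 'l letter list list \<Rightarrow> 'l letter list" where
  "alternating_chunks w N b [] = []"
| "alternating_chunks w N b (g # gs) =
    (let p = word_power (if b then w else inv_word w) N in inv_word p @ g @ p)
      @ alternating_chunks w N (\<not> b) gs"

text \<open>By \<open>sandwich_power\<close> the letters that meet between two chunks are neighbours
  in \<open>w @ w\<close> or in its inverse, so nothing cancels there. The first letter is recorded
  for the sake of the induction.\<close>

lemma alternating_chunks_nontrivial:
  assumes w: "distinct_cyclic w"
    and gs: "gs \<noteq> []" "\<And>g. g \<in> set gs \<Longrightarrow> \<not> in_cyclic w g \<and> length g < N"
  shows "red (alternating_chunks w N b gs) \<noteq> [] \<and>
    hd (red (alternating_chunks w N b gs)) = (if b then inv_letter (last w) else hd w)"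
  using gs
proof (induction gs arbitrary: b)
  case (Cons g gs)
  let ?v = "if b then w else inv_word w"
  have wne: "w \<noteq> []" and cyc: "hd w \<noteq> inv_letter (last w)"
    using w by (auto simp: distinct_cyclic_def reduced_append)
  have dv: "distinct_cyclic ?v"
    using w by (simp add: distinct_cyclic_inv_word)
  have "\<not> in_cyclic ?v g" "N > length g"
    using Cons.prems by (auto simp: in_cyclic_inv_word)
  from sandwich_power[OF dv this]
  obtain c where c: "red (inv_word (word_power ?v N) @ g @ word_power ?v N) = c" "c \<noteq> []"
    "hd c = inv_letter (last ?v)" "last c = last ?v" .
  have hv: "inv_letter (last ?v) = (if b then inv_letter (last w) else hd w)"
    using wne by (simp add: last_inv_word)
  let ?d = "red (alternating_chunks w N (\<not> b) gs)"
  have "red (alternating_chunks w N b (g # gs)) = red (c @ ?d)"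
    unfolding alternating_chunks.simps Let_def
    by (intro red_append_cong) (simp_all add: c(1)[symmetric] red_reduced reduced_red)
  moreover have "reduced (c @ ?d)"
  proof (cases "gs = []")
    case True
    then show ?thesis using reduced_red c(1) by force
  next
    case False
    then have "hd ?d = (if \<not> b then inv_letter (last w) else hd w)"
      using Cons by simp
    moreover have "last c = (if b then last w else inv_letter (hd w))"
      using c(4) wne by (simp add: last_inv_word)
    ultimately show ?thesis
      using cyc c(1) reduced_red by (auto simp: reduced_append)
  qed
  ultimately have "red (alternating_chunks w N b (g # gs)) = c @ ?d"
    by (simp add: red_reduced)
  then show ?case using c hv by simp
qed simp

section \<open>Words that stay nontrivial when conjugates of one element replace some
  letters\<close>

definition ends_in :: "'l letter \<Rightarrow> 'l letter list \<Rightarrow> bool"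
  where "ends_in t w \<longleftrightarrow> red w \<noteq> [] \<and> hd (red w) = inv_letter t \<and> last (red w) = t"

text \<open>Equivalent to \<open>t # v @ [inv_letter t]\<close> being reduced: \<open>v\<close> can
  stand between two words with \<open>ends_in t\<close> and no letter cancels.\<close>

definition fits :: "'l letter \<Rightarrow> 'l letter list \<Rightarrow> bool"
  where "fits t v \<longleftrightarrow> reduced v \<and> v \<noteq> [] \<and> hd v \<noteq> inv_letter t \<and> last v \<noteq> t"

lemma fits_inv_word: "fits t v \<Longrightarrow> fits t (inv_word v)"
  by (auto simp: fits_def hd_inv_word last_inv_word)

lemma ends_in_append:
  assumes "ends_in t a" "fits t v" "ends_in t b"
  shows "ends_in t (a @ v @ b)"
proof -
  have "red (a @ v @ b) = red (red a @ v @ red b)"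
    by (intro red_append_cong) (simp_all add: red_reduced reduced_red)
  also have "\<dots> = red a @ v @ red b"
    using assms
    by (intro red_reduced) (auto simp: reduced_append ends_in_def fits_def reduced_red hd_append)
  finally show ?thesis
    using assms by (simp add: ends_in_def)
qed

text \<open>Labels \<open>Inl\<close> are the kept generators, a basis of \<open>F\<close> in the
  application; labels \<open>Inr\<close> are the killed ones, which receive words in that
  basis.\<close>

fun subst_letter :: "('i \<Rightarrow> 'l letter list) \<Rightarrow> ('l + 'i) letter \<Rightarrow> 'l letter list" where
  "subst_letter u (Inl i, b) = [(i, b)]"
| "subst_letter u (Inr i, b) = (if b then u i else inv_word (u i))"

context
  fixes x y :: 'l and M :: nat and t :: "'l letter"
  assumes xy: "x \<noteq> y" and t: "t \<noteq> (x, False)"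
begin

text \<open>Each block has its task. The long power of \<open>x\<close> outlasts any shorter word
  met in the middle. The power of \<open>y\<close> encodes the index, with \<open>Suc\<close> so
  that it is never empty. The last \<open>x\<close> separates this power from \<open>t\<close>,
  which may itself be a letter on \<open>y\<close>.\<close>

definition stem :: "nat \<Rightarrow> 'l letter list"
  where "stem \<alpha> = replicate M (x, True) @ replicate (Suc \<alpha>) (y, True) @ [(x, True), t]"

lemma inv_word_replicate: "inv_word (replicate n z) = replicate n (inv_letter z)"
  by (simp add: inv_word_def)

lemma reduced_replicate: "reduced (replicate n z)"
  by (induction n) (auto simp: reduced_Cons)

lemma word_power_single: "word_power [z] n = replicate n z"
  by (induction n) auto

text \<open>Conjugation by the power of \<open>x\<close> either produces a word that begins and ends
  on \<open>x\<close>, by \<open>sandwich_power\<close>, or \<open>k\<close> is itself a power of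
  \<open>x\<close> and is left unchanged. Only a trivial \<open>k\<close> lets the powers of
  \<open>y\<close> meet, and then the different indices leave a nonzero power of
  \<open>y\<close>.\<close>

lemma ends_in_stem:
  assumes k: "length k < M" and nontriv: "red k \<noteq> [] \<or> \<alpha> \<noteq> \<beta>"
  shows "ends_in t (inv_word (stem \<alpha>) @ k @ stem \<beta>)"
proof -
  let ?X = "replicate M (x, True)" and ?Y = "\<lambda>n. replicate n (y, True)"
  define \<kappa> where "\<kappa> = red (inv_word ?X @ k @ ?X)"
  define c where "c = [inv_letter t, (x, False)] @ inv_word (?Y (Suc \<alpha>)) @ \<kappa> @ ?Y (Suc \<beta>) @ [(x, True), t]"
  have "red (inv_word (stem \<alpha>) @ k @ stem \<beta>) = 
      red (([inv_letter t, (x, False)] @ inv_word (?Y (Suc \<alpha>))) @ (inv_word ?X @ k @ ?X) @ ?Y (Suc \<beta>) @ [(x, True), t])"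
    by (simp add: stem_def inv_letter_def)
  also have "\<dots> = red (([inv_letter t, (x, False)] @ inv_word (?Y (Suc \<alpha>))) @ \<kappa> @ ?Y (Suc \<beta>) @ [(x, True), t])"
    by (intro red_append_cong refl) (simp add: \<kappa>_def red_reduced reduced_red)
  finally have eq: "red (inv_word (stem \<alpha>) @ k @ stem \<beta>) = red c"
    by (simp add: c_def)
  have t': "inv_letter t \<noteq> (x, True)"
    using t by (metis inv_letter_def fst_conv snd_conv inv_letter_inv_letter)
  have main: "ends_in t c" if "\<kappa> \<noteq> []" "fst (hd \<kappa>) = x" "fst (last \<kappa>) = x"
  proof -
    have "reduced \<kappa>" by (simp add: \<kappa>_def reduced_red)
    then have "reduced c"
      using that xy t t' unfolding c_def
      by (simp add: reduced_append reduced_Cons inv_word_replicate reduced_replicate hd_append)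
        (auto simp: inv_letter_def)
    then show ?thesis
      by (simp add: ends_in_def red_reduced) (simp add: c_def)
  qed
  have dc: "distinct_cyclic [(x, True)]"
    by (simp add: distinct_cyclic_def inv_letter_def)
  show ?thesis
  proof (cases "in_cyclic [(x, True)] k")
    case False
    from sandwich_power[OF dc False k] obtain d where
      "red (inv_word (word_power [(x, True)] M) @ k @ word_power [(x, True)] M) = d" "d \<noteq> []"
      "hd d = inv_letter (last [(x, True)])" "last d = last [(x, True)]" .
    then have "ends_in t c"
      by (intro main) (auto simp: \<kappa>_def word_power_single inv_letter_def)
    then show ?thesis using eq by (simp add: ends_in_def)
  next
    case True
    then obtain n z where z: "red k = red (replicate n z)" "fst z = x"
      by (auto simp: in_cyclic_def word_power_single inv_letter_def)
    then have rk: "red k = replicate n z"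
      by (simp add: red_reduced reduced_replicate)
    have "z = (x, True) \<or> z = inv_letter (x, True)"
      using z(2) by (cases z) (auto simp: inv_letter_def)
    then have comm: "replicate n z @ ?X = ?X @ replicate n z \<or> 
        inv_word ?X @ replicate n z = replicate n z @ inv_word ?X"
      by (metis inv_word_replicate append_replicate_commute)
    have "\<kappa> = red (inv_word ?X @ replicate n z @ ?X)"
      unfolding \<kappa>_def by (intro red_append_cong refl) (simp add: rk[symmetric] red_reduced reduced_red)
    also have "\<dots> = red (replicate n z)"
      using comm
    proof
      assume "replicate n z @ ?X = ?X @ replicate n z"
      then show ?thesis by (simp add: red_inv_word_left)
    next
      assume "inv_word ?X @ replicate n z = replicate n z @ inv_word ?X"
      then have e: "inv_word ?X @ replicate n z @ ?X = replicate n z @ inv_word ?X @ ?X @ []"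
        by (metis append_assoc append_Nil2)
      show ?thesis
        unfolding e using red_append_cong[OF refl red_inv_word_left[of ?X "[]"], of "replicate n z"]
        by (simp only: append_Nil2)
    qed
    finally have \<kappa>: "\<kappa> = replicate n z"
      by (simp add: red_reduced reduced_replicate)
    show ?thesis
    proof (cases "n = 0")
      case False
      then have "ends_in t c"
        by (intro main) (auto simp: \<kappa> z(2))
      then show ?thesis using eq by (simp add: ends_in_def)
    next
      case True
      then have ab: "\<alpha> \<noteq> \<beta>" using nontriv rk by simp
      define \<mu> where "\<mu> = (if \<alpha> < \<beta> then ?Y (\<beta> - \<alpha>) else inv_word (?Y (\<alpha> - \<beta>)))"
      have "red (inv_word (?Y (Suc \<alpha>)) @ ?Y (Suc \<beta>)) = red \<mu>"
      proof (cases "\<alpha> < \<beta>")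
        case True
        then have "?Y (Suc \<beta>) = ?Y (Suc \<alpha>) @ ?Y (\<beta> - \<alpha>)"
          by (simp flip: replicate_add add: replicate_Suc[symmetric] del: replicate_Suc)
        then show ?thesis using True by (simp add: \<mu>_def red_inv_word_left del: replicate_Suc)
      next
        case False
        then have "?Y (Suc \<alpha>) = ?Y (Suc \<beta>) @ ?Y (\<alpha> - \<beta>)"
          by (simp flip: replicate_add add: replicate_Suc[symmetric] del: replicate_Suc)
        then have "inv_word (?Y (Suc \<alpha>)) @ ?Y (Suc \<beta>) = inv_word (?Y (\<alpha> - \<beta>)) @ inv_word (?Y (Suc \<beta>)) @ ?Y (Suc \<beta>) @ []"
          by (simp del: replicate_Suc)
        then show ?thesis 
          using False red_append_cong[OF refl red_inv_word_left[of "?Y (Suc \<beta>)" "[]"], of "inv_word (?Y (\<alpha> - \<beta>))"]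
          by (simp add: \<mu>_def del: replicate_Suc)
      qed
      then have "red ([inv_letter t, (x, False)] @ (inv_word (?Y (Suc \<alpha>)) @ ?Y (Suc \<beta>)) @ [(x, True), t])
         = red ([inv_letter t, (x, False)] @ \<mu> @ [(x, True), t])"
        by (intro red_append_cong refl)
      then have "red c = red ([inv_letter t, (x, False)] @ \<mu> @ [(x, True), t])"
        using True by (simp add: c_def \<kappa>)
      moreover have "reduced ([inv_letter t, (x, False)] @ \<mu> @ [(x, True), t])"
        using xy t t' ab unfolding \<mu>_def
        by (auto simp: reduced_append reduced_Cons inv_word_replicate reduced_replicate inv_letter_def)
      ultimately show ?thesis
        using eq by (simp add: ends_in_def red_reduced)
    qed
  qed
qed

text \<open>Two conjugates instead of one: a spread word opens with the stem \<open>2 * i\<close>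
  and closes with the stem \<open>2 * i + 1\<close>, its inverse the other way round. Hence
  neighbouring spread words meet in equal stems only if their letters are inverse to each other.
  With a single conjugate, a repeated letter would put two copies of \<open>v\<close> side by
  side.\<close>

definition spread :: "'l letter list \<Rightarrow> nat \<Rightarrow> 'l letter list"
  where "spread v i = stem (2 * i) @ v @ inv_word (stem (2 * i)) @ stem (2 * i + 1) @ v @ inv_word (stem (2 * i + 1))"

text \<open>Reading \<open>e\<close> from the left, \<open>k\<close> is the run of kept letters
  since the last substituted word and \<open>\<alpha>\<close> is the index of the stem with which
  that word closed. \<open>ends_in_stem\<close> applies to this stem, the run and the next stem; if
  the run is empty the indices differ because \<open>e\<close> is reduced.
  \<open>length k + length e\<close> bounds every run that can still arise.\<close>

lemma subst_nontrivial_aux: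
  assumes v: "fits t v"
    and "length k + length e < M" "reduced (map (\<lambda>(i, b). (Inl i, b)) k @ e)"
    and "\<And>i b. (Inr i, b) \<in> set e \<Longrightarrow> i < n"
    and "k = [] \<Longrightarrow> e = [] \<Longrightarrow> \<alpha> \<noteq> 2 * n"
    and "\<And>i b e'. k = [] \<Longrightarrow> e = (Inr i, b) # e' \<Longrightarrow> \<alpha> \<noteq> (if b then 2 * i else 2 * i + 1)"
  shows "ends_in t (inv_word (stem \<alpha>) @ k @ concat (map (subst_letter (spread v)) e) @ stem (2 * n))"
  using assms(2-)
proof (induction e arbitrary: k \<alpha>)
  case Nil
  have "reduced k" if "reduced (map (\<lambda>(i, b). (Inl i :: 'l + nat, b)) k)" for k :: "'l letter list"
    using that by (induction k rule: reduced.induct) (auto simp: inv_letter_def)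
  then have "red k = k" using Nil by (simp add: red_reduced)
  then show ?case
    using ends_in_stem[of k \<alpha> "2 * n"] Nil by auto
next
  case (Cons z e)
  have "reduced k" if "reduced (map (\<lambda>(i, b). (Inl i :: 'l + nat, b)) k)" for k :: "'l letter list"
    using that by (induction k rule: reduced.induct) (auto simp: inv_letter_def)
  then have rk: "red k = k" using Cons.prems(2) by (simp add: red_reduced reduced_append)
  obtain l b where z: "z = (l, b)" by (cases z)
  show ?case
  proof (cases l)
    case (Inl i)
    have "ends_in t (inv_word (stem \<alpha>) @ (k @ [(i, b)]) @ concat (map (subst_letter (spread v)) e) @ stem (2 * n))"
    proof (rule Cons.IH)
      show "reduced (map (\<lambda>(i, b). (Inl i, b)) (k @ [(i, b)]) @ e)"
        using Cons.prems(2) by (simp add: z Inl)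
    qed (use Cons.prems in auto)
    then show ?thesis by (simp add: z Inl)
  next
    case (Inr i)
    let ?p = "if b then 2 * i else 2 * i + 1" and ?q = "if b then 2 * i + 1 else 2 * i"
    let ?v = "if b then v else inv_word v"
    have f: "fits t ?v" using v by (simp add: fits_inv_word)
    have s: "subst_letter (spread v) z = stem ?p @ ?v @ inv_word (stem ?p) @ stem ?q @ ?v @ inv_word (stem ?q)"
      by (simp add: z Inr spread_def)
    have 1: "ends_in t (inv_word (stem \<alpha>) @ k @ stem ?p)"
      using Cons.prems(5)[of i b e] Cons.prems(1) rk by (intro ends_in_stem) (auto simp: z Inr)
    have 2: "ends_in t (inv_word (stem ?p) @ [] @ stem ?q)"
      using Cons.prems(1) by (intro ends_in_stem) auto
    \<comment> \<open>The rest is entered from the stem with which the present spread word closes,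
      and with an empty run.\<close>
    have 3: "ends_in t (inv_word (stem ?q) @ [] @ concat (map (subst_letter (spread v)) e) @ stem (2 * n))"
    proof (rule Cons.IH)
      have rz: "reduced (z # e)" using Cons.prems(2) by (simp add: reduced_append)
      then show "reduced (map (\<lambda>(i, b). (Inl i, b)) [] @ e)" by (simp add: reduced_Cons)
      have "i < n" using Cons.prems(3) by (auto simp: z Inr)
      then show "?q \<noteq> 2 * n" by (auto; presburger)
      fix j c e' assume "e = (Inr j, c) # e'"
      then have "(Inr j, c) \<noteq> inv_letter z"
        using rz by auto
      then show "?q \<noteq> (if c then 2 * j else 2 * j + 1)"
        by (auto simp: z Inr inv_letter_def; presburger)
    qed (use Cons.prems in auto)
    from ends_in_append[OF 1 f ends_in_append[OF 2 f 3]] show ?thesis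
      by (simp add: s)
  qed
qed

text \<open>Both ends are closed off with the stem of index \<open>2 * n\<close>, larger than every
  index that occurs in a spread word. This only conjugates the word.\<close>

lemma subst_nontrivial:
  assumes v: "fits t v" and e: "reduced e" "e \<noteq> []" "length e < M"
    and n: "\<And>i b. (Inr i, b) \<in> set e \<Longrightarrow> i < n"
  shows "red (concat (map (subst_letter (spread v)) e)) \<noteq> []"
proof -
  have "ends_in t (inv_word (stem (2 * n)) @ [] @ concat (map (subst_letter (spread v)) e) @ stem (2 * n))"
  proof (rule subst_nontrivial_aux[OF v])
    fix i b e' assume "e = (Inr i, b) # e'"
    then have "i < n" using n by auto
    then show "2 * n \<noteq> (if b then 2 * i else 2 * i + 1)" by (auto; presburger)
  qed (use e n in auto)
  then show ?thesis
    using red_eq_Nil_conj[of "stem (2 * n)" "concat (map (subst_letter (spread v)) e)"]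
    by (simp add: ends_in_def)
qed

end

section \<open>Values of words in a group, and the boundary word of one half\<close>

definition lit :: "('h, 'c) monoid_scheme \<Rightarrow> ('l \<Rightarrow> 'h) \<Rightarrow> 'l letter \<Rightarrow> 'h"
  where "lit H f x = (if snd x then f (fst x) else inv\<^bsub>H\<^esub> (f (fst x)))"

definition wval :: "('h, 'c) monoid_scheme \<Rightarrow> ('l \<Rightarrow> 'h) \<Rightarrow> 'l letter list \<Rightarrow> 'h"
  where "wval H f w = foldr (\<lambda>x a. lit H f x \<otimes>\<^bsub>H\<^esub> a) w \<one>\<^bsub>H\<^esub>"

lemma wval_Nil [simp]: "wval H f [] = \<one>\<^bsub>H\<^esub>"
  and wval_Cons: "wval H f (x # w) = lit H f x \<otimes>\<^bsub>H\<^esub> wval H f w"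
  by (simp_all add: wval_def)

lemma lit_simps [simp]: "lit H f (l, True) = f l" "lit H f (l, False) = inv\<^bsub>H\<^esub> (f l)"
  by (simp_all add: lit_def)

lemma wval_cong: "(\<And>x. x \<in> set w \<Longrightarrow> f (fst x) = f' (fst x)) \<Longrightarrow> wval H f w = wval H f' w"
  by (induction w) (auto simp: wval_Cons lit_def)

context group
begin

lemma cancel_left [simp]: "x \<in> carrier G \<Longrightarrow> y \<in> carrier G \<Longrightarrow> x \<otimes> (inv x \<otimes> y) = y"
  "x \<in> carrier G \<Longrightarrow> y \<in> carrier G \<Longrightarrow> inv x \<otimes> (x \<otimes> y) = y"
  by (simp_all flip: m_assoc)

context
  fixes f :: "'l \<Rightarrow> 'a"
  assumes f [simp]: "\<And>l. f l \<in> carrier G"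
begin

lemma lit_closed [simp]: "lit G f x \<in> carrier G"
  by (simp add: lit_def)

lemma wval_closed [simp]: "wval G f w \<in> carrier G"
  by (induction w) (simp_all add: wval_Cons)

lemma wval_append: "wval G f (u @ v) = wval G f u \<otimes> wval G f v"
  by (induction u) (simp_all add: wval_Cons m_assoc)

lemma lit_inv_letter: "lit G f (inv_letter x) = inv (lit G f x)"
  by (simp add: lit_def inv_letter_def)

lemma wval_inv_word: "wval G f (inv_word w) = inv (wval G f w)"
  by (induction w) (simp_all add: wval_Cons wval_append lit_inv_letter inv_mult_group)

lemma wval_cancel_cons: "wval G f (cancel_cons x w) = lit G f x \<otimes> wval G f w"
  by (cases w) (simp_all add: wval_Cons lit_inv_letter)

lemma wval_red: "wval G f (red w) = wval G f w"
  by (induction w) (simp_all add: red_def wval_Cons wval_cancel_cons)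

lemma wval_red_eq: "red u = red v \<Longrightarrow> wval G f u = wval G f v"
  by (metis wval_red)

lemma wval_power: "wval G f (word_power w n) = wval G f w [^] n"
  by (induction n) (simp_all add: word_power_Suc2 wval_append del: word_power.simps(2))

lemma wval_concat: 
  assumes "\<And>x. x \<in> set w \<Longrightarrow> wval G f (s x) = lit H f' x" "\<And>x. x \<in> set w \<Longrightarrow> lit H f' x = lit G f'' x"
    "\<And>l. f'' l \<in> carrier G"
  shows "wval G f (concat (map s w)) = wval G f'' w"
  using assms by (induction w) (simp_all add: wval_append wval_Cons)

lemma wval_conj:
  assumes c: "c \<in> carrier G"
  shows "wval G (\<lambda>l. c \<otimes> f l \<otimes> inv c) w = c \<otimes> wval G f w \<otimes> inv c"
proof (induction w)
  case (Cons x w)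
  have "lit G (\<lambda>l. c \<otimes> f l \<otimes> inv c) x = c \<otimes> lit G f x \<otimes> inv c"
    using c by (simp add: lit_def inv_mult_group m_assoc)
  then show ?case
    using Cons c by (simp add: wval_Cons m_assoc)
qed (use c in simp)

end

lemma wval_in_subgroup:
  assumes "subgroup N G" "\<And>x. x \<in> set w \<Longrightarrow> f (fst x) \<in> N"
  shows "wval G f w \<in> N"
  using assms(2)
  by (induction w) (auto simp: wval_Cons lit_def subgroup.one_closed[OF assms(1)]
      intro!: subgroup.m_closed[OF assms(1)] subgroup.m_inv_closed[OF assms(1)])

end

lemma wval_hom:
  assumes "group H" "group K" "h \<in> hom H K" "\<And>l. f l \<in> carrier H"
  shows "h (wval H f w) = wval K (\<lambda>l. h (f l)) w"
proof -
  interpret group_hom H K h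
    using assms by (simp add: group_hom_def group_hom_axioms_def)
  have l: "h (lit H f x) = lit K (\<lambda>l. h (f l)) x" for x
    using assms(4) by (simp add: lit_def)
  show ?thesis
    using assms(4) l by (induction w) (simp_all add: wval_Cons G.wval_closed G.lit_closed)
qed

text \<open>With \<open>Inl i\<close> for \<open>x_i\<close> and \<open>Inr i\<close> for
  \<open>y_i\<close>, the word at \<open>k = 0\<close> is \<open>x_0 ... x_(r-1)\<close> followed by
  the conjugates \<open>y_i x_i^-1 y_i^-1\<close> in reverse order. It is the boundary of a disc
  with \<open>2 * r\<close> holes that are joined in pairs, that is, of a surface of genus
  \<open>r\<close> with one boundary circle. In this form it collapses from the inside when all
  \<open>y_i\<close> become trivial, and a single hole can be moved by conjugating one
  factor.\<close>

definition nested_word :: "nat \<Rightarrow> nat \<Rightarrow> (nat + nat) letter list"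
  where "nested_word k r = map (\<lambda>i. (Inl i, True)) [k..<r]
    @ concat (map (\<lambda>i. [(Inr i, True), (Inl i, False), (Inr i, False)]) (rev [k..<r]))"

lemma nested_word_end [simp]: "nested_word r r = []"
  by (simp add: nested_word_def)

lemma nested_word_step: "k < r \<Longrightarrow> nested_word k r = (Inl k, True) # nested_word (Suc k) r @ [(Inr k, True), (Inl k, False), (Inr k, False)]"
  by (simp add: nested_word_def upt_conv_Cons)

lemma set_nested_word: "x \<in> set (nested_word k r) \<Longrightarrow> \<exists>i. (fst x = Inl i \<or> fst x = Inr i) \<and> k \<le> i \<and> i < r"
  by (auto simp: nested_word_def)

text \<open>Every signed letter occurs exactly once, and wrapping one more handle around the inner
  word creates no inverse neighbours. Cyclically, the outermost letters \<open>y_0^-1\<close> and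
  \<open>x_0\<close> meet.\<close>

lemma distinct_cyclic_nested_word:
  assumes "r > 0"
  shows "distinct_cyclic (nested_word 0 r)"
proof -
  let ?n = "\<lambda>k. nested_word k r"
  have "k < r \<Longrightarrow> distinct (?n k) \<and> reduced (?n k) \<and> ?n k \<noteq> [] \<and> hd (?n k) = (Inl k, True) \<and> last (?n k) = (Inr k, False)" for k
  proof (induction "r - Suc k" arbitrary: k)
    case 0
    then have "r = Suc k" by simp
    then have "?n k = [(Inl k, True), (Inr k, True), (Inl k, False), (Inr k, False)]"
      by (simp add: nested_word_step)
    then show ?case by (simp add: inv_letter_def)
  next
    case (Suc n)
    then have k: "Suc k < r" "n = r - Suc (Suc k)" by auto
    have IH: "distinct (?n (Suc k))" "reduced (?n (Suc k))" "?n (Suc k) \<noteq> []" "hd (?n (Suc k)) = (Inl (Suc k), True)"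
      "last (?n (Suc k)) = (Inr (Suc k), False)"
      using Suc(1)[OF k(2,1)] by auto
    have new: "(Inl k, b) \<notin> set (?n (Suc k))" "(Inr k, b) \<notin> set (?n (Suc k))" for b
      using set_nested_word[of _ "Suc k" r] by fastforce+
    have "reduced (?n (Suc k) @ [(Inr k, True), (Inl k, False), (Inr k, False)])"
      using IH by (auto simp: reduced_append inv_letter_def)
    then show ?case
      using k(1) IH new by (simp add: nested_word_step[of k r] reduced_Cons hd_append inv_letter_def)
  qed
  from this[OF assms] show ?thesis
    by (auto simp: distinct_cyclic_def reduced_append inv_letter_def)
qed

section \<open>Geometry of the glued polygon\<close>

text \<open>The angle is measured in sides: vertices are the integers and \<open>4 * g\<close> is
  the period.\<close>

definition circle_pt :: "nat \<Rightarrow> real \<Rightarrow> complex"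
  where "circle_pt g a = cis (2 * pi * a / real (4 * g))"

lemma side_circle_pt: "side g k t = circle_pt g (real k + t)"
  by (simp add: side_def circle_pt_def)

lemma norm_circle_pt [simp]: "norm (circle_pt g a) = 1"
  by (simp add: circle_pt_def)

lemma circle_pt_add: "circle_pt g (a + b) = circle_pt g a * circle_pt g b"
  by (simp add: circle_pt_def cis_mult ring_distribs add_divide_distrib)

lemma circle_pt_0 [simp]: "circle_pt g 0 = 1"
  by (simp add: circle_pt_def)

lemma circle_pt_minus: "circle_pt g (- a) = cnj (circle_pt g a)"
  by (simp add: circle_pt_def cis_cnj)

lemma circle_pt_neq_0 [simp]: "circle_pt g a \<noteq> 0"
  by (simp add: circle_pt_def)

lemma dist_circle_pt: "dist (circle_pt g a) (circle_pt g b) = norm (circle_pt g (a - b) - 1)"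
proof -
  have "circle_pt g a - circle_pt g b = circle_pt g b * (circle_pt g (a - b) - 1)"
    using circle_pt_add[of g b "a - b"] by (simp add: algebra_simps)
  then show ?thesis
    by (simp add: dist_norm norm_mult)
qed

lemma dist_circle_pt_reflect:
  "dist (circle_pt g (c - a)) (circle_pt g (c - b)) = dist (circle_pt g a) (circle_pt g b)"
proof -
  have "norm (circle_pt g (- (a - b)) - 1) = norm (cnj (circle_pt g (a - b) - 1))"
    by (simp only: circle_pt_minus complex_cnj_diff complex_cnj_one)
  also have "\<dots> = norm (circle_pt g (a - b) - 1)"
    by (rule complex_mod_cnj)
  finally show ?thesis
    by (simp add: dist_circle_pt)
qed

lemma continuous_on_circle_pt [continuous_intros]:
  "continuous_on A f \<Longrightarrow> continuous_on A (\<lambda>x. circle_pt g (f x))"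
proof -
  have "circle_pt g a = exp (\<i> * of_real (a * (2 * pi / real (4 * g))))" for a
    by (simp add: circle_pt_def cis_conv_exp mult.commute)
  then show "continuous_on A f \<Longrightarrow> continuous_on A (\<lambda>x. circle_pt g (f x))"
    by (simp only:) (intro continuous_intros)
qed

lemma circle_pt_eq_iff:
  assumes "g > 0"
  shows "circle_pt g a = circle_pt g b \<longleftrightarrow> (\<exists>n::int. a = b + of_int n * real (4 * g))"
proof -
  have "circle_pt g a = circle_pt g b \<longleftrightarrow> 
      (\<exists>n::int. 2 * pi * a / real (4 * g) = 2 * pi * b / real (4 * g) + 2 * pi * n)"
    unfolding circle_pt_def using sin_cos_eq_iff[of "2 * pi * a / real (4 * g)" "2 * pi * b / real (4 * g)"]
    by (auto simp: complex_eq_iff)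
  also have "\<dots> \<longleftrightarrow> (\<exists>n::int. a = b + of_int n * real (4 * g))"
  proof (intro ex_cong1)
    fix n :: int
    have "2 * pi * b / real (4 * g) + 2 * pi * n = (2 * pi) * (b + of_int n * real (4 * g)) / real (4 * g)"
      using assms by (simp add: field_simps)
    moreover have "2 * pi * a / real (4 * g) = (2 * pi) * (b + of_int n * real (4 * g)) / real (4 * g) \<longleftrightarrow>
        (2 * pi) * a = (2 * pi) * (b + of_int n * real (4 * g))"
      using assms by (intro divide_cancel_right[THEN trans]) simp
    ultimately show "2 * pi * a / real (4 * g) = 2 * pi * b / real (4 * g) + 2 * pi * n \<longleftrightarrow> a = b + of_int n * real (4 * g)"
      by (simp only: mult_cancel_left) simp
  qed
  finally show ?thesis .
qed

lemma circle_pt_surj: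
  assumes "g > 0" "norm z = 1"
  shows "\<exists>a\<in>{0..<real (4 * g)}. z = circle_pt g a"
proof -
  have z: "z = cis (Arg2pi z)"
    using assms Arg2pi_eq[of z] by (simp add: cis_conv_exp)
  have "z = circle_pt g (Arg2pi z * real (4 * g) / (2 * pi))"
    using assms by (subst z) (simp add: circle_pt_def)
  moreover have "Arg2pi z * real (4 * g) / (2 * pi) < real (4 * g)"
    using Arg2pi_lt_2pi[of z] assms by (simp add: field_simps)
  ultimately show ?thesis
    using Arg2pi_ge_0[of z] by (intro bexI) auto
qed

definition gluing_step :: "nat \<Rightarrow> (complex \<times> complex) set"
  where "gluing_step g = side_pairing g \<union> (side_pairing g)\<inverse>"

text \<open>In the side coordinate a pairing and its converse are one and the same reflection
  \<open>b \<mapsto> 2 * k + 3 - b\<close>, which exchanges \<open>[k, k + 1]\<close> and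
  \<open>[k + 2, k + 3]\<close>. Later arguments thus need not distinguish a side from its
  partner.\<close>

lemma gluing_stepE:
  assumes "(z, z') \<in> gluing_step g"
  obtains k b where "k < 4 * g" "k mod 4 < 2" "z = circle_pt g b" "z' = circle_pt g (2 * real k + 3 - b)"
    "b \<in> {real k..real k + 1} \<or> b \<in> {real k + 2..real k + 3}"
proof -
  from assms consider "(z, z') \<in> side_pairing g" | "(z', z) \<in> side_pairing g"
    by (auto simp: gluing_step_def)
  then show thesis
  proof cases
    case 1
    then obtain k t where "k < 4 * g" "k mod 4 < 2" "t \<in> {0..1}" "z = side g k t" "z' = side g (k + 2) (1 - t)"
      by (auto simp: side_pairing_def)
    then show thesis
      by (intro that[of k "real k + t"]) (auto simp: side_circle_pt algebra_simps)
  next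
    case 2
    then obtain k t where "k < 4 * g" "k mod 4 < 2" "t \<in> {0..1}" "z' = side g k t" "z = side g (k + 2) (1 - t)"
      by (auto simp: side_pairing_def)
    then show thesis
      by (intro that[of k "real k + 3 - t"]) (auto simp: side_circle_pt algebra_simps)
  qed
qed

lemma gluing_stepI:
  assumes "k < 4 * g" "k mod 4 < 2" "b \<in> {real k..real k + 1} \<or> b \<in> {real k + 2..real k + 3}"
  shows "(circle_pt g b, circle_pt g (2 * real k + 3 - b)) \<in> gluing_step g"
  using assms(3)
proof
  assume "b \<in> {real k..real k + 1}"
  then have "(side g k (b - real k), side g (k + 2) (1 - (b - real k))) \<in> side_pairing g"
    using assms unfolding side_pairing_def by (intro CollectI exI[of _ k] exI[of _ "b - real k"]) auto
  then show ?thesis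
    by (simp add: gluing_step_def side_circle_pt algebra_simps)
next
  assume "b \<in> {real k + 2..real k + 3}"
  then have "(side g k (real k + 3 - b), side g (k + 2) (1 - (real k + 3 - b))) \<in> side_pairing g"
    using assms unfolding side_pairing_def by (intro CollectI exI[of _ k] exI[of _ "real k + 3 - b"]) auto
  then show ?thesis
    by (simp add: gluing_step_def side_circle_pt algebra_simps)
qed

lemma gluing_alt: "gluing g = (gluing_step g)\<^sup>* \<inter> cball 0 1 \<times> cball 0 1"
  by (simp add: gluing_def gluing_step_def)

lemma gluing_step_norm: "(z, z') \<in> gluing_step g \<Longrightarrow> norm z = 1 \<and> norm z' = 1"
  by (auto elim!: gluing_stepE)

lemma gluing_step_subset: "gluing_step g \<subseteq> gluing g"
  by (auto simp: gluing_alt dest: gluing_step_norm)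

lemma gluing_class_subset:
  assumes "z \<in> A" "\<And>u v. u \<in> A \<Longrightarrow> (u, v) \<in> gluing_step g \<Longrightarrow> v \<in> A"
  shows "gluing g `` {z} \<subseteq> A"
proof
  fix v assume "v \<in> gluing g `` {z}"
  then have "(z, v) \<in> (gluing_step g)\<^sup>*"
    by (simp add: gluing_alt)
  then show "v \<in> A"
    by (induction rule: rtrancl_induct) (use assms in auto)
qed

lemma gluing_class_interior: "norm z < 1 \<Longrightarrow> gluing g `` {z} = {z}"
  using gluing_class_subset[of z "{z}" g] gluing_step_norm[of z _ g]
  by (force simp: gluing_alt)

text \<open>Gluing sends an angle \<open>b\<close> to an integer minus \<open>b\<close>, and the
  period is an integer. So all angles in the class of a point of angle \<open>a\<close> are
  congruent to \<open>a\<close> or \<open>-a\<close> modulo 1, and one period contains finitely many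
  of these.\<close>

lemma gluing_class_boundary:
  assumes g: "g > 0" and z: "norm z = 1"
  shows "finite (gluing g `` {z})" "\<And>c. c \<in> gluing g `` {z} \<Longrightarrow> norm c = 1"
proof -
  obtain a where a: "z = circle_pt g a" using circle_pt_surj[OF g z] by auto
  define A where "A = {circle_pt g b | b. b - a \<in> \<int> \<or> b + a \<in> \<int>}"
  have sub: "gluing g `` {z} \<subseteq> A"
  proof (rule gluing_class_subset)
    show "z \<in> A" by (auto simp: A_def a intro!: exI[of _ a])
    fix u v assume "u \<in> A" "(u, v) \<in> gluing_step g"
    then obtain b k b' where b: "u = circle_pt g b" "b - a \<in> \<int> \<or> b + a \<in> \<int>" 
        "u = circle_pt g b'" "v = circle_pt g (2 * real k + 3 - b')"
      by (auto simp: A_def elim!: gluing_stepE)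
    then obtain n :: int where n: "b' = b + of_int n * real (4 * g)"
      using circle_pt_eq_iff[OF g] by metis
    have e: "2 * real k + 3 - b' - a = of_int (2 * int k + 3 - n * int (4 * g)) - (b + a)"
      "2 * real k + 3 - b' + a = of_int (2 * int k + 3 - n * int (4 * g)) - (b - a)"
      by (simp_all add: n)
    have "2 * real k + 3 - b' - a \<in> \<int> \<or> 2 * real k + 3 - b' + a \<in> \<int>"
      using b(2) unfolding e by (metis Ints_diff Ints_of_int)
    then show "v \<in> A" using b by (auto simp: A_def)
  qed
  have "A \<subseteq> circle_pt g ` ((\<lambda>m. of_int m + a) ` {-\<lceil>\<bar>a\<bar>\<rceil>..int (4 * g) + \<lceil>\<bar>a\<bar>\<rceil>} \<union> (\<lambda>m. of_int m - a) ` {-\<lceil>\<bar>a\<bar>\<rceil>..int (4 * g) + \<lceil>\<bar>a\<bar>\<rceil>})"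
  proof
    fix v assume "v \<in> A"
    then obtain b where b: "v = circle_pt g b" "b - a \<in> \<int> \<or> b + a \<in> \<int>" by (auto simp: A_def)
    obtain b' where b': "b' \<in> {0..<real (4 * g)}" "v = circle_pt g b'"
      using circle_pt_surj[OF g, of v] b by auto
    obtain n :: int where n: "b' = b + of_int n * real (4 * g)"
      using circle_pt_eq_iff[OF g] b b' by metis
    have "b' - a = (b - a) + of_int (n * int (4 * g))" "b' + a = (b + a) + of_int (n * int (4 * g))"
      by (simp_all add: n)
    then have "b' - a \<in> \<int> \<or> b' + a \<in> \<int>"
      using b(2) by (metis Ints_add Ints_of_int)
    then obtain m :: int where "b' = of_int m + a \<or> b' = of_int m - a"
      by (metis Ints_cases add_diff_cancel diff_add_cancel)
    moreover from this have "m \<in> {-\<lceil>\<bar>a\<bar>\<rceil>..int (4 * g) + \<lceil>\<bar>a\<bar>\<rceil>}"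
    proof -
      assume "b' = of_int m + a \<or> b' = of_int m - a"
      then have "of_int m \<ge> - \<bar>a\<bar>" "of_int m \<le> real (4 * g) + \<bar>a\<bar>" using b'(1) by auto
      moreover have "\<bar>a\<bar> \<le> of_int \<lceil>\<bar>a\<bar>\<rceil>" by simp
      ultimately have "of_int m \<ge> (of_int (- \<lceil>\<bar>a\<bar>\<rceil>) :: real)" "of_int m \<le> (of_int (int (4 * g) + \<lceil>\<bar>a\<bar>\<rceil>) :: real)"
        by linarith+
      then show ?thesis unfolding of_int_le_iff by simp
    qed
    ultimately show "v \<in> circle_pt g ` ((\<lambda>m. of_int m + a) ` {-\<lceil>\<bar>a\<bar>\<rceil>..int (4 * g) + \<lceil>\<bar>a\<bar>\<rceil>} \<union> (\<lambda>m. of_int m - a) ` {-\<lceil>\<bar>a\<bar>\<rceil>..int (4 * g) + \<lceil>\<bar>a\<bar>\<rceil>})"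
      using b'(2) by auto
  qed
  then have "finite A" by (rule finite_subset) auto
  then show "finite (gluing g `` {z})" using sub finite_subset by blast
  show "norm c = 1" if "c \<in> gluing g `` {z}" for c
    using that sub by (auto simp: A_def)
qed

lemma eventually_at_right_0I:
  "d > 0 \<Longrightarrow> (\<And>e::real. 0 < e \<Longrightarrow> e < d \<Longrightarrow> P e) \<Longrightarrow> eventually P (at_right 0)"
  unfolding eventually_at_right_field by blast

text \<open>Each requirement holds for all small enough radii: the class is finite, and sides are
  closed, so a side that misses a class point keeps a positive distance from it. The filter at 0
  from the right collects the finitely many conditions.\<close>

lemma gluing_radius:
  assumes g: "g > 0" and z0: "z0 \<in> cball 0 1" and \<eta>: "\<eta> > 0"
  obtains \<epsilon> where "\<epsilon> > 0" "\<epsilon> < 1/2" "\<epsilon> < \<eta>"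
    "\<And>c c'. c \<in> gluing g `` {z0} \<Longrightarrow> c' \<in> gluing g `` {z0} \<Longrightarrow> c \<noteq> c' \<Longrightarrow> 4 * \<epsilon> < dist c c'"
    "\<And>c b m. c \<in> gluing g `` {z0} \<Longrightarrow> m < 4 * g \<Longrightarrow> b \<in> {real m..real m + 1} \<Longrightarrow>
      dist (circle_pt g b) c < \<epsilon> \<Longrightarrow> c \<in> circle_pt g ` {real m..real m + 1}"
    "norm z0 < 1 \<Longrightarrow> \<epsilon> < 1 - norm z0"
proof -
  let ?C = "gluing g `` {z0}"
  have fin: "finite ?C"
    using gluing_class_interior[of z0 g] gluing_class_boundary(1)[OF g, of z0] z0 by fastforce
  have 1: "eventually (\<lambda>e::real. \<forall>c\<in>?C. \<forall>c'\<in>?C. c \<noteq> c' \<longrightarrow> 4 * e < dist c c') (at_right 0)"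
  proof (intro eventually_ball_finite[OF fin] ballI)
    fix c c' assume "c \<in> ?C" "c' \<in> ?C"
    show "eventually (\<lambda>e::real. c \<noteq> c' \<longrightarrow> 4 * e < dist c c') (at_right 0)"
      by (rule eventually_at_right_0I[of "if c = c' then 1 else dist c c' / 4"]) (auto split: if_splits)
  qed
  have 2: "eventually (\<lambda>e::real. \<forall>c\<in>?C. \<forall>m\<in>{..<4 * g}. c \<notin> circle_pt g ` {real m..real m + 1} \<longrightarrow>
      (\<forall>z\<in>circle_pt g ` {real m..real m + 1}. e < dist c z)) (at_right 0)"
  proof (intro eventually_ball_finite[OF fin] eventually_ball_finite ballI)
    fix c m assume "c \<in> ?C"
    have "closed (circle_pt g ` {real m..real m + 1})"
      by (intro compact_imp_closed compact_continuous_image continuous_intros) auto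
    then show "eventually (\<lambda>e::real. c \<notin> circle_pt g ` {real m..real m + 1} \<longrightarrow>
      (\<forall>z\<in>circle_pt g ` {real m..real m + 1}. e < dist c z)) (at_right 0)"
      using separate_point_closed[of "circle_pt g ` {real m..real m + 1}" c]
      by (cases "c \<in> circle_pt g ` {real m..real m + 1}")
         (auto intro!: eventually_at_right_0I dest: order.strict_trans2)
  qed simp
  have 3: "eventually (\<lambda>e::real. norm z0 < 1 \<longrightarrow> e < 1 - norm z0) (at_right 0)"
    by (rule eventually_at_right_0I[of "if norm z0 < 1 then 1 - norm z0 else 1"]) auto
  have 4: "eventually (\<lambda>e::real. 0 < e \<and> e < 1/2 \<and> e < \<eta>) (at_right 0)"
    by (rule eventually_at_right_0I[of "min (1/2) \<eta>"]) (use \<eta> in auto)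
  have "eventually (\<lambda>e::real. (\<forall>c\<in>?C. \<forall>c'\<in>?C. c \<noteq> c' \<longrightarrow> 4 * e < dist c c') \<and> 
    (\<forall>c\<in>?C. \<forall>m\<in>{..<4 * g}. c \<notin> circle_pt g ` {real m..real m + 1} \<longrightarrow>
      (\<forall>z\<in>circle_pt g ` {real m..real m + 1}. e < dist c z)) \<and> (norm z0 < 1 \<longrightarrow> e < 1 - norm z0) \<and> (0 < e \<and> e < 1/2 \<and> e < \<eta>)) (at_right 0)"
    by (intro eventually_conj 1 2 3 4)
  then obtain e where e: "\<forall>c\<in>?C. \<forall>c'\<in>?C. c \<noteq> c' \<longrightarrow> 4 * e < dist c c'" 
    "\<forall>c\<in>?C. \<forall>m\<in>{..<4 * g}. c \<notin> circle_pt g ` {real m..real m + 1} \<longrightarrow>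
      (\<forall>z\<in>circle_pt g ` {real m..real m + 1}. e < dist c z)" "norm z0 < 1 \<longrightarrow> e < 1 - norm z0" "0 < e" "e < 1/2" "e < \<eta>"
    using eventually_happens'[OF trivial_limit_at_right_real] by blast
  show ?thesis
  proof (rule that[of e])
    fix c b m assume "c \<in> ?C" "m < 4 * g" "b \<in> {real m..real m + 1}" "dist (circle_pt g b) c < e"
    then show "c \<in> circle_pt g ` {real m..real m + 1}"
      using e(2) by (metis dist_commute imageI lessThan_iff not_less_iff_gr_or_eq)
  qed (use e in auto)
qed

text \<open>A contraction to \<open>c\<close> that stays in the disc and respects the gluing. At a
  boundary point it is linear in logarithmic polar coordinates: boundary points then move along the
  circle, linearly in the angle, and the side pairings, being reflections of the angle, commute with
  it.\<close>

definition retract_to :: "complex \<Rightarrow> complex \<Rightarrow> real \<Rightarrow> complex"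
  where "retract_to c z s = (if norm c < 1 then (1 - s) *\<^sub>R z + s *\<^sub>R c else c * exp (of_real (1 - s) * Ln (z / c)))"

lemma circle_pt_angle: "circle_pt g a = exp (\<i> * of_real (2 * pi * a / real (4 * g)))"
  by (simp add: circle_pt_def cis_conv_exp)

text \<open>There are at least four sides, so an angle of at most one side is at most
  \<open>pi / 2\<close> and the principal branch of \<open>Ln\<close> returns it unchanged.\<close>

lemma retract_to_circle:
  assumes g: "g > 0" and ab: "\<bar>b - a\<bar> \<le> 1"
  shows "retract_to (circle_pt g a) (circle_pt g b) s = circle_pt g (a + (1 - s) * (b - a))"
proof -
  define t where "t = 2 * pi * (b - a) / real (4 * g)"
  have q: "circle_pt g b / circle_pt g a = exp (\<i> * of_real t)"
    unfolding t_def circle_pt_angle[symmetric] using circle_pt_add[of g a "b - a"] by simp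
  have "\<bar>t\<bar> = 2 * pi * \<bar>b - a\<bar> / real (4 * g)"
    by (simp add: t_def abs_mult)
  also have "\<dots> \<le> 2 * pi * 1 / 4"
    using g ab by (intro frac_le mult_left_mono) auto
  also have "\<dots> < pi" by (simp)
  finally have "\<bar>t\<bar> < pi" .
  then have "Ln (exp (\<i> * of_real t)) = \<i> * of_real t"
    by (intro Ln_exp) (auto simp: abs_less_iff)
  then have "retract_to (circle_pt g a) (circle_pt g b) s = circle_pt g a * exp (of_real (1 - s) * (\<i> * of_real t))"
    by (simp add: retract_to_def q)
  also have "of_real (1 - s) * (\<i> * of_real t) = \<i> * of_real (2 * pi * ((1 - s) * (b - a)) / real (4 * g))"
    by (simp add: t_def)
  finally show ?thesis
    by (simp only: circle_pt_angle[symmetric] circle_pt_add)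
qed

lemma not_nonpos_quotient:
  fixes c z :: complex
  assumes "norm c = 1" "dist z c < 1"
  shows "z / c \<notin> \<real>\<^sub>\<le>\<^sub>0"
proof
  assume "z / c \<in> \<real>\<^sub>\<le>\<^sub>0"
  then obtain r :: real where "z / c = of_real r" "r \<le> 0" by (auto simp: nonpos_Reals_def)
  moreover have "norm (z / c - 1) < 1"
  proof -
    have "c \<noteq> 0" using assms(1) by auto
    then have "z / c - 1 = (z - c) / c" unfolding diff_divide_distrib by simp
    then show ?thesis using assms by (simp add: norm_divide dist_norm)
  qed
  ultimately have "norm (of_real (r - 1) :: complex) < 1" by simp
  then show False
    using \<open>r \<le> 0\<close> unfolding norm_of_real by simp
qed

lemma retract_to_props:
  assumes "norm c \<le> 1" "norm z \<le> 1" "dist z c < 1" "s \<in> {0..1}"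
  shows "norm (retract_to c z s) \<le> 1" "retract_to c z 0 = z" "retract_to c z 1 = c" "retract_to c c s = c"
proof -
  show 1: "retract_to c z 1 = c" by (simp add: retract_to_def)
  show "retract_to c c s = c"
    using assms by (auto simp: retract_to_def algebra_simps)
  show 0: "retract_to c z 0 = z"
  proof (cases "norm c < 1")
    case False
    then have "z / c \<noteq> 0" "norm c = 1"
      using assms not_nonpos_quotient[of c z] by auto
    then show ?thesis by (auto simp: retract_to_def)
  qed (simp add: retract_to_def)
  show "norm (retract_to c z s) \<le> 1"
  proof (cases "norm c < 1")
    case True
    have "norm ((1 - s) *\<^sub>R z + s *\<^sub>R c) \<le> (1 - s) * norm z + s * norm c"
      using assms(4) by (intro order_trans[OF norm_triangle_ineq]) auto
    also have "\<dots> \<le> (1 - s) * 1 + s * 1"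
      using assms by (intro add_mono mult_left_mono) auto
    finally show ?thesis using True by (simp add: retract_to_def)
  next
    case False
    then have c: "norm c = 1" using assms by simp
    then have zc: "z / c \<noteq> 0" using not_nonpos_quotient[of c z] assms by auto
    \<comment> \<open>In logarithmic coordinates the disc becomes the half plane of nonpositive real
      part, which is preserved by scaling with \<open>1 - s\<close>.\<close>
    have "Re (Ln (z / c)) = ln (norm z)"
      using zc c by (simp add: Re_Ln norm_divide)
    moreover have "norm z > 0" using zc by auto
    then have "ln (norm z) \<le> 0" using assms by simp
    ultimately have "(1 - s) * Re (Ln (z / c)) \<le> 0"
      using assms(4) by (intro mult_nonneg_nonpos) auto
    then show ?thesis using False c by (simp add: retract_to_def norm_mult)
  qed
qed

lemma continuous_on_retract_to:
  assumes "norm c \<le> 1"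
  shows "continuous_on (ball c 1 \<times> UNIV) (\<lambda>(z, s). retract_to c z s)"
proof (cases "norm c < 1")
  case True
  then show ?thesis
    unfolding retract_to_def by (simp add: case_prod_unfold) (intro continuous_intros)
next
  case False
  then have c: "norm c = 1" using assms by simp
  then show ?thesis
    unfolding retract_to_def case_prod_unfold
    using not_nonpos_quotient[OF c] False
    by (simp) (intro continuous_intros; force simp: dist_commute)
qed

text \<open>The part of the disc within \<open>\<epsilon>\<close> of a gluing class is saturated and
  contracts onto the class compatibly with the gluing. A boundary point near a class point
  \<open>c\<close> lies on a side through \<open>c\<close>, by \<open>gluing_radius\<close>, and the
  reflection carries it to a point at the same distance from the partner of \<open>c\<close>. All
  local arguments on the surface go through this statement.\<close>

lemma gluing_nbhd:
  assumes g: "g > 0" and z0: "z0 \<in> cball 0 1" and \<eta>: "\<eta> > 0"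
  obtains \<epsilon> :: real and d :: "complex \<Rightarrow> real \<Rightarrow> complex" where "\<epsilon> > 0" "\<epsilon> < \<eta>"
    "\<And>c c'. c \<in> gluing g `` {z0} \<Longrightarrow> c' \<in> gluing g `` {z0} \<Longrightarrow> c \<noteq> c' \<Longrightarrow> 4 * \<epsilon> < dist c c'"
    "\<And>c k t. \<lbrakk>c \<in> gluing g `` {z0}; k < 4 * g; k mod 4 < 2; t \<in> {0..1}; dist (side g k t) c < \<epsilon>\<rbrakk> \<Longrightarrow>
      \<exists>t'\<in>{0..1}. c = side g k t' \<and> dist (side g (k + 2) (1 - t)) (side g (k + 2) (1 - t')) < \<epsilon>"
    "\<And>z. z \<in> cball 0 1 \<Longrightarrow> \<exists>c\<in>gluing g `` {z0}. dist z c < \<epsilon> \<Longrightarrow>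
      gluing g `` {z} \<subseteq> {z \<in> cball 0 1. \<exists>c\<in>gluing g `` {z0}. dist z c < \<epsilon>}"
    "continuous_on ({z \<in> cball 0 1. \<exists>c\<in>gluing g `` {z0}. dist z c < \<epsilon>} \<times> {0..1}) (\<lambda>(z, s). d z s)"
    "\<And>z s. z \<in> cball 0 1 \<Longrightarrow> \<exists>c\<in>gluing g `` {z0}. dist z c < \<epsilon> \<Longrightarrow> s \<in> {0..1} \<Longrightarrow> d z s \<in> cball 0 1"
    "\<And>z c. z \<in> cball 0 1 \<Longrightarrow> c \<in> gluing g `` {z0} \<Longrightarrow> dist z c < \<epsilon> \<Longrightarrow> d z 0 = z \<and> d z 1 = c"
    "\<And>c s. c \<in> gluing g `` {z0} \<Longrightarrow> s \<in> {0..1} \<Longrightarrow> d c s = c"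
    "\<And>z z' s. \<lbrakk>z \<in> cball 0 1; \<exists>c\<in>gluing g `` {z0}. dist z c < \<epsilon>; (z, z') \<in> gluing g; s \<in> {0..1}\<rbrakk> \<Longrightarrow>
      (d z s, d z' s) \<in> gluing g"
proof -
  let ?C = "gluing g `` {z0}" and ?D = "cball 0 1 :: complex set"
  obtain \<epsilon> where e: "\<epsilon> > 0" "\<epsilon> < 1/2" "\<epsilon> < \<eta>"
    and sep: "\<And>c c'. c \<in> ?C \<Longrightarrow> c' \<in> ?C \<Longrightarrow> c \<noteq> c' \<Longrightarrow> 4 * \<epsilon> < dist c c'"
    and arc: "\<And>c b m. c \<in> ?C \<Longrightarrow> m < 4 * g \<Longrightarrow> b \<in> {real m..real m + 1} \<Longrightarrow>
      dist (circle_pt g b) c < \<epsilon> \<Longrightarrow> c \<in> circle_pt g ` {real m..real m + 1}"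
    and inner: "norm z0 < 1 \<Longrightarrow> \<epsilon> < 1 - norm z0"
    using gluing_radius[OF g z0 \<eta>] by blast
  define U where "U = {z \<in> ?D. \<exists>c\<in>?C. dist z c < \<epsilon>}"
  \<comment> \<open>Class points are more than \<open>4 * \<epsilon>\<close> apart, so at most one
    is within \<open>\<epsilon>\<close> of \<open>z\<close> and the choice is forced.\<close>
  define near where "near z = (SOME c. c \<in> ?C \<and> dist z c < \<epsilon>)" for z
  define d where "d z s = retract_to (near z) z s" for z s
  have CD: "?C \<subseteq> ?D" by (auto simp: gluing_alt)
  have near: "near z = c" if "c \<in> ?C" "dist z c < \<epsilon>" for z c
  proof -
    have "near z \<in> ?C \<and> dist z (near z) < \<epsilon>"
      unfolding near_def by (rule someI[of _ c]) (use that in simp)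
    then show ?thesis
      using sep[of "near z" c] that dist_triangle2[of "near z" c z] e(1) by (smt (verit) dist_commute)
  qed
  have pts: "\<exists>a\<in>{real m..real m + 1}. c = circle_pt g a" if "c \<in> ?C" "m < 4 * g" "b \<in> {real m..real m + 1}"
      "dist (circle_pt g b) c < \<epsilon>" for c m b
    using arc[OF that] by auto
  have stepU: "\<exists>c\<in>?C. dist z c < \<epsilon> \<and> (\<exists>c'\<in>?C. dist z' c' < \<epsilon> \<and> 
      (\<forall>s\<in>{0..1}. (retract_to c z s, retract_to c' z' s) \<in> gluing_step g))"
    if zU: "z \<in> U" and zz: "(z, z') \<in> gluing_step g" for z z'
  proof -
    obtain c where c: "c \<in> ?C" "dist z c < \<epsilon>" using zU by (auto simp: U_def)
    obtain k b where kb: "k < 4 * g" "k mod 4 < 2" "z = circle_pt g b" "z' = circle_pt g (2 * real k + 3 - b)"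
      "b \<in> {real k..real k + 1} \<or> b \<in> {real k + 2..real k + 3}"
      using zz by (rule gluing_stepE)
    define m where "m = (if b \<in> {real k..real k + 1} then k else k + 2)"
    have m: "m < 4 * g" "b \<in> {real m..real m + 1}"
    proof -
      have "k + 2 < 4 * g" using kb(1,2) by presburger
      then show "m < 4 * g" by (simp add: m_def)
      show "b \<in> {real m..real m + 1}" using kb(5) by (auto simp: m_def)
    qed
    then obtain a where a: "a \<in> {real m..real m + 1}" "c = circle_pt g a"
      using pts[of c m b] c kb(3) by auto
    let ?c' = "circle_pt g (2 * real k + 3 - a)"
    have st: "(circle_pt g x, circle_pt g (2 * real k + 3 - x)) \<in> gluing_step g" if "x \<in> {real m..real m + 1}" for x
      using that kb(1,2) by (intro gluing_stepI) (auto simp: m_def split: if_splits)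
    have "?c' \<in> ?C"
    proof -
      have "(c, ?c') \<in> gluing g"
        using st[OF a(1)] a(2) gluing_step_subset by auto
      then show ?thesis
        using c(1) equiv_gluing[of g] by (auto elim!: equivE dest: transD)
    qed
    moreover have "dist z' ?c' < \<epsilon>"
      using c(2) by (simp add: kb(3,4) a(2) dist_circle_pt_reflect)
    moreover have "(retract_to c z s, retract_to ?c' z' s) \<in> gluing_step g" if s: "s \<in> {0..1}" for s
    proof -
      have ab: "\<bar>b - a\<bar> \<le> 1" using m(2) a(1) by auto
      have 1: "retract_to c z s = circle_pt g (a + (1 - s) * (b - a))"
        unfolding a(2) kb(3) by (rule retract_to_circle[OF g ab])
      have "retract_to ?c' z' s = circle_pt g (2 * real k + 3 - a + (1 - s) * ((2 * real k + 3 - b) - (2 * real k + 3 - a)))"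
        unfolding kb(4) by (rule retract_to_circle[OF g]) (use ab in auto)
      also have "2 * real k + 3 - a + (1 - s) * ((2 * real k + 3 - b) - (2 * real k + 3 - a)) =
          2 * real k + 3 - (a + (1 - s) * (b - a))"
        by (simp add: algebra_simps)
      finally have 2: "retract_to ?c' z' s = circle_pt g (2 * real k + 3 - (a + (1 - s) * (b - a)))" .
      have "a + (1 - s) * (b - a) \<in> {real m..real m + 1}"
      proof -
        have "(1 - s) *\<^sub>R b + s *\<^sub>R a \<in> {real m..real m + 1}"
          by (rule convexD_alt[of _ b a s, OF _ m(2) a(1)]) (use s in auto)
        then show ?thesis by (simp add: algebra_simps)
      qed
      from st[OF this] show ?thesis unfolding 1 2 .
    qed
    ultimately show ?thesis using c by blast
  qed
  have retr: "norm c \<le> 1 \<and> norm z \<le> 1 \<and> dist z c < 1" if "c \<in> ?C" "dist z c < \<epsilon>" "z \<in> ?D" for c z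
    using that CD e by (auto simp: subset_iff)
  have trans: "trans (gluing g)"
    using equiv_gluing[of g] by (rule equivE)
  have gl: "z' \<in> U \<and> (\<forall>s\<in>{0..1}. (d z s, d z' s) \<in> gluing g)" if "z \<in> U" "(z, z') \<in> gluing g" for z z'
  proof -
    have "(z, z') \<in> (gluing_step g)\<^sup>*" using that(2) by (simp add: gluing_alt)
    then show ?thesis
    proof (induction rule: rtrancl_induct)
      case base
      have "d z s \<in> ?D" if "s \<in> {0..1}" for s
        using \<open>z \<in> U\<close> retract_to_props(1)[of _ z s] retr that near by (auto simp: U_def d_def)
      then show ?case using that(1) by (auto simp: gluing_alt)
    next
      case (step y y')
      then obtain c c' where cc: "c \<in> ?C" "dist y c < \<epsilon>" "c' \<in> ?C" "dist y' c' < \<epsilon>"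
        "\<forall>s\<in>{0..1}. (retract_to c y s, retract_to c' y' s) \<in> gluing_step g"
        using stepU[of y y'] by auto
      have y': "y' \<in> U" using cc step.hyps(2) by (auto simp: U_def dest: gluing_step_norm)
      have "\<forall>s\<in>{0..1}. (d y s, d y' s) \<in> gluing g"
        using cc near gluing_step_subset[of g] by (simp add: d_def subset_iff)
      then show ?case
        using y' step.IH trans by (auto dest: transD)
    qed
  qed
  show ?thesis
  proof (rule that[of \<epsilon> d])
    fix c k t assume ck: "c \<in> ?C" "k < 4 * g" "k mod 4 < 2" "t \<in> {0..1}" "dist (side g k t) c < \<epsilon>"
    then obtain a where a: "a \<in> {real k..real k + 1}" "c = circle_pt g a"
      using pts[of c k "real k + t"] by (auto simp: side_circle_pt)
    have "dist (circle_pt g (2 * real k + 3 - (real k + t))) (circle_pt g (2 * real k + 3 - a)) = dist (side g k t) c"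
      by (simp only: dist_circle_pt_reflect side_circle_pt a(2))
    then have "dist (side g (k + 2) (1 - t)) (side g (k + 2) (1 - (a - real k))) = dist (side g k t) c"
      by (simp add: side_circle_pt algebra_simps)
    then show "\<exists>t'\<in>{0..1}. c = side g k t' \<and> dist (side g (k + 2) (1 - t)) (side g (k + 2) (1 - t')) < \<epsilon>"
      using a ck(5) by (intro bexI[of _ "a - real k"]) (auto simp: side_circle_pt)
  next
    show "continuous_on ({z \<in> ?D. \<exists>c\<in>?C. dist z c < \<epsilon>} \<times> {0..1}) (\<lambda>(z, s). d z s)"
      unfolding continuous_on_eq_continuous_within
    proof
      fix w assume w: "w \<in> {z \<in> ?D. \<exists>c\<in>?C. dist z c < \<epsilon>} \<times> {0..1::real}"
      then obtain c where c: "c \<in> ?C" "dist (fst w) c < \<epsilon>" by auto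
      have cont: "continuous_on (ball c \<epsilon> \<times> UNIV) (\<lambda>(z, s). retract_to c z s)"
      proof (rule continuous_on_subset[OF continuous_on_retract_to])
        show "norm c \<le> 1" using CD c(1) by auto
      qed (use e in auto)
      have "continuous_on (ball c \<epsilon> \<times> UNIV) (\<lambda>(z, s). d z s)"
        using cont by (rule continuous_on_eq) (auto simp: d_def near[OF c(1)] dist_commute)
      then have "continuous (at w) (\<lambda>(z, s). d z s)"
        by (rule continuous_on_interior)
          (use c(2) in \<open>auto simp: interior_open open_Times mem_Times_iff dist_commute\<close>)
      then show "continuous (at w within {z \<in> ?D. \<exists>c\<in>?C. dist z c < \<epsilon>} \<times> {0..1}) (\<lambda>(z, s). d z s)"
        by (rule continuous_at_imp_continuous_at_within)
    qed
  next
    fix z s assume "z \<in> ?D" "\<exists>c\<in>?C. dist z c < \<epsilon>" "s \<in> {0..1::real}"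
    then show "d z s \<in> ?D"
      using retract_to_props(1)[of _ z s] retr near by (auto simp: d_def)
  next
    fix z c assume "z \<in> ?D" "c \<in> ?C" "dist z c < \<epsilon>"
    then show "d z 0 = z \<and> d z 1 = c"
      using retract_to_props(2,3)[of c z 0] retr[of c z] near by (auto simp: d_def)
  next
    fix c s assume c: "c \<in> ?C" "s \<in> {0..1::real}"
    have "near c = c" using near[of c c] c(1) e(1) by simp
    moreover have "c \<in> ?D" using CD c(1) by blast
    ultimately show "d c s = c"
      using retract_to_props(4)[of c c s] c(2) by (simp add: d_def)
  next
    fix z assume "z \<in> ?D" "\<exists>c\<in>?C. dist z c < \<epsilon>"
    then have "z \<in> U" by (simp add: U_def)
    then show "gluing g `` {z} \<subseteq> {z \<in> ?D. \<exists>c\<in>?C. dist z c < \<epsilon>}"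
      using gl[of z] by (auto simp only: U_def)
  next
    fix z z' s assume "z \<in> ?D" "\<exists>c\<in>?C. dist z c < \<epsilon>" "(z, z') \<in> gluing g" "s \<in> {0..1::real}"
    then have "z \<in> U" "(z, z') \<in> gluing g" "s \<in> {0..1}" by (simp_all add: U_def)
    then show "(d z s, d z' s) \<in> gluing g"
      using gl[of z z'] by simp
  qed (fact e(1), fact e(3), fact sep)
qed

lemma topspace_surface: "topspace (closed_oriented_surface g) = cball 0 1 // gluing g"
  by (simp add: closed_oriented_surface_def topspace_quotient_topology)

lemma surface_class_eq:
  assumes "A \<in> cball 0 1 // gluing g" "z \<in> A"
  shows "A = gluing g `` {z}" "z \<in> cball 0 1"
proof -
  obtain y where y: "A = gluing g `` {y}"
    using assms(1) by (auto elim: quotientE)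
  then have "(y, z) \<in> gluing g" using assms(2) by simp
  then show "A = gluing g `` {z}" "z \<in> cball 0 1"
    using equiv_class_eq[OF equiv_gluing] y by (auto simp: gluing_alt)
qed

lemma surface_class_nonempty: "A \<in> cball 0 1 // gluing g \<Longrightarrow> \<exists>z. z \<in> A"
  using equiv_gluing[of g] by (metis ex_in_conv in_quotient_imp_non_empty)

lemma self_in_gluing_class: "z \<in> cball 0 1 \<Longrightarrow> z \<in> gluing g `` {z}"
  by (simp add: gluing_alt)

lemma openin_surface:
  assumes "openin (top_of_set (cball 0 1)) U" "\<And>z. z \<in> U \<Longrightarrow> gluing g `` {z} \<subseteq> U"
  shows "openin (closed_oriented_surface g) {A \<in> cball 0 1 // gluing g. A \<subseteq> U}"
proof -
  have "U \<subseteq> cball 0 1" using assms(1) openin_subset by fastforce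
  then have "{x \<in> cball 0 1. gluing g `` {x} \<in> {A \<in> cball 0 1 // gluing g. A \<subseteq> U}} = U"
    using assms(2) self_in_gluing_class[of _ g] by (auto simp: quotientI subset_iff)
  then show ?thesis
    using assms(1) by (auto simp: closed_oriented_surface_def openin_quotient_topology)
qed

lemma openin_near:
  "openin (top_of_set D) {z \<in> D. \<exists>c\<in>C. dist z c < \<epsilon>}"
proof -
  have "{z \<in> D. \<exists>c\<in>C. dist z c < \<epsilon>} = D \<inter> (\<Union>c\<in>C. ball c \<epsilon>)"
    by (auto simp: dist_commute)
  then show ?thesis by (simp add: openin_open_Int open_UN)
qed

text \<open>A saturated open subset of the disc is open in the surface, so continuity of
  \<open>\<Phi>\<close> controls all representatives of \<open>\<Phi> q\<close> at once.\<close>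

lemma surface_map_near:
  fixes Q :: "'q::metric_space set"
  assumes \<Phi>: "continuous_map (top_of_set Q) (closed_oriented_surface g) \<Phi>" and q0: "q0 \<in> Q"
    and sat: "\<And>z. z \<in> cball 0 1 \<Longrightarrow> \<exists>c\<in>\<Phi> q0. dist z c < \<epsilon> \<Longrightarrow>
      gluing g `` {z} \<subseteq> {z \<in> cball 0 1. \<exists>c\<in>\<Phi> q0. dist z c < \<epsilon>}" and \<epsilon>: "\<epsilon> > 0"
  obtains \<delta> where "\<delta> > 0" "\<And>q z. q \<in> Q \<Longrightarrow> dist q q0 < \<delta> \<Longrightarrow> z \<in> \<Phi> q \<Longrightarrow> \<exists>c\<in>\<Phi> q0. dist z c < \<epsilon>"
proof -
  let ?U = "{z \<in> cball 0 1. \<exists>c\<in>\<Phi> q0. dist z c < \<epsilon>}"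
  let ?V = "{A \<in> cball 0 1 // gluing g. A \<subseteq> ?U}"
  have "openin (closed_oriented_surface g) ?V"
    using sat by (intro openin_surface openin_near) auto
  then have "openin (top_of_set Q) {q \<in> Q. \<Phi> q \<in> ?V}"
    using \<Phi> by (auto simp: continuous_map_def)
  moreover have "\<Phi> q0 \<in> cball 0 1 // gluing g"
    using \<Phi> q0 by (auto simp: continuous_map_def topspace_surface Pi_iff)
  then have "\<Phi> q0 \<in> ?V"
    using \<epsilon> surface_class_eq(2) by (auto intro!: bexI)
  ultimately obtain \<delta> where "\<delta> > 0" "\<And>q. q \<in> Q \<Longrightarrow> dist q q0 < \<delta> \<Longrightarrow> \<Phi> q \<in> ?V"
    using q0 by (auto simp: openin_euclidean_subtopology_iff)
  then show ?thesis by (intro that[of \<delta>]) blast+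
qed

section \<open>Flat labellings and holonomy: homomorphisms out of the surface group\<close>

text \<open>In effect a lift of \<open>\<Phi>\<close> to the covering space assembled from copies of
  the polygon indexed by \<open>H\<close>: the label tells in which copy a representative lies, and
  passing from a side to its partner multiplies it by \<open>e k\<close> on the right. Working with
  labels avoids the construction of that space.\<close>

definition flat :: "('h, 'c) monoid_scheme \<Rightarrow> nat \<Rightarrow> (nat \<Rightarrow> 'h) \<Rightarrow> 'q::metric_space set \<Rightarrow>
    ('q \<Rightarrow> complex set) \<Rightarrow> ('q \<Rightarrow> complex \<Rightarrow> 'h) \<Rightarrow> bool"
  where "flat H g e Q \<Phi> l \<longleftrightarrow>
    (\<forall>q\<in>Q. \<forall>z\<in>\<Phi> q. l q z \<in> carrier H) \<and>
    (\<forall>q\<in>Q. \<forall>k<4 * g. k mod 4 < 2 \<longrightarrow> (\<forall>t\<in>{0..1}. side g k t \<in> \<Phi> q \<longrightarrow>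
      l q (side g (k + 2) (1 - t)) = l q (side g k t) \<otimes>\<^bsub>H\<^esub> e k)) \<and>
    (\<forall>q\<in>Q. \<exists>\<delta>>0. \<forall>q'\<in>Q. dist q' q < \<delta> \<longrightarrow> (\<forall>z\<in>\<Phi> q. \<forall>z'\<in>\<Phi> q'. dist z' z < \<delta> \<longrightarrow> l q' z' = l q z))"

lemma flatD:
  assumes "flat H g e Q \<Phi> l" "q \<in> Q"
  shows "z \<in> \<Phi> q \<Longrightarrow> l q z \<in> carrier H"
    "k < 4 * g \<Longrightarrow> k mod 4 < 2 \<Longrightarrow> t \<in> {0..1} \<Longrightarrow> side g k t \<in> \<Phi> q \<Longrightarrow>
      l q (side g (k + 2) (1 - t)) = l q (side g k t) \<otimes>\<^bsub>H\<^esub> e k"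
    "\<exists>\<delta>>0. \<forall>q'\<in>Q. dist q' q < \<delta> \<longrightarrow> (\<forall>z\<in>\<Phi> q. \<forall>z'\<in>\<Phi> q'. dist z' z < \<delta> \<longrightarrow> l q' z' = l q z)"
  using assms unfolding flat_def by blast+

lemma flat_subset: "flat H g e Q \<Phi> l \<Longrightarrow> Q' \<subseteq> Q \<Longrightarrow> flat H g e Q' \<Phi> l"
  unfolding flat_def by (meson subset_iff)

text \<open>No continuity is asked for. \<open>L\<close> serves only to label the points of one
  gluing class consistently; nearness then spreads these labels to a neighbourhood.\<close>

definition equivariant :: "('h, 'c) monoid_scheme \<Rightarrow> nat \<Rightarrow> (nat \<Rightarrow> 'h) \<Rightarrow> (complex \<Rightarrow> 'h) \<Rightarrow> bool"
  where "equivariant H g e L \<longleftrightarrow> (\<forall>z. L z \<in> carrier H) \<and>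
    (\<forall>k<4 * g. k mod 4 < 2 \<longrightarrow> (\<forall>t\<in>{0..1}. L (side g (k + 2) (1 - t)) = L (side g k t) \<otimes>\<^bsub>H\<^esub> e k))"

text \<open>A representative takes over the label of the class point of \<open>\<Phi> q0\<close>
  near to it. Crossing a side close to a class point matches crossing the same side at that class
  point.\<close>

lemma flat_local_existence:
  fixes Q :: "'q::metric_space set"
  assumes g: "g > 0" and L: "equivariant H g e L"
    and \<Phi>: "continuous_map (top_of_set Q) (closed_oriented_surface g) \<Phi>" and q0: "q0 \<in> Q"
  obtains \<delta> l where "\<delta> > 0" "flat H g e (Q \<inter> ball q0 \<delta>) \<Phi> l"
proof -
  have cl: "\<Phi> q \<in> cball 0 1 // gluing g" if "q \<in> Q" for q
    using \<Phi> that by (auto simp: continuous_map_def topspace_surface Pi_iff)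
  obtain z0 where z0: "z0 \<in> \<Phi> q0" using surface_class_nonempty[OF cl[OF q0]] by blast
  have C: "\<Phi> q0 = gluing g `` {z0}" "z0 \<in> cball 0 1"
    using surface_class_eq[OF cl[OF q0] z0] by auto
  obtain \<epsilon> where e: "\<epsilon> > 0"
    and sep: "\<And>c c'. c \<in> \<Phi> q0 \<Longrightarrow> c' \<in> \<Phi> q0 \<Longrightarrow> c \<noteq> c' \<Longrightarrow> 4 * \<epsilon> < dist c c'"
    and sd: "\<And>c k t. \<lbrakk>c \<in> \<Phi> q0; k < 4 * g; k mod 4 < 2; t \<in> {0..1}; dist (side g k t) c < \<epsilon>\<rbrakk> \<Longrightarrow>
      \<exists>t'\<in>{0..1}. c = side g k t' \<and> dist (side g (k + 2) (1 - t)) (side g (k + 2) (1 - t')) < \<epsilon>"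
    and sat: "\<And>z. z \<in> cball 0 1 \<Longrightarrow> \<exists>c\<in>\<Phi> q0. dist z c < \<epsilon> \<Longrightarrow>
      gluing g `` {z} \<subseteq> {z \<in> cball 0 1. \<exists>c\<in>\<Phi> q0. dist z c < \<epsilon>}"
    unfolding C(1) by (rule gluing_nbhd[OF g C(2) zero_less_one]) blast
  obtain \<delta> where d: "\<delta> > 0" "\<And>q z. q \<in> Q \<Longrightarrow> dist q q0 < \<delta> \<Longrightarrow> z \<in> \<Phi> q \<Longrightarrow> \<exists>c\<in>\<Phi> q0. dist z c < \<epsilon>"
    using surface_map_near[OF \<Phi> q0 sat e] by blast
  define near where "near z = (SOME c. c \<in> \<Phi> q0 \<and> dist z c < \<epsilon>)" for z
  have near: "near z \<in> \<Phi> q0 \<and> dist z (near z) < \<epsilon>" if "\<exists>c\<in>\<Phi> q0. dist z c < \<epsilon>" for z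
    unfolding near_def by (rule someI_ex) (use that in blast)
  have near_eq: "near z' = c" if "c \<in> \<Phi> q0" "dist z c < \<epsilon>" "dist z' z < \<epsilon>" "\<exists>c\<in>\<Phi> q0. dist z' c < \<epsilon>" for z z' c
    using sep[of "near z'" c] near[of z'] that dist_triangle[of "near z'" c z] dist_triangle[of "near z'" z z'] e
    by (smt (verit) dist_commute)
  have "flat H g e (Q \<inter> ball q0 \<delta>) \<Phi> (\<lambda>q z. L (near z))"
    unfolding flat_def
  proof (intro conjI ballI allI impI)
    fix q z show "L (near z) \<in> carrier H" using L by (simp add: equivariant_def)
  next
    fix q k t assume q: "q \<in> Q \<inter> ball q0 \<delta>" and k: "k < 4 * g" "k mod 4 < 2" and t: "t \<in> {0..1}" "side g k t \<in> \<Phi> q"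
    let ?z = "side g k t" and ?z' = "side g (k + 2) (1 - t)"
    have nz: "near ?z \<in> \<Phi> q0" "dist ?z (near ?z) < \<epsilon>"
      using d(2)[of q ?z] q t near by (auto simp: dist_commute)
    obtain t' where t': "t' \<in> {0..1}" "near ?z = side g k t'" "dist ?z' (side g (k + 2) (1 - t')) < \<epsilon>"
      using sd[OF nz(1) k t(1) nz(2)] by blast
    have "(near ?z, side g (k + 2) (1 - t')) \<in> gluing_step g"
      using t' k by (auto simp: gluing_step_def side_pairing_def)
    then have mem: "side g (k + 2) (1 - t') \<in> \<Phi> q0"
      using surface_class_eq(1)[OF cl[OF q0] nz(1)] gluing_step_subset[of g] by auto
    have "near ?z' = side g (k + 2) (1 - t')"
      by (rule near_eq[OF mem t'(3)]) (use e mem t'(3) in auto)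
    then show "L (near ?z') = L (near ?z) \<otimes>\<^bsub>H\<^esub> e k"
      using L k t' by (simp add: equivariant_def)
  next
    fix q assume q: "q \<in> Q \<inter> ball q0 \<delta>"
    show "\<exists>\<delta>'>0. \<forall>q'\<in>Q \<inter> ball q0 \<delta>. dist q' q < \<delta>' \<longrightarrow> (\<forall>z\<in>\<Phi> q. \<forall>z'\<in>\<Phi> q'. dist z' z < \<delta>' \<longrightarrow> L (near z') = L (near z))"
    proof (intro exI[of _ \<epsilon>] conjI e ballI impI)
      fix q' z z' assume "q' \<in> Q \<inter> ball q0 \<delta>" "z \<in> \<Phi> q" "z' \<in> \<Phi> q'" "dist z' z < \<epsilon>"
      then have "near z' = near z"
        using near[of z] d(2)[of q z] d(2)[of q' z'] q by (intro near_eq[of "near z" z]) (auto simp: dist_commute)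
      then show "L (near z') = L (near z)" by simp
    qed
  qed
  then show ?thesis using that d(1) by blast
qed

text \<open>Side crossings multiply on the right and hence drop out of
  \<open>l' q z \<otimes> inv (l q z)\<close>. This quotient depends on \<open>q\<close> alone and
  is locally constant in it.\<close>

lemma flat_unique:
  fixes Q :: "'q::metric_space set"
  assumes g: "g > 0" and H: "group H" and e: "\<And>k. e k \<in> carrier H"
    and \<Phi>: "continuous_map (top_of_set Q) (closed_oriented_surface g) \<Phi>"
    and Q: "connected Q" and l: "flat H g e Q \<Phi> l" and l': "flat H g e Q \<Phi> l'"
    and q: "q \<in> Q" "z \<in> \<Phi> q" "p \<in> Q" "y \<in> \<Phi> p"
  shows "l' q z \<otimes>\<^bsub>H\<^esub> inv\<^bsub>H\<^esub> (l q z) = l' p y \<otimes>\<^bsub>H\<^esub> inv\<^bsub>H\<^esub> (l p y)"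
proof -
  interpret group H by (rule H)
  let ?r = "\<lambda>q z. l' q z \<otimes>\<^bsub>H\<^esub> inv\<^bsub>H\<^esub> (l q z)"
  have cl: "\<Phi> q \<in> cball 0 1 // gluing g" if "q \<in> Q" for q
    using \<Phi> that by (auto simp: continuous_map_def topspace_surface Pi_iff)
  have pair: "?r q (side g (k + 2) (1 - t)) = ?r q (side g k t)"
    if "q \<in> Q" "k < 4 * g" "k mod 4 < 2" "t \<in> {0..1}" "side g k t \<in> \<Phi> q" for q k t
  proof -
    have "l' q (side g k t) \<in> carrier H" "l q (side g k t) \<in> carrier H"
      using flatD(1)[OF l \<open>q \<in> Q\<close>] flatD(1)[OF l' \<open>q \<in> Q\<close>] that by auto
    then show ?thesis
      using flatD(2)[OF l that(1-5)] flatD(2)[OF l' that(1-5)] e[of k]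
      by (simp add: inv_mult_group m_assoc)
  qed
  have cls: "?r q z = ?r q z'" if q: "q \<in> Q" "z \<in> \<Phi> q" "z' \<in> \<Phi> q" for q z z'
  proof -
    have "(z, z') \<in> (gluing_step g)\<^sup>*"
      using surface_class_eq(1)[OF cl[OF q(1)] q(2)] q(3) by (auto simp: gluing_alt)
    then have "z' \<in> \<Phi> q \<and> ?r q z = ?r q z'"
    proof (induction rule: rtrancl_induct)
      case (step u v)
      have "v \<in> \<Phi> q"
        using surface_class_eq(1)[OF cl[OF q(1)], of u] step gluing_step_subset[of g] by auto
      moreover have "?r q u = ?r q v"
        using step(2) pair[OF q(1)] step(3) \<open>v \<in> \<Phi> q\<close> by (auto simp: gluing_step_def side_pairing_def)
      ultimately show ?case using step by simp
    qed (use q in simp)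
    then show ?thesis by simp
  qed
  define \<rho> where "\<rho> q = ?r q (SOME z. z \<in> \<Phi> q)" for q
  have \<rho>: "\<rho> q = ?r q z" if "q \<in> Q" "z \<in> \<Phi> q" for q z
    unfolding \<rho>_def using that by (intro cls) (auto intro: someI[of "\<lambda>z. z \<in> \<Phi> q"])
  have "\<rho> q = \<rho> p"
  proof (rule connected_local_const[OF Q q(1) q(3)], intro ballI)
    fix q0 assume q0: "q0 \<in> Q"
    obtain z0 where z0: "z0 \<in> \<Phi> q0" using surface_class_nonempty[OF cl[OF q0]] by blast
    have C: "\<Phi> q0 = gluing g `` {z0}" "z0 \<in> cball 0 1"
      using surface_class_eq[OF cl[OF q0] z0] by auto
    obtain d1 where d1: "d1 > 0" "\<forall>q'\<in>Q. dist q' q0 < d1 \<longrightarrow> (\<forall>z\<in>\<Phi> q0. \<forall>z'\<in>\<Phi> q'. dist z' z < d1 \<longrightarrow> l q' z' = l q0 z)"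
      using flatD(3)[OF l q0] by blast
    obtain d2 where d2: "d2 > 0" "\<forall>q'\<in>Q. dist q' q0 < d2 \<longrightarrow> (\<forall>z\<in>\<Phi> q0. \<forall>z'\<in>\<Phi> q'. dist z' z < d2 \<longrightarrow> l' q' z' = l' q0 z)"
      using flatD(3)[OF l' q0] by blast
    obtain \<epsilon> where \<epsilon>: "\<epsilon> > 0" "\<epsilon> < min d1 d2"
      and sat: "\<And>z. z \<in> cball 0 1 \<Longrightarrow> \<exists>c\<in>\<Phi> q0. dist z c < \<epsilon> \<Longrightarrow>
        gluing g `` {z} \<subseteq> {z \<in> cball 0 1. \<exists>c\<in>\<Phi> q0. dist z c < \<epsilon>}"
      unfolding C(1) by (rule gluing_nbhd[OF g C(2), of "min d1 d2"]) (use d1 d2 in auto)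
    obtain \<delta> where d: "\<delta> > 0" "\<And>q z. q \<in> Q \<Longrightarrow> dist q q0 < \<delta> \<Longrightarrow> z \<in> \<Phi> q \<Longrightarrow> \<exists>c\<in>\<Phi> q0. dist z c < \<epsilon>"
      using surface_map_near[OF \<Phi> q0 sat \<epsilon>(1)] by blast
    have "\<rho> q0 = \<rho> q'" if q': "q' \<in> Q" "dist q' q0 < min \<delta> (min d1 d2)" for q'
    proof -
      obtain z' where z': "z' \<in> \<Phi> q'" using surface_class_nonempty[OF cl[OF q'(1)]] by blast
      then obtain c where c: "c \<in> \<Phi> q0" "dist z' c < \<epsilon>" using d(2)[of q' z'] q' by auto
      then have "l q' z' = l q0 c" "l' q' z' = l' q0 c"
        using d1(2) d2(2) q' z' \<epsilon> by auto
      then show ?thesis using \<rho>[OF q0 c(1)] \<rho>[OF q'(1) z'] by simp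
    qed
    then show "eventually (\<lambda>q'. \<rho> q0 = \<rho> q') (at q0 within Q)"
      unfolding eventually_at using d d1 d2 by (intro exI[of _ "min \<delta> (min d1 d2)"]) auto
  qed
  then show ?thesis using \<rho> q by simp
qed

lemma flat_left_mult:
  assumes "group H" "\<And>k. e k \<in> carrier H" "h \<in> carrier H" "flat H g e Q \<Phi> l"
  shows "flat H g e Q \<Phi> (\<lambda>q z. h \<otimes>\<^bsub>H\<^esub> l q z)"
proof -
  interpret group H by fact
  show ?thesis
    using assms(2-4) unfolding flat_def by (simp add: m_assoc)
qed

text \<open>Closedness of the pieces takes care of local constancy: a point outside one of them has
  a neighbourhood that avoids it.\<close>

lemma flat_union:
  assumes 1: "flat H g e Q1 \<Phi> l1" and 2: "flat H g e Q2 \<Phi> l2" and c: "closed Q1" "closed Q2"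
    and eq: "\<And>q z. q \<in> Q1 \<Longrightarrow> q \<in> Q2 \<Longrightarrow> z \<in> \<Phi> q \<Longrightarrow> l1 q z = l2 q z"
    and cl: "\<And>q. q \<in> Q1 \<union> Q2 \<Longrightarrow> \<Phi> q \<in> cball 0 1 // gluing g"
  shows "flat H g e (Q1 \<union> Q2) \<Phi> (\<lambda>q. if q \<in> Q1 then l1 q else l2 q)"
proof -
  let ?l = "\<lambda>q. if q \<in> Q1 then l1 q else l2 q"
  have l2: "?l q z = l2 q z" if "q \<in> Q2" "z \<in> \<Phi> q" for q z
    using that eq by auto
  define near where "near Q' q \<longleftrightarrow> (\<exists>\<delta>>0. \<forall>q'\<in>Q'. dist q' q < \<delta> \<longrightarrow>
      (\<forall>z\<in>\<Phi> q. \<forall>z'\<in>\<Phi> q'. dist z' z < \<delta> \<longrightarrow> ?l q' z' = ?l q z))" for Q' q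
  have far: "near Q' q" if Q': "closed Q'" "q \<notin> Q'" for Q' q
  proof -
    obtain \<delta> where d: "\<delta> > 0" "ball q \<delta> \<subseteq> - Q'"
      using Q' open_contains_ball[of "- Q'"] by auto
    then have "\<not> dist q' q < \<delta>" if "q' \<in> Q'" for q'
      using that by (auto simp: subset_iff dist_commute)
    then show ?thesis unfolding near_def using d(1) by blast
  qed
  have D1: "near Q1 q" for q
  proof (cases "q \<in> Q1")
    case True
    then show ?thesis using flatD(3)[OF 1 True] by (simp add: near_def)
  qed (use far c in blast)
  have D2: "near Q2 q" for q
  proof (cases "q \<in> Q2")
    case True
    then show ?thesis using flatD(3)[OF 2 True] unfolding near_def by (simp add: l2 del: if_split cong: conj_cong)
  qed (use far c in blast)
  show ?thesis
    unfolding flat_def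
  proof (intro conjI ballI allI impI)
    fix q z assume "q \<in> Q1 \<union> Q2" "z \<in> \<Phi> q"
    then show "?l q z \<in> carrier H" using flatD(1)[OF 1, of q] flatD(1)[OF 2, of q] by auto
  next
    fix q k t assume "q \<in> Q1 \<union> Q2" "k < 4 * g" "k mod 4 < 2" "t \<in> {0..1::real}" "side g k t \<in> \<Phi> q"
    then show "?l q (side g (k + 2) (1 - t)) = ?l q (side g k t) \<otimes>\<^bsub>H\<^esub> e k"
      using flatD(2)[OF 1, of q k t] flatD(2)[OF 2, of q k t] by auto
  next
    fix q assume q: "q \<in> Q1 \<union> Q2"
    obtain d1 where d1: "d1 > 0" "\<forall>q'\<in>Q1. dist q' q < d1 \<longrightarrow> (\<forall>z\<in>\<Phi> q. \<forall>z'\<in>\<Phi> q'. dist z' z < d1 \<longrightarrow> ?l q' z' = ?l q z)"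
      using D1[of q] unfolding near_def by blast
    obtain d2 where d2: "d2 > 0" "\<forall>q'\<in>Q2. dist q' q < d2 \<longrightarrow> (\<forall>z\<in>\<Phi> q. \<forall>z'\<in>\<Phi> q'. dist z' z < d2 \<longrightarrow> ?l q' z' = ?l q z)"
      using D2[of q] unfolding near_def by blast
    show "\<exists>\<delta>>0. \<forall>q'\<in>Q1 \<union> Q2. dist q' q < \<delta> \<longrightarrow> (\<forall>z\<in>\<Phi> q. \<forall>z'\<in>\<Phi> q'. dist z' z < \<delta> \<longrightarrow> ?l q' z' = ?l q z)"
    proof (intro exI[of _ "min d1 d2"] conjI ballI impI)
      fix q' z z' assume *: "q' \<in> Q1 \<union> Q2" "dist q' q < min d1 d2" "z \<in> \<Phi> q" "z' \<in> \<Phi> q'" "dist z' z < min d1 d2"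
      from *(1) show "?l q' z' = ?l q z"
      proof
        assume "q' \<in> Q1"
        from d1(2)[rule_format, OF this] * show ?thesis by simp
      next
        assume "q' \<in> Q2"
        from d2(2)[rule_format, OF this] * show ?thesis by simp
      qed
    qed (use d1 d2 in simp)
  qed
qed

text \<open>On the connected overlap the two labellings differ by one left factor \<open>h\<close>,
  which is absorbed into the second.\<close>

lemma flat_glue:
  fixes Q1 Q2 :: "'q::metric_space set"
  assumes g: "g > 0" and H: "group H" and e: "\<And>k. e k \<in> carrier H"
    and \<Phi>: "continuous_map (top_of_set (Q1 \<union> Q2)) (closed_oriented_surface g) \<Phi>"
    and 1: "flat H g e Q1 \<Phi> l1" and 2: "flat H g e Q2 \<Phi> l2" and c: "closed Q1" "closed Q2"
    and conn: "connected (Q1 \<inter> Q2)" "Q1 \<inter> Q2 \<noteq> {}"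
  shows "\<exists>l. flat H g e (Q1 \<union> Q2) \<Phi> l"
proof -
  interpret group H by (rule H)
  have cl: "\<Phi> q \<in> cball 0 1 // gluing g" if "q \<in> Q1 \<union> Q2" for q
    using \<Phi> that by (auto simp: continuous_map_def topspace_surface Pi_iff)
  obtain p where p: "p \<in> Q1 \<inter> Q2" using conn by blast
  obtain y where y: "y \<in> \<Phi> p" using surface_class_nonempty[OF cl] p by blast
  define h where "h = l1 p y \<otimes>\<^bsub>H\<^esub> inv\<^bsub>H\<^esub> (l2 p y)"
  have car: "l1 q z \<in> carrier H" "l2 q z \<in> carrier H" if "q \<in> Q1 \<inter> Q2" "z \<in> \<Phi> q" for q z
    using flatD(1)[OF 1] flatD(1)[OF 2] that by auto
  have h: "h \<in> carrier H" using car[OF p y] by (simp add: h_def)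
  have \<Phi>12: "continuous_map (top_of_set (Q1 \<inter> Q2)) (closed_oriented_surface g) \<Phi>"
    using continuous_map_from_subtopology[OF \<Phi>, of "Q1 \<inter> Q2"] by (simp add: subtopology_subtopology Int_absorb1 inf.coboundedI1 le_supI1)
  have eq: "l1 q z = h \<otimes>\<^bsub>H\<^esub> l2 q z" if "q \<in> Q1" "q \<in> Q2" "z \<in> \<Phi> q" for q z
  proof -
    have "l1 q z \<otimes>\<^bsub>H\<^esub> inv\<^bsub>H\<^esub> (l2 q z) = h"
      unfolding h_def using that p y
      by (intro flat_unique[OF g H e \<Phi>12 conn(1) flat_subset[OF 2] flat_subset[OF 1]]) auto
    then show ?thesis using car[of q z] that by (simp add: inv_solve_right' h)
  qed
  show ?thesis
    using flat_union[OF 1 flat_left_mult[OF H e h 2] c eq cl] by blast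
qed

text \<open>Local labellings are glued by bisection (\<open>Bolzano\<close>), first along a row to
  obtain a strip of some positive height, then over the strips. The pieces overlap in segments, so
  the overlaps are connected.\<close>

lemma flat_exists_square:
  assumes g: "g > 0" and H: "group H" and e: "\<And>k. e k \<in> carrier H" and L: "equivariant H g e L"
    and \<Phi>: "continuous_map (top_of_set ({0..1} \<times> {0..1})) (closed_oriented_surface g) \<Phi>"
  shows "\<exists>l. flat H g e ({0..1::real} \<times> {0..1::real}) \<Phi> l"
proof -
  let ?I = "{0..1::real}"
  have sub: "continuous_map (top_of_set Q) (closed_oriented_surface g) \<Phi>" if "Q \<subseteq> ?I \<times> ?I" for Q
    using continuous_map_from_subtopology[OF \<Phi>, of Q] that by (simp add: subtopology_subtopology Int_absorb1)
  have glue: "\<exists>l. flat H g e Q \<Phi> l" if ex: "\<exists>l. flat H g e Q1 \<Phi> l" "\<exists>l. flat H g e Q2 \<Phi> l"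
    and Q: "closed Q1" "closed Q2" "connected (Q1 \<inter> Q2)" "Q1 \<inter> Q2 \<noteq> {}" "Q \<subseteq> Q1 \<union> Q2" "Q1 \<union> Q2 \<subseteq> ?I \<times> ?I"
    for Q Q1 Q2
  proof -
    obtain l1 l2 where "flat H g e Q1 \<Phi> l1" "flat H g e Q2 \<Phi> l2" using ex by blast
    from flat_glue[OF g H e sub[OF Q(6)] this Q(1-4)] obtain l where "flat H g e (Q1 \<union> Q2) \<Phi> l" by blast
    from flat_subset[OF this Q(5)] show ?thesis by blast
  qed
  have strip: "0 \<le> (0::real) \<and> (1::real) \<le> 1 \<longrightarrow> (\<exists>\<delta>>0. \<exists>l. flat H g e ({0..1} \<times> ({t0 - \<delta>..t0 + \<delta>} \<inter> ?I)) \<Phi> l)"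
    if t0: "t0 \<in> ?I" for t0
    using zero_le_one
  proof (induction rule: Bolzano[of 0 1 "\<lambda>a b. 0 \<le> a \<and> b \<le> 1 \<longrightarrow> (\<exists>\<delta>>0. \<exists>l. flat H g e ({a..b} \<times> ({t0 - \<delta>..t0 + \<delta>} \<inter> ?I)) \<Phi> l)"])
    case (trans a b c)
    show ?case
    proof
      assume ac: "0 \<le> a \<and> c \<le> 1"
      obtain d1 l1 where 1: "d1 > 0" "flat H g e ({a..b} \<times> ({t0 - d1..t0 + d1} \<inter> ?I)) \<Phi> l1"
        using trans ac by auto
      obtain d2 l2 where h2: "d2 > 0" "flat H g e ({b..c} \<times> ({t0 - d2..t0 + d2} \<inter> ?I)) \<Phi> l2"
        using trans ac by auto
      define d where "d = min d1 d2"
      let ?J = "{t0 - d..t0 + d} \<inter> ?I"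
      have "\<exists>l. flat H g e ({a..c} \<times> ?J) \<Phi> l"
      proof (rule glue)
        show "\<exists>l. flat H g e ({a..b} \<times> ?J) \<Phi> l"
          by (rule exI[of _ l1], rule flat_subset[OF 1(2)]) (auto simp: d_def)
        show "\<exists>l. flat H g e ({b..c} \<times> ?J) \<Phi> l"
          by (rule exI[of _ l2], rule flat_subset[OF h2(2)]) (auto simp: d_def)
        have "({a..b} \<times> ?J) \<inter> ({b..c} \<times> ?J) = {b} \<times> ?J" using trans by auto
        moreover have "connected ({b} \<times> ?J)" by (intro connected_Times) (auto simp: Int_atLeastAtMost)
        moreover have "(b, t0) \<in> {b} \<times> ?J" using t0 1 h2 by (auto simp: d_def)
        ultimately show "connected (({a..b} \<times> ?J) \<inter> ({b..c} \<times> ?J))" "({a..b} \<times> ?J) \<inter> ({b..c} \<times> ?J) \<noteq> {}"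
          by auto
        show "{a..b} \<times> ?J \<union> {b..c} \<times> ?J \<subseteq> ?I \<times> ?I" using trans ac by auto
      qed (auto intro!: closed_Times closed_Int)
      then show "\<exists>\<delta>>0. \<exists>l. flat H g e ({a..c} \<times> ({t0 - \<delta>..t0 + \<delta>} \<inter> ?I)) \<Phi> l"
        using 1(1) h2(1) by (intro exI[of _ d] conjI) (simp_all add: d_def)
    qed
  next
    case (local x)
    then have "(x, t0) \<in> ?I \<times> ?I" using t0 by auto
    from flat_local_existence[OF g L \<Phi> this] obtain \<delta> l where d: "\<delta> > 0"
      "flat H g e (?I \<times> ?I \<inter> ball (x, t0) \<delta>) \<Phi> l" by blast
    show ?case
    proof (rule exI[of _ "\<delta> / 2"], intro conjI allI impI)
      fix a b assume ab: "a \<le> x \<and> x \<le> b \<and> b - a < \<delta> / 2" "0 \<le> a \<and> b \<le> 1"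
      \<comment> \<open>A width below \<open>\<delta> / 2\<close> and a half height of
        \<open>\<delta> / 3\<close> add up to less than \<open>\<delta>\<close>.\<close>
      have "{a..b} \<times> ({t0 - \<delta>/3..t0 + \<delta>/3} \<inter> ?I) \<subseteq> ?I \<times> ?I \<inter> ball (x, t0) \<delta>"
      proof
        fix w assume w: "w \<in> {a..b} \<times> ({t0 - \<delta>/3..t0 + \<delta>/3} \<inter> ?I)"
        obtain u v where uv: "w = (u, v)" by (cases w)
        have "dist (x, t0) (u, v) \<le> dist x u + dist t0 v"
          by (simp add: dist_prod_def sqrt_sum_squares_le_sum)
        moreover have "dist x u < \<delta> / 2" "dist t0 v \<le> \<delta> / 3"
        proof -
          have "a \<le> u" "u \<le> b" "t0 - \<delta> / 3 \<le> v" "v \<le> t0 + \<delta> / 3" using w uv by auto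
          then show "dist x u < \<delta> / 2" "dist t0 v \<le> \<delta> / 3"
            using ab unfolding dist_real_def by linarith+
        qed
        ultimately show "w \<in> ?I \<times> ?I \<inter> ball (x, t0) \<delta>"
          using w uv ab d(1) by auto
      qed
      then show "\<exists>\<delta>>0. \<exists>l. flat H g e ({a..b} \<times> ({t0 - \<delta>..t0 + \<delta>} \<inter> ?I)) \<Phi> l"
        using flat_subset[OF d(2)] d(1) by (intro exI[of _ "\<delta>/3"]) auto
    qed (use d in auto)
  qed
  have "0 \<le> (0::real) \<and> (1::real) \<le> 1 \<longrightarrow> (\<exists>l. flat H g e (?I \<times> {0..1}) \<Phi> l)"
    using zero_le_one
  proof (induction rule: Bolzano[of 0 1 "\<lambda>c d. 0 \<le> c \<and> d \<le> 1 \<longrightarrow> (\<exists>l. flat H g e (?I \<times> {c..d}) \<Phi> l)"])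
    case (trans a b c)
    show ?case
    proof
      assume ac: "0 \<le> a \<and> c \<le> 1"
      show "\<exists>l. flat H g e (?I \<times> {a..c}) \<Phi> l"
      proof (rule glue)
        show "\<exists>l. flat H g e (?I \<times> {a..b}) \<Phi> l" "\<exists>l. flat H g e (?I \<times> {b..c}) \<Phi> l" using trans ac by auto
        have "(?I \<times> {a..b}) \<inter> (?I \<times> {b..c}) = ?I \<times> {b}" using trans by auto
        moreover have "connected (?I \<times> {b})" by (intro connected_Times) auto
        ultimately show "connected ((?I \<times> {a..b}) \<inter> (?I \<times> {b..c}))" "(?I \<times> {a..b}) \<inter> (?I \<times> {b..c}) \<noteq> {}"
          by auto
        show "?I \<times> {a..b} \<union> ?I \<times> {b..c} \<subseteq> ?I \<times> ?I" using trans ac by auto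
      qed (auto intro!: closed_Times)
    qed
  next
    case (local x)
    then obtain \<delta> l where d: "\<delta> > 0" "flat H g e (?I \<times> ({x - \<delta>..x + \<delta>} \<inter> ?I)) \<Phi> l"
      using strip[of x] by auto
    show ?case
    proof (intro exI[of _ \<delta>] conjI allI impI)
      fix a b assume ab: "a \<le> x \<and> x \<le> b \<and> b - a < \<delta>" "0 \<le> a \<and> b \<le> 1"
      then have "?I \<times> {a..b} \<subseteq> ?I \<times> ({x - \<delta>..x + \<delta>} \<inter> ?I)" by auto
      then show "\<exists>l. flat H g e (?I \<times> {a..b}) \<Phi> l" using flat_subset[OF d(2)] by blast
    qed (use d in auto)
  qed
  then show ?thesis by simp
qed

lemma flat_compose:
  assumes l: "flat H g e Q \<Phi> l" and f: "continuous_on Q' f" "f ` Q' \<subseteq> Q"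
    and \<Psi>: "\<And>q. q \<in> Q' \<Longrightarrow> \<Psi> q = \<Phi> (f q)"
  shows "flat H g e Q' \<Psi> (\<lambda>q. l (f q))"
  unfolding flat_def
proof (intro conjI ballI allI impI)
  fix q z assume "q \<in> Q'" "z \<in> \<Psi> q"
  then show "l (f q) z \<in> carrier H" using flatD(1)[OF l, of "f q"] f(2) \<Psi> by auto
next
  fix q k t assume "q \<in> Q'" "k < 4 * g" "k mod 4 < 2" "t \<in> {0..1::real}" "side g k t \<in> \<Psi> q"
  then show "l (f q) (side g (k + 2) (1 - t)) = l (f q) (side g k t) \<otimes>\<^bsub>H\<^esub> e k"
    using flatD(2)[OF l, of "f q" k t] f(2) \<Psi> by auto
next
  fix q assume q: "q \<in> Q'"
  then have fq: "f q \<in> Q" using f(2) by auto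
  obtain \<delta> where d: "\<delta> > 0" "\<forall>q'\<in>Q. dist q' (f q) < \<delta> \<longrightarrow> (\<forall>z\<in>\<Phi> (f q). \<forall>z'\<in>\<Phi> q'. dist z' z < \<delta> \<longrightarrow> l q' z' = l (f q) z)"
    using flatD(3)[OF l fq] by blast
  obtain \<eta> where n: "\<eta> > 0" "\<forall>q'\<in>Q'. dist q' q < \<eta> \<longrightarrow> dist (f q') (f q) < \<delta>"
    using f(1) q d(1) unfolding continuous_on_iff by blast
  show "\<exists>\<delta>>0. \<forall>q'\<in>Q'. dist q' q < \<delta> \<longrightarrow> (\<forall>z\<in>\<Psi> q. \<forall>z'\<in>\<Psi> q'. dist z' z < \<delta> \<longrightarrow> l (f q') z' = l (f q) z)"
  proof (intro exI[of _ "min \<delta> \<eta>"] conjI ballI impI)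
    fix q' z z' assume *: "q' \<in> Q'" "dist q' q < min \<delta> \<eta>" "z \<in> \<Psi> q" "z' \<in> \<Psi> q'" "dist z' z < min \<delta> \<eta>"
    then have "f q' \<in> Q" "dist (f q') (f q) < \<delta>" "z \<in> \<Phi> (f q)" "z' \<in> \<Phi> (f q')" "dist z' z < \<delta>"
      using f(2) n(2) \<Psi> q by auto
    then show "l (f q') z' = l (f q) z" using d(2) by blast
  qed (use d n in simp)
qed

text \<open>A continuous choice of representatives never jumps from a side to its partner, so its
  label is locally constant.\<close>

lemma flat_along:
  fixes Q :: "'q::metric_space set"
  assumes l: "flat H g e Q \<Phi> l" and Q: "connected Q" and \<zeta>: "continuous_on Q \<zeta>" "\<And>q. q \<in> Q \<Longrightarrow> \<zeta> q \<in> \<Phi> q"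
    and p: "p \<in> Q" and q: "q \<in> Q"
  shows "l p (\<zeta> p) = l q (\<zeta> q)"
proof (rule connected_local_const[OF Q p q, of "\<lambda>q. l q (\<zeta> q)"], intro ballI)
  fix a assume a: "a \<in> Q"
  obtain \<delta> where d: "\<delta> > 0" "\<forall>q'\<in>Q. dist q' a < \<delta> \<longrightarrow> (\<forall>z\<in>\<Phi> a. \<forall>z'\<in>\<Phi> q'. dist z' z < \<delta> \<longrightarrow> l q' z' = l a z)"
    using flatD(3)[OF l a] by blast
  obtain \<eta> where n: "\<eta> > 0" "\<forall>q'\<in>Q. dist q' a < \<eta> \<longrightarrow> dist (\<zeta> q') (\<zeta> a) < \<delta>"
    using \<zeta>(1) a d(1) unfolding continuous_on_iff by blast
  have "l a (\<zeta> a) = l q' (\<zeta> q')" if "q' \<in> Q" "dist q' a < min \<delta> \<eta>" for q'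
    using d(2)[rule_format, OF that(1) _ \<zeta>(2)[OF a] \<zeta>(2)[OF that(1)]] n(2)[rule_format, OF that(1)] that(2) by simp
  then show "eventually (\<lambda>b. l a (\<zeta> a) = l b (\<zeta> b)) (at a within Q)"
    unfolding eventually_at using d n by (intro exI[of _ "min \<delta> \<eta>"]) auto
qed

text \<open>A handle with \<open>a = e (4 * j)\<close> and \<open>b = e (4 * j + 1)\<close>
  contributes \<open>a b^-1 a^-1 b\<close>. This is the monodromy around the vertex of the polygon,
  see \<open>vertex_value\<close>.\<close>

primrec handle_prod :: "('h, 'c) monoid_scheme \<Rightarrow> (nat \<Rightarrow> 'h) \<Rightarrow> nat \<Rightarrow> 'h" where
  "handle_prod H e 0 = \<one>\<^bsub>H\<^esub>"
| "handle_prod H e (Suc j) = handle_prod H e j \<otimes>\<^bsub>H\<^esub>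
    (e (4 * j) \<otimes>\<^bsub>H\<^esub> inv\<^bsub>H\<^esub> (e (4 * j + 1)) \<otimes>\<^bsub>H\<^esub> inv\<^bsub>H\<^esub> (e (4 * j)) \<otimes>\<^bsub>H\<^esub> e (4 * j + 1))"

text \<open>The side pairings identify the vertices of a handle in the order \<open>4 j\<close>,
  \<open>4 j + 3\<close>, \<open>4 j + 2\<close>, \<open>4 j + 1\<close>, \<open>4 j + 4\<close>,
  and each identification determines the next label. After a full handle the label is the next
  \<open>handle_prod\<close>.\<close>

definition vertex_value :: "('h, 'c) monoid_scheme \<Rightarrow> (nat \<Rightarrow> 'h) \<Rightarrow> nat \<Rightarrow> 'h"
  where "vertex_value H e n = (let x = handle_prod H e (n div 4); a = e (4 * (n div 4)); b = e (4 * (n div 4) + 1) in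
    if n mod 4 = 0 then x
    else if n mod 4 = 1 then x \<otimes>\<^bsub>H\<^esub> a \<otimes>\<^bsub>H\<^esub> inv\<^bsub>H\<^esub> b \<otimes>\<^bsub>H\<^esub> inv\<^bsub>H\<^esub> a
    else if n mod 4 = 2 then x \<otimes>\<^bsub>H\<^esub> a \<otimes>\<^bsub>H\<^esub> inv\<^bsub>H\<^esub> b
    else x \<otimes>\<^bsub>H\<^esub> a)"

lemma handle_prod_closed: "group H \<Longrightarrow> (\<And>k. e k \<in> carrier H) \<Longrightarrow> handle_prod H e j \<in> carrier H"
  by (induction j) (auto intro!: group.inv_closed monoid.m_closed group.is_monoid monoid.one_closed)

lemma vertex_value_closed:
  assumes "group H" "\<And>k. e k \<in> carrier H" shows "vertex_value H e n \<in> carrier H"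
proof -
  interpret group H by fact
  show ?thesis using assms(2) handle_prod_closed[OF assms] by (simp add: vertex_value_def Let_def)
qed

lemma vertex_value_step:
  assumes "group H" "\<And>k. e k \<in> carrier H" "k mod 4 < 2"
  shows "vertex_value H e (k + 3) = vertex_value H e k \<otimes>\<^bsub>H\<^esub> e k"
    "vertex_value H e (k + 2) = vertex_value H e (k + 1) \<otimes>\<^bsub>H\<^esub> e k"
proof -
  interpret group H by fact
  note [simp] = assms(2) handle_prod_closed[OF assms(1,2)]
  define j where "j = k div 4"
  have "k = 4 * j \<or> k = 4 * j + 1" using assms(3) unfolding j_def by presburger
  then show "vertex_value H e (k + 3) = vertex_value H e k \<otimes>\<^bsub>H\<^esub> e k"
    "vertex_value H e (k + 2) = vertex_value H e (k + 1) \<otimes>\<^bsub>H\<^esub> e k"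
  proof (atomize(full), elim disjE)
    assume k: "k = 4 * j"
    have m: "(4 * j + 3) div 4 = j" "(4 * j + 2) div 4 = j" "(4 * j + 1) div 4 = j" "(4 * j) div 4 = j"
      "(4 * j + 3) mod 4 = 3" "(4 * j + 2) mod 4 = 2" "(4 * j + 1) mod 4 = 1" "(4 * j) mod 4 = 0" by presburger+
    show "vertex_value H e (k + 3) = vertex_value H e k \<otimes>\<^bsub>H\<^esub> e k \<and>
      vertex_value H e (k + 2) = vertex_value H e (k + 1) \<otimes>\<^bsub>H\<^esub> e k"
      unfolding vertex_value_def k m Let_def by (simp add: m_assoc)
  next
    assume k: "k = 4 * j + 1"
    have m: "(4 * j + 1 + 3) div 4 = Suc j" "(4 * j + 1 + 2) div 4 = j" "(4 * j + 1 + 1) div 4 = j" "(4 * j + 1) div 4 = j"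
      "(4 * j + 1 + 3) mod 4 = 0" "(4 * j + 1 + 2) mod 4 = 3" "(4 * j + 1 + 1) mod 4 = 2" "(4 * j + 1) mod 4 = 1" by presburger+
    show "vertex_value H e (k + 3) = vertex_value H e k \<otimes>\<^bsub>H\<^esub> e k \<and>
      vertex_value H e (k + 2) = vertex_value H e (k + 1) \<otimes>\<^bsub>H\<^esub> e k"
      unfolding vertex_value_def k m Let_def by (simp add: m_assoc)
  qed
qed

text \<open>Inside a side only that side and its partner have to agree: the first of the two gets
  the unit, and its partner, two indices later, gets the \<open>e\<close> of the first.\<close>

definition angle_value :: "('h, 'c) monoid_scheme \<Rightarrow> (nat \<Rightarrow> 'h) \<Rightarrow> real \<Rightarrow> 'h"
  where "angle_value H e a = (if a = real (nat \<lfloor>a\<rfloor>) then vertex_value H e (nat \<lfloor>a\<rfloor>)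
    else if nat \<lfloor>a\<rfloor> mod 4 < 2 then \<one>\<^bsub>H\<^esub> else e (nat \<lfloor>a\<rfloor> - 2))"

text \<open>A conflict could arise only where the circle closes up. There the labels for the angles
  \<open>0\<close> and \<open>4 * g\<close> are the empty and the full \<open>handle_prod\<close>,
  which agree by \<open>rel\<close>.\<close>

lemma exists_equivariant:
  assumes g: "g > 0" and H: "group H" and e: "\<And>k. e k \<in> carrier H" and rel: "handle_prod H e g = \<one>\<^bsub>H\<^esub>"
  obtains L where "equivariant H g e L"
proof -
  interpret group H by (rule H)
  define L where "L z = (if norm z = 1 then angle_value H e (SOME a. a \<in> {0..<real (4 * g)} \<and> z = circle_pt g a) else \<one>\<^bsub>H\<^esub>)" for z
  have closed: "L z \<in> carrier H" for z
    using e vertex_value_closed[OF H e] by (simp add: L_def angle_value_def)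
  have L0: "L (circle_pt g a) = angle_value H e a" if "a \<in> {0..<real (4 * g)}" for a
  proof -
    have "(SOME b. b \<in> {0..<real (4 * g)} \<and> circle_pt g a = circle_pt g b) = a"
    proof (rule some_equality)
      fix b assume b: "b \<in> {0..<real (4 * g)} \<and> circle_pt g a = circle_pt g b"
      then obtain n :: int where n: "a = b + of_int n * real (4 * g)"
        using circle_pt_eq_iff[OF g] by metis
      then have "\<bar>of_int n * real (4 * g)\<bar> < 1 * real (4 * g)" using b that by auto
      then have "\<bar>n\<bar> < 1" using g by (simp add: abs_mult)
      then show "b = a" using n by simp
    qed (use that in simp)
    then show ?thesis by (simp add: L_def)
  qed
  have L1: "L (circle_pt g a) = angle_value H e a" if "a \<in> {0..real (4 * g)}" for a
  proof (cases "a = real (4 * g)")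
    case True
    have "circle_pt g a = circle_pt g 0"
      unfolding circle_pt_eq_iff[OF g] True by (rule exI[of _ 1]) simp
    moreover have "nat \<lfloor>a\<rfloor> = 4 * g" using True by (metis floor_of_nat nat_int)
    then have "angle_value H e a = angle_value H e 0"
      using True rel by (simp add: angle_value_def vertex_value_def)
    ultimately show ?thesis using L0[of 0] g by simp
  qed (use L0 that in auto)
  have "L (side g (k + 2) (1 - t)) = L (side g k t) \<otimes>\<^bsub>H\<^esub> e k" if k: "k < 4 * g" "k mod 4 < 2" and t: "t \<in> {0..1}" for k t
  proof -
    have k2: "k + 3 \<le> 4 * g" using k by presburger
    then have "real k + 3 \<le> real (4 * g)" by (metis of_nat_add of_nat_le_iff of_nat_numeral)
    then have 1: "L (side g k t) = angle_value H e (real k + t)" 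
      and 2: "L (side g (k + 2) (1 - t)) = angle_value H e (real k + 3 - t)"
      unfolding side_circle_pt using t by (auto simp: algebra_simps intro!: L1[THEN trans])
    consider "t = 0" | "t = 1" | "0 < t" "t < 1" using t by fastforce
    then show ?thesis
    proof cases
      case a: 1
      have "nat \<lfloor>real k\<rfloor> = k" "nat \<lfloor>real k + 3\<rfloor> = k + 3" by (simp_all add: nat_add_distrib)
      then show ?thesis using 1 2 a vertex_value_step[OF H e k(2)] by (simp add: angle_value_def)
    next
      case a: 2
      have f: "nat \<lfloor>real k + 1\<rfloor> = k + 1" "nat \<lfloor>real k + 2\<rfloor> = k + 2"
        "nat (2 + int k) = Suc (Suc k)" by (simp_all add: nat_add_distrib)
      have "real k + 3 - t = real k + 2" using a by simp
      then show ?thesis using 1 2 a vertex_value_step[where e = e, OF H e k(2)] f by (simp add: angle_value_def)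
    next
      case a: 3
      have "\<lfloor>real k + t\<rfloor> = int k" "\<lfloor>real k + 3 - t\<rfloor> = int (k + 2)" using a by (simp_all add: floor_unique)
      then have f: "nat \<lfloor>real k + t\<rfloor> = k" "nat \<lfloor>real k + 3 - t\<rfloor> = k + 2" by (simp_all only: nat_int)
      have m: "\<not> (k + 2) mod 4 < 2" using k(2) by presburger
      have "angle_value H e (real k + t) = \<one>\<^bsub>H\<^esub>"
        using a k(2) unfolding angle_value_def f by simp
      moreover have "angle_value H e (real k + 3 - t) = e k"
        using a m unfolding angle_value_def f by simp
      ultimately show ?thesis using 1 2 e by simp
    qed
  qed
  then show thesis using closed that[of L] by (simp add: equivariant_def)
qed

abbreviation surf_proj :: "nat \<Rightarrow> complex \<Rightarrow> complex set"
  where "surf_proj g z \<equiv> gluing g `` {z}"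

lemma continuous_surf_proj: "continuous_map (top_of_set (cball 0 1)) (closed_oriented_surface g) (surf_proj g)"
  unfolding closed_oriented_surface_def by (rule quotient_imp_continuous_map[OF quotient_map_quotient_topology])

text \<open>From the centre out to side \<open>k\<close> and back from the partner side. The
  crossing position is a parameter because the surface relation is read off at the vertices, where
  \<open>\<tau>\<close> is \<open>0\<close> or \<open>1\<close>.\<close>

definition gen_loop :: "nat \<Rightarrow> nat \<Rightarrow> real \<Rightarrow> real \<Rightarrow> complex set"
  where "gen_loop g k \<tau> = loop_join (\<lambda>s. surf_proj g (s *\<^sub>R side g k \<tau>)) (\<lambda>s. surf_proj g ((1 - s) *\<^sub>R side g (k + 2) (1 - \<tau>)))"

abbreviation base_pt :: "complex set" where "base_pt \<equiv> {0}"

lemma surf_proj_0 [simp]: "surf_proj g 0 = base_pt"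
  by (simp add: gluing_class_interior)

lemma norm_side [simp]: "norm (side g k t) = 1"
  by (simp add: side_circle_pt)

lemma side_glued: 
  assumes "k < 4 * g" "k mod 4 < 2" "t \<in> {0..1}"
  shows "surf_proj g (side g (k + 2) (1 - t)) = surf_proj g (side g k t)"
proof -
  have "(side g k t, side g (k + 2) (1 - t)) \<in> gluing g"
    using assms gluing_step_subset[of g] by (auto simp: gluing_step_def side_pairing_def)
  then show ?thesis by (rule equiv_class_eq[OF equiv_gluing, symmetric])
qed

lemma loop_join_first: "t \<in> {0..1} \<Longrightarrow> loop_join p q (t / 2) = p t"
  by (simp add: loop_join_def)

lemma loop_join_second: "t \<in> {0..1} \<Longrightarrow> p 1 = q 0 \<Longrightarrow> loop_join p q ((1 + t) / 2) = q t"
proof -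
  have "2 * ((1 + t) / 2) - 1 = t" by (simp add: field_simps)
  then show "t \<in> {0..1} \<Longrightarrow> p 1 = q 0 \<Longrightarrow> loop_join p q ((1 + t) / 2) = q t"
    unfolding loop_join_def by (cases "t = 0") (simp_all only:, auto)
qed

lemma homotopy_of_family:
  fixes h :: "real \<Rightarrow> real \<Rightarrow> 'x"
  assumes "continuous_map (top_of_set ({0..1} \<times> {0..1})) X (\<lambda>(\<sigma>, s). h \<sigma> s)"
    "\<And>\<sigma>. \<sigma> \<in> {0..1} \<Longrightarrow> h \<sigma> 0 = x \<and> h \<sigma> 1 = x"
  shows "(h 0, h 1) \<in> loop_homotopy X x"
  unfolding loop_homotopy_def homotopic_with_def
  using assms by (auto simp: prod_topology_subtopology_eu intro!: exI[of _ "\<lambda>(\<sigma>, s). h \<sigma> s"])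

lemma family_join:
  fixes a b :: "real \<Rightarrow> real \<Rightarrow> 'x"
  assumes a: "continuous_map (top_of_set ({0..1} \<times> {0..1})) X (\<lambda>(\<sigma>, s). a \<sigma> s)"
    and b: "continuous_map (top_of_set ({0..1} \<times> {0..1})) X (\<lambda>(\<sigma>, s). b \<sigma> s)"
    and ab: "\<And>\<sigma>. \<sigma> \<in> {0..1} \<Longrightarrow> a \<sigma> 1 = b \<sigma> 0"
  shows "continuous_map (top_of_set ({0..1} \<times> {0..1})) X (\<lambda>(\<sigma>, s). loop_join (a \<sigma>) (b \<sigma>) s)"
proof -
  let ?K = "top_of_set ({0..1::real} \<times> {0..1::real})"
  have "continuous_map ?K X (\<lambda>z. if snd z \<le> 1/2 then a (fst z) (2 * snd z) else b (fst z) (2 * snd z - 1))"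
  proof (rule continuous_map_cases_le)
    show "continuous_map ?K euclideanreal snd"
      by (simp add: continuous_on_snd)
    have a': "continuous_map ?K X (\<lambda>z. a (fst z) (snd z))" and b': "continuous_map ?K X (\<lambda>z. b (fst z) (snd z))"
      using a b by (simp_all add: case_prod_unfold)
    have "continuous_map (subtopology ?K {z \<in> topspace ?K. snd z \<le> 1 / 2}) ?K (\<lambda>z. (fst z, 2 * snd z))"
      by (auto simp: subtopology_subtopology intro!: continuous_intros)
    from continuous_map_compose[OF this a']
    show "continuous_map (subtopology ?K {z \<in> topspace ?K. snd z \<le> 1 / 2}) X (\<lambda>z. a (fst z) (2 * snd z))"
      by (simp only: o_def fst_conv snd_conv)
    have "continuous_map (subtopology ?K {z \<in> topspace ?K. 1 / 2 \<le> snd z}) ?K (\<lambda>z. (fst z, 2 * snd z - 1))"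
      by (auto simp: subtopology_subtopology intro!: continuous_intros)
    from continuous_map_compose[OF this b']
    show "continuous_map (subtopology ?K {z \<in> topspace ?K. 1 / 2 \<le> snd z}) X (\<lambda>z. b (fst z) (2 * snd z - 1))"
      by (simp only: o_def fst_conv snd_conv)
    show "a (fst z) (2 * snd z) = b (fst z) (2 * snd z - 1)" if "z \<in> topspace ?K" "snd z = 1 / 2" for z
    proof -
      have "2 * snd z = 1" "fst z \<in> {0..1}" using that by auto
      then show ?thesis using ab by simp
    qed
  qed simp
  then show ?thesis
    by (simp add: loop_join_def case_prod_unfold)
qed

lemma family_of_disc:
  fixes f :: "real \<Rightarrow> real \<Rightarrow> complex"
  assumes "continuous_on ({0..1} \<times> {0..1}) (\<lambda>(\<sigma>, s). f \<sigma> s)"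
    "\<And>\<sigma> s. \<sigma> \<in> {0..1} \<Longrightarrow> s \<in> {0..1} \<Longrightarrow> f \<sigma> s \<in> cball 0 1"
  shows "continuous_map (top_of_set ({0..1} \<times> {0..1})) (closed_oriented_surface g) (\<lambda>(\<sigma>, s). surf_proj g (f \<sigma> s))"
  using continuous_map_compose[OF _ continuous_surf_proj, of "top_of_set ({0..1} \<times> {0..1})" "\<lambda>(\<sigma>, s). f \<sigma> s" g] assms
  by (auto simp: o_def case_prod_unfold Pi_iff)

lemma homotopy_reflD: "(p, p) \<in> loop_homotopy X x \<Longrightarrow> p \<in> loops_at X x"
  by (drule loop_homotopyD) simp

lemma gen_loop_homotopy:
  assumes k: "k < 4 * g" "k mod 4 < 2" and t: "\<tau> \<in> {0..1}" "\<tau>' \<in> {0..1}"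
  shows "(gen_loop g k \<tau>, gen_loop g k \<tau>') \<in> loop_homotopy (closed_oriented_surface g) base_pt"
proof -
  define T where "T \<sigma> = (1 - \<sigma>) * \<tau> + \<sigma> * \<tau>'" for \<sigma>
  have T: "T \<sigma> \<in> {0..1}" if "\<sigma> \<in> {0..1}" for \<sigma>
    using convexD_alt[of "{0..1::real}" \<tau> \<tau>' \<sigma>] t that by (simp add: T_def)
  have c1: "continuous_on ({0..1} \<times> {0..1}) (\<lambda>(\<sigma>, s). s *\<^sub>R side g k (T \<sigma>))"
    unfolding side_circle_pt T_def case_prod_unfold by (intro continuous_intros)
  have c2: "continuous_on ({0..1} \<times> {0..1}) (\<lambda>(\<sigma>, s). (1 - s) *\<^sub>R side g (k + 2) (1 - T \<sigma>))"
    unfolding side_circle_pt T_def case_prod_unfold by (intro continuous_intros)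
  have "(gen_loop g k (T 0), gen_loop g k (T 1)) \<in> loop_homotopy (closed_oriented_surface g) base_pt"
  proof (rule homotopy_of_family)
    show "continuous_map (top_of_set ({0..1} \<times> {0..1})) (closed_oriented_surface g) (\<lambda>(\<sigma>, s). gen_loop g k (T \<sigma>) s)"
      unfolding gen_loop_def
    proof (rule family_join[OF family_of_disc[OF c1] family_of_disc[OF c2]])
      show "surf_proj g (1 *\<^sub>R side g k (T \<sigma>)) = surf_proj g ((1 - 0) *\<^sub>R side g (k + 2) (1 - T \<sigma>))" if "\<sigma> \<in> {0..1}" for \<sigma>
        using side_glued[OF k T[OF that]] by simp
    qed auto
  qed (simp add: gen_loop_def loop_join_def)
  then show ?thesis by (simp add: T_def)
qed

lemma gen_loop_loop:
  assumes "k < 4 * g" "k mod 4 < 2" "\<tau> \<in> {0..1}"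
  shows "gen_loop g k \<tau> \<in> loops_at (closed_oriented_surface g) base_pt"
  using homotopy_reflD[OF gen_loop_homotopy[OF assms assms(3)]] .

text \<open>Labels are compared at the centre \<open>0\<close>, the only representative of
  \<open>base_pt\<close>. The inverse stands on the left because two flat labellings differ by a
  constant left factor, which then cancels.\<close>

definition holonomy :: "('h, 'c) monoid_scheme \<Rightarrow> nat \<Rightarrow> (nat \<Rightarrow> 'h) \<Rightarrow> (real \<Rightarrow> complex set) \<Rightarrow> 'h"
  where "holonomy H g e p = (let l = SOME l. flat H g e {0..1} p l in inv\<^bsub>H\<^esub> (l 0 0) \<otimes>\<^bsub>H\<^esub> l 1 0)"

context
  fixes H :: "('h, 'c) monoid_scheme" (structure) and g :: nat and e :: "nat \<Rightarrow> 'h"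
  assumes g: "g > 0" and H: "group H" and e: "\<And>k. e k \<in> carrier H" and rel: "handle_prod H e g = \<one>"
begin

interpretation group H by (rule H)

lemma flat_square:
  assumes "continuous_map (top_of_set ({0..1} \<times> {0..1})) (closed_oriented_surface g) \<Phi>"
  shows "\<exists>l. flat H g e ({0..1::real} \<times> {0..1::real}) \<Phi> l"
proof -
  obtain L where "equivariant H g e L" by (rule exists_equivariant[OF g H e rel])
  from flat_exists_square[OF g H e this assms] show ?thesis .
qed

lemma flat_path:
  assumes "pathin (closed_oriented_surface g) p"
  shows "\<exists>l. flat H g e {0..1} p l"
proof -
  have "continuous_map (top_of_set ({0..1::real} \<times> {0..1})) (top_of_set {0..1::real}) snd"
    by (auto intro!: continuous_intros)
  then have "continuous_map (top_of_set ({0..1::real} \<times> {0..1})) (closed_oriented_surface g) (p \<circ> snd)"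
    using assms unfolding pathin_def by (rule continuous_map_compose)
  from flat_square[OF this] obtain l where l: "flat H g e ({0..1::real} \<times> {0..1}) (p \<circ> snd) l" by blast
  have "flat H g e {0..1} p (\<lambda>t. l (0, t))"
    by (rule flat_compose[OF l]) (auto intro!: continuous_intros)
  then show ?thesis by blast
qed

lemma holonomy_eq:
  assumes p: "p \<in> loops_at (closed_oriented_surface g) base_pt" and l: "flat H g e {0..1} p l"
  shows "holonomy H g e p = inv (l 0 0) \<otimes> l 1 0"
proof -
  define m where "m = (SOME l. flat H g e {0..1} p l)"
  have m: "flat H g e {0..1} p m" unfolding m_def by (rule someI[of "flat H g e {0..1} p", OF l])
  have p': "continuous_map (top_of_set {0..1}) (closed_oriented_surface g) p" "p 0 = base_pt" "p 1 = base_pt"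
    using p by (auto simp: loops_at_def pathin_def)
  have "m 1 0 \<otimes> inv (l 1 0) = m 0 0 \<otimes> inv (l 0 0)"
    by (rule flat_unique[OF g H e p'(1) _ l m]) (auto simp: p')
  moreover have car: "m 1 0 \<in> carrier H" "m 0 0 \<in> carrier H" "l 1 0 \<in> carrier H" "l 0 0 \<in> carrier H"
    using flatD(1)[OF m] flatD(1)[OF l] p' by auto
  ultimately have "m 1 0 = m 0 0 \<otimes> inv (l 0 0) \<otimes> l 1 0"
    by (metis inv_solve_right' m_closed inv_closed)
  then have "inv (m 0 0) \<otimes> m 1 0 = inv (l 0 0) \<otimes> l 1 0"
    using car by (simp add: m_assoc)
  then show ?thesis by (simp add: holonomy_def m_def Let_def)
qed

lemma holonomy_closed:
  assumes p: "p \<in> loops_at (closed_oriented_surface g) base_pt"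
  shows "holonomy H g e p \<in> carrier H"
proof -
  obtain l where l: "flat H g e {0..1} p l"
    using flat_path[of p] p by (auto simp: loops_at_def)
  have "p 0 = base_pt" "p 1 = base_pt" using p by (auto simp: loops_at_def)
  then have "l 0 0 \<in> carrier H" "l 1 0 \<in> carrier H" using flatD(1)[OF l] by auto
  then show ?thesis using holonomy_eq[OF p l] by simp
qed

text \<open>A labelling over the homotopy square restricts to both loops, and along its two edges at
  the base point the label of the centre is constant.\<close>

lemma holonomy_homotopic:
  assumes pq: "(p, q) \<in> loop_homotopy (closed_oriented_surface g) base_pt"
  shows "holonomy H g e p = holonomy H g e q"
proof -
  have loops: "p \<in> loops_at (closed_oriented_surface g) base_pt" "q \<in> loops_at (closed_oriented_surface g) base_pt"
    using loop_homotopyD[OF pq] by auto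
  obtain h :: "real \<times> real \<Rightarrow> complex set" where h: "continuous_map (top_of_set ({0..1} \<times> {0..1})) (closed_oriented_surface g) h"
      "\<forall>s. h (0, s) = p s" "\<forall>s. h (1, s) = q s"
      "\<forall>t\<in>{0..1}. h (t, 0) = base_pt \<and> h (t, 1) = base_pt"
    using pq unfolding loop_homotopy_def homotopic_with_def by (auto simp: prod_topology_subtopology_eu)
  obtain l where l: "flat H g e ({0..1::real} \<times> {0..1}) h l"
    using flat_square[OF h(1)] by blast
  have 1: "flat H g e {0..1} p (\<lambda>t. l (0, t))" "flat H g e {0..1} q (\<lambda>t. l (1, t))"
    by (rule flat_compose[OF l]; auto intro!: continuous_intros simp: h)+
  have 2: "l (0, c) 0 = l (1, c) 0" if c: "c \<in> {0, 1}" for c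
  proof -
    have f: "flat H g e {0..1} (\<lambda>_. base_pt) (\<lambda>t. l (t, c))"
      by (rule flat_compose[OF l]) (use c h(4) in \<open>auto intro!: continuous_intros\<close>)
    show ?thesis
      by (rule flat_along[OF f, of "\<lambda>_. 0" 0 1]) auto
  qed
  show ?thesis
    using holonomy_eq[OF loops(1) 1(1)] holonomy_eq[OF loops(2) 1(2)] 2 by simp
qed

lemma holonomy_join:
  assumes p: "p \<in> loops_at (closed_oriented_surface g) base_pt" and q: "q \<in> loops_at (closed_oriented_surface g) base_pt"
  shows "holonomy H g e (loop_join p q) = holonomy H g e p \<otimes> holonomy H g e q"
proof -
  have pq: "loop_join p q \<in> loops_at (closed_oriented_surface g) base_pt"
    using p q by (rule loop_join_loops_at)
  obtain l where l: "flat H g e {0..1} (loop_join p q) l"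
    using flat_path[of "loop_join p q"] pq by (auto simp: loops_at_def)
  have ends: "p 0 = base_pt" "p 1 = base_pt" "q 0 = base_pt" "q 1 = base_pt"
    using p q by (auto simp: loops_at_def)
  have 1: "flat H g e {0..1} p (\<lambda>t. l (t / 2))"
    by (rule flat_compose[OF l]) (auto intro!: continuous_intros simp: loop_join_first)
  have 2: "flat H g e {0..1} q (\<lambda>t. l ((1 + t) / 2))"
    by (rule flat_compose[OF l]) (auto intro!: continuous_intros simp: loop_join_second ends)
  have "l 0 0 \<in> carrier H" "l 1 0 \<in> carrier H" "l (1/2) 0 \<in> carrier H"
    using flatD(1)[OF l] ends by (auto simp: loop_join_def)
  then show ?thesis
    using holonomy_eq[OF p 1] holonomy_eq[OF q 2] holonomy_eq[OF pq l]
    by (simp add: m_assoc)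
qed

text \<open>The label is constant along both radii by \<open>flat_along\<close>; the only change is
  the factor \<open>e k\<close> at the crossing.\<close>

lemma holonomy_gen_loop:
  assumes k: "k < 4 * g" "k mod 4 < 2" and t: "\<tau> \<in> {0..1}"
  shows "holonomy H g e (gen_loop g k \<tau>) = e k"
proof -
  let ?z = "side g k \<tau>" and ?z' = "side g (k + 2) (1 - \<tau>)"
  have loop: "gen_loop g k \<tau> \<in> loops_at (closed_oriented_surface g) base_pt"
    using k t by (rule gen_loop_loop)
  obtain l where l: "flat H g e {0..1} (gen_loop g k \<tau>) l"
    using flat_path[of "gen_loop g k \<tau>"] loop by (auto simp: loops_at_def)
  have gl: "surf_proj g ?z' = surf_proj g ?z" by (rule side_glued[OF k t])
  have 1: "flat H g e {0..1} (\<lambda>s. surf_proj g (s *\<^sub>R ?z)) (\<lambda>t. l (t / 2))"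
    by (rule flat_compose[OF l]) (auto intro!: continuous_intros simp: gen_loop_def loop_join_first)
  have 2: "flat H g e {0..1} (\<lambda>s. surf_proj g ((1 - s) *\<^sub>R ?z')) (\<lambda>t. l ((1 + t) / 2))"
  proof (rule flat_compose[OF l])
    fix t :: real assume t: "t \<in> {0..1}"
    show "surf_proj g ((1 - t) *\<^sub>R ?z') = gen_loop g k \<tau> ((1 + t) / 2)"
      unfolding gen_loop_def by (subst loop_join_second[OF t]) (use gl in simp_all)
  qed (auto intro!: continuous_intros)
  have "l (0 / 2) (0 *\<^sub>R ?z) = l (1 / 2) (1 *\<^sub>R ?z)"
    by (rule flat_along[OF 1, of "\<lambda>s. s *\<^sub>R ?z"]) (auto intro!: continuous_intros simp: gluing_alt)
  moreover have "l ((1 + 0) / 2) ((1 - 0) *\<^sub>R ?z') = l ((1 + 1) / 2) ((1 - 1) *\<^sub>R ?z')"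
    by (rule flat_along[OF 2, of "\<lambda>s. (1 - s) *\<^sub>R ?z'"]) (auto intro!: continuous_intros simp: gluing_alt)
  moreover have mem: "?z \<in> gen_loop g k \<tau> (1/2)"
    by (simp add: gen_loop_def loop_join_def gluing_alt)
  have "l (1/2) ?z' = l (1/2) ?z \<otimes> e k"
    by (rule flatD(2)[OF l _ k t mem]) simp
  moreover have "l (1/2) ?z \<in> carrier H"
    using flatD(1)[OF l _ mem] by simp
  ultimately show ?thesis
    using holonomy_eq[OF loop l] e[of k] by (simp flip: m_assoc)
qed

text \<open>One half of the presentation of the surface group: values on the edge loops that satisfy
  the surface relation extend to a homomorphism, namely to holonomy.\<close>

lemma surface_hom_exists:
  obtains h where "h \<in> hom (fundamental_group (closed_oriented_surface g) base_pt) H"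
    "\<And>k. k < 4 * g \<Longrightarrow> k mod 4 < 2 \<Longrightarrow>
      h (loop_homotopy (closed_oriented_surface g) base_pt `` {gen_loop g k 0}) = e k"
proof -
  let ?X = "closed_oriented_surface g"
  let ?R = "loop_homotopy ?X base_pt"
  define h where "h A = holonomy H g e (SOME p. p \<in> A)" for A
  have h: "h (?R `` {p}) = holonomy H g e p" if "p \<in> loops_at ?X base_pt" for p
  proof -
    have "p \<in> ?R `` {p}" using equiv_class_self[OF equiv_loop_homotopy that] .
    then have "(SOME q. q \<in> ?R `` {p}) \<in> ?R `` {p}" by (rule someI[of "\<lambda>q. q \<in> ?R `` {p}"])
    then have "(p, SOME q. q \<in> ?R `` {p}) \<in> ?R" by blast
    then show ?thesis using holonomy_homotopic by (simp add: h_def)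
  qed
  have "h \<in> hom (fundamental_group ?X base_pt) H"
  proof (rule homI)
    fix A assume "A \<in> carrier (fundamental_group ?X base_pt)"
    then show "h A \<in> carrier H"
      by (auto simp: fundamental_group_def h holonomy_closed elim!: quotientE)
  next
    fix A B assume "A \<in> carrier (fundamental_group ?X base_pt)" "B \<in> carrier (fundamental_group ?X base_pt)"
    then obtain p q where "A = ?R `` {p}" "p \<in> loops_at ?X base_pt" "B = ?R `` {q}" "q \<in> loops_at ?X base_pt"
      by (auto simp: fundamental_group_def elim!: quotientE)
    then show "h (A \<otimes>\<^bsub>fundamental_group ?X base_pt\<^esub> B) = h A \<otimes> h B"
      by (simp add: mult_fundamental_group h loop_join_loops_at holonomy_join)
  qed
  then show thesis
    by (rule that) (simp add: h gen_loop_loop holonomy_gen_loop)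
qed

end

section \<open>Generation by the edge loops, and the surface relation\<close>

text \<open>An initial piece of \<open>p\<close>, closed up along the radius from a representative
  \<open>z\<close> of \<open>p t\<close>. It interpolates between the trivial loop and
  \<open>p\<close>, and its class changes only when the representative changes, by a
  generator.\<close>

definition trace :: "nat \<Rightarrow> (real \<Rightarrow> complex set) \<Rightarrow> real \<Rightarrow> complex \<Rightarrow> real \<Rightarrow> complex set"
  where "trace g p t z = loop_join (\<lambda>s. p (s * t)) (\<lambda>s. surf_proj g ((1 - s) *\<^sub>R z))"

lemma loop_join_joinpaths: "loop_join p q = p +++ q"
  by (simp add: loop_join_def joinpaths_def)

lemma loop_homotopy_cong:
  assumes "(q, r) \<in> loop_homotopy X x" "\<And>s. s \<in> {0..1} \<Longrightarrow> q' s = q s" "\<And>s. s \<in> {0..1} \<Longrightarrow> r' s = r s"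
  shows "(q', r') \<in> loop_homotopy X x"
  using assms(1) unfolding loop_homotopy_def mem_Collect_eq case_prod_conv
  by (rule homotopic_with_eq) (use assms(2,3) in auto)

context
  fixes g :: nat and p :: "real \<Rightarrow> complex set"
  assumes g: "g > 0" and p: "p \<in> loops_at (closed_oriented_surface g) base_pt"
begin

private abbreviation (input) "X \<equiv> closed_oriented_surface g"
private abbreviation (input) "PG \<equiv> fundamental_group X base_pt"
private abbreviation (input) "cls q \<equiv> loop_homotopy X base_pt `` {q}"

lemma p_cont: "continuous_map (top_of_set {0..1}) X p" and p_ends: "p 0 = base_pt" "p 1 = base_pt"
  using p by (auto simp: loops_at_def pathin_def)

lemma p_class: "t \<in> {0..1} \<Longrightarrow> p t \<in> cball 0 1 // gluing g"
  using p_cont by (auto simp: continuous_map_def topspace_surface Pi_iff)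

lemma p_class_eq: "t \<in> {0..1} \<Longrightarrow> z \<in> p t \<Longrightarrow> p t = surf_proj g z \<and> z \<in> cball 0 1"
  using surface_class_eq[OF p_class] by blast

lemma family_of_path:
  fixes u :: "real \<Rightarrow> real \<Rightarrow> real"
  assumes "continuous_on ({0..1} \<times> {0..1}) (\<lambda>(\<sigma>, s). u \<sigma> s)"
    "\<And>\<sigma> s. \<sigma> \<in> {0..1} \<Longrightarrow> s \<in> {0..1} \<Longrightarrow> u \<sigma> s \<in> {0..1}"
  shows "continuous_map (top_of_set ({0..1} \<times> {0..1})) X (\<lambda>(\<sigma>, s). p (u \<sigma> s))"
  using continuous_map_compose[OF _ p_cont, of "top_of_set ({0..1} \<times> {0..1})" "\<lambda>(\<sigma>, s). u \<sigma> s"] assms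
  by (auto simp: o_def case_prod_unfold Pi_iff)

lemma mult_unit_interval: "s \<in> {0..1} \<Longrightarrow> t \<in> {0..1} \<Longrightarrow> s * t \<in> {0..1::real}"
  by (simp add: mult_le_one)

text \<open>Tails that come from paths in the convex disc are deformed into each other along
  straight lines.\<close>

lemma disc_tail_homotopy:
  fixes c c' :: "real \<Rightarrow> complex"
  assumes t: "t \<in> {0..1}" and c: "continuous_on {0..1} c" "c ` {0..1} \<subseteq> cball 0 1" "c 0 \<in> p t" "c 1 = 0"
    and c': "continuous_on {0..1} c'" "c' ` {0..1} \<subseteq> cball 0 1" "c' 0 = c 0" "c' 1 = 0"
  shows "(loop_join (\<lambda>s. p (s * t)) (\<lambda>s. surf_proj g (c s)), loop_join (\<lambda>s. p (s * t)) (\<lambda>s. surf_proj g (c' s)))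
    \<in> loop_homotopy X base_pt"
proof -
  define h where "h \<sigma> = loop_join (\<lambda>s. p (s * t)) (\<lambda>s. surf_proj g ((1 - \<sigma>) *\<^sub>R c s + \<sigma> *\<^sub>R c' s))" for \<sigma>
  have comp: "continuous_on ({0..1} \<times> {0..1}) (\<lambda>z. f (snd z))" if "continuous_on {0..1} f" for f :: "real \<Rightarrow> complex"
    by (rule continuous_on_compose2[OF that]) (auto intro!: continuous_intros)
  have "(h 0, h 1) \<in> loop_homotopy X base_pt"
  proof (rule homotopy_of_family)
    show "continuous_map (top_of_set ({0..1} \<times> {0..1})) X (\<lambda>(\<sigma>, s). h \<sigma> s)"
      unfolding h_def
    proof (rule family_join[OF family_of_path family_of_disc])
      show "continuous_on ({0..1} \<times> {0..1}) (\<lambda>(\<sigma>, s). (1 - \<sigma>) *\<^sub>R c s + \<sigma> *\<^sub>R c' s)"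
        unfolding case_prod_unfold using comp[OF c(1)] comp[OF c'(1)] by (intro continuous_intros)
      show "(1 - \<sigma>) *\<^sub>R c s + \<sigma> *\<^sub>R c' s \<in> cball 0 1" if "\<sigma> \<in> {0..1}" "s \<in> {0..1}" for \<sigma> s
      proof -
        have "c s \<in> cball 0 1" "c' s \<in> cball 0 1" using that c(2) c'(2) by blast+
        then show ?thesis using that(1) by (intro convexD_alt[OF convex_cball]) auto
      qed
      show "p (1 * t) = surf_proj g ((1 - \<sigma>) *\<^sub>R c 0 + \<sigma> *\<^sub>R c' 0)" if "\<sigma> \<in> {0..1}" for \<sigma>
        using p_class_eq[OF t c(3)] c'(3) by (simp add: scaleR_left_diff_distrib)
    qed (use t mult_unit_interval in \<open>auto simp: case_prod_unfold intro!: continuous_intros\<close>)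
    show "h \<sigma> 0 = base_pt \<and> h \<sigma> 1 = base_pt" for \<sigma>
      using p_ends c(4) c'(4) by (simp add: h_def loop_join_def)
  qed
  then show ?thesis by (simp add: h_def)
qed

lemma trace_loop:
  assumes "t \<in> {0..1}" "z \<in> p t"
  shows "trace g p t z \<in> loops_at X base_pt"
proof (rule homotopy_reflD)
  show "(trace g p t z, trace g p t z) \<in> loop_homotopy X base_pt"
    unfolding trace_def
    using assms p_class_eq[OF assms]
    by (intro disc_tail_homotopy)
      (auto intro!: continuous_intros mult_le_one simp: abs_mult image_subset_iff)
qed

text \<open>The trace returns to the centre along the radius on which \<open>gen_loop\<close> then
  goes out again. Shortening this excursion leaves the return from the partner point.\<close>

lemma trace_mult_gen_loop:
  assumes t: "t \<in> {0..1}" and k: "k < 4 * g" "k mod 4 < 2" "\<tau> \<in> {0..1}" and z: "side g k \<tau> \<in> p t"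
  shows "cls (trace g p t (side g k \<tau>)) \<otimes>\<^bsub>PG\<^esub> cls (gen_loop g k \<tau>) = cls (trace g p t (side g (k + 2) (1 - \<tau>)))"
proof -
  let ?z = "side g k \<tau>" and ?z' = "side g (k + 2) (1 - \<tau>)"
  have pt: "p t = surf_proj g ?z" using p_class_eq[OF t z] by simp
  have gl: "surf_proj g ?z' = surf_proj g ?z" by (rule side_glued[OF k])
  have z': "?z' \<in> p t" unfolding pt gl[symmetric] by (simp add: gluing_alt)
  \<comment> \<open>At \<open>\<sigma>\<close> the excursion along the radius goes inwards only as
    far as \<open>1 - \<sigma>\<close>: it is complete at \<open>1\<close> and stationary at
    \<open>0\<close>.\<close>
  define h where "h \<sigma> = loop_join (loop_join (\<lambda>s. p (s * t)) (\<lambda>s. surf_proj g ((1 - \<sigma> * s) *\<^sub>R ?z)))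
     (loop_join (\<lambda>s. surf_proj g ((1 - \<sigma> + \<sigma> * s) *\<^sub>R ?z)) (\<lambda>s. surf_proj g ((1 - s) *\<^sub>R ?z')))" for \<sigma>
  have nrm: "norm (r *\<^sub>R side g j \<rho>) \<le> 1" if "0 \<le> r" "r \<le> 1" for r j \<rho> using that by simp
  have "(h 0, h 1) \<in> loop_homotopy X base_pt"
  proof (rule homotopy_of_family)
    show "continuous_map (top_of_set ({0..1} \<times> {0..1})) X (\<lambda>(\<sigma>, s). h \<sigma> s)"
      unfolding h_def
    proof (intro family_join family_of_path family_of_disc)
      fix \<sigma> s :: real assume st: "\<sigma> \<in> {0..1}" "s \<in> {0..1}"
      have 1: "0 \<le> \<sigma> * s" "\<sigma> * s \<le> \<sigma>" "\<sigma> * s \<le> 1" using st by (auto simp: mult_left_le mult_le_one)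
      show "s * t \<in> {0..1}" using st t by (intro mult_unit_interval)
      show "(1 - \<sigma> * s) *\<^sub>R ?z \<in> cball 0 1" "(1 - \<sigma> + \<sigma> * s) *\<^sub>R ?z \<in> cball 0 1" "(1 - s) *\<^sub>R ?z' \<in> cball 0 1"
        using nrm[of "1 - \<sigma> * s"] nrm[of "1 - \<sigma> + \<sigma> * s"] nrm[of "1 - s"] 1 st by auto
    next
      fix \<sigma> :: real assume "\<sigma> \<in> {0..1}"
      show "p (1 * t) = surf_proj g ((1 - \<sigma> * 0) *\<^sub>R ?z)" using pt by simp
      show "surf_proj g ((1 - \<sigma> + \<sigma> * 1) *\<^sub>R ?z) = surf_proj g ((1 - 0) *\<^sub>R ?z')" using gl by simp
      show "loop_join (\<lambda>s. p (s * t)) (\<lambda>s. surf_proj g ((1 - \<sigma> * s) *\<^sub>R ?z)) 1 = 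
        loop_join (\<lambda>s. surf_proj g ((1 - \<sigma> + \<sigma> * s) *\<^sub>R ?z)) (\<lambda>s. surf_proj g ((1 - s) *\<^sub>R ?z')) 0"
        by (simp add: loop_join_def)
    qed (auto simp: case_prod_unfold intro!: continuous_intros)
    show "h \<sigma> 0 = base_pt \<and> h \<sigma> 1 = base_pt" for \<sigma>
      using p_ends by (simp add: h_def loop_join_def)
  qed
  moreover have h1: "h 1 = loop_join (trace g p t ?z) (gen_loop g k \<tau>)"
    by (simp add: h_def trace_def gen_loop_def)
  \<comment> \<open>At \<open>\<sigma> = 0\<close> the second and third quarters are stationary;
    clamping the parameter at \<open>1/2\<close> reproduces this from the trace.\<close>
  moreover have "(h 0, trace g p t ?z') \<in> loop_homotopy X base_pt"
  proof (rule loop_homotopy_interval[where u = "\<lambda>s. min (2 * s) (max (1/2) (2 * s - 1))" and v = "\<lambda>s. s"])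
    show "continuous_map (top_of_set {0..1}) X (trace g p t ?z')"
      using trace_loop[OF t z'] by (simp add: loops_at_def pathin_def)
    show "trace g p t ?z' (min (2 * 0) (max (1/2) (2 * 0 - 1))) = base_pt" "trace g p t ?z' (min (2 * 1) (max (1/2) (2 * 1 - 1))) = base_pt"
      using p_ends by (simp_all add: trace_def loop_join_def)
    fix s :: real assume s: "s \<in> {0..1}"
    have mid: "surf_proj g ?z = p t" using pt by simp
    consider "s \<le> 1/4" | "1/4 < s" "s \<le> 1/2" | "1/2 < s" "s \<le> 3/4" | "3/4 < s" by linarith
    then show "h 0 s = trace g p t ?z' (min (2 * s) (max (1/2) (2 * s - 1)))"
    proof cases
      case 1
      then have "min (2 * s) (max (1/2) (2 * s - 1)) = 2 * s" by simp
      then show ?thesis using 1 by (simp add: h_def trace_def loop_join_def)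
    next
      case 2
      then have "min (2 * s) (max (1/2) (2 * s - 1)) = 1/2" by simp
      then show ?thesis using 2 mid by (simp add: h_def trace_def loop_join_def)
    next
      case 3
      then have "min (2 * s) (max (1/2) (2 * s - 1)) = 1/2" by simp
      then show ?thesis using 3 mid by (simp add: h_def trace_def loop_join_def)
    next
      case 4
      then have "min (2 * s) (max (1/2) (2 * s - 1)) = 2 * s - 1" by simp
      then show ?thesis using 4 by (simp add: h_def trace_def loop_join_def)
    qed
  qed (auto intro!: continuous_intros)
  ultimately have "cls (loop_join (trace g p t ?z) (gen_loop g k \<tau>)) = cls (trace g p t ?z')"
    by (metis equiv_class_eq[OF equiv_loop_homotopy])
  then show ?thesis
    by (simp add: mult_fundamental_group trace_loop[OF t z] gen_loop_loop[OF k])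
qed

text \<open>Near \<open>t0\<close> the contraction of \<open>gluing_nbhd\<close> descends to the
  surface and carries \<open>p t\<close> to \<open>p t0\<close>. Following \<open>p\<close>, then
  the contraction, then the radius from \<open>z0\<close> gives a homotopy over the times between
  \<open>t0\<close> and \<open>t\<close>; its two ends are traces up to a change of tail inside the
  disc.\<close>

lemma trace_locally_const:
  assumes t0: "t0 \<in> {0..1}"
  shows "\<exists>\<delta>>0. \<forall>t\<in>{0..1}. \<bar>t - t0\<bar> < \<delta> \<longrightarrow> (\<forall>z\<in>p t. \<exists>z0\<in>p t0. cls (trace g p t z) = cls (trace g p t0 z0))"
proof -
  let ?I = "top_of_set {0..1::real}" and ?D = "top_of_set (cball 0 1 :: complex set)"
  obtain y0 where y0: "y0 \<in> p t0" using surface_class_nonempty[OF p_class[OF t0]] by blast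
  have C: "p t0 = surf_proj g y0" "y0 \<in> cball 0 1" using p_class_eq[OF t0 y0] by auto
  obtain \<epsilon> :: real and d :: "complex \<Rightarrow> real \<Rightarrow> complex" where e: "\<epsilon> > 0"
    and sat: "\<And>z. z \<in> cball 0 1 \<Longrightarrow> \<exists>c\<in>p t0. dist z c < \<epsilon> \<Longrightarrow>
      gluing g `` {z} \<subseteq> {z \<in> cball 0 1. \<exists>c\<in>p t0. dist z c < \<epsilon>}"
    and dc: "continuous_on ({z \<in> cball 0 1. \<exists>c\<in>p t0. dist z c < \<epsilon>} \<times> {0..1}) (\<lambda>(z, s). d z s)"
    and dD: "\<And>z s. z \<in> cball 0 1 \<Longrightarrow> \<exists>c\<in>p t0. dist z c < \<epsilon> \<Longrightarrow> s \<in> {0..1} \<Longrightarrow> d z s \<in> cball 0 1"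
    and d01: "\<And>z c. z \<in> cball 0 1 \<Longrightarrow> c \<in> p t0 \<Longrightarrow> dist z c < \<epsilon> \<Longrightarrow> d z 0 = z \<and> d z 1 = c"
    and dfix: "\<And>c s. c \<in> p t0 \<Longrightarrow> s \<in> {0..1} \<Longrightarrow> d c s = c"
    and dgl: "\<And>z z' s. \<lbrakk>z \<in> cball 0 1; \<exists>c\<in>p t0. dist z c < \<epsilon>; (z, z') \<in> gluing g; s \<in> {0..1}\<rbrakk> \<Longrightarrow>
      (d z s, d z' s) \<in> gluing g"
    unfolding C(1) by (rule gluing_nbhd[OF g C(2) zero_less_one]) blast
  define U where "U = {z \<in> cball 0 1. \<exists>c\<in>p t0. dist z c < \<epsilon>}"
  define V where "V = {A \<in> cball 0 1 // gluing g. A \<subseteq> U}"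
  obtain \<delta> where \<delta>: "\<delta> > 0" "\<And>q z. q \<in> {0..1} \<Longrightarrow> dist q t0 < \<delta> \<Longrightarrow> z \<in> p q \<Longrightarrow> \<exists>c\<in>p t0. dist z c < \<epsilon>"
    using surface_map_near[OF p_cont t0 sat e] by blast
  have pV: "p t \<in> V" if "t \<in> {0..1}" "\<bar>t - t0\<bar> < \<delta>" for t
  proof -
    have "z \<in> U" if "z \<in> p t" for z
      using \<delta>(2)[OF \<open>t \<in> {0..1}\<close> _ that] \<open>\<bar>t - t0\<bar> < \<delta>\<close> p_class_eq[OF \<open>t \<in> {0..1}\<close> that]
      by (simp add: U_def dist_real_def)
    then show ?thesis using p_class[OF \<open>t \<in> {0..1}\<close>] by (auto simp: V_def)
  qed
  \<comment> \<open>The contraction on classes; the representative does not matter, since the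
    contraction respects the gluing.\<close>
  define Dc where "Dc y s = surf_proj g (d (SOME z. z \<in> y) s)" for y s
  have Dc: "Dc y s = surf_proj g (d z s)" if "y \<in> V" "z \<in> y" "s \<in> {0..1}" for y z s
  proof -
    have "(SOME z. z \<in> y) \<in> y" using that(2) by (rule someI[of "\<lambda>z. z \<in> y"])
    moreover have "y = surf_proj g z" using that surface_class_eq(1)[of y g z] by (auto simp: V_def)
    ultimately have "(z, SOME z. z \<in> y) \<in> gluing g" by auto
    moreover have "z \<in> U" using that by (auto simp: V_def)
    ultimately have "(d z s, d (SOME z. z \<in> y) s) \<in> gluing g"
      using dgl[of z _ s] that(3) by (auto simp: U_def)
    then show ?thesis unfolding Dc_def by (rule equiv_class_eq[OF equiv_gluing, symmetric])
  qed
  have opU: "openin ?D U" unfolding U_def by (rule openin_near)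
  have opV: "openin X V" unfolding V_def by (rule openin_surface[OF opU]) (use sat in \<open>auto simp: U_def\<close>)
  have quo: "quotient_map ?D X (surf_proj g)"
    unfolding closed_oriented_surface_def by (rule quotient_map_quotient_topology)
  have UV: "{x \<in> topspace ?D. surf_proj g x \<in> V} = U"
  proof -
    have 1: "surf_proj g x \<in> V" if x: "x \<in> U" for x
    proof -
      have "x \<in> cball 0 1" "surf_proj g x \<subseteq> U" using x sat[of x] by (simp_all add: U_def)
      then show ?thesis by (simp add: V_def quotientI)
    qed
    have 2: "x \<in> U" if "x \<in> cball 0 1" "surf_proj g x \<in> V" for x
      using that self_in_gluing_class[OF that(1), of g] unfolding V_def by blast
    have 3: "U \<subseteq> cball 0 1" by (auto simp: U_def)
    show ?thesis using 1 2 3 by auto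
  qed
  have quoV: "quotient_map (subtopology ?D U) (subtopology X V) (surf_proj g)"
    using quotient_map_restriction[OF quo UV] opV by blast
  \<comment> \<open>The interval is locally compact, so its product with the quotient map is again a
    quotient map. Joint continuity of \<open>Dc\<close> can therefore be checked upstairs.\<close>
  have "quotient_map (prod_topology (subtopology ?D U) ?I) (prod_topology (subtopology X V) ?I) (\<lambda>(x, y). (surf_proj g x, y))"
    by (rule quotient_map_prod_left[OF _ _ quoV])
      (auto intro!: compact_imp_locally_compact_space compact_space_subtopology Hausdorff_space_subtopology)
  then have contDc: "continuous_map (prod_topology (subtopology X V) ?I) X (\<lambda>(y, s). Dc y s)"
  proof (rule continuous_compose_quotient_map)
    have UD: "U \<subseteq> cball 0 1" by (auto simp: U_def)
    have sub: "prod_topology (subtopology ?D U) ?I = top_of_set (U \<times> {0..1})"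
      using UD by (simp add: subtopology_subtopology Int_absorb1 prod_topology_subtopology_eu)
    have "continuous_map (top_of_set (U \<times> {0..1})) ?D (\<lambda>(z, s). d z s)"
    proof -
      have "d z s \<in> cball 0 1" if "z \<in> U" "s \<in> {0..1}" for z s
        using dD[of z s] that unfolding U_def by blast
      then show ?thesis using dc[folded U_def] by (auto simp: image_subset_iff)
    qed
    from continuous_map_compose[OF this continuous_surf_proj]
    have "continuous_map (top_of_set (U \<times> {0..1})) X (\<lambda>w. surf_proj g (d (fst w) (snd w)))"
      by (simp add: o_def case_prod_unfold)
    then show "continuous_map (prod_topology (subtopology ?D U) ?I) X ((\<lambda>(y, s). Dc y s) \<circ> (\<lambda>(x, y). (surf_proj g x, y)))"
      unfolding sub
    proof (rule continuous_map_eq)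
      fix w assume "w \<in> topspace (top_of_set (U \<times> {0..1::real}))"
      then have w: "fst w \<in> U" "snd w \<in> {0..1}" by auto
      then have "surf_proj g (fst w) \<in> V" "fst w \<in> surf_proj g (fst w)"
        using UV UD self_in_gluing_class by auto
      from Dc[OF this w(2)] show "surf_proj g (d (fst w) (snd w)) = ((\<lambda>(y, s). Dc y s) \<circ> (\<lambda>(x, y). (surf_proj g x, y))) w"
        by (simp add: case_prod_unfold)
    qed
  qed
  show ?thesis
  proof (intro exI[of _ \<delta>] conjI ballI impI)
    fix t z assume t: "t \<in> {0..1}" "\<bar>t - t0\<bar> < \<delta>" and z: "z \<in> p t"
    obtain z0 where z0: "z0 \<in> p t0" "dist z z0 < \<epsilon>"
      using \<delta>(2)[OF t(1) _ z] t(2) by (auto simp: dist_real_def)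
    have zD: "z \<in> cball 0 1" "z0 \<in> cball 0 1" using p_class_eq z z0 t(1) t0 by auto
    define T where "T \<kappa> = (1 - \<kappa>) * t0 + \<kappa> * t" for \<kappa>
    have T: "T \<kappa> \<in> {0..1}" "\<bar>T \<kappa> - t0\<bar> < \<delta>" if "\<kappa> \<in> {0..1}" for \<kappa>
    proof -
      show "T \<kappa> \<in> {0..1}"
        using convexD_alt[of "{0..1::real}" t0 t \<kappa>] t0 t that by (simp add: T_def)
      have "T \<kappa> - t0 = \<kappa> * (t - t0)" by (simp add: T_def algebra_simps)
      then have "\<bar>T \<kappa> - t0\<bar> = \<kappa> * \<bar>t - t0\<bar>" using that by (simp add: abs_mult)
      also have "\<dots> \<le> 1 * \<bar>t - t0\<bar>" using that by (intro mult_right_mono) auto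
      finally show "\<bar>T \<kappa> - t0\<bar> < \<delta>" using t by simp
    qed
    have contT: "continuous_on ({0..1} \<times> {0..1}) (\<lambda>z. T (fst z))"
      unfolding T_def by (intro continuous_intros)
    define J where "J \<kappa> = loop_join (\<lambda>s. p (s * T \<kappa>)) (loop_join (\<lambda>s. Dc (p (T \<kappa>)) s) (\<lambda>s. surf_proj g ((1 - s) *\<^sub>R z0)))" for \<kappa>
    have pt0: "p t0 = surf_proj g z0" using p_class_eq[OF t0 z0(1)] by simp
    have "(J 0, J 1) \<in> loop_homotopy X base_pt"
    proof (rule homotopy_of_family)
      show "continuous_map (top_of_set ({0..1} \<times> {0..1})) X (\<lambda>(\<kappa>, s). J \<kappa> s)"
        unfolding J_def
      proof (rule family_join[OF _ family_join])
        show "continuous_map (top_of_set ({0..1} \<times> {0..1})) X (\<lambda>(\<kappa>, s). p (s * T \<kappa>))"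
        proof (rule family_of_path[where u = "\<lambda>\<kappa> s. s * T \<kappa>"])
          show "continuous_on ({0..1} \<times> {0..1}) (\<lambda>(\<kappa>, s). s * T \<kappa>)"
            unfolding case_prod_unfold by (intro continuous_intros contT)
          show "s * T \<kappa> \<in> {0..1}" if "\<kappa> \<in> {0..1}" "s \<in> {0..1}" for \<kappa> s
            by (rule mult_unit_interval[OF that(2) T(1)[OF that(1)]])
        qed
        show "continuous_map (top_of_set ({0..1} \<times> {0..1})) X (\<lambda>(\<kappa> :: real, s). surf_proj g ((1 - s) *\<^sub>R z0))"
        proof (rule family_of_disc[where f = "\<lambda>_ s. (1 - s) *\<^sub>R z0"])
          show "continuous_on ({0..1} \<times> {0..1}) (\<lambda>(\<kappa> :: real, s). (1 - s) *\<^sub>R z0)"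
            unfolding case_prod_unfold by (intro continuous_intros)
          show "(1 - s) *\<^sub>R z0 \<in> cball 0 1" if "s \<in> {0..1}" for s :: real
            using zD(2) that by (simp add: mult_le_one)
        qed
        have "continuous_map (top_of_set ({0..1} \<times> {0..1})) X (\<lambda>(\<kappa>, s :: real). p (T \<kappa>))"
        proof (rule family_of_path[where u = "\<lambda>\<kappa> s. T \<kappa>"])
          show "continuous_on ({0..1} \<times> {0..1}) (\<lambda>(\<kappa>, s :: real). T \<kappa>)"
            unfolding case_prod_unfold by (rule contT)
        qed (rule T(1))
        then have "continuous_map (top_of_set ({0..1} \<times> {0..1})) (prod_topology (subtopology X V) ?I) (\<lambda>(\<kappa>, s). (p (T \<kappa>), s))"
          using pV[OF T] by (auto simp: continuous_map_pairwise o_def case_prod_unfold continuous_map_in_subtopology image_subset_iff intro!: continuous_intros)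
        from continuous_map_compose[OF this contDc]
        show "continuous_map (top_of_set ({0..1} \<times> {0..1})) X (\<lambda>(\<kappa>, s). Dc (p (T \<kappa>)) s)"
          by (simp add: o_def case_prod_unfold)
      next
        fix \<kappa> :: real assume k: "\<kappa> \<in> {0..1}"
        obtain y where y: "y \<in> p (T \<kappa>)" using surface_class_nonempty[OF p_class[OF T(1)[OF k]]] by blast
        obtain c where c: "c \<in> p t0" "dist y c < \<epsilon>"
          using \<delta>(2)[OF T(1)[OF k] _ y] T(2)[OF k] by (auto simp: dist_real_def)
        have yD: "y \<in> cball 0 1" "p (T \<kappa>) = surf_proj g y" using p_class_eq[OF T(1)[OF k] y] by auto
        have y01: "d y 0 = y" "d y 1 = c" using d01[OF yD(1) c] by auto
        have D0: "Dc (p (T \<kappa>)) 0 = p (T \<kappa>)" and D1: "Dc (p (T \<kappa>)) 1 = p t0"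
          using Dc[OF pV[OF T[OF k]] y, of 0] Dc[OF pV[OF T[OF k]] y, of 1] y01 yD(2) p_class_eq[OF t0 c(1)] by auto
        show "Dc (p (T \<kappa>)) 1 = surf_proj g ((1 - 0) *\<^sub>R z0)" using D1 pt0 by simp
        show "p (1 * T \<kappa>) = loop_join (\<lambda>s. Dc (p (T \<kappa>)) s) (\<lambda>s. surf_proj g ((1 - s) *\<^sub>R z0)) 0"
          using D0 by (simp add: loop_join_def)
      qed
      show "J \<kappa> 0 = base_pt \<and> J \<kappa> 1 = base_pt" for \<kappa>
        using p_ends by (simp add: J_def loop_join_def)
    qed
    moreover have "(J 0, trace g p t0 z0) \<in> loop_homotopy X base_pt"
    proof -
      let ?c = "loop_join (\<lambda>_. z0) (\<lambda>s. (1 - s) *\<^sub>R z0)"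
      have D: "Dc (p t0) s = surf_proj g z0" if "s \<in> {0..1}" for s
        using Dc[OF pV[OF t0] z0(1) that] \<delta>(1) dfix[OF z0(1) that] by simp
      have "continuous_on {0..1} ?c"
        unfolding loop_join_joinpaths path_def[symmetric]
        by (rule path_join_imp) (auto simp: path_def pathstart_def pathfinish_def intro!: continuous_intros)
      moreover have "?c ` {0..1} \<subseteq> cball 0 1"
        using zD(2) by (auto simp: loop_join_def mult_le_one)
      ultimately have "(loop_join (\<lambda>s. p (s * t0)) (\<lambda>s. surf_proj g (?c s)), trace g p t0 z0) \<in> loop_homotopy X base_pt"
        unfolding trace_def using t0 z0(1) zD(2)
        by (intro disc_tail_homotopy) (auto simp: mult_le_one image_subset_iff loop_join_def intro!: continuous_intros)
      then show ?thesis
        by (rule loop_homotopy_cong) (auto simp: J_def T_def loop_join_def D)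
    qed
    moreover have "(J 1, trace g p t z) \<in> loop_homotopy X base_pt"
    proof -
      let ?c = "loop_join (d z) (\<lambda>s. (1 - s) *\<^sub>R z0)"
      have ez: "\<exists>c\<in>p t0. dist z c < \<epsilon>" using z0 by blast
      have dz: "d z 0 = z" "d z 1 = z0" using d01[OF zD(1) z0] by auto
      have D: "Dc (p t) s = surf_proj g (d z s)" if "s \<in> {0..1}" for s
        by (rule Dc[OF pV[OF t] z that])
      have "continuous_on {0..1} (\<lambda>s. (\<lambda>(z, s). d z s) (z, s))"
        by (rule continuous_on_compose2[OF dc]) (use zD ez in \<open>auto intro!: continuous_intros\<close>)
      then have "path (d z)" by (simp add: path_def)
      then have "continuous_on {0..1} ?c"
        unfolding loop_join_joinpaths path_def[symmetric]
        by (rule path_join_imp) (auto simp: path_def pathstart_def pathfinish_def dz intro!: continuous_intros)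
      moreover have "?c ` {0..1} \<subseteq> cball 0 1"
      proof -
        have "d z (2 * s) \<in> cball 0 1" if "0 \<le> s" "s \<le> 1/2" for s using dD[OF zD(1) ez, of "2 * s"] that by simp
        then show ?thesis using zD(2) by (auto simp: loop_join_def mult_le_one)
      qed
      ultimately have "(loop_join (\<lambda>s. p (s * t)) (\<lambda>s. surf_proj g (?c s)), trace g p t z) \<in> loop_homotopy X base_pt"
        unfolding trace_def using t z zD(1) dz
        by (intro disc_tail_homotopy) (auto simp: mult_le_one image_subset_iff loop_join_def intro!: continuous_intros)
      then show ?thesis
        by (rule loop_homotopy_cong) (auto simp: J_def T_def loop_join_def D)
    qed
    ultimately have "cls (trace g p t z) = cls (trace g p t0 z0)"
      by (metis equiv_class_eq[OF equiv_loop_homotopy])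
    then show "\<exists>z0\<in>p t0. cls (trace g p t z) = cls (trace g p t0 z0)"
      using z0(1) by blast
  qed (use \<delta> in simp)
qed

end

text \<open>Indices that are not the first side of a pair get the unit, so that all values lie in
  the group.\<close>

definition surface_gen :: "nat \<Rightarrow> nat \<Rightarrow> (real \<Rightarrow> complex set) set"
  where "surface_gen g k = (if k < 4 * g \<and> k mod 4 < 2
    then loop_homotopy (closed_oriented_surface g) base_pt `` {gen_loop g k 0}
    else \<one>\<^bsub>fundamental_group (closed_oriented_surface g) base_pt\<^esub>)"

lemma base_pt_in_surface: "base_pt \<in> topspace (closed_oriented_surface g)"
proof -
  have "surf_proj g 0 \<in> cball 0 1 // gluing g" by (rule quotientI) simp
  then show ?thesis by (simp add: topspace_surface)
qed

lemma group_surface: "group (fundamental_group (closed_oriented_surface g) base_pt)"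
  by (rule group_fundamental_group[OF base_pt_in_surface])

lemma surface_gen_eq:
  assumes "k < 4 * g" "k mod 4 < 2" "\<tau> \<in> {0..1}"
  shows "loop_homotopy (closed_oriented_surface g) base_pt `` {gen_loop g k \<tau>} = surface_gen g k"
  using equiv_class_eq[OF equiv_loop_homotopy gen_loop_homotopy[OF assms, of 0]] assms by (simp add: surface_gen_def)

lemma surface_gen_closed: "surface_gen g k \<in> carrier (fundamental_group (closed_oriented_surface g) base_pt)"
proof (cases "k < 4 * g \<and> k mod 4 < 2")
  case True
  then have "gen_loop g k 0 \<in> loops_at (closed_oriented_surface g) base_pt"
    by (intro gen_loop_loop) auto
  then have "loop_homotopy (closed_oriented_surface g) base_pt `` {gen_loop g k 0} \<in> carrier (fundamental_group (closed_oriented_surface g) base_pt)"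
    by (simp add: fundamental_group_def quotientI)
  then show ?thesis using True by (simp add: surface_gen_def)
next
  case False
  then show ?thesis
    unfolding surface_gen_def if_not_P[OF False]
    by (intro monoid.one_closed group.is_monoid group_surface)
qed

lemma trace_mult_surface_gen:
  assumes g: "g > 0" and p: "p \<in> loops_at (closed_oriented_surface g) base_pt"
    and "t \<in> {0..1}" "k < 4 * g" "k mod 4 < 2" "\<tau> \<in> {0..1}" "side g k \<tau> \<in> p t"
  shows "loop_homotopy (closed_oriented_surface g) base_pt `` {trace g p t (side g (k + 2) (1 - \<tau>))} =
    loop_homotopy (closed_oriented_surface g) base_pt `` {trace g p t (side g k \<tau>)}
      \<otimes>\<^bsub>fundamental_group (closed_oriented_surface g) base_pt\<^esub> surface_gen g k"
  using trace_mult_gen_loop[OF assms] surface_gen_eq[OF assms(4-6)] by simp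

text \<open>Whether the class of \<open>trace g p t z\<close> lies in \<open>N\<close> depends
  neither on \<open>z\<close>, by \<open>trace_mult_surface_gen\<close>, nor on \<open>t\<close>,
  where it is locally constant. At time \<open>0\<close> the class is trivial, at time
  \<open>1\<close> it is that of \<open>p\<close>.\<close>

lemma surface_generated:
  assumes g: "g > 0" and N: "subgroup N (fundamental_group (closed_oriented_surface g) base_pt)"
    and gen: "\<And>k. k < 4 * g \<Longrightarrow> k mod 4 < 2 \<Longrightarrow> surface_gen g k \<in> N"
  shows "carrier (fundamental_group (closed_oriented_surface g) base_pt) \<subseteq> N"
proof
  let ?X = "closed_oriented_surface g"
  let ?P = "fundamental_group ?X base_pt" and ?cls = "\<lambda>q. loop_homotopy ?X base_pt `` {q}"
  interpret group ?P by (rule group_surface)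
  fix A assume "A \<in> carrier ?P"
  then obtain p where A: "A = ?cls p" and p: "p \<in> loops_at ?X base_pt"
    by (auto simp: fundamental_group_def elim!: quotientE)
  define f where "f t z = ?cls (trace g p t z)" for t z
  have carf: "f t z \<in> carrier ?P" if "t \<in> {0..1}" "z \<in> p t" for t z
    using trace_loop[OF g p that] by (simp add: f_def fundamental_group_def quotientI)
  have stepN: "f t z \<in> N \<longleftrightarrow> f t z' \<in> N" if t: "t \<in> {0..1}" and z: "z \<in> p t" "z' \<in> p t" and st: "(z, z') \<in> side_pairing g" for t z z'
  proof -
    obtain k \<tau> where k: "k < 4 * g" "k mod 4 < 2" "\<tau> \<in> {0..1}" "z = side g k \<tau>" "z' = side g (k + 2) (1 - \<tau>)"
      using st by (auto simp: side_pairing_def)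
    have eq: "f t z' = f t z \<otimes>\<^bsub>?P\<^esub> surface_gen g k"
      unfolding f_def k(4,5) by (rule trace_mult_surface_gen[OF g p t k(1-3)]) (use z k in simp)
    have gN: "surface_gen g k \<in> N" by (rule gen[OF k(1,2)])
    have "f t z = f t z' \<otimes>\<^bsub>?P\<^esub> inv\<^bsub>?P\<^esub> surface_gen g k"
      using eq carf[OF t z(1)] surface_gen_closed[of g k] by (simp add: m_assoc)
    then show ?thesis
      using eq gN N subgroup.m_closed subgroup.m_inv_closed by metis
  qed
  have indep: "f t z \<in> N \<longleftrightarrow> f t z' \<in> N" if t: "t \<in> {0..1}" and z: "z \<in> p t" "z' \<in> p t" for t z z'
  proof -
    have pt: "p t = surf_proj g z" using p_class_eq[OF g p t z(1)] by simp
    then have "(z, z') \<in> (gluing_step g)\<^sup>*" using z(2) by (auto simp: gluing_alt)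
    then have "z' \<in> p t \<and> (f t z \<in> N \<longleftrightarrow> f t z' \<in> N)"
    proof (induction rule: rtrancl_induct)
      case (step u v)
      have u: "u \<in> p t" using step.IH by simp
      have "v \<in> p t" using p_class_eq[OF g p t u] step.hyps(2) gluing_step_subset[of g] by auto
      moreover have "f t u \<in> N \<longleftrightarrow> f t v \<in> N"
        using step.hyps(2) stepN[OF t u \<open>v \<in> p t\<close>] stepN[OF t \<open>v \<in> p t\<close> u]
        by (auto simp: gluing_step_def)
      ultimately show ?case using step.IH by simp
    qed (use z in simp)
    then show ?thesis by simp
  qed
  define inN where "inN t \<longleftrightarrow> (\<exists>z\<in>p t. f t z \<in> N)" for t
  have inN: "inN t \<longleftrightarrow> f t z \<in> N" if "t \<in> {0..1}" "z \<in> p t" for t z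
    unfolding inN_def using indep[OF that(1)] that(2) by blast
  have "inN 0 = inN 1"
  proof (rule connected_local_const[of "{0..1}" 0 1 inN])
    show "\<forall>t0\<in>{0..1}. eventually (\<lambda>t. inN t0 = inN t) (at t0 within {0..1})"
    proof
    fix t0 :: real assume t0: "t0 \<in> {0..1}"
    obtain \<delta> where d: "\<delta> > 0" "\<forall>t\<in>{0..1}. \<bar>t - t0\<bar> < \<delta> \<longrightarrow> (\<forall>z\<in>p t. \<exists>z0\<in>p t0. f t z = f t0 z0)"
      using trace_locally_const[OF g p t0] unfolding f_def by blast
    have "inN t0 = inN t" if t: "t \<in> {0..1}" "\<bar>t - t0\<bar> < \<delta>" for t
    proof -
      obtain z where z: "z \<in> p t" using surface_class_nonempty[OF p_class[OF g p t(1)]] by blast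
      then obtain z0 where z0: "z0 \<in> p t0" "f t z = f t0 z0" using d(2) t by blast
      then show ?thesis using inN[OF t(1) z] inN[OF t0 z0(1)] by simp
    qed
    then show "eventually (\<lambda>t. inN t0 = inN t) (at t0 within {0..1})"
      unfolding eventually_at using d(1) by (intro exI[of _ \<delta>]) (auto simp: dist_real_def)
    qed
  qed auto
  have ends: "0 \<in> p 0" "0 \<in> p 1" using p_ends[OF g p] by auto
  have one: "\<one>\<^bsub>?P\<^esub> = ?cls (\<lambda>_. base_pt)" by (simp add: fundamental_group_def)
  have const: "(\<lambda>_. base_pt) \<in> loops_at ?X base_pt"
    using base_pt_in_surface[of g] by (simp add: loops_at_def pathin_def)
  have "trace g p 0 0 = (\<lambda>_. base_pt)"
    using p_ends[OF g p] by (auto simp: trace_def loop_join_def)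
  then have "f 0 0 \<in> N"
    using subgroup.one_closed[OF N] one by (simp add: f_def)
  then have "f 1 0 \<in> N"
    using \<open>inN 0 = inN 1\<close> inN[of 0 0] inN[of 1 0] ends by simp
  moreover have "trace g p 1 0 = loop_join p (\<lambda>_. base_pt)"
    by (simp add: trace_def loop_join_def)
  then have "f 1 0 = A \<otimes>\<^bsub>?P\<^esub> \<one>\<^bsub>?P\<^esub>"
    by (simp add: f_def A one mult_fundamental_group p const)
  then have "f 1 0 = A"
    using \<open>A \<in> carrier ?P\<close> by simp
  ultimately show "A \<in> N" by simp
qed

text \<open>The loop \<open>p\<close> runs to a vertex and back. At time \<open>1/2\<close> all
  vertices are representatives, and passing through them in the order of \<open>vertex_value\<close>
  multiplies the trace by \<open>handle_prod\<close> and ends at the trace of the initial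
  vertex.\<close>

lemma surface_relation:
  assumes g: "g > 0"
  shows "handle_prod (fundamental_group (closed_oriented_surface g) base_pt) (surface_gen g) g =
    \<one>\<^bsub>fundamental_group (closed_oriented_surface g) base_pt\<^esub>"
proof -
  let ?X = "closed_oriented_surface g"
  let ?P = "fundamental_group ?X base_pt"
  interpret group ?P by (rule group_surface)
  define v where "v n = circle_pt g (real n)" for n
  define p where "p = loop_join (\<lambda>s. surf_proj g (s *\<^sub>R v 0)) (\<lambda>s. surf_proj g ((1 - s) *\<^sub>R v 0))"
  have c: "continuous_map (top_of_set {0..1}) ?X (\<lambda>s. surf_proj g (c s))"
    if "continuous_on {0..1} c" "c ` {0..1} \<subseteq> cball 0 1" for c :: "real \<Rightarrow> complex"
    using continuous_map_compose[OF _ continuous_surf_proj, of "top_of_set {0..1}" c g] that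
    by (auto simp: o_def image_subset_iff)
  have p_eq: "p s = surf_proj g ((if s \<le> 1/2 then 2 * s else 2 - 2 * s) *\<^sub>R v 0)" for s
    by (simp add: p_def loop_join_def)
  have "continuous_map (top_of_set {0..1}) ?X (\<lambda>s. surf_proj g ((1 - \<bar>2 * s - 1\<bar>) *\<^sub>R v 0))"
    by (rule c) (auto intro!: continuous_intros simp: v_def)
  moreover have "p s = surf_proj g ((1 - \<bar>2 * s - 1\<bar>) *\<^sub>R v 0)" for s
  proof -
    have "(if s \<le> 1/2 then 2 * s else 2 - 2 * s) = 1 - \<bar>2 * s - 1\<bar>" by auto
    then show ?thesis using p_eq by simp
  qed
  ultimately have "continuous_map (top_of_set {0..1}) ?X p" by presburger
  then have p: "p \<in> loops_at ?X base_pt"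
    by (simp add: loops_at_def pathin_def p_def loop_join_def)
  define f where "f n = loop_homotopy ?X base_pt `` {trace g p (1/2) (v n)}" for n
  have half: "p (1/2) = surf_proj g (v 0)" by (simp add: p_eq)
  have pair: "f (k + 3) = f k \<otimes>\<^bsub>?P\<^esub> surface_gen g k \<and> v (k + 3) \<in> p (1/2)"
    if "k < 4 * g" "k mod 4 < 2" "v k \<in> p (1/2)" for k
  proof -
    have s: "side g k 0 = v k" "side g (k + 2) (1 - 0) = v (k + 3)" by (simp_all add: side_circle_pt v_def algebra_simps)
    have "p (1/2) = surf_proj g (v k)" using p_class_eq[OF g p _ that(3)] by simp
    also have "\<dots> = surf_proj g (v (k + 3))" using side_glued[OF that(1,2), of 0] unfolding s by simp
    finally have "v (k + 3) \<in> p (1/2)" by (simp add: v_def gluing_alt)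
    moreover have "f (k + 3) = f k \<otimes>\<^bsub>?P\<^esub> surface_gen g k"
      unfolding f_def using trace_mult_surface_gen[OF g p _ that(1,2), of "1/2" 0] that(3) unfolding s by simp
    ultimately show ?thesis by simp
  qed
  have pair': "f (k + 2) = f (k + 1) \<otimes>\<^bsub>?P\<^esub> surface_gen g k"
    if "k < 4 * g" "k mod 4 < 2" "v (k + 1) \<in> p (1/2) \<or> v (k + 2) \<in> p (1/2)" for k
  proof -
    have s: "side g k 1 = v (k + 1)" "side g (k + 2) (1 - 1) = v (k + 2)" by (simp_all add: side_circle_pt v_def algebra_simps)
    have eq: "surf_proj g (v (k + 2)) = surf_proj g (v (k + 1))" using side_glued[OF that(1,2), of 1] unfolding s by simp
    have "v (k + 1) \<in> p (1/2)"
      using that(3)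
    proof
      assume "v (k + 2) \<in> p (1/2)"
      then have "p (1/2) = surf_proj g (v (k + 1))" using p_class_eq[OF g p, of "1/2"] eq by simp
      then show ?thesis by (simp add: v_def gluing_alt)
    qed
    then show ?thesis
      unfolding f_def using trace_mult_surface_gen[OF g p _ that(1,2), of "1/2" 1] unfolding s by simp
  qed
  have mem: "v (k + 1) \<in> p (1/2)" if "k < 4 * g" "k mod 4 < 2" "v (k + 2) \<in> p (1/2)" for k
  proof -
    have s: "side g k 1 = v (k + 1)" "side g (k + 2) (1 - 1) = v (k + 2)" by (simp_all add: side_circle_pt v_def algebra_simps)
    have eq: "surf_proj g (v (k + 2)) = surf_proj g (v (k + 1))" using side_glued[OF that(1,2), of 1] unfolding s by simp
    have "p (1/2) = surf_proj g (v (k + 1))" using p_class_eq[OF g p, of "1/2"] that(3) eq by simp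
    then show ?thesis by (simp add: v_def gluing_alt)
  qed
  have car: "f n \<in> carrier ?P" if "v n \<in> p (1/2)" for n
    using trace_loop[OF g p _ that] by (simp add: f_def fundamental_group_def quotientI)
  note sg = surface_gen_closed[of g]
  have hp: "handle_prod ?P (surface_gen g) j \<in> carrier ?P" for j
    by (intro handle_prod_closed group_surface sg)
  have "j \<le> g \<Longrightarrow> v (4 * j) \<in> p (1/2) \<and> f (4 * j) = f 0 \<otimes>\<^bsub>?P\<^esub> handle_prod ?P (surface_gen g) j" for j
  proof (induction j)
    case 0
    have "v 0 \<in> p (1/2)" unfolding half by (simp add: v_def gluing_alt)
    then show ?case using car[of 0] by simp
  next
    case (Suc j)
    let ?k = "4 * j" and ?a = "surface_gen g (4 * j)" and ?b = "surface_gen g (4 * j + 1)"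
    have k: "?k < 4 * g" "?k mod 4 < 2" "?k + 1 < 4 * g" "(?k + 1) mod 4 < 2" using Suc.prems by presburger+
    have v0: "v ?k \<in> p (1/2)" using Suc by simp
    have 3: "f (?k + 3) = f ?k \<otimes>\<^bsub>?P\<^esub> ?a" "v (?k + 3) \<in> p (1/2)" using pair[OF k(1,2) v0] by auto
    have v2: "v (?k + 2) \<in> p (1/2)" using mem[OF k(3,4)] 3(2) by (simp add: numeral_eq_Suc)
    have 2: "f (?k + 3) = f (?k + 2) \<otimes>\<^bsub>?P\<^esub> ?b" using pair'[OF k(3,4)] 3(2) by (simp add: numeral_eq_Suc)
    have v1: "v (?k + 1) \<in> p (1/2)" using mem[OF k(1,2) v2] .
    have 1: "f (?k + 2) = f (?k + 1) \<otimes>\<^bsub>?P\<^esub> ?a" using pair'[OF k(1,2)] v2 by blast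
    have 4: "f (?k + 4) = f (?k + 1) \<otimes>\<^bsub>?P\<^esub> ?b" "v (?k + 4) \<in> p (1/2)" using pair[OF k(3,4) v1] by (simp_all add: numeral_eq_Suc)
    note cars = car[OF v0] car[OF v1] car[OF v2] sg[of ?k] sg[of "?k + 1"] hp[of j] car[of 0]
    have "f (?k + 2) = f ?k \<otimes>\<^bsub>?P\<^esub> ?a \<otimes>\<^bsub>?P\<^esub> inv\<^bsub>?P\<^esub> ?b"
      using 2 3(1) cars by (metis inv_solve_right m_closed)
    then have "f (?k + 1) = f ?k \<otimes>\<^bsub>?P\<^esub> ?a \<otimes>\<^bsub>?P\<^esub> inv\<^bsub>?P\<^esub> ?b \<otimes>\<^bsub>?P\<^esub> inv\<^bsub>?P\<^esub> ?a"
      using 1 cars by (metis inv_solve_right m_closed inv_closed)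
    then have "f (?k + 4) = f ?k \<otimes>\<^bsub>?P\<^esub> (?a \<otimes>\<^bsub>?P\<^esub> inv\<^bsub>?P\<^esub> ?b \<otimes>\<^bsub>?P\<^esub> inv\<^bsub>?P\<^esub> ?a \<otimes>\<^bsub>?P\<^esub> ?b)"
      using 4 cars by (simp add: m_assoc)
    moreover have "f 0 \<in> carrier ?P" using car[of 0] half by (simp add: v_def gluing_alt)
    ultimately show ?case
      using Suc 4(2) cars by (simp add: m_assoc add.commute)
  qed
  from this[of g] have "f (4 * g) = f 0 \<otimes>\<^bsub>?P\<^esub> handle_prod ?P (surface_gen g) g" by simp
  moreover have "v (4 * g) = v 0"
    unfolding v_def circle_pt_eq_iff[OF g] by (rule exI[of _ 1]) simp
  then have "f (4 * g) = f 0" by (simp add: f_def)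
  moreover have "f 0 \<in> carrier ?P" using car[of 0] half by (simp add: v_def gluing_alt)
  ultimately show ?thesis
    using hp[of g] by (metis r_cancel_one' l_cancel_one')
qed

section \<open>The surface group of genus \<open>2 * r\<close> as a double\<close>

text \<open>Polygon edges in terms of generators of the two halves, chosen to make the surface
  relation telescope. With \<open>w_j\<close> for the value of \<open>nested_word j r\<close>,
  handle \<open>j < r\<close> contributes \<open>w_j w_(j+1)^-1\<close> in the first half; a later
  handle contributes \<open>w_(i+1) w_i^-1\<close> in the second, with \<open>i\<close> running
  backwards.\<close>

definition handle_gens :: "('k, 'c) monoid_scheme \<Rightarrow> nat \<Rightarrow> (bool \<Rightarrow> nat + nat \<Rightarrow> 'k) \<Rightarrow> nat \<Rightarrow> 'k"
  where "handle_gens K r \<rho> n = (let j = n div 4; i = 2 * r - 1 - j in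
    if n mod 4 = 0 then
      (if j < r then \<rho> True (Inl j) else wval K (\<rho> False) (nested_word (Suc i) r) \<otimes>\<^bsub>K\<^esub> \<rho> False (Inr i))
    else if n mod 4 = 1 then
      (if j < r then inv\<^bsub>K\<^esub> (wval K (\<rho> True) (nested_word (Suc j) r) \<otimes>\<^bsub>K\<^esub> \<rho> True (Inr j)) else inv\<^bsub>K\<^esub> (\<rho> False (Inl i)))
    else \<one>\<^bsub>K\<^esub>)"

lemma handle_gens_simps:
  "j < r \<Longrightarrow> handle_gens K r \<rho> (4 * j) = \<rho> True (Inl j)"
  "j < r \<Longrightarrow> handle_gens K r \<rho> (4 * j + 1) = inv\<^bsub>K\<^esub> (wval K (\<rho> True) (nested_word (Suc j) r) \<otimes>\<^bsub>K\<^esub> \<rho> True (Inr j))"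
  "i < r \<Longrightarrow> handle_gens K r \<rho> (4 * (2 * r - 1 - i)) = wval K (\<rho> False) (nested_word (Suc i) r) \<otimes>\<^bsub>K\<^esub> \<rho> False (Inr i)"
  "i < r \<Longrightarrow> handle_gens K r \<rho> (4 * (2 * r - 1 - i) + 1) = inv\<^bsub>K\<^esub> (\<rho> False (Inl i))"
proof -
  have 1: "(4 * j + 1) div 4 = j" "(4 * j + 1) mod 4 = 1" "4 * j div 4 = j" "4 * j mod 4 = 0" for j :: nat by presburger+
  show "j < r \<Longrightarrow> handle_gens K r \<rho> (4 * j) = \<rho> True (Inl j)"
    "j < r \<Longrightarrow> handle_gens K r \<rho> (4 * j + 1) = inv\<^bsub>K\<^esub> (wval K (\<rho> True) (nested_word (Suc j) r) \<otimes>\<^bsub>K\<^esub> \<rho> True (Inr j))"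
    unfolding handle_gens_def 1 Let_def by simp_all
  assume i: "i < r"
  then have 2: "\<not> 2 * r - 1 - i < r" "2 * r - 1 - (2 * r - 1 - i) = i" by auto
  show "handle_gens K r \<rho> (4 * (2 * r - 1 - i)) = wval K (\<rho> False) (nested_word (Suc i) r) \<otimes>\<^bsub>K\<^esub> \<rho> False (Inr i)"
    "handle_gens K r \<rho> (4 * (2 * r - 1 - i) + 1) = inv\<^bsub>K\<^esub> (\<rho> False (Inl i))"
    unfolding handle_gens_def 1 Let_def 2 using 2(1) by simp_all
qed

lemma (in group) nested_word_val_step:
  assumes "\<And>l. f l \<in> carrier G" "k < r"
  shows "wval G f (nested_word k r) = f (Inl k) \<otimes> wval G f (nested_word (Suc k) r) \<otimes> f (Inr k) \<otimes> inv f (Inl k) \<otimes> inv f (Inr k)"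
  using assms by (simp add: nested_word_step wval_Cons wval_append m_assoc)

text \<open>The telescoping partial products. At \<open>n = r\<close> the second part turns the
  surface relation into equality of the two boundary words.\<close>

lemma handle_prod_handle_gens:
  assumes "group K" and \<rho>: "\<And>b l. \<rho> b l \<in> carrier K"
  shows "n \<le> r \<Longrightarrow> handle_prod K (handle_gens K r \<rho>) n \<otimes>\<^bsub>K\<^esub> wval K (\<rho> True) (nested_word n r) = wval K (\<rho> True) (nested_word 0 r)"
    and "n \<le> r \<Longrightarrow> handle_prod K (handle_gens K r \<rho>) (r + n) = wval K (\<rho> True) (nested_word 0 r) \<otimes>\<^bsub>K\<^esub> inv\<^bsub>K\<^esub> wval K (\<rho> False) (nested_word (r - n) r)"
proof -
  interpret group K by fact
  let ?e = "handle_gens K r \<rho>"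
  note [simp] = \<rho> wval_closed[of "\<rho> b" for b, OF \<rho>]
  have e: "?e n \<in> carrier K" for n by (simp add: handle_gens_def Let_def)
  note [simp] = handle_prod_closed[OF is_group, of ?e, OF e]
  have 1: "n \<le> r \<Longrightarrow> handle_prod K ?e n \<otimes>\<^bsub>K\<^esub> wval K (\<rho> True) (nested_word n r) = wval K (\<rho> True) (nested_word 0 r)" for n
  proof (induction n)
    case (Suc n)
    have "handle_prod K ?e n \<otimes>\<^bsub>K\<^esub> wval K (\<rho> True) (nested_word n r) = wval K (\<rho> True) (nested_word 0 r)" using Suc by simp
    then show ?case
      using Suc.prems nested_word_val_step[of "\<rho> True" n r]
      by (simp add: handle_gens_simps[simplified] inv_mult_group m_assoc)
  qed simp
  then show "n \<le> r \<Longrightarrow> handle_prod K ?e n \<otimes>\<^bsub>K\<^esub> wval K (\<rho> True) (nested_word n r) = wval K (\<rho> True) (nested_word 0 r)" .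
  show "n \<le> r \<Longrightarrow> handle_prod K ?e (r + n) = wval K (\<rho> True) (nested_word 0 r) \<otimes>\<^bsub>K\<^esub> inv\<^bsub>K\<^esub> wval K (\<rho> False) (nested_word (r - n) r)"
  proof (induction n)
    case 0
    then show ?case using 1[of r] by simp
  next
    case (Suc n)
    define i where "i = r - Suc n"
    have i: "i < r" "r + n = 2 * r - 1 - i" "r - n = Suc i" "r - Suc n = i" using Suc.prems by (auto simp: i_def)
    have "handle_prod K ?e (r + Suc n) = wval K (\<rho> True) (nested_word 0 r) \<otimes>\<^bsub>K\<^esub> inv\<^bsub>K\<^esub> wval K (\<rho> False) (nested_word (Suc i) r) \<otimes>\<^bsub>K\<^esub>
       (?e (4 * (r + n)) \<otimes>\<^bsub>K\<^esub> inv\<^bsub>K\<^esub> (?e (4 * (r + n) + 1)) \<otimes>\<^bsub>K\<^esub> inv\<^bsub>K\<^esub> (?e (4 * (r + n))) \<otimes>\<^bsub>K\<^esub> ?e (4 * (r + n) + 1))"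
      using Suc i by simp
    also have "\<dots> = wval K (\<rho> True) (nested_word 0 r) \<otimes>\<^bsub>K\<^esub> inv\<^bsub>K\<^esub> wval K (\<rho> False) (nested_word i r)"
      unfolding i(2) handle_gens_simps(3,4)[OF i(1)]
      using nested_word_val_step[of "\<rho> False" i r] i(1)
      by (simp add: inv_mult_group m_assoc)
    finally show ?case by (simp add: i(4))
  qed
qed

text \<open>The system is triangular: \<open>nested_word (Suc i) r\<close> involves only indices
  above \<open>i\<close>, so \<open>f (Inr i)\<close> can be solved for from the largest index
  downwards.\<close>

lemma (in group) exists_nested_gens:
  assumes "\<And>i. A i \<in> carrier G" "\<And>i. B i \<in> carrier G"
  shows "\<exists>f. (\<forall>l. f l \<in> carrier G) \<and> (\<forall>i<r. f (Inl i) = A i \<and> wval G f (nested_word (Suc i) r) \<otimes> f (Inr i) = B i)"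
proof -
  have "n \<le> r \<Longrightarrow> \<exists>f. (\<forall>l. f l \<in> carrier G) \<and> (\<forall>i. f (Inl i) = A i) \<and> (\<forall>i<r. r - n \<le> i \<longrightarrow> wval G f (nested_word (Suc i) r) \<otimes> f (Inr i) = B i)" for n
  proof (induction n)
    case 0
    then show ?case using assms by (intro exI[of _ "case_sum A (\<lambda>_. \<one>)"]) (auto split: sum.splits)
  next
    case (Suc n)
    then obtain f where f: "\<And>l. f l \<in> carrier G" "\<And>i. f (Inl i) = A i"
      "\<And>i. i < r \<Longrightarrow> r - n \<le> i \<Longrightarrow> wval G f (nested_word (Suc i) r) \<otimes> f (Inr i) = B i" by auto
    define k where "k = r - Suc n"
    have k: "k < r" "r - n = Suc k" using Suc.prems by (auto simp: k_def)
    define f' where "f' = f(Inr k := inv wval G f (nested_word (Suc k) r) \<otimes> B k)"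
    have f': "f' l \<in> carrier G" for l using f(1) assms by (simp add: f'_def)
    have eq: "wval G f' (nested_word (Suc i) r) = wval G f (nested_word (Suc i) r)" if "k \<le> i" for i
      by (rule wval_cong) (use set_nested_word that in \<open>fastforce simp: f'_def\<close>)
    have "wval G f' (nested_word (Suc i) r) \<otimes> f' (Inr i) = B i" if "i < r" "k \<le> i" for i
    proof (cases "i = k")
      case True
      then show ?thesis using eq[of k] f(1) assms by (simp add: f'_def)
    next
      case False
      then show ?thesis using eq[of i] f(3)[of i] that k by (simp add: f'_def)
    qed
    moreover have "f' (Inl i) = A i" for i using f(2) by (simp add: f'_def)
    ultimately show ?case using f' unfolding k_def[symmetric] by blast
  qed
  from this[of r] show ?thesis by auto
qed

abbreviation "surf_group r \<equiv> fundamental_group (closed_oriented_surface (2 * r)) base_pt"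

text \<open>Obtained by solving \<open>handle_gens\<close> for the polygon edges. The Boolean tells
  on which side of the separating curve a generator lives.\<close>

definition double_gen :: "nat \<Rightarrow> bool \<Rightarrow> nat + nat \<Rightarrow> (real \<Rightarrow> complex set) set"
  where "double_gen r = (SOME \<rho>. (\<forall>b l. \<rho> b l \<in> carrier (surf_group r)) \<and>
    (\<forall>j<2 * r. handle_gens (surf_group r) r \<rho> (4 * j) = surface_gen (2 * r) (4 * j) \<and>
      handle_gens (surf_group r) r \<rho> (4 * j + 1) = surface_gen (2 * r) (4 * j + 1)))"

lemma double_gen:
  shows "double_gen r b l \<in> carrier (surf_group r)"
    and "j < 2 * r \<Longrightarrow> handle_gens (surf_group r) r (double_gen r) (4 * j) = surface_gen (2 * r) (4 * j)"
    and "j < 2 * r \<Longrightarrow> handle_gens (surf_group r) r (double_gen r) (4 * j + 1) = surface_gen (2 * r) (4 * j + 1)"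
proof -
  let ?P = "surf_group r" and ?E = "surface_gen (2 * r)"
  interpret group ?P by (rule group_surface)
  note [simp] = surface_gen_closed[of "2 * r"]
  obtain f1 where f1: "\<And>l. f1 l \<in> carrier ?P"
    "\<And>i. i < r \<Longrightarrow> f1 (Inl i) = ?E (4 * i) \<and> wval ?P f1 (nested_word (Suc i) r) \<otimes>\<^bsub>?P\<^esub> f1 (Inr i) = inv\<^bsub>?P\<^esub> ?E (4 * i + 1)"
    using exists_nested_gens[of "\<lambda>i. ?E (4 * i)" "\<lambda>i. inv\<^bsub>?P\<^esub> ?E (4 * i + 1)" r] by auto
  obtain f2 where f2: "\<And>l. f2 l \<in> carrier ?P"
    "\<And>i. i < r \<Longrightarrow> f2 (Inl i) = inv\<^bsub>?P\<^esub> ?E (4 * (2 * r - 1 - i) + 1) \<and> wval ?P f2 (nested_word (Suc i) r) \<otimes>\<^bsub>?P\<^esub> f2 (Inr i) = ?E (4 * (2 * r - 1 - i))"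
    using exists_nested_gens[of "\<lambda>i. inv\<^bsub>?P\<^esub> ?E (4 * (2 * r - 1 - i) + 1)" "\<lambda>i. ?E (4 * (2 * r - 1 - i))" r] by auto
  define \<rho> where "\<rho> b = (if b then f1 else f2)" for b
  have "handle_gens ?P r \<rho> (4 * j) = ?E (4 * j) \<and> handle_gens ?P r \<rho> (4 * j + 1) = ?E (4 * j + 1)" if j: "j < 2 * r" for j
  proof (cases "j < r")
    case True
    then show ?thesis unfolding handle_gens_simps(1,2)[OF True] using f1(2)[OF True] by (simp add: \<rho>_def)
  next
    case False
    define i where "i = 2 * r - 1 - j"
    have i: "i < r" "j = 2 * r - 1 - i" using False j by (auto simp: i_def)
    show ?thesis unfolding i(2) handle_gens_simps(3,4)[OF i(1)] using f2(2)[OF i(1)] by (simp add: \<rho>_def)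
  qed
  then have "\<exists>\<rho>. (\<forall>b l. \<rho> b l \<in> carrier (surf_group r)) \<and>
    (\<forall>j<2 * r. handle_gens (surf_group r) r \<rho> (4 * j) = surface_gen (2 * r) (4 * j) \<and>
      handle_gens (surf_group r) r \<rho> (4 * j + 1) = surface_gen (2 * r) (4 * j + 1))"
    using f1(1) f2(1) by (intro exI[of _ \<rho>]) (auto simp: \<rho>_def)
  from someI_ex[OF this] show "double_gen r b l \<in> carrier (surf_group r)"
    "j < 2 * r \<Longrightarrow> handle_gens (surf_group r) r (double_gen r) (4 * j) = surface_gen (2 * r) (4 * j)"
    "j < 2 * r \<Longrightarrow> handle_gens (surf_group r) r (double_gen r) (4 * j + 1) = surface_gen (2 * r) (4 * j + 1)"
    unfolding double_gen_def by blast+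
qed

lemma handle_prod_cong:
  "(\<And>j. j < n \<Longrightarrow> e (4 * j) = e' (4 * j) \<and> e (4 * j + 1) = e' (4 * j + 1)) \<Longrightarrow> handle_prod H e n = handle_prod H e' n"
  by (induction n) auto

lemma double_gen_relation:
  assumes "r > 0"
  shows "wval (surf_group r) (double_gen r True) (nested_word 0 r) = wval (surf_group r) (double_gen r False) (nested_word 0 r)"
proof -
  let ?P = "surf_group r"
  interpret group ?P by (rule group_surface)
  have "handle_prod ?P (handle_gens ?P r (double_gen r)) (r + r) = handle_prod ?P (surface_gen (2 * r)) (2 * r)"
    unfolding mult_2[symmetric] by (rule handle_prod_cong) (use double_gen(2,3) in blast)
  also have "\<dots> = \<one>\<^bsub>?P\<^esub>" using assms by (intro surface_relation) simp
  finally have "wval ?P (double_gen r True) (nested_word 0 r) \<otimes>\<^bsub>?P\<^esub> inv\<^bsub>?P\<^esub> wval ?P (double_gen r False) (nested_word 0 r) = \<one>\<^bsub>?P\<^esub>"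
    using handle_prod_handle_gens(2)[OF group_surface double_gen(1), of r r] by simp
  moreover have w: "wval ?P (double_gen r b) (nested_word 0 r) \<in> carrier ?P" for b
    by (rule wval_closed[OF double_gen(1)])
  ultimately have "inv\<^bsub>?P\<^esub> (inv\<^bsub>?P\<^esub> wval ?P (double_gen r False) (nested_word 0 r)) = wval ?P (double_gen r True) (nested_word 0 r)"
    by (intro inv_equality) auto
  then show ?thesis using w by simp
qed

definition valid_label :: "nat \<Rightarrow> nat + nat \<Rightarrow> bool"
  where "valid_label r l \<longleftrightarrow> (case l of Inl i \<Rightarrow> i < r | Inr i \<Rightarrow> i < r)"

lemma valid_label_simps [simp]: "valid_label r (Inl i) \<longleftrightarrow> i < r" "valid_label r (Inr i) \<longleftrightarrow> i < r"
  by (simp_all add: valid_label_def)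

lemma valid_nested_word: "x \<in> set (nested_word k r) \<Longrightarrow> valid_label r (fst x)"
  by (drule set_nested_word) auto

lemma double_gen_generates:
  assumes "r > 0" "subgroup N (surf_group r)" and N: "\<And>b l. valid_label r l \<Longrightarrow> double_gen r b l \<in> N"
  shows "carrier (surf_group r) \<subseteq> N"
proof (rule surface_generated[OF _ assms(2)])
  let ?P = "surf_group r"
  interpret group ?P by (rule group_surface)
  note sub = subgroup.m_closed[OF assms(2)] subgroup.m_inv_closed[OF assms(2)] subgroup.one_closed[OF assms(2)]
  have w: "wval ?P (double_gen r b) (nested_word k r) \<in> N" for b k
    by (rule wval_in_subgroup[OF assms(2)]) (rule N[OF valid_nested_word])
  fix k assume k: "k < 4 * (2 * r)" "k mod 4 < 2"
  define j where "j = k div 4"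
  have j: "j < 2 * r" "k = 4 * j \<or> k = 4 * j + 1" using k unfolding j_def by presburger+
  have "handle_gens ?P r (double_gen r) k \<in> N"
  proof (cases "j < r")
    case True
    then show ?thesis using j(2) handle_gens_simps(1,2)[OF True, of ?P "double_gen r"] sub w N by auto
  next
    case False
    define i where "i = 2 * r - 1 - j"
    have i: "i < r" "j = 2 * r - 1 - i" using False j(1) by (auto simp: i_def)
    show ?thesis using j(2) handle_gens_simps(3,4)[OF i(1), of ?P "double_gen r"] sub w N i by auto
  qed
  then show "surface_gen (2 * r) k \<in> N" using j double_gen(2,3)[OF j(1)] by auto
qed (use assms in simp)

text \<open>The universal property of the double. \<open>handle_gens\<close> translates
  \<open>\<rho>\<close> into edge values subject to the surface relation; going through the
  triangular system once more shows that the resulting homomorphism takes the values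
  \<open>\<rho>\<close> on \<open>double_gen\<close>.\<close>

lemma double_gen_hom:
  assumes r: "r > 0" and K: "group K" and \<rho>: "\<And>b l. \<rho> b l \<in> carrier K"
    and rel: "wval K (\<rho> True) (nested_word 0 r) = wval K (\<rho> False) (nested_word 0 r)"
  shows "\<exists>h\<in>hom (surf_group r) K. \<forall>b l. valid_label r l \<longrightarrow> h (double_gen r b l) = \<rho> b l"
proof -
  let ?P = "surf_group r" and ?e = "handle_gens K r \<rho>"
  interpret K: group K by (rule K)
  have w: "wval K (\<rho> b) w \<in> carrier K" for b w using \<rho> by (simp add: K.wval_closed)
  have e: "?e n \<in> carrier K" for n using \<rho> w by (simp add: handle_gens_def Let_def)
  have "handle_prod K ?e (2 * r) = \<one>\<^bsub>K\<^esub>"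
    using handle_prod_handle_gens(2)[OF K \<rho>, of r r] rel w by (simp add: mult_2)
  then obtain h where h: "h \<in> hom ?P K" "\<And>k. k < 4 * (2 * r) \<Longrightarrow> k mod 4 < 2 \<Longrightarrow>
      h (loop_homotopy (closed_oriented_surface (2 * r)) base_pt `` {gen_loop (2 * r) k 0}) = ?e k"
    using surface_hom_exists[of "2 * r" K ?e] r K e by (metis nat_0_less_mult_iff zero_less_numeral)
  interpret h: group_hom ?P K h
    using h(1) K group_surface[of "2 * r"] by (simp add: group_hom_def group_hom_axioms_def)
  have he: "h (handle_gens ?P r (double_gen r) (4 * j)) = ?e (4 * j)"
    "h (handle_gens ?P r (double_gen r) (4 * j + 1)) = ?e (4 * j + 1)" if j: "j < 2 * r" for j
  proof -
    have k: "4 * j < 4 * (2 * r)" "4 * j mod 4 < 2" "4 * j + 1 < 4 * (2 * r)" "(4 * j + 1) mod 4 < 2" using j by presburger+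
    show "h (handle_gens ?P r (double_gen r) (4 * j)) = ?e (4 * j)"
      using h(2)[OF k(1,2)] k(1,2) unfolding double_gen(2)[OF j] surface_gen_def by simp
    show "h (handle_gens ?P r (double_gen r) (4 * j + 1)) = ?e (4 * j + 1)"
      using h(2)[OF k(3,4)] k(3,4) unfolding double_gen(3)[OF j] surface_gen_def by simp
  qed
  have hw: "h (wval ?P (double_gen r b) w) = wval K (\<lambda>l. h (double_gen r b l)) w" for b w
    by (rule wval_hom[OF group_surface K h(1) double_gen(1)])
  note wP = h.G.wval_closed[of "double_gen r b" for b, OF double_gen(1)]
  have inl: "h (double_gen r b (Inl i)) = \<rho> b (Inl i)" if i: "i < r" for b i
  proof (cases b)
    case True
    then show ?thesis using he(1)[of i] i unfolding handle_gens_simps(1)[OF i] by simp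
  next
    case False
    have "inv\<^bsub>K\<^esub> h (double_gen r False (Inl i)) = inv\<^bsub>K\<^esub> \<rho> False (Inl i)"
      using he(2)[of "2 * r - 1 - i"] i double_gen(1) unfolding handle_gens_simps(4)[OF i] by simp
    then have "inv\<^bsub>K\<^esub> (inv\<^bsub>K\<^esub> h (double_gen r False (Inl i))) = inv\<^bsub>K\<^esub> (inv\<^bsub>K\<^esub> \<rho> False (Inl i))" by (rule arg_cong)
    then show ?thesis using False \<rho> double_gen(1) by simp
  qed
  have inr_eq: "h (wval ?P (double_gen r b) (nested_word (Suc i) r) \<otimes>\<^bsub>?P\<^esub> double_gen r b (Inr i)) =
      wval K (\<rho> b) (nested_word (Suc i) r) \<otimes>\<^bsub>K\<^esub> \<rho> b (Inr i)" if i: "i < r" for b i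
  proof (cases b)
    case False
    then show ?thesis using he(1)[of "2 * r - 1 - i"] i unfolding handle_gens_simps(3)[OF i] by simp
  next
    case True
    let ?c = "wval ?P (double_gen r True) (nested_word (Suc i) r) \<otimes>\<^bsub>?P\<^esub> double_gen r True (Inr i)"
    let ?d = "wval K (\<rho> True) (nested_word (Suc i) r) \<otimes>\<^bsub>K\<^esub> \<rho> True (Inr i)"
    have c: "?c \<in> carrier ?P" by (intro h.G.m_closed wP double_gen(1))
    have d: "?d \<in> carrier K" by (intro K.m_closed w \<rho>)
    have "i < 2 * r" using i by simp
    from he(2)[OF this] have "inv\<^bsub>K\<^esub> (h ?c) = inv\<^bsub>K\<^esub> ?d"
      unfolding handle_gens_simps(2)[OF i] h.hom_inv[OF c] .
    then have "inv\<^bsub>K\<^esub> (inv\<^bsub>K\<^esub> (h ?c)) = inv\<^bsub>K\<^esub> (inv\<^bsub>K\<^esub> ?d)" by (rule arg_cong)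
    then show ?thesis
      unfolding K.inv_inv[OF h.hom_closed[OF c]] K.inv_inv[OF d] using True by simp
  qed
  have inr: "h (double_gen r b (Inr i)) = \<rho> b (Inr i)" if "i < r" for b i
    using that
  proof (induction "r - i" arbitrary: i rule: less_induct)
    case less
    have "wval K (\<lambda>l. h (double_gen r b l)) (nested_word (Suc i) r) = wval K (\<rho> b) (nested_word (Suc i) r)"
    proof (rule wval_cong)
      fix x assume "x \<in> set (nested_word (Suc i) r)"
      then obtain m where m: "fst x = Inl m \<or> fst x = Inr m" "Suc i \<le> m" "m < r"
        using set_nested_word by blast
      then show "h (double_gen r b (fst x)) = \<rho> b (fst x)"
        using inl[of m b] less(1)[of m] by auto
    qed
    then show ?case
      using inr_eq[OF less.prems, of b] hw[of b] double_gen(1) \<rho> w wP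
      by (simp add: K.Units_l_cancel[unfolded K.Units_eq])
  qed
  show ?thesis
    using h(1) inl inr by (intro bexI[of _ h]) (auto simp: valid_label_def split: sum.splits)
qed

section \<open>Alternating products, marked monomorphisms and the Dehn twist\<close>

fun alt_val :: "('h, 'c) monoid_scheme \<Rightarrow> (bool \<Rightarrow> 'l \<Rightarrow> 'h) \<Rightarrow> bool \<Rightarrow> 'l letter list list \<Rightarrow> 'h" where
  "alt_val H \<rho> b [] = \<one>\<^bsub>H\<^esub>"
| "alt_val H \<rho> b (u # us) = wval H (\<rho> b) u \<otimes>\<^bsub>H\<^esub> alt_val H \<rho> (\<not> b) us"

lemma (in group) alt_val_closed [simp]: "(\<And>b l. \<rho> b l \<in> carrier G) \<Longrightarrow> alt_val G \<rho> b us \<in> carrier G"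
  by (induction us arbitrary: b) auto

lemma (in group) alt_val_append:
  assumes "\<And>b l. \<rho> b l \<in> carrier G"
  shows "alt_val G \<rho> b (us @ vs) = alt_val G \<rho> b us \<otimes> alt_val G \<rho> (b = even (length us)) vs"
proof (induction us arbitrary: b)
  case (Cons u us)
  have "((\<not> b) = even (length us)) = (b = even (length (u # us)))" by auto
  then show ?case using Cons[of "\<not> b"] assms by (simp add: m_assoc)
qed (use assms in simp)

abbreviation valid_words :: "nat \<Rightarrow> (nat + nat) letter list list \<Rightarrow> bool"
  where "valid_words r us \<equiv> (\<forall>u\<in>set us. \<forall>x\<in>set u. valid_label r (fst x))"

context
  fixes r :: nat
  assumes r: "r > 0"
begin

interpretation P: group "surf_group r" by (rule group_surface)

private abbreviation (input) "P \<equiv> surf_group r"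
private abbreviation (input) "w \<equiv> nested_word 0 r"

lemmas wval_gen_closed = P.wval_closed[of "double_gen r b" for b, OF double_gen(1)]

lemma surface_words:
  assumes "a \<in> carrier P"
  obtains u where "\<forall>x\<in>set u. valid_label r (snd (fst x))" "a = wval P (\<lambda>(b, l). double_gen r b l) u"
proof -
  let ?f = "\<lambda>(b, l). double_gen r b l"
  have f: "?f z \<in> carrier P" for z by (simp add: case_prod_unfold double_gen(1))
  define N where "N = {wval P ?f u | u. \<forall>x\<in>set u. valid_label r (snd (fst x))}"
  have "subgroup N P"
  proof (rule P.subgroupI)
    show "N \<subseteq> carrier P" using P.wval_closed[OF f] by (auto simp: N_def)
    show "N \<noteq> {}" by (auto simp: N_def intro!: exI[of _ "[]"])
    fix a assume "a \<in> N"
    then obtain u where u: "a = wval P ?f u" "\<forall>x\<in>set u. valid_label r (snd (fst x))" by (auto simp: N_def)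
    then show "inv\<^bsub>P\<^esub> a \<in> N"
      unfolding N_def using P.wval_inv_word[where f = ?f and w = u, OF f]
      by (intro CollectI exI[of _ "inv_word u"]) (auto simp: inv_word_def)
    fix b assume "b \<in> N"
    then obtain v where v: "b = wval P ?f v" "\<forall>x\<in>set v. valid_label r (snd (fst x))" by (auto simp: N_def)
    show "a \<otimes>\<^bsub>P\<^esub> b \<in> N"
      unfolding N_def using P.wval_append[where f = ?f and u = u and v = v, OF f] u v by (intro CollectI exI[of _ "u @ v"]) auto
  qed
  moreover have "double_gen r b l \<in> N" if "valid_label r l" for b l
    unfolding N_def using that double_gen(1) by (intro CollectI exI[of _ "[((b, l), True)]"]) (simp add: wval_Cons)
  ultimately have "a \<in> N" using double_gen_generates[OF r] assms by blast
  then show thesis using that by (auto simp: N_def)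
qed

lemma surface_alt_words:
  assumes "a \<in> carrier P"
  shows "\<exists>b us. valid_words r us \<and> a = alt_val P (double_gen r) b us"
proof -
  obtain u where u: "\<forall>x\<in>set u. valid_label r (snd (fst x))" "a = wval P (\<lambda>(b, l). double_gen r b l) u"
    by (rule surface_words[OF assms])
  have "\<exists>b us. valid_words r us \<and> wval P (\<lambda>(b, l). double_gen r b l) u = alt_val P (double_gen r) b us"
    using u(1)
  proof (induction u)
    case Nil
    show ?case by (intro exI[of _ True] exI[of _ "[]"]) simp
  next
    case (Cons x u)
    then obtain c us where us: "valid_words r us" "wval P (\<lambda>(b, l). double_gen r b l) u = alt_val P (double_gen r) c us" by auto
    obtain b l s where x: "x = ((b, l), s)" by (metis prod.exhaust)
    have l: "lit P (\<lambda>(b, l). double_gen r b l) x = wval P (double_gen r b) [(l, s)]"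
      using P.lit_closed[of "double_gen r b", OF double_gen(1)] by (simp add: x lit_def wval_Cons double_gen(1))
    define us' where "us' = (if c = b then [(l, s)] # [] # us else [(l, s)] # us)"
    have "valid_words r us'" using us(1) Cons.prems by (auto simp: us'_def x)
    moreover have "wval P (\<lambda>(b, l). double_gen r b l) (x # u) = alt_val P (double_gen r) b us'"
      using us(2) l P.alt_val_closed[of "double_gen r", OF double_gen(1)] by (auto simp: wval_Cons us'_def)
    ultimately show ?case by blast
  qed
  then show ?thesis using u(2) by simp
qed

text \<open>Powers of the boundary word have the same value in both halves, so a factor from the
  cyclic subgroup can change sides. The word is replaced by an explicit power because
  \<open>u\<close> itself need not consist of valid labels.\<close>

lemma in_cyclic_transfer:
  assumes "in_cyclic w u"
  obtains v where "\<forall>x\<in>set v. valid_label r (fst x)" "\<And>b c. wval P (double_gen r b) u = wval P (double_gen r c) v"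
proof -
  obtain n where n: "red u = red (word_power w n) \<or> red u = red (inv_word (word_power w n))"
    using assms by (auto simp: in_cyclic_def inv_word_power)
  define v where "v = (if red u = red (word_power w n) then word_power w n else inv_word (word_power w n))"
  have rv: "red u = red v" using n by (auto simp: v_def)
  have "set (word_power w n) \<subseteq> set w" by (induction n) auto
  then have "\<forall>x\<in>set (word_power w n). valid_label r (fst x)" using valid_nested_word by blast
  then have "\<forall>x\<in>set v. valid_label r (fst x)" by (auto simp: v_def inv_word_def)
  moreover have "wval P (double_gen r b) u = wval P (double_gen r c) v" for b c
  proof -
    have W: "wval P (double_gen r b) w = wval P (double_gen r c) w"
      using double_gen_relation[OF r] by (cases b; cases c) auto
    have "wval P (double_gen r b) u = wval P (double_gen r b) v"
      by (rule P.wval_red_eq[OF double_gen(1) rv])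
    also have "\<dots> = wval P (double_gen r c) v"
      unfolding v_def by (simp add: P.wval_power[OF double_gen(1)] P.wval_inv_word[OF double_gen(1)] W)
    finally show ?thesis .
  qed
  ultimately show thesis by (rule that)
qed

text \<open>Neighbouring factors can be merged across a factor that lies in the amalgamated cyclic subgroup.\<close>

lemma surface_reduced_alt_words:
  assumes "a \<in> carrier P"
  obtains b us where "valid_words r us" "a = alt_val P (double_gen r) b us"
    "length us \<le> 1 \<or> (\<forall>u\<in>set us. \<not> in_cyclic w u)"
proof -
  define Q where "Q n \<longleftrightarrow> (\<exists>b us. valid_words r us \<and> a = alt_val P (double_gen r) b us \<and> length us = n)" for n
  have "\<exists>n. Q n" using surface_alt_words[OF assms] by (auto simp: Q_def)
  then obtain n where n: "Q n" "\<And>m. m < n \<Longrightarrow> \<not> Q m" by (metis exists_least_iff)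
  then obtain b us where us: "valid_words r us" "a = alt_val P (double_gen r) b us" "length us = n" by (auto simp: Q_def)
  note app = P.alt_val_append[of "double_gen r", OF double_gen(1)]
  note cl = P.alt_val_closed[of "double_gen r", OF double_gen(1)] wval_gen_closed
  have "length us \<le> 1 \<or> (\<forall>u\<in>set us. \<not> in_cyclic w u)"
  proof (rule ccontr)
    assume "\<not> ?thesis"
    then obtain u where len: "length us > 1" and u: "u \<in> set us" "in_cyclic w u" by auto
    obtain xs ys where xy: "us = xs @ u # ys" using u(1) by (meson split_list)
    obtain v where v: "\<forall>x\<in>set v. valid_label r (fst x)" "\<And>b c. wval P (double_gen r b) u = wval P (double_gen r c) v"
      by (rule in_cyclic_transfer[OF u(2)]) blast
    have "\<exists>c zs. valid_words r zs \<and> a = alt_val P (double_gen r) c zs \<and> length zs < length us"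
    proof (cases "xs = []")
      case True
      then obtain y ys' where ys: "ys = y # ys'" using len xy by (cases ys) auto
      have "a = alt_val P (double_gen r) (\<not> b) ((v @ y) # ys')"
        using us(2) v(2)[of b "\<not> b"] cl by (simp add: xy True ys P.wval_append[OF double_gen(1)] P.m_assoc)
      moreover have "valid_words r ((v @ y) # ys')" using us(1) v(1) by (auto simp: xy True ys)
      ultimately show ?thesis by (intro exI[of _ "\<not> b"] exI[of _ "(v @ y) # ys'"]) (simp add: xy True ys)
    next
      case False
      then obtain x xs' where xs: "xs = xs' @ [x]" by (metis rev_exhaust)
      define c where "c \<longleftrightarrow> (b = even (length xs'))"
      have c: "(b = even (length xs)) \<longleftrightarrow> \<not> c" by (auto simp: c_def xs)
      have a: "a = alt_val P (double_gen r) b xs' \<otimes>\<^bsub>P\<^esub> (wval P (double_gen r c) x \<otimes>\<^bsub>P\<^esub> 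
          (wval P (double_gen r c) v \<otimes>\<^bsub>P\<^esub> alt_val P (double_gen r) c ys))"
        using us(2) v(2)[of "\<not> c" c] cl app[of b "xs' @ [x]" "u # ys"] app[of b xs' "[x]"] c
        by (simp add: xy xs c_def[symmetric] P.m_assoc)
      show ?thesis
      proof (cases ys)
        case Nil
        have "a = alt_val P (double_gen r) b (xs' @ [x @ v])"
          using a cl app[of b xs' "[x @ v]"] by (simp add: Nil c_def[symmetric] P.wval_append[OF double_gen(1)] P.m_assoc)
        moreover have "valid_words r (xs' @ [x @ v])" using us(1) v(1) by (auto simp: xy xs)
        ultimately show ?thesis by (intro exI[of _ b] exI[of _ "xs' @ [x @ v]"]) (simp add: xy xs Nil)
      next
        case (Cons y ys')
        have "a = alt_val P (double_gen r) b (xs' @ (x @ v @ y) # ys')"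
          using a cl app[of b xs' "(x @ v @ y) # ys'"] by (simp add: Cons c_def[symmetric] P.wval_append[OF double_gen(1)] P.m_assoc)
        moreover have "valid_words r (xs' @ (x @ v @ y) # ys')" using us(1) v(1) by (auto simp: xy xs Cons)
        ultimately show ?thesis by (intro exI[of _ b] exI[of _ "xs' @ (x @ v @ y) # ys'"]) (simp add: xy xs Cons)
      qed
    qed
    then obtain c zs where "valid_words r zs" "a = alt_val P (double_gen r) c zs" "length zs < n" using us(3) by auto
    then show False using n(2)[of "length zs"] unfolding Q_def by blast
  qed
  then show thesis using that us by blast
qed

lemma surface_hom_unique:
  assumes "group K" "h \<in> hom P K" "h' \<in> hom P K"
    and eq: "\<And>b l. valid_label r l \<Longrightarrow> h (double_gen r b l) = h' (double_gen r b l)" and a: "a \<in> carrier P"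
  shows "h a = h' a"
proof -
  interpret h: group_hom P K h using assms group_surface by (simp add: group_hom_def group_hom_axioms_def)
  interpret h': group_hom P K h' using assms group_surface by (simp add: group_hom_def group_hom_axioms_def)
  have "subgroup {a \<in> carrier P. h a = h' a} P"
    by (rule P.subgroupI) (auto intro!: exI[of _ "\<one>\<^bsub>P\<^esub>"])
  then show ?thesis
    using double_gen_generates[OF r, of "{a \<in> carrier P. h a = h' a}"] eq a double_gen(1) by blast
qed

text \<open>Injectivity keeps a nontrivial element nontrivial, so that it can be modified again.
  Fixing the \<open>Inl\<close> generators of the \<open>True\<close> half is a closed condition on
  the representations, hence \<open>F\<close> remains in the image in the limit.\<close>

definition marked_monos :: "((real \<Rightarrow> complex set) set \<Rightarrow> (real \<Rightarrow> complex set) set) set"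
  where "marked_monos = {\<tau> \<in> hom P P. inj_on \<tau> (carrier P) \<and> (\<forall>i<r. \<tau> (double_gen r True (Inl i)) = double_gen r True (Inl i))}"

lemma marked_monos_id: "(\<lambda>a. a) \<in> marked_monos"
  by (simp add: marked_monos_def hom_def inj_on_def)

lemma marked_monos_compose: "\<tau> \<in> marked_monos \<Longrightarrow> \<tau>' \<in> marked_monos \<Longrightarrow> (\<lambda>a. \<tau> (\<tau>' a)) \<in> marked_monos"
proof -
  assume t: "\<tau> \<in> marked_monos" and t': "\<tau>' \<in> marked_monos"
  have hom: "\<tau> \<in> hom P P" "\<tau>' \<in> hom P P" and inj: "inj_on \<tau> (carrier P)" "inj_on \<tau>' (carrier P)"
    using t t' by (simp_all add: marked_monos_def)
  have "inj_on (\<tau> \<circ> \<tau>') (carrier P)"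
    by (rule comp_inj_on[OF inj(2) inj_on_subset[OF inj(1) hom_carrier[OF hom(2)]]])
  moreover have "\<tau> \<circ> \<tau>' \<in> hom P P" by (rule Group.hom_compose[OF hom(2,1)])
  ultimately show ?thesis
    using t t' by (simp add: marked_monos_def o_def)
qed

text \<open>A homomorphism that undoes \<open>\<sigma>\<close> on the generators undoes it
  everywhere, whence injectivity.\<close>

lemma marked_monosI:
  assumes s: "\<sigma> \<in> hom P P" and s': "\<sigma>' \<in> hom P P" 
    and inv: "\<And>b l. valid_label r l \<Longrightarrow> \<sigma>' (\<sigma> (double_gen r b l)) = double_gen r b l"
    and x: "\<And>i. i < r \<Longrightarrow> \<sigma> (double_gen r True (Inl i)) = double_gen r True (Inl i)"
  shows "\<sigma> \<in> marked_monos"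
proof -
  have h1: "(\<lambda>a. \<sigma>' (\<sigma> a)) \<in> hom P P" using Group.hom_compose[OF s s'] by (simp add: o_def)
  have h2: "(\<lambda>a. a) \<in> hom P P" by (simp add: hom_def)
  have "\<sigma>' (\<sigma> a) = a" if "a \<in> carrier P" for a
    by (rule surface_hom_unique[OF group_surface h1 h2 inv that])
  then have "inj_on \<sigma> (carrier P)" by (rule inj_on_inverseI)
  then show ?thesis using s x by (simp add: marked_monos_def)
qed

text \<open>The Dehn twist along the separating curve: the \<open>False\<close> half is conjugated
  by a power of the boundary word.\<close>

definition twist :: "nat \<Rightarrow> bool \<Rightarrow> nat + nat \<Rightarrow> (real \<Rightarrow> complex set) set"
  where "twist n b l = (let c = wval P (double_gen r True) (word_power w n) in
    if b then double_gen r b l else c \<otimes>\<^bsub>P\<^esub> double_gen r b l \<otimes>\<^bsub>P\<^esub> inv\<^bsub>P\<^esub> c)"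

text \<open>The conjugating element commutes with the boundary word, so the relation between the
  halves persists. The twist by its inverse fixes it, being the identity on the \<open>True\<close>
  half, and thus is a left inverse.\<close>

lemma twist_exists:
  obtains \<theta> where "\<theta> \<in> marked_monos" "\<And>b l. valid_label r l \<Longrightarrow> \<theta> (double_gen r b l) = twist n b l"
proof -
  define c where "c = wval P (double_gen r True) (word_power w n)"
  note [simp] = double_gen(1) 
  have c [simp]: "c \<in> carrier P" unfolding c_def by (rule wval_gen_closed)
  let ?W = "wval P (double_gen r True) w"
  have W: "?W \<in> carrier P" by (rule wval_gen_closed)
  have cW: "c \<otimes>\<^bsub>P\<^esub> ?W = ?W \<otimes>\<^bsub>P\<^esub> c"
    unfolding c_def P.wval_power[OF double_gen(1)] using W by (metis P.nat_pow_Suc P.nat_pow_Suc2)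
  have ex: "\<exists>h\<in>hom P P. \<forall>b l. valid_label r l \<longrightarrow> h (double_gen r b l) = (if b then double_gen r b l else d \<otimes>\<^bsub>P\<^esub> double_gen r b l \<otimes>\<^bsub>P\<^esub> inv\<^bsub>P\<^esub> d)"
    if d: "d \<in> carrier P" and dW: "d \<otimes>\<^bsub>P\<^esub> ?W = ?W \<otimes>\<^bsub>P\<^esub> d" for d
  proof (rule double_gen_hom[OF r group_surface])
    have "wval P (\<lambda>l. d \<otimes>\<^bsub>P\<^esub> double_gen r False l \<otimes>\<^bsub>P\<^esub> inv\<^bsub>P\<^esub> d) w = d \<otimes>\<^bsub>P\<^esub> ?W \<otimes>\<^bsub>P\<^esub> inv\<^bsub>P\<^esub> d"
      using P.wval_conj[OF double_gen(1) d] double_gen_relation[OF r] by simp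
    also have "\<dots> = ?W" unfolding dW using d W by (simp add: P.m_assoc)
    finally show "wval P (\<lambda>l. if True then double_gen r True l else d \<otimes>\<^bsub>P\<^esub> double_gen r True l \<otimes>\<^bsub>P\<^esub> inv\<^bsub>P\<^esub> d) w =
      wval P (\<lambda>l. if False then double_gen r False l else d \<otimes>\<^bsub>P\<^esub> double_gen r False l \<otimes>\<^bsub>P\<^esub> inv\<^bsub>P\<^esub> d) w"
      by simp
  qed (use d in simp)
  have fix_c: "h c = c" if h: "h \<in> hom P P" "\<And>l. valid_label r l \<Longrightarrow> h (double_gen r True l) = double_gen r True l" for h
  proof -
    have "h c = wval P (\<lambda>l. h (double_gen r True l)) (word_power w n)"
      unfolding c_def by (rule wval_hom[OF group_surface group_surface h(1) double_gen(1)])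
    also have "\<dots> = c"
    proof -
      have "set (word_power w n) \<subseteq> set w" by (induction n) auto
      then show ?thesis unfolding c_def using h(2) valid_nested_word by (intro wval_cong) blast
    qed
    finally show ?thesis .
  qed
  obtain \<theta> where t: "\<theta> \<in> hom P P" "\<And>b l. valid_label r l \<Longrightarrow> \<theta> (double_gen r b l) = (if b then double_gen r b l else c \<otimes>\<^bsub>P\<^esub> double_gen r b l \<otimes>\<^bsub>P\<^esub> inv\<^bsub>P\<^esub> c)"
    using ex[OF c cW] by blast
  have icW: "inv\<^bsub>P\<^esub> c \<otimes>\<^bsub>P\<^esub> ?W = ?W \<otimes>\<^bsub>P\<^esub> inv\<^bsub>P\<^esub> c"
  proof -
    have "inv\<^bsub>P\<^esub> c \<otimes>\<^bsub>P\<^esub> (c \<otimes>\<^bsub>P\<^esub> ?W) \<otimes>\<^bsub>P\<^esub> inv\<^bsub>P\<^esub> c = inv\<^bsub>P\<^esub> c \<otimes>\<^bsub>P\<^esub> (?W \<otimes>\<^bsub>P\<^esub> c) \<otimes>\<^bsub>P\<^esub> inv\<^bsub>P\<^esub> c" using cW by simp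
    then show ?thesis using W by (simp add: P.m_assoc)
  qed
  obtain \<theta>' where t': "\<theta>' \<in> hom P P" "\<And>b l. valid_label r l \<Longrightarrow> \<theta>' (double_gen r b l) = (if b then double_gen r b l else inv\<^bsub>P\<^esub> c \<otimes>\<^bsub>P\<^esub> double_gen r b l \<otimes>\<^bsub>P\<^esub> inv\<^bsub>P\<^esub> (inv\<^bsub>P\<^esub> c))"
    using ex[OF P.inv_closed[OF c] icW] by blast
  interpret t': group_hom P P \<theta>' using t' group_surface by (simp add: group_hom_def group_hom_axioms_def)
  have c': "\<theta>' c = c" by (rule fix_c[OF t'(1)]) (simp add: t'(2))
  have "\<theta> \<in> marked_monos"
  proof (rule marked_monosI[OF t(1) t'(1)])
    show "\<theta>' (\<theta> (double_gen r b l)) = double_gen r b l" if "valid_label r l" for b l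
      using that t(2)[OF that] t'(2)[OF that] c' by (simp add: P.m_assoc)
  qed (simp add: t(2))
  then show thesis
    using t(2) that by (simp add: twist_def c_def Let_def)
qed

lemma set_red: "set (red u) \<subseteq> set u"
  using set_foldr_cancel_cons[of u "[]"] by (simp add: red_def)

text \<open>Up to conjugation, \<open>e\<close> is the image of the twisted element when the halves
  are identified, as a reduced word. It depends on \<open>a\<close> only and not on
  \<open>\<psi>\<close> and \<open>\<sigma>\<close>, so it can be used for representations that are
  constructed afterwards.\<close>

lemma twist_detects:
  fixes K :: "('k, 'c) monoid_scheme" (structure)
  assumes K: "group K" and a: "a \<in> carrier P" "a \<noteq> \<one>\<^bsub>P\<^esub>"
  obtains \<theta> e where "\<theta> \<in> marked_monos" "\<And>\<psi> \<sigma>. \<lbrakk>\<psi> \<in> hom P K; \<And>l. \<sigma> l \<in> carrier K; \<And>b l. valid_label r l \<Longrightarrow> \<psi> (double_gen r b l) = \<sigma> l\<rbrakk> \<Longrightarrow>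
      \<psi> (\<theta> a) = \<one> \<Longrightarrow> wval K \<sigma> e = \<one>"
    "\<exists>n. \<forall>b l. valid_label r l \<longrightarrow> \<theta> (double_gen r b l) = twist n b l"
    "reduced e" "e \<noteq> []" "\<forall>x\<in>set e. valid_label r (fst x)"
proof -
  interpret K: group K by (rule K)
  obtain b us where us: "valid_words r us" "a = alt_val P (double_gen r) b us"
    "length us \<le> 1 \<or> (\<forall>u\<in>set us. \<not> in_cyclic w u)"
    by (rule surface_reduced_alt_words[OF a(1)])
  have ne: "us \<noteq> []" using us(2) a(2) by auto
  \<comment> \<open>Larger than the length of every factor, as \<open>sandwich_power\<close>
    requires. The twist has exponent \<open>N + N\<close> because two chunks meet between
    neighbouring factors.\<close>
  define N where "N = Suc (sum_list (map length us))"
  have N: "length u < N" if "u \<in> set us" for u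
    using member_le_sum_list[of "length u" "map length us"] that by (simp add: N_def)
  define e where "e = red (alternating_chunks w N b us)"
  have dw: "distinct_cyclic w" by (rule distinct_cyclic_nested_word[OF r])
  have e_ne: "e \<noteq> []"
  proof (cases "length us \<le> 1")
    \<comment> \<open>A single factor may lie in the cyclic subgroup, but then its own nontriviality
      suffices.\<close>
    case True
    then obtain u where u: "us = [u]" using ne by (cases us) auto
    have "red u \<noteq> []"
    proof
      assume "red u = []"
      then have "wval P (double_gen r b) u = wval P (double_gen r b) []"
        by (intro P.wval_red_eq[OF double_gen(1)]) simp
      then show False using us(2) a(2) wval_gen_closed by (simp add: u)
    qed
    then show ?thesis by (simp add: e_def u Let_def red_eq_Nil_conj)
  next
    case False
    then show ?thesis
      using alternating_chunks_nontrivial[OF dw ne, of N b] us(3) N by (auto simp: e_def)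
  qed
  have val: "set (word_power v n) \<subseteq> set v" for v :: "(nat + nat) letter list" and n by (induction n) auto
  have vw: "valid_label r (fst x)" if "x \<in> set (word_power w n) \<union> set (word_power (inv_word w) n)" for x n
    using that val[of w n] val[of "inv_word w" n] valid_nested_word by (fastforce simp: inv_word_def)
  have "\<forall>x\<in>set (alternating_chunks w N b us). valid_label r (fst x)"
    using us(1)
  proof (induction us arbitrary: b)
    case (Cons u us)
    then have "\<forall>x\<in>set (alternating_chunks w N (\<not> b) us). valid_label r (fst x)" by auto
    moreover have "valid_label r (fst x)" if "x \<in> set (inv_word (word_power (if b then w else inv_word w) N))" for x
      using that vw[of x N] by (auto simp: inv_word_power split: if_splits)
    moreover have "valid_label r (fst x)" if "x \<in> set (word_power (if b then w else inv_word w) N)" for x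
      using that vw[of x N] by (auto split: if_splits)
    ultimately show ?case using Cons.prems by (auto simp: Let_def)
  qed simp
  then have e_val: "\<forall>x\<in>set e. valid_label r (fst x)"
    using set_red by (auto simp: e_def)
  obtain \<theta> where t: "\<theta> \<in> marked_monos" "\<And>b l. valid_label r l \<Longrightarrow> \<theta> (double_gen r b l) = twist (N + N) b l"
    using twist_exists[of "N + N"] by blast
  have thom: "\<theta> \<in> hom P P" using t(1) by (simp add: marked_monos_def)
  have main: "wval K \<sigma> e = \<one>"
    if psi: "\<psi> \<in> hom P K" and sig: "\<And>l. \<sigma> l \<in> carrier K" and ps: "\<And>b l. valid_label r l \<Longrightarrow> \<psi> (double_gen r b l) = \<sigma> l"
      and triv: "\<psi> (\<theta> a) = \<one>" for \<psi> \<sigma>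
  proof -
    note wK [simp] = K.wval_closed[of \<sigma>, OF sig]
    define h where "h x = \<psi> (\<theta> x)" for x
    have h: "h \<in> hom P K" using Group.hom_compose[OF thom psi] by (simp add: h_def[abs_def] o_def)
    interpret h: group_hom P K h using h K group_surface by (simp add: group_hom_def group_hom_axioms_def)
    interpret ps: group_hom P K \<psi> using psi K group_surface by (simp add: group_hom_def group_hom_axioms_def)
    define Z where "Z = wval K \<sigma> (word_power w N)"
    have Z [simp]: "Z \<in> carrier K" by (simp add: Z_def)
    have "\<psi> (wval P (double_gen r True) (word_power w (N + N))) = wval K (\<lambda>l. \<psi> (double_gen r True l)) (word_power w (N + N))"
      by (rule wval_hom[OF group_surface K psi double_gen(1)])
    also have "\<dots> = wval K \<sigma> (word_power w (N + N))"
      by (rule wval_cong) (use ps vw in blast)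
    finally have pc: "\<psi> (wval P (double_gen r True) (word_power w (N + N))) = Z \<otimes> Z"
      by (simp add: Z_def word_power_add K.wval_append[OF sig])
    have hT: "h (wval P (double_gen r True) u) = wval K \<sigma> u" and hF: "h (wval P (double_gen r False) u) = Z \<otimes> Z \<otimes> wval K \<sigma> u \<otimes> inv (Z \<otimes> Z)"
      if u: "\<forall>x\<in>set u. valid_label r (fst x)" for u
    proof -
      have hw: "h (wval P (double_gen r b) u) = wval K (\<lambda>l. h (double_gen r b l)) u" for b
        by (rule wval_hom[OF group_surface K h double_gen(1)])
      show "h (wval P (double_gen r True) u) = wval K \<sigma> u"
        unfolding hw by (rule wval_cong) (use u t(2) ps in \<open>auto simp: h_def twist_def Let_def\<close>)
      have "wval K (\<lambda>l. h (double_gen r False l)) u = wval K (\<lambda>l. Z \<otimes> Z \<otimes> \<sigma> l \<otimes> inv (Z \<otimes> Z)) u"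
        by (rule wval_cong) (use u t(2) ps pc wval_gen_closed double_gen(1) in \<open>simp add: h_def twist_def Let_def\<close>)
      then show "h (wval P (double_gen r False) u) = Z \<otimes> Z \<otimes> wval K \<sigma> u \<otimes> inv (Z \<otimes> Z)"
        unfolding hw using K.wval_conj[where f = \<sigma> and c = "Z \<otimes> Z" and w = u, OF sig] by simp
    qed
    \<comment> \<open>Each \<open>Z \<otimes> Z\<close> around a \<open>False\<close> factor is
      shared between that factor and its neighbours, one \<open>Z\<close> for each chunk; what is
      left over is the conjugation by \<open>Z\<close> at the ends.\<close>
    have "wval K \<sigma> (alternating_chunks w N b us) = inv Z \<otimes> h (alt_val P (double_gen r) b us) \<otimes> Z"
      using us(1)
    proof (induction us arbitrary: b)
      case (Cons u us)
      note ac = P.alt_val_closed[of "double_gen r", OF double_gen(1)]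
      have IH: "wval K \<sigma> (alternating_chunks w N (\<not> b) us) = inv Z \<otimes> h (alt_val P (double_gen r) (\<not> b) us) \<otimes> Z"
        using Cons by auto
      have u: "\<forall>x\<in>set u. valid_label r (fst x)" using Cons.prems by auto
      show ?case
      proof (cases b)
        case True
        then show ?thesis
          using IH hT[OF u] ac wval_gen_closed
          by (simp add: Let_def K.wval_append[OF sig] K.wval_inv_word[OF sig] Z_def[symmetric] K.m_assoc)
      next
        case False
        then show ?thesis
          using IH hF[OF u] ac wval_gen_closed
          by (simp add: Let_def K.wval_append[OF sig] K.wval_inv_word[OF sig] Z_def[symmetric] K.m_assoc
              inv_word_power[symmetric] K.inv_mult_group)
      qed
    qed simp
    also have "\<dots> = \<one>" using triv us(2) by (simp add: h_def)
    finally show ?thesis by (simp add: e_def K.wval_red[OF sig])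
  qed
  show thesis
  proof (rule that[OF t(1) _ _ _ e_ne e_val])
    show "\<exists>n. \<forall>b l. valid_label r l \<longrightarrow> \<theta> (double_gen r b l) = twist n b l" using t(2) by blast
    show "reduced e" by (simp add: e_def reduced_red)
  qed (rule main)
qed

end

section \<open>Slides: twists that involve both halves\<close>

text \<open>The loop around the second hole of handle \<open>i\<close>. The boundary word is the
  product of all \<open>x_i\<close> and of these loops in reverse order.\<close>

definition prim :: "('h, 'c) monoid_scheme \<Rightarrow> (nat + nat \<Rightarrow> 'h) \<Rightarrow> nat \<Rightarrow> 'h"
  where "prim H f i = f (Inr i) \<otimes>\<^bsub>H\<^esub> inv\<^bsub>H\<^esub> f (Inl i) \<otimes>\<^bsub>H\<^esub> inv\<^bsub>H\<^esub> f (Inr i)"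

definition list_prod :: "('h, 'c) monoid_scheme \<Rightarrow> (nat \<Rightarrow> 'h) \<Rightarrow> nat list \<Rightarrow> 'h"
  where "list_prod H f is = foldr (\<lambda>i a. f i \<otimes>\<^bsub>H\<^esub> a) is \<one>\<^bsub>H\<^esub>"

lemma list_prod_simps [simp]: "list_prod H f [] = \<one>\<^bsub>H\<^esub>" "list_prod H f (i # is) = f i \<otimes>\<^bsub>H\<^esub> list_prod H f is"
  by (simp_all add: list_prod_def)

lemma list_prod_cong: "(\<And>i. i \<in> set is \<Longrightarrow> f i = f' i) \<Longrightarrow> list_prod H f is = list_prod H f' is"
  by (induction "is") auto

lemma (in group) list_prod_closed [simp]: "(\<And>i. f i \<in> carrier G) \<Longrightarrow> list_prod G f is \<in> carrier G"
  by (induction "is") auto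

lemma (in group) list_prod_append: "(\<And>i. f i \<in> carrier G) \<Longrightarrow> list_prod G f (is @ js) = list_prod G f is \<otimes> list_prod G f js"
  by (induction "is") (auto simp: m_assoc)

lemma (in group_hom) list_prod_hom: "(\<And>i. f i \<in> carrier G) \<Longrightarrow> h (list_prod G f is) = list_prod H (\<lambda>i. h (f i)) is"
  by (induction "is") auto

lemma (in group_hom) prim_hom: "(\<And>l. f l \<in> carrier G) \<Longrightarrow> h (prim G f i) = prim H (\<lambda>l. h (f l)) i"
  by (simp add: prim_def)

lemma (in group) prim_closed [simp]: "(\<And>l. f l \<in> carrier G) \<Longrightarrow> prim G f i \<in> carrier G"
  by (simp add: prim_def)

lemma (in group) nested_word_val:
  assumes f: "\<And>l. f l \<in> carrier G" and i: "i < r" and j: "j < r"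
  shows "wval G f (nested_word 0 r) = list_prod G (\<lambda>i. f (Inl i)) [0..<r] \<otimes> list_prod G (prim G f) (rev [Suc i..<r]) \<otimes> prim G f i \<otimes> list_prod G (prim G f) (rev [0..<i])" (is ?A)
    and "wval G f (nested_word 0 r) = list_prod G (\<lambda>i. f (Inl i)) [0..<j] \<otimes> f (Inl j) \<otimes> list_prod G (\<lambda>i. f (Inl i)) [Suc j..<r] \<otimes>
      list_prod G (prim G f) (rev [Suc i..<r]) \<otimes> prim G f i \<otimes> list_prod G (prim G f) (rev [0..<i])" (is ?B)
proof -
  have 1: "wval G f (map (\<lambda>i. (Inl i, True)) is) = list_prod G (\<lambda>i. f (Inl i)) is" for "is"
    by (induction "is") (auto simp: wval_Cons)
  have 2: "wval G f (concat (map (\<lambda>i. [(Inr i, True), (Inl i, False), (Inr i, False)]) is)) = list_prod G (prim G f) is" for "is"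
    using f by (induction "is") (auto simp: wval_Cons wval_append prim_def m_assoc)
  have u: "[0..<r] = [0..<k] @ k # [Suc k..<r]" if "k < r" for k
    using that by (metis le_add_same_cancel1 le_add_diff_inverse less_or_eq_imp_le upt_add_eq_append upt_conv_Cons zero_le)
  have "wval G f (nested_word 0 r) = list_prod G (\<lambda>i. f (Inl i)) [0..<r] \<otimes> list_prod G (prim G f) (rev [0..<r])"
    using f by (simp add: nested_word_def wval_append 1 2)
  moreover have "list_prod G (prim G f) (rev [0..<r]) = list_prod G (prim G f) (rev [Suc i..<r]) \<otimes> prim G f i \<otimes> list_prod G (prim G f) (rev [0..<i])"
    unfolding u[OF i] using f by (simp add: list_prod_append m_assoc)
  moreover have "list_prod G (\<lambda>i. f (Inl i)) [0..<r] = list_prod G (\<lambda>i. f (Inl i)) [0..<j] \<otimes> f (Inl j) \<otimes> list_prod G (\<lambda>i. f (Inl i)) [Suc j..<r]"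
    unfolding u[OF j] using f by (simp add: list_prod_append m_assoc)
  ultimately show ?A ?B using f by (simp_all add: m_assoc)
qed

text \<open>The algebra of a twist along the curve \<open>X Y^-1\<close>, around the hole
  \<open>X\<close> of one half and the holes \<open>p\<close> and \<open>Q\<close> of the other. All
  three are conjugated by the same \<open>z\<close>, which commutes with the curve; \<open>e\<close>
  and \<open>d\<close> are \<open>z\<close> transported to the places of \<open>p\<close> and
  \<open>Q\<close>.\<close>

lemma (in group) slide_identity:
  assumes [simp]: "A \<in> carrier G" "U \<in> carrier G" "X \<in> carrier G" "V \<in> carrier G" "p1 \<in> carrier G" "p \<in> carrier G"
      "p2 \<in> carrier G" "U' \<in> carrier G" "Q \<in> carrier G" "V' \<in> carrier G" "z \<in> carrier G"
    and L: "L = V \<otimes> inv V'" and B: "B = inv U' \<otimes> inv p2" and Y: "Y = L \<otimes> B \<otimes> p \<otimes> inv B \<otimes> Q \<otimes> inv L"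
    and rel: "A \<otimes> U \<otimes> X \<otimes> V = p1 \<otimes> p \<otimes> p2 \<otimes> U' \<otimes> Q \<otimes> V'"
    and z: "z \<otimes> (X \<otimes> inv Y) = X \<otimes> inv Y \<otimes> z"
    and e: "e = inv B \<otimes> inv L \<otimes> z \<otimes> L \<otimes> B" and d: "d = inv L \<otimes> z \<otimes> L"
  shows "A \<otimes> U \<otimes> (z \<otimes> X \<otimes> inv z) \<otimes> V = p1 \<otimes> (e \<otimes> p \<otimes> inv e) \<otimes> p2 \<otimes> U' \<otimes> (d \<otimes> Q \<otimes> inv d) \<otimes> V'"
proof -
  have [simp]: "L \<in> carrier G" "B \<in> carrier G" "Y \<in> carrier G" by (simp_all add: L B Y)
  define T where "T = p1 \<otimes> inv B \<otimes> inv L"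
  have [simp]: "T \<in> carrier G" by (simp add: T_def)
  \<comment> \<open>The relation between the halves, solved so that the block \<open>Y\<close> of
    the second half replaces the block \<open>X\<close> of the first; commutation of
    \<open>z\<close> with \<open>X Y^-1\<close> then carries the conjugation across.\<close>
  have "T \<otimes> Y = (p1 \<otimes> p \<otimes> p2 \<otimes> U' \<otimes> Q \<otimes> V') \<otimes> inv V"
    unfolding T_def Y by (simp add: m_assoc inv_mult_group L B)
  also have "\<dots> = A \<otimes> U \<otimes> X" unfolding rel[symmetric] by (simp add: m_assoc)
  finally have TY: "T \<otimes> Y = A \<otimes> U \<otimes> X" .
  have "X \<otimes> inv Y \<otimes> z \<otimes> Y = z \<otimes> X" unfolding z[symmetric] by (simp add: m_assoc)
  then have zY: "z \<otimes> Y = Y \<otimes> inv X \<otimes> z \<otimes> X"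
    by (simp add: m_assoc) (metis (no_types, opaque_lifting) \<open>Y \<in> carrier G\<close> assms(11,3) cancel_left inv_closed m_closed)
  have "p1 \<otimes> (e \<otimes> p \<otimes> inv e) \<otimes> p2 \<otimes> U' \<otimes> (d \<otimes> Q \<otimes> inv d) \<otimes> V' = T \<otimes> (z \<otimes> Y) \<otimes> inv z \<otimes> V"
    unfolding T_def Y e d by (simp add: m_assoc inv_mult_group) (simp add: L B m_assoc inv_mult_group)
  also have "\<dots> = (T \<otimes> Y) \<otimes> inv X \<otimes> z \<otimes> X \<otimes> inv z \<otimes> V" unfolding zY by (simp add: m_assoc)
  also have "\<dots> = A \<otimes> U \<otimes> (z \<otimes> X \<otimes> inv z) \<otimes> V" unfolding TY by (simp add: m_assoc)
  finally show ?thesis by simp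
qed

context
  fixes r i j :: nat
  assumes r: "r > 0" and i: "i < r" and j: "j < r"
begin

interpretation P: group "surf_group r" by (rule group_surface)

private abbreviation (input) "P2 \<equiv> surf_group r"
private abbreviation (input) "w2 \<equiv> nested_word 0 r"

text \<open>These four are defined over an arbitrary group so that \<open>slide_hom\<close> can
  compute their images, in particular after folding, where \<open>slide_L\<close> becomes
  trivial.\<close>

definition slide_L where "slide_L f K = list_prod K (prim K (f True)) (rev [0..<i]) \<otimes>\<^bsub>K\<^esub> inv\<^bsub>K\<^esub> list_prod K (prim K (f False)) (rev [0..<i])"
definition slide_B where "slide_B f K = inv\<^bsub>K\<^esub> list_prod K (prim K (f False)) (rev [Suc i..<r]) \<otimes>\<^bsub>K\<^esub> inv\<^bsub>K\<^esub> list_prod K (\<lambda>m. f False (Inl m)) [Suc j..<r]"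
definition slide_Y where "slide_Y f K = slide_L f K \<otimes>\<^bsub>K\<^esub> slide_B f K \<otimes>\<^bsub>K\<^esub> f False (Inl j) \<otimes>\<^bsub>K\<^esub> inv\<^bsub>K\<^esub> slide_B f K \<otimes>\<^bsub>K\<^esub> prim K (f False) i \<otimes>\<^bsub>K\<^esub> inv\<^bsub>K\<^esub> slide_L f K"
definition slide_c where "slide_c f K = prim K (f True) i \<otimes>\<^bsub>K\<^esub> inv\<^bsub>K\<^esub> slide_Y f K"

lemma slide_closed:
  fixes K :: "('k, 'c) monoid_scheme"
  assumes "group K" "\<And>b l. f b l \<in> carrier K"
  shows "slide_L f K \<in> carrier K" "slide_B f K \<in> carrier K" "slide_Y f K \<in> carrier K" "slide_c f K \<in> carrier K"
proof -
  interpret K: group K by fact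
  show "slide_L f K \<in> carrier K" "slide_B f K \<in> carrier K" "slide_Y f K \<in> carrier K" "slide_c f K \<in> carrier K"
    using assms(2) by (simp_all add: slide_L_def slide_B_def slide_Y_def slide_c_def)
qed

lemma slide_hom:
  assumes "group_hom H K h" "\<And>b l. f b l \<in> carrier H"
  shows "h (slide_L f H) = slide_L (\<lambda>b l. h (f b l)) K" "h (slide_B f H) = slide_B (\<lambda>b l. h (f b l)) K"
    "h (slide_Y f H) = slide_Y (\<lambda>b l. h (f b l)) K" "h (slide_c f H) = slide_c (\<lambda>b l. h (f b l)) K"
proof -
  interpret group_hom H K h by fact
  note c = slide_closed[of H f, OF G.is_group assms(2)]
  show L: "h (slide_L f H) = slide_L (\<lambda>b l. h (f b l)) K" and B: "h (slide_B f H) = slide_B (\<lambda>b l. h (f b l)) K"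
    using assms(2) by (simp_all add: slide_L_def slide_B_def list_prod_hom prim_hom)
  show Y: "h (slide_Y f H) = slide_Y (\<lambda>b l. h (f b l)) K"
    using assms(2) c by (simp add: slide_Y_def L B prim_hom)
  show "h (slide_c f H) = slide_c (\<lambda>b l. h (f b l)) K"
    using assms(2) c by (simp add: slide_c_def Y prim_hom)
qed

private abbreviation (input) "gn \<equiv> double_gen r"
private abbreviation (input) "LL \<equiv> slide_L gn P2"
private abbreviation (input) "BB \<equiv> slide_B gn P2"

definition slide_e where "slide_e z = inv\<^bsub>P2\<^esub> BB \<otimes>\<^bsub>P2\<^esub> inv\<^bsub>P2\<^esub> LL \<otimes>\<^bsub>P2\<^esub> z \<otimes>\<^bsub>P2\<^esub> LL \<otimes>\<^bsub>P2\<^esub> BB"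
definition slide_d where "slide_d z = inv\<^bsub>P2\<^esub> LL \<otimes>\<^bsub>P2\<^esub> z \<otimes>\<^bsub>P2\<^esub> LL"

text \<open>A left factor on \<open>y_i\<close> conjugates the loop \<open>prim\<close> of index
  \<open>i\<close>. In the \<open>False\<close> half \<open>x_j\<close> is conjugated as well, and
  \<open>y_j\<close> absorbs the inverse on its right, which leaves the loop of handle
  \<open>j\<close> as it is. For \<open>i = j\<close> both effects fall on the same
  generator.\<close>

definition slide_gen where "slide_gen z b l = (if b then (if l = Inr i then z \<otimes>\<^bsub>P2\<^esub> gn True l else gn True l)
    else (case l of Inl m \<Rightarrow> (if m = j then slide_e z \<otimes>\<^bsub>P2\<^esub> gn False l \<otimes>\<^bsub>P2\<^esub> inv\<^bsub>P2\<^esub> slide_e z else gn False l)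
      | Inr m \<Rightarrow> (if m = i then slide_d z else \<one>\<^bsub>P2\<^esub>) \<otimes>\<^bsub>P2\<^esub> gn False l \<otimes>\<^bsub>P2\<^esub> (if m = j then inv\<^bsub>P2\<^esub> slide_e z else \<one>\<^bsub>P2\<^esub>)))"

lemmas slide_P_closed = slide_closed[of P2 gn, OF group_surface double_gen(1)]

lemma slide_pieces:
  assumes z [simp]: "z \<in> carrier P2"
  shows "slide_gen z b l \<in> carrier P2" "slide_e z \<in> carrier P2" "slide_d z \<in> carrier P2"
    and "m \<noteq> i \<Longrightarrow> prim P2 (slide_gen z b) m = prim P2 (gn b) m"
    and "prim P2 (slide_gen z True) i = z \<otimes>\<^bsub>P2\<^esub> prim P2 (gn True) i \<otimes>\<^bsub>P2\<^esub> inv\<^bsub>P2\<^esub> z"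
    and "prim P2 (slide_gen z False) i = slide_d z \<otimes>\<^bsub>P2\<^esub> prim P2 (gn False) i \<otimes>\<^bsub>P2\<^esub> inv\<^bsub>P2\<^esub> slide_d z"
    and "slide_L (slide_gen z) P2 = LL" "slide_B (slide_gen z) P2 = BB"
proof -
  note [simp] = double_gen(1) slide_P_closed
  show e [simp]: "slide_e z \<in> carrier P2" and d [simp]: "slide_d z \<in> carrier P2"
    by (simp_all add: slide_e_def slide_d_def)
  have ic: "(if c then x else y) \<in> carrier P2" if "x \<in> carrier P2" "y \<in> carrier P2" for c x y
    using that by simp
  show "slide_gen z b l \<in> carrier P2"
    unfolding slide_gen_def
    by (cases l) (simp_all only: sum.case, (intro ic P.m_closed P.inv_closed P.one_closed e d double_gen(1) z)+)
  have pr: "prim P2 (slide_gen z b) m = prim P2 (gn b) m" if "m \<noteq> i" for m b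
    using that by (cases b; cases "m = j") (simp_all add: prim_def slide_gen_def P.m_assoc P.inv_mult_group)
  then show "m \<noteq> i \<Longrightarrow> prim P2 (slide_gen z b) m = prim P2 (gn b) m" .
  show "prim P2 (slide_gen z True) i = z \<otimes>\<^bsub>P2\<^esub> prim P2 (gn True) i \<otimes>\<^bsub>P2\<^esub> inv\<^bsub>P2\<^esub> z"
    by (simp add: prim_def slide_gen_def P.m_assoc P.inv_mult_group)
  show "prim P2 (slide_gen z False) i = slide_d z \<otimes>\<^bsub>P2\<^esub> prim P2 (gn False) i \<otimes>\<^bsub>P2\<^esub> inv\<^bsub>P2\<^esub> slide_d z"
  proof -
    have gI: "slide_gen z False (Inr i) = slide_d z \<otimes>\<^bsub>P2\<^esub> gn False (Inr i) \<otimes>\<^bsub>P2\<^esub> (if i = j then inv\<^bsub>P2\<^esub> slide_e z else \<one>\<^bsub>P2\<^esub>)"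
      unfolding slide_gen_def by (simp only: if_False if_True sum.case refl)
    have gL: "slide_gen z False (Inl i) = (if i = j then slide_e z \<otimes>\<^bsub>P2\<^esub> gn False (Inl i) \<otimes>\<^bsub>P2\<^esub> inv\<^bsub>P2\<^esub> slide_e z else gn False (Inl i))"
      unfolding slide_gen_def by (simp only: if_False if_True sum.case refl)
    show ?thesis
    proof (cases "i = j")
      case True
      show ?thesis unfolding prim_def gI gL if_P[OF True] by (simp add: P.m_assoc P.inv_mult_group)
    next
      case False
      show ?thesis unfolding prim_def gI gL if_not_P[OF False] by (simp add: P.m_assoc P.inv_mult_group)
    qed
  qed
  have "list_prod P2 (prim P2 (slide_gen z b)) (rev [0..<i]) = list_prod P2 (prim P2 (gn b)) (rev [0..<i])" for b
    by (rule list_prod_cong) (use pr in auto)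
  then show "slide_L (slide_gen z) P2 = LL" by (simp add: slide_L_def)
  have "list_prod P2 (prim P2 (slide_gen z False)) (rev [Suc i..<r]) = list_prod P2 (prim P2 (gn False)) (rev [Suc i..<r])"
    by (rule list_prod_cong) (use pr in auto)
  moreover have "list_prod P2 (\<lambda>m. slide_gen z False (Inl m)) [Suc j..<r] = list_prod P2 (\<lambda>m. gn False (Inl m)) [Suc j..<r]"
    by (rule list_prod_cong) (auto simp: slide_gen_def)
  ultimately show "slide_B (slide_gen z) P2 = BB" by (simp add: slide_B_def)
qed

text \<open>A twist fixes its own curve: the substitution conjugates \<open>slide_c\<close> by
  \<open>z\<close>, which commutes with it.\<close>

lemma slide_c_invariant:
  assumes z [simp]: "z \<in> carrier P2" and comm: "z \<otimes>\<^bsub>P2\<^esub> slide_c gn P2 = slide_c gn P2 \<otimes>\<^bsub>P2\<^esub> z"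
  shows "slide_c (slide_gen z) P2 = slide_c gn P2"
proof -
  note [simp] = double_gen(1) slide_P_closed slide_pieces(1,2,3)[OF z]
  have "slide_gen z False (Inl j) = slide_e z \<otimes>\<^bsub>P2\<^esub> gn False (Inl j) \<otimes>\<^bsub>P2\<^esub> inv\<^bsub>P2\<^esub> slide_e z"
    by (simp add: slide_gen_def)
  then have "slide_Y (slide_gen z) P2 = z \<otimes>\<^bsub>P2\<^esub> slide_Y gn P2 \<otimes>\<^bsub>P2\<^esub> inv\<^bsub>P2\<^esub> z"
    unfolding slide_Y_def slide_pieces(6-8)[OF z]
    by (simp add: slide_e_def slide_d_def P.m_assoc P.inv_mult_group)
  then have "slide_c (slide_gen z) P2 = z \<otimes>\<^bsub>P2\<^esub> slide_c gn P2 \<otimes>\<^bsub>P2\<^esub> inv\<^bsub>P2\<^esub> z"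
    unfolding slide_c_def slide_pieces(5)[OF z] by (simp add: P.m_assoc P.inv_mult_group)
  also have "\<dots> = slide_c gn P2" unfolding comm by (simp add: P.m_assoc)
  finally show ?thesis .
qed

text \<open>The three fixed elements are recorded because \<open>z\<close>, \<open>slide_e z\<close>
  and \<open>slide_d z\<close> are built from them, so that the slide by the inverse of
  \<open>z\<close> can be seen to undo this one.\<close>

lemma slide_exists:
  assumes z [simp]: "z \<in> carrier P2" and comm: "z \<otimes>\<^bsub>P2\<^esub> slide_c gn P2 = slide_c gn P2 \<otimes>\<^bsub>P2\<^esub> z"
  obtains S where "S \<in> hom P2 P2" "\<And>b l. valid_label r l \<Longrightarrow> S (gn b l) = slide_gen z b l"
    "S LL = LL" "S BB = BB" "S (slide_c gn P2) = slide_c gn P2"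
proof -
  note [simp] = double_gen(1) slide_P_closed slide_pieces(1,2,3)[OF z]
  note nw = P.nested_word_val[OF _ i j]
  have lp: "list_prod P2 (prim P2 (slide_gen z b)) ms = list_prod P2 (prim P2 (gn b)) ms" if "i \<notin> set ms" for ms b
  proof (rule list_prod_cong)
    fix m assume "m \<in> set ms"
    with that have "m \<noteq> i" by auto
    then show "prim P2 (slide_gen z b) m = prim P2 (gn b) m" by (rule slide_pieces(4)[OF z])
  qed
  have relT: "wval P2 (slide_gen z True) w2 = list_prod P2 (\<lambda>m. gn True (Inl m)) [0..<r] \<otimes>\<^bsub>P2\<^esub> list_prod P2 (prim P2 (gn True)) (rev [Suc i..<r]) \<otimes>\<^bsub>P2\<^esub>
     (z \<otimes>\<^bsub>P2\<^esub> prim P2 (gn True) i \<otimes>\<^bsub>P2\<^esub> inv\<^bsub>P2\<^esub> z) \<otimes>\<^bsub>P2\<^esub> list_prod P2 (prim P2 (gn True)) (rev [0..<i])"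
  proof -
    have 1: "list_prod P2 (prim P2 (slide_gen z True)) (rev [Suc i..<r]) = list_prod P2 (prim P2 (gn True)) (rev [Suc i..<r])"
      "list_prod P2 (prim P2 (slide_gen z True)) (rev [0..<i]) = list_prod P2 (prim P2 (gn True)) (rev [0..<i])"
      using lp[of "rev [Suc i..<r]" True] lp[of "rev [0..<i]" True] by simp_all
    have 2: "list_prod P2 (\<lambda>m. slide_gen z True (Inl m)) [0..<r] = list_prod P2 (\<lambda>m. gn True (Inl m)) [0..<r]"
      by (rule list_prod_cong) (auto simp: slide_gen_def)
    show ?thesis unfolding nw(1)[of "slide_gen z True", OF slide_pieces(1)[OF z]] 1 2 slide_pieces(5)[OF z] ..
  qed
  have relF: "wval P2 (slide_gen z False) w2 = list_prod P2 (\<lambda>m. gn False (Inl m)) [0..<j] \<otimes>\<^bsub>P2\<^esub> 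
     (slide_e z \<otimes>\<^bsub>P2\<^esub> gn False (Inl j) \<otimes>\<^bsub>P2\<^esub> inv\<^bsub>P2\<^esub> slide_e z) \<otimes>\<^bsub>P2\<^esub> list_prod P2 (\<lambda>m. gn False (Inl m)) [Suc j..<r] \<otimes>\<^bsub>P2\<^esub>
     list_prod P2 (prim P2 (gn False)) (rev [Suc i..<r]) \<otimes>\<^bsub>P2\<^esub>
     (slide_d z \<otimes>\<^bsub>P2\<^esub> prim P2 (gn False) i \<otimes>\<^bsub>P2\<^esub> inv\<^bsub>P2\<^esub> slide_d z) \<otimes>\<^bsub>P2\<^esub> list_prod P2 (prim P2 (gn False)) (rev [0..<i])"
  proof -
    have 1: "list_prod P2 (prim P2 (slide_gen z False)) (rev [Suc i..<r]) = list_prod P2 (prim P2 (gn False)) (rev [Suc i..<r])"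
      "list_prod P2 (prim P2 (slide_gen z False)) (rev [0..<i]) = list_prod P2 (prim P2 (gn False)) (rev [0..<i])"
      using lp[of "rev [Suc i..<r]" False] lp[of "rev [0..<i]" False] by simp_all
    have 2: "list_prod P2 (\<lambda>m. slide_gen z False (Inl m)) [0..<j] = list_prod P2 (\<lambda>m. gn False (Inl m)) [0..<j]"
      "list_prod P2 (\<lambda>m. slide_gen z False (Inl m)) [Suc j..<r] = list_prod P2 (\<lambda>m. gn False (Inl m)) [Suc j..<r]"
    proof -
      have "list_prod P2 (\<lambda>m. slide_gen z False (Inl m)) ms = list_prod P2 (\<lambda>m. gn False (Inl m)) ms" if "j \<notin> set ms" for ms
        by (rule list_prod_cong) (use that in \<open>auto simp: slide_gen_def\<close>)
      then show "list_prod P2 (\<lambda>m. slide_gen z False (Inl m)) [0..<j] = list_prod P2 (\<lambda>m. gn False (Inl m)) [0..<j]"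
        "list_prod P2 (\<lambda>m. slide_gen z False (Inl m)) [Suc j..<r] = list_prod P2 (\<lambda>m. gn False (Inl m)) [Suc j..<r]"
        by simp_all
    qed
    have 3: "slide_gen z False (Inl j) = slide_e z \<otimes>\<^bsub>P2\<^esub> gn False (Inl j) \<otimes>\<^bsub>P2\<^esub> inv\<^bsub>P2\<^esub> slide_e z"
      by (simp add: slide_gen_def)
    show ?thesis unfolding nw(2)[of "slide_gen z False", OF slide_pieces(1)[OF z]] 1 2 3 slide_pieces(6)[OF z] ..
  qed
  have rel: "wval P2 (slide_gen z True) w2 = wval P2 (slide_gen z False) w2"
    unfolding relT relF
  proof (rule P.slide_identity[OF _ _ _ _ _ _ _ _ _ _ _ slide_L_def slide_B_def slide_Y_def])
    show "list_prod P2 (\<lambda>m. gn True (Inl m)) [0..<r] \<otimes>\<^bsub>P2\<^esub> list_prod P2 (prim P2 (gn True)) (rev [Suc i..<r]) \<otimes>\<^bsub>P2\<^esub> prim P2 (gn True) i \<otimes>\<^bsub>P2\<^esub> list_prod P2 (prim P2 (gn True)) (rev [0..<i]) =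
      list_prod P2 (\<lambda>m. gn False (Inl m)) [0..<j] \<otimes>\<^bsub>P2\<^esub> gn False (Inl j) \<otimes>\<^bsub>P2\<^esub> list_prod P2 (\<lambda>m. gn False (Inl m)) [Suc j..<r] \<otimes>\<^bsub>P2\<^esub>
      list_prod P2 (prim P2 (gn False)) (rev [Suc i..<r]) \<otimes>\<^bsub>P2\<^esub> prim P2 (gn False) i \<otimes>\<^bsub>P2\<^esub> list_prod P2 (prim P2 (gn False)) (rev [0..<i])"
      using double_gen_relation[OF r] unfolding nw(1)[of "gn True", OF double_gen(1)] nw(2)[of "gn False", OF double_gen(1)] .
    show "z \<otimes>\<^bsub>P2\<^esub> (prim P2 (gn True) i \<otimes>\<^bsub>P2\<^esub> inv\<^bsub>P2\<^esub> slide_Y gn P2) = prim P2 (gn True) i \<otimes>\<^bsub>P2\<^esub> inv\<^bsub>P2\<^esub> slide_Y gn P2 \<otimes>\<^bsub>P2\<^esub> z"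
      using comm by (simp add: slide_c_def)
  qed (simp_all add: slide_e_def slide_d_def)
  obtain S where S: "S \<in> hom P2 P2" "\<And>b l. valid_label r l \<Longrightarrow> S (gn b l) = slide_gen z b l"
    using double_gen_hom[OF r group_surface slide_pieces(1)[OF z] rel] by blast
  interpret S: group_hom P2 P2 S using S(1) group_surface by (simp add: group_hom_def group_hom_axioms_def)
  have prS: "prim P2 (\<lambda>l. S (gn b l)) m = prim P2 (slide_gen z b) m" if "m < r" for b m
    using S(2) that by (simp add: prim_def)
  have LS: "slide_L (\<lambda>b l. S (gn b l)) P2 = slide_L (slide_gen z) P2"
  proof -
    have "list_prod P2 (prim P2 (\<lambda>l. S (gn b l))) (rev [0..<i]) = list_prod P2 (prim P2 (slide_gen z b)) (rev [0..<i])" for b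
      by (rule list_prod_cong) (use prS i in auto)
    then show ?thesis by (simp add: slide_L_def)
  qed
  have BS: "slide_B (\<lambda>b l. S (gn b l)) P2 = slide_B (slide_gen z) P2"
  proof -
    have "list_prod P2 (prim P2 (\<lambda>l. S (gn False l))) (rev [Suc i..<r]) = list_prod P2 (prim P2 (slide_gen z False)) (rev [Suc i..<r])"
      by (rule list_prod_cong) (use prS in auto)
    moreover have "list_prod P2 (\<lambda>m. S (gn False (Inl m))) [Suc j..<r] = list_prod P2 (\<lambda>m. slide_gen z False (Inl m)) [Suc j..<r]"
      by (rule list_prod_cong) (use S(2) in auto)
    ultimately show ?thesis by (simp add: slide_B_def)
  qed
  have cS: "slide_c (\<lambda>b l. S (gn b l)) P2 = slide_c (slide_gen z) P2"
    unfolding slide_c_def slide_Y_def LS BS using prS[OF i] S(2)[of "Inl j" False] j by simp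
  note sh = slide_hom[of P2 P2 S gn, OF S.group_hom_axioms double_gen(1)]
  show thesis
    by (rule that[OF S]) (simp_all add: sh LS BS cS slide_pieces(7,8)[OF z] slide_c_invariant[OF z comm])
qed

end

context
  fixes r i j :: nat
  assumes r: "r > 0" and i: "i < r" and j: "j < r"
begin

interpretation P: group "surf_group r" by (rule group_surface)

private abbreviation (input) "P3 \<equiv> surf_group r"
private abbreviation (input) "gn2 \<equiv> double_gen r"
private abbreviation (input) "LL2 \<equiv> slide_L i gn2 P3"
private abbreviation (input) "BB2 \<equiv> slide_B r i j gn2 P3"
private abbreviation (input) "cc \<equiv> slide_c r i j gn2 P3"

lemmas sl_closed [simp] = slide_P_closed[OF r i j]
lemmas sl_pieces = slide_pieces[OF r i j]

lemma slide_marked: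
  assumes z: "z = cc \<or> z = inv\<^bsub>P3\<^esub> cc"
  obtains S where "S \<in> marked_monos r" "\<And>b l. valid_label r l \<Longrightarrow> S (gn2 b l) = slide_gen r i j z b l"
proof -
  note [simp] = double_gen(1)
  have zc [simp]: "z \<in> carrier P3" using z by (elim disjE) simp_all
  have comm: "y \<otimes>\<^bsub>P3\<^esub> cc = cc \<otimes>\<^bsub>P3\<^esub> y" if "y = cc \<or> y = inv\<^bsub>P3\<^esub> cc" for y
    using that by (elim disjE) (simp_all only: sl_closed P.l_inv P.r_inv)
  have z': "inv\<^bsub>P3\<^esub> z = cc \<or> inv\<^bsub>P3\<^esub> z = inv\<^bsub>P3\<^esub> cc"
    using z by (elim disjE) (simp_all only: sl_closed P.inv_inv simp_thms)
  obtain S where S: "S \<in> hom P3 P3" "\<And>b l. valid_label r l \<Longrightarrow> S (gn2 b l) = slide_gen r i j z b l"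
    "S LL2 = LL2" "S BB2 = BB2" "S cc = cc"
    by (rule slide_exists[OF r i j zc comm[OF z]]) (rule that)
  obtain S' where S': "S' \<in> hom P3 P3" "\<And>b l. valid_label r l \<Longrightarrow> S' (gn2 b l) = slide_gen r i j (inv\<^bsub>P3\<^esub> z) b l"
    "S' LL2 = LL2" "S' BB2 = BB2" "S' cc = cc"
    by (rule slide_exists[OF r i j P.inv_closed[OF zc] comm[OF z']]) (rule that)
  interpret S': group_hom P3 P3 S' using S'(1) group_surface by (simp add: group_hom_def group_hom_axioms_def)
  note [simp] = sl_pieces(1-3)[OF zc] sl_pieces(1-3)[OF P.inv_closed[OF zc]]
  have S'z: "S' z = z"
    using z by (elim disjE) (simp_all only: S'(5) sl_closed S'.hom_inv)
  have S'e: "S' (slide_e r i j z) = slide_e r i j z" and S'd: "S' (slide_d r i z) = slide_d r i z"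
    by (simp_all add: slide_e_def[OF r i j] slide_d_def[OF r i j] S'(3,4) S'z)
  have e': "slide_e r i j (inv\<^bsub>P3\<^esub> z) = inv\<^bsub>P3\<^esub> slide_e r i j z" and d': "slide_d r i (inv\<^bsub>P3\<^esub> z) = inv\<^bsub>P3\<^esub> slide_d r i z"
    by (simp_all add: slide_e_def[OF r i j] slide_d_def[OF r i j] P.inv_mult_group P.m_assoc)
  have "S \<in> marked_monos r"
  proof (rule marked_monosI[OF r S(1) S'(1)])
    fix b l assume l: "valid_label r l"
    have eq: "S' (S (gn2 b l)) = S' (slide_gen r i j z b l)" using S(2)[OF l] by simp
    show "S' (S (gn2 b l)) = gn2 b l"
    proof (cases b)
      case True
      then show ?thesis unfolding eq using S'(2)[OF l, of True]
        by (cases "l = Inr i") (simp_all add: slide_gen_def[OF r i j] S'z)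
    next
      case False
      have g: "S' (gn2 False l) = slide_gen r i j (inv\<^bsub>P3\<^esub> z) False l" using S'(2)[OF l] by simp
      show ?thesis
      proof (cases l)
        case (Inl m)
        then show ?thesis unfolding eq using g False
          by (cases "m = j") (simp_all add: slide_gen_def[OF r i j] S'e e' P.m_assoc)
      next
        case (Inr m)
        have ic [simp]: "(if c then x else y) \<in> carrier P3" if "x \<in> carrier P3" "y \<in> carrier P3" for c x y
          using that by simp
        define \<alpha> where "\<alpha> = (if m = i then slide_d r i z else \<one>\<^bsub>P3\<^esub>)"
        define \<beta> where "\<beta> = (if m = j then slide_e r i j z else \<one>\<^bsub>P3\<^esub>)"
        have [simp]: "\<alpha> \<in> carrier P3" "\<beta> \<in> carrier P3" by (simp_all add: \<alpha>_def \<beta>_def)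
        have 1: "slide_gen r i j z False (Inr m) = \<alpha> \<otimes>\<^bsub>P3\<^esub> gn2 False (Inr m) \<otimes>\<^bsub>P3\<^esub> inv\<^bsub>P3\<^esub> \<beta>"
          unfolding slide_gen_def[OF r i j] \<alpha>_def \<beta>_def if_distrib[of "m_inv P3"] P.inv_one by (simp only: if_False sum.case)
        have 2: "slide_gen r i j (inv\<^bsub>P3\<^esub> z) False (Inr m) = inv\<^bsub>P3\<^esub> \<alpha> \<otimes>\<^bsub>P3\<^esub> gn2 False (Inr m) \<otimes>\<^bsub>P3\<^esub> inv\<^bsub>P3\<^esub> (inv\<^bsub>P3\<^esub> \<beta>)"
          unfolding slide_gen_def[OF r i j] \<alpha>_def \<beta>_def if_distrib[of "m_inv P3"] P.inv_one e' d' by (simp only: if_False sum.case)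
        have 3: "S' \<alpha> = \<alpha>" "S' \<beta> = \<beta>" by (simp_all add: \<alpha>_def \<beta>_def S'e S'd if_distrib)
        show ?thesis unfolding eq using g False Inr 1 2 3 by (simp add: P.m_assoc)
      qed
    qed
  next
    fix m assume "m < r"
    then show "S (gn2 True (Inl m)) = gn2 True (Inl m)" using S(2)[of "Inl m" True] by (simp add: slide_gen_def[OF r i j])
  qed
  then show thesis by (rule that[OF _ S(2)])
qed

text \<open>A twist inside one handle: multiplying \<open>y_j\<close> on the right by a power of
  \<open>x_j\<close> changes neither \<open>y_j x_j^-1 y_j^-1\<close> nor, therefore, the boundary
  word.\<close>

lemma handle_twist_marked:
  assumes s: "s = gn2 False (Inl j) \<or> s = inv\<^bsub>P3\<^esub> gn2 False (Inl j)"
  obtains D where "D \<in> marked_monos r"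
    "\<And>b l. valid_label r l \<Longrightarrow> D (gn2 b l) = (if b \<or> l \<noteq> Inr j then gn2 b l else gn2 b l \<otimes>\<^bsub>P3\<^esub> s)"
proof -
  note [simp] = double_gen(1)
  let ?\<rho> = "\<lambda>s b l. if b \<or> l \<noteq> Inr j then gn2 b l else gn2 b l \<otimes>\<^bsub>P3\<^esub> s"
  have ex: "\<exists>D\<in>hom P3 P3. \<forall>b l. valid_label r l \<longrightarrow> D (gn2 b l) = ?\<rho> s b l"
    if s: "s = gn2 False (Inl j) \<or> s = inv\<^bsub>P3\<^esub> gn2 False (Inl j)" for s
  proof (rule double_gen_hom[OF r group_surface])
    have [simp]: "s \<in> carrier P3" using s by auto
    show cl: "?\<rho> s b l \<in> carrier P3" for b l by simp
    have "prim P3 (?\<rho> s False) m = prim P3 (gn2 False) m" for m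
      using s by (auto simp: prim_def P.m_assoc P.inv_mult_group)
    then have "prim P3 (?\<rho> s False) = prim P3 (gn2 False)" by blast
    then have "wval P3 (?\<rho> s False) (nested_word 0 r) = wval P3 (gn2 False) (nested_word 0 r)"
      unfolding P.nested_word_val(1)[of "?\<rho> s False", OF cl i j] P.nested_word_val(1)[of "gn2 False", OF double_gen(1) i j]
      by simp
    then show "wval P3 (?\<rho> s True) (nested_word 0 r) = wval P3 (?\<rho> s False) (nested_word 0 r)"
      using double_gen_relation[OF r] by simp
  qed
  have [simp]: "s \<in> carrier P3" using s by auto
  have s': "inv\<^bsub>P3\<^esub> s = gn2 False (Inl j) \<or> inv\<^bsub>P3\<^esub> s = inv\<^bsub>P3\<^esub> gn2 False (Inl j)" using s by auto
  obtain D where D: "D \<in> hom P3 P3" "\<And>b l. valid_label r l \<Longrightarrow> D (gn2 b l) = ?\<rho> s b l" using ex[OF s] by blast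
  obtain D' where D': "D' \<in> hom P3 P3" "\<And>b l. valid_label r l \<Longrightarrow> D' (gn2 b l) = ?\<rho> (inv\<^bsub>P3\<^esub> s) b l" using ex[OF s'] by blast
  interpret D': group_hom P3 P3 D' using D'(1) group_surface by (simp add: group_hom_def group_hom_axioms_def)
  have "D' (gn2 False (Inl j)) = gn2 False (Inl j)" using D'(2)[of "Inl j" False] j by simp
  then have D's: "D' s = s" using s by auto
  have "D \<in> marked_monos r"
  proof (rule marked_monosI[OF r D(1) D'(1)])
    fix b l assume l: "valid_label r l"
    show "D' (D (gn2 b l)) = gn2 b l"
      using D(2)[OF l, of b] D'(2)[OF l, of b] D's by (auto simp: P.m_assoc)
  qed (use D(2) in simp)
  then show thesis by (rule that[OF _ D(2)])
qed

text \<open>After folding, the loops of handle \<open>i\<close> in the two halves coincide and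
  cancel, so the curve of the slide becomes a conjugate of \<open>x_j^-1\<close>. The slide then
  multiplies both copies of \<open>y_i\<close> by the same element, but also alters
  \<open>y_j\<close> in the \<open>False\<close> half by a power of \<open>x_j\<close>. The handle
  twist repairs this, so both halves agree again.\<close>

lemma push_marked:
  fixes K :: "('k, 'c) monoid_scheme" (structure)
  assumes K: "group K"
  obtains \<tau> where "\<tau> \<in> marked_monos r"
    "\<And>\<psi> \<sigma> b l. \<lbrakk>\<psi> \<in> hom P3 K; \<And>l. \<sigma> l \<in> carrier K; \<And>b l. valid_label r l \<Longrightarrow> \<psi> (gn2 b l) = \<sigma> l; valid_label r l\<rbrakk> \<Longrightarrow>
      \<psi> (\<tau> (gn2 b l)) = (if l = Inr i then slide_B r i j (\<lambda>_. \<sigma>) K \<otimes> (if pos then \<sigma> (Inl j) else inv \<sigma> (Inl j)) \<otimes> inv slide_B r i j (\<lambda>_. \<sigma>) K \<otimes> \<sigma> l else \<sigma> l)"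
proof -
  interpret K: group K by (rule K)
  note [simp] = double_gen(1)
  \<comment> \<open>The signs are opposite since the curve folds to a conjugate of the inverse of
    \<open>x_j\<close>.\<close>
  define z where "z = (if pos then inv\<^bsub>P3\<^esub> cc else cc)"
  have zc [simp]: "z \<in> carrier P3" by (simp add: z_def)
  note [simp] = sl_pieces(1-3)[OF zc]
  obtain S where S: "S \<in> marked_monos r" "\<And>b l. valid_label r l \<Longrightarrow> S (gn2 b l) = slide_gen r i j z b l"
  proof -
    have "z = cc \<or> z = inv\<^bsub>P3\<^esub> cc" by (simp add: z_def)
    then show ?thesis by (rule slide_marked) (rule that)
  qed
  define s where "s = (if pos then gn2 False (Inl j) else inv\<^bsub>P3\<^esub> gn2 False (Inl j))"
  obtain D where D: "D \<in> marked_monos r" 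
    "\<And>b l. valid_label r l \<Longrightarrow> D (gn2 b l) = (if b \<or> l \<noteq> Inr j then gn2 b l else gn2 b l \<otimes>\<^bsub>P3\<^esub> s)"
  proof -
    have "s = gn2 False (Inl j) \<or> s = inv\<^bsub>P3\<^esub> gn2 False (Inl j)" by (simp add: s_def)
    then show ?thesis by (rule handle_twist_marked) (rule that)
  qed
  have SD: "(\<lambda>a. S (D a)) \<in> marked_monos r" by (rule marked_monos_compose[OF r S(1) D(1)])
  interpret S: group_hom P3 P3 S using S(1) group_surface by (simp add: marked_monos_def[OF r] group_hom_def group_hom_axioms_def)
  have "\<psi> (S (D (gn2 b l))) = (if l = Inr i then slide_B r i j (\<lambda>_. \<sigma>) K \<otimes> (if pos then \<sigma> (Inl j) else inv \<sigma> (Inl j)) \<otimes> inv slide_B r i j (\<lambda>_. \<sigma>) K \<otimes> \<sigma> l else \<sigma> l)"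
    if psi: "\<psi> \<in> hom P3 K" and sig [simp]: "\<And>l. \<sigma> l \<in> carrier K" and ps: "\<And>b l. valid_label r l \<Longrightarrow> \<psi> (gn2 b l) = \<sigma> l"
      and l: "valid_label r l" for \<psi> \<sigma> b l
  proof -
    interpret ps: group_hom P3 K \<psi> using psi K group_surface by (simp add: group_hom_def group_hom_axioms_def)
    define B where "B = slide_B r i j (\<lambda>_. \<sigma>) K"
    note scl = slide_closed[OF r i j K, of "\<lambda>_. \<sigma>"]
    have [simp]: "B \<in> carrier K" using scl(2) by (simp add: B_def)
    have [simp]: "\<psi> (gn2 b (Inl m)) = \<sigma> (Inl m)" "\<psi> (gn2 b (Inr m)) = \<sigma> (Inr m)" if "m < r" for b m using ps that by simp_all
    have pr: "prim K (\<lambda>l. \<psi> (gn2 b l)) m = prim K \<sigma> m" if "m < r" for b m using that by (simp add: prim_def)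
    have prl: "list_prod K (prim K (\<lambda>l. \<psi> (gn2 b l))) ms = list_prod K (prim K \<sigma>) ms" if "set ms \<subseteq> {..<r}" for b ms
      by (rule list_prod_cong) (use pr that in auto)
    have L1: "slide_L i (\<lambda>b l. \<psi> (gn2 b l)) K = \<one>"
    proof -
      have "set (rev [0..<i]) \<subseteq> {..<r}" using i by auto
      from prl[OF this] show ?thesis by (simp add: slide_L_def[OF r i j])
    qed
    have B1: "slide_B r i j (\<lambda>b l. \<psi> (gn2 b l)) K = B"
    proof -
      have "set (rev [Suc i..<r]) \<subseteq> {..<r}" by auto
      moreover have "list_prod K (\<lambda>m. \<psi> (gn2 False (Inl m))) [Suc j..<r] = list_prod K (\<lambda>m. \<sigma> (Inl m)) [Suc j..<r]"
        by (rule list_prod_cong) auto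
      ultimately show ?thesis using prl by (simp add: slide_B_def[OF r i j] B_def)
    qed
    note sh = slide_hom[OF r i j ps.group_hom_axioms, where f = gn2, OF double_gen(1)]
    have pL: "\<psi> LL2 = \<one>" and pB: "\<psi> BB2 = B" using sh(1,2) L1 B1 by simp_all
    have "\<psi> cc = prim K \<sigma> i \<otimes> inv (B \<otimes> \<sigma> (Inl j) \<otimes> inv B \<otimes> prim K \<sigma> i)"
      using sh(4) pr[OF i] j by (simp add: slide_c_def[OF r i j] slide_Y_def[OF r i j] L1 B1)
    then have pc: "\<psi> cc = B \<otimes> inv \<sigma> (Inl j) \<otimes> inv B"
      by (simp add: K.inv_mult_group K.m_assoc)
    define y where "y = (if pos then \<sigma> (Inl j) else inv \<sigma> (Inl j))"
    have [simp]: "y \<in> carrier K" by (simp add: y_def)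
    have pz: "\<psi> z = B \<otimes> y \<otimes> inv B"
      by (simp add: z_def y_def pc K.inv_mult_group K.m_assoc)
    have pe: "\<psi> (slide_e r i j z) = y" and pd: "\<psi> (slide_d r i z) = B \<otimes> y \<otimes> inv B"
      by (simp_all add: slide_e_def[OF r i j] slide_d_def[OF r i j] pL pB pz K.m_assoc)
    have conj: "y \<otimes> \<sigma> (Inl j) \<otimes> inv y = \<sigma> (Inl j)" by (simp add: y_def K.m_assoc)
    have eS: "\<psi> (S (gn2 b l)) = (if b then if l = Inr i then B \<otimes> y \<otimes> inv B \<otimes> \<sigma> l else \<sigma> l
        else (if l = Inr i then B \<otimes> y \<otimes> inv B \<otimes> \<sigma> l else \<sigma> l) \<otimes> (if l = Inr j then inv y else \<one>))"
      if l: "valid_label r l" for b l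
    proof (cases b)
      case True
      then show ?thesis using S(2)[OF l, of b] ps[OF l] by (cases "l = Inr i") (simp_all add: slide_gen_def[OF r i j] pz)
    next
      case False
      show ?thesis
      proof (cases l)
        case (Inl m)
        then show ?thesis using S(2)[OF l, of b] ps[OF l] False conj by (cases "m = j") (simp_all add: slide_gen_def[OF r i j] pe)
      next
        case (Inr m)
        define \<alpha> where "\<alpha> = (if m = i then slide_d r i z else \<one>\<^bsub>P3\<^esub>)"
        define \<beta> where "\<beta> = (if m = j then inv\<^bsub>P3\<^esub> slide_e r i j z else \<one>\<^bsub>P3\<^esub>)"
        have [simp]: "\<alpha> \<in> carrier P3" "\<beta> \<in> carrier P3" by (simp_all add: \<alpha>_def \<beta>_def)
        have "slide_gen r i j z False (Inr m) = \<alpha> \<otimes>\<^bsub>P3\<^esub> gn2 False (Inr m) \<otimes>\<^bsub>P3\<^esub> \<beta>"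
          unfolding slide_gen_def[OF r i j] \<alpha>_def \<beta>_def by (simp only: if_False sum.case)
        moreover have "\<psi> \<alpha> = (if m = i then B \<otimes> y \<otimes> inv B else \<one>)" "\<psi> \<beta> = (if m = j then inv y else \<one>)"
          by (simp_all add: \<alpha>_def \<beta>_def pd pe)
        ultimately have "\<psi> (S (gn2 False l)) = (if m = i then B \<otimes> y \<otimes> inv B else \<one>) \<otimes> \<sigma> (Inr m) \<otimes> (if m = j then inv y else \<one>)"
          using S(2)[OF l, of False] l Inr by simp
        then show ?thesis using False Inr by simp
      qed
    qed
    have "\<psi> (S s) = y"
    proof -
      have "\<psi> (S (gn2 False (Inl j))) = \<sigma> (Inl j)" using eS[of "Inl j" False] j by simp
      then show ?thesis by (simp add: s_def y_def)
    qed
    note sy = this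
    have sP: "s \<in> carrier P3" by (simp add: s_def)
    define v where "v = (if l = Inr i then B \<otimes> y \<otimes> inv B \<otimes> \<sigma> l else \<sigma> l)"
    have v: "v \<in> carrier K" by (simp add: v_def)
    have ev: "\<psi> (S (gn2 b l)) = (if b then v else v \<otimes> (if l = Inr j then inv y else \<one>))"
      unfolding eS[OF l, of b] v_def by (simp only: if_False if_True split: if_split)
    have "\<psi> (S (D (gn2 b l))) = v"
    proof (cases "b \<or> l \<noteq> Inr j")
      case True
      then have "D (gn2 b l) = gn2 b l" using D(2)[OF l, of b] by simp
      then show ?thesis using ev True v by auto
    next
      case False
      then have "D (gn2 b l) = gn2 b l \<otimes>\<^bsub>P3\<^esub> s" using D(2)[OF l, of b] by simp
      then have "\<psi> (S (D (gn2 b l))) = \<psi> (S (gn2 b l)) \<otimes> y" using sP sy by simp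
      also have "\<dots> = v" unfolding ev using False v by (simp add: K.m_assoc)
      finally show ?thesis .
    qed
    then have "\<psi> (S (D (gn2 b l))) = (if l = Inr i then B \<otimes> y \<otimes> inv B \<otimes> \<sigma> l else \<sigma> l)" by (simp only: v_def)
    then show ?thesis by (simp add: B_def y_def)
  qed
  then show thesis by (rule that[OF SD])
qed

end

section \<open>All tuples in \<open>F\<close> occur as values of the killed generators\<close>

context
  fixes r :: nat and K :: "('k, 'c) monoid_scheme" (structure) and f :: "nat \<Rightarrow> 'k" and F :: "'k set"
    and \<phi>0 :: "(real \<Rightarrow> complex set) set \<Rightarrow> 'k"
  assumes r: "r > 0" and K: "group K" and F: "subgroup F K" and fF: "\<And>m. f m \<in> F"
    and Fgen: "\<And>h. h \<in> F \<Longrightarrow> \<exists>v. h = wval K f v \<and> (\<forall>x\<in>set v. fst x < r)"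
    and \<phi>0: "\<phi>0 \<in> hom (surf_group r) K" "\<And>b l. valid_label r l \<Longrightarrow> \<phi>0 (double_gen r b l) = case_sum f (\<lambda>_. \<one>) l"
begin

interpretation K: group K by (rule K)

text \<open>Both halves take the same values, whatever \<open>b\<close>: the representation stays
  folded, as \<open>twist_detects\<close> requires.\<close>

definition reach :: "(nat \<Rightarrow> 'k) \<Rightarrow> bool"
  where "reach u \<longleftrightarrow> (\<exists>\<tau>\<in>marked_monos r. \<forall>b l. valid_label r l \<longrightarrow> \<phi>0 (\<tau> (double_gen r b l)) = case_sum f u l)"

lemma F_carrier: "h \<in> F \<Longrightarrow> h \<in> carrier K"
  by (rule subgroup.mem_carrier[OF F])

text \<open>The push is the inner map and \<open>\<tau>\<close> the outer one, so the push formula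
  is evaluated at the representation that \<open>\<tau>\<close> already provides.\<close>

lemma reach_step:
  assumes u: "\<And>m. u m \<in> F" "reach u" and i: "i < r" and j: "j < r"
  shows "reach (u(i := slide_B r i j (\<lambda>_. case_sum f u) K \<otimes> (if pos then f j else inv f j) \<otimes> inv slide_B r i j (\<lambda>_. case_sum f u) K \<otimes> u i))"
proof -
  obtain \<tau> where t: "\<tau> \<in> marked_monos r" "\<And>b l. valid_label r l \<Longrightarrow> \<phi>0 (\<tau> (double_gen r b l)) = case_sum f u l"
    using u(2) by (auto simp: reach_def)
  have sig: "case_sum f u l \<in> carrier K" for l
    using fF u(1) F_carrier by (simp split: sum.split)
  have hom: "(\<lambda>a. \<phi>0 (\<tau> a)) \<in> hom (surf_group r) K"
    using Group.hom_compose[of \<tau> "surf_group r" "surf_group r" \<phi>0 K] t(1) \<phi>0(1) by (simp add: marked_monos_def[OF r] o_def)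
  show ?thesis
  proof (rule push_marked[OF r i j K, where pos = pos])
    fix \<tau>' assume t': "\<tau>' \<in> marked_monos r"
    "\<And>\<psi> \<sigma> b l. \<lbrakk>\<psi> \<in> hom (surf_group r) K; \<And>l. \<sigma> l \<in> carrier K; \<And>b l. valid_label r l \<Longrightarrow> \<psi> (double_gen r b l) = \<sigma> l; valid_label r l\<rbrakk> \<Longrightarrow>
      \<psi> (\<tau>' (double_gen r b l)) = (if l = Inr i then slide_B r i j (\<lambda>_. \<sigma>) K \<otimes> (if pos then \<sigma> (Inl j) else inv \<sigma> (Inl j)) \<otimes> inv slide_B r i j (\<lambda>_. \<sigma>) K \<otimes> \<sigma> l else \<sigma> l)"
  show ?thesis
    unfolding reach_def
  proof (intro bexI[of _ "\<lambda>a. \<tau> (\<tau>' a)"] allI impI)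
    show "(\<lambda>a. \<tau> (\<tau>' a)) \<in> marked_monos r" by (rule marked_monos_compose[OF r t(1) t'(1)])
    fix b l assume l: "valid_label r l"
    show "\<phi>0 (\<tau> (\<tau>' (double_gen r b l))) = case_sum f (u(i := slide_B r i j (\<lambda>_. case_sum f u) K \<otimes> (if pos then f j else inv f j) \<otimes> inv slide_B r i j (\<lambda>_. case_sum f u) K \<otimes> u i)) l"
      using t'(2)[OF hom sig t(2) l] by (auto split: sum.split)
  qed
  qed
qed

text \<open>\<open>reach_step\<close> multiplies \<open>u i\<close> by conjugates of the
  \<open>f j\<close>. The conjugator involves, besides elements of the basis, only entries of
  \<open>u\<close> with index above \<open>i\<close>, which the move does not change; hence moves
  can be repeated, the possible factors form a subgroup, and this subgroup turns out to be
  \<open>F\<close>.\<close>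

lemma reach_mult:
  assumes i: "i < r" and h: "h \<in> F" and u: "\<And>m. u m \<in> F" "reach u"
  shows "reach (u(i := h \<otimes> u i))"
proof -
  define k where "k u = inv list_prod K (prim K (case_sum f u)) (rev [Suc i..<r])" for u
  note Fc = subgroup.m_closed[OF F] subgroup.m_inv_closed[OF F] subgroup.one_closed[OF F]
  note [simp] = F_carrier fF
  have kF: "k u \<in> F" if "\<And>m. u m \<in> F" for u
  proof -
    have cs: "case_sum f u l \<in> F" for l using that by (simp split: sum.split)
    have "prim K (case_sum f u) m \<in> F" for m unfolding prim_def by (intro Fc(1,2) cs)
    then have "list_prod K (prim K (case_sum f u)) ms \<in> F" for ms by (induction ms) (auto simp: Fc)
    then show ?thesis by (simp add: k_def Fc)
  qed
  define k0 where "k0 = k u"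
  have k0F: "k0 \<in> F" using kF u(1) by (simp add: k0_def)
  have kupd: "k (v(i := x)) = k v" for v x
    unfolding k_def by (intro arg_cong[of _ _ "m_inv K"] list_prod_cong) (auto simp: prim_def)
  define Hs where "Hs = {h \<in> F. \<forall>v. (\<forall>m. v m \<in> F) \<longrightarrow> k v = k0 \<longrightarrow> reach v \<longrightarrow> reach (v(i := h \<otimes> v i)) \<and> reach (v(i := inv h \<otimes> v i))}"
  have HsD: "reach (v(i := h \<otimes> v i))" "reach (v(i := inv h \<otimes> v i))" if "h \<in> Hs" "\<forall>m. v m \<in> F" "k v = k0" "reach v" for h v
    using that unfolding Hs_def by blast+
  have Hsub: "subgroup Hs K"
  proof (rule K.subgroupI)
    show "Hs \<subseteq> carrier K" by (auto simp: Hs_def)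
    have "\<one> \<in> Hs" by (auto simp: Hs_def Fc fun_upd_idem)
    then show "Hs \<noteq> {}" by blast
    fix a assume a: "a \<in> Hs"
    then show "inv a \<in> Hs" by (auto simp: Hs_def Fc)
    fix b assume b: "b \<in> Hs"
    have ab: "a \<in> F" "b \<in> F" using a b by (auto simp: Hs_def)
    show "a \<otimes> b \<in> Hs"
      unfolding Hs_def
    proof (intro CollectI conjI allI impI)
      show "a \<otimes> b \<in> F" using ab by (simp add: Fc)
      fix v assume v: "\<forall>m. v m \<in> F" "k v = k0" "reach v"
      have "reach ((v(i := b \<otimes> v i))(i := a \<otimes> (v(i := b \<otimes> v i)) i))"
        by (rule HsD(1)[OF a]) (use v ab HsD(1)[OF b v] in \<open>auto simp: Fc kupd\<close>)
      then show "reach (v(i := a \<otimes> b \<otimes> v i))" using ab v by (simp add: K.m_assoc)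
      have "reach ((v(i := inv a \<otimes> v i))(i := inv b \<otimes> (v(i := inv a \<otimes> v i)) i))"
        by (rule HsD(2)[OF b]) (use v ab HsD(2)[OF a v] in \<open>auto simp: Fc kupd\<close>)
      then show "reach (v(i := inv (a \<otimes> b) \<otimes> v i))" using ab v by (simp add: K.m_assoc K.inv_mult_group)
    qed
  qed
  note Hc = subgroup.m_closed[OF Hsub] subgroup.m_inv_closed[OF Hsub] subgroup.one_closed[OF Hsub]
  define p2 where "p2 j = list_prod K f [Suc j..<r]" for j
  have p2F: "p2 j \<in> F" for j
  proof -
    have "list_prod K f ms \<in> F" for ms by (induction ms) (auto simp: Fc)
    then show ?thesis by (simp add: p2_def)
  qed
  have kp2: "k0 \<otimes> list_prod K f ms \<otimes> inv k0 = list_prod K (\<lambda>m. k0 \<otimes> f m \<otimes> inv k0) ms" for ms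
  proof (induction ms)
    case (Cons m ms)
    have "k0 \<otimes> list_prod K f (m # ms) \<otimes> inv k0 = (k0 \<otimes> f m \<otimes> inv k0) \<otimes> (k0 \<otimes> list_prod K f ms \<otimes> inv k0)"
      using k0F by (simp add: K.m_assoc)
    then show ?case unfolding Cons by simp
  qed (use k0F in simp)
  \<comment> \<open>The available conjugator also contains the product of the \<open>f m\<close>
    with \<open>m > j\<close>. By induction their conjugates by \<open>k0\<close> already lie in
    \<open>Hs\<close>, so this part can be removed.\<close>
  have kf: "k0 \<otimes> f j \<otimes> inv k0 \<in> Hs" if "j < r" for j
    using that
  proof (induction "r - j" arbitrary: j rule: less_induct)
    case less
    define \<eta> where "\<eta> = k0 \<otimes> inv p2 j \<otimes> f j \<otimes> inv (k0 \<otimes> inv p2 j)"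
    have [simp]: "p2 j \<in> F" "k0 \<in> F" using p2F k0F by auto
    have eta: "\<eta> \<in> Hs"
      unfolding Hs_def
    proof (intro CollectI conjI allI impI)
      show "\<eta> \<in> F" by (simp add: \<eta>_def Fc)
      fix v assume v: "\<forall>m. v m \<in> F" "k v = k0" "reach v"
      have "slide_B r i j (\<lambda>_. case_sum f v) K = k v \<otimes> inv p2 j"
        by (simp add: slide_B_def[OF r i less.prems] k_def p2_def)
      then have sB: "slide_B r i j (\<lambda>_. case_sum f v) K = k0 \<otimes> inv p2 j" using v by simp
      show "reach (v(i := \<eta> \<otimes> v i))"
        using reach_step[OF _ v(3) i less.prems, of True] v(1) unfolding sB \<eta>_def by simp
      have "inv \<eta> = k0 \<otimes> inv p2 j \<otimes> inv f j \<otimes> inv (k0 \<otimes> inv p2 j)"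
        by (simp add: \<eta>_def K.inv_mult_group K.m_assoc)
      then show "reach (v(i := inv \<eta> \<otimes> v i))"
        using reach_step[OF _ v(3) i less.prems, of False] v(1) unfolding sB by simp
    qed
    have "list_prod K (\<lambda>m. k0 \<otimes> f m \<otimes> inv k0) ms \<in> Hs" if "set ms \<subseteq> {Suc j..<r}" for ms
      using that by (induction ms) (use less in \<open>auto simp: Hc\<close>)
    then have "k0 \<otimes> p2 j \<otimes> inv k0 \<in> Hs" unfolding p2_def kp2 by simp
    then have "(k0 \<otimes> p2 j \<otimes> inv k0) \<otimes> \<eta> \<otimes> inv (k0 \<otimes> p2 j \<otimes> inv k0) \<in> Hs"
      using eta by (simp add: Hc)
    also have "(k0 \<otimes> p2 j \<otimes> inv k0) \<otimes> \<eta> \<otimes> inv (k0 \<otimes> p2 j \<otimes> inv k0) = k0 \<otimes> f j \<otimes> inv k0"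
      by (simp add: \<eta>_def K.inv_mult_group K.m_assoc)
    finally show ?case .
  qed
  have "inv k0 \<otimes> h \<otimes> k0 \<in> F" using h k0F by (simp add: Fc)
  then obtain v where v: "inv k0 \<otimes> h \<otimes> k0 = wval K f v" "\<forall>x\<in>set v. fst x < r" using Fgen by blast
  have "wval K (\<lambda>m. k0 \<otimes> f m \<otimes> inv k0) v \<in> Hs"
    by (rule K.wval_in_subgroup[OF Hsub]) (use kf v(2) in blast)
  moreover have "wval K (\<lambda>m. k0 \<otimes> f m \<otimes> inv k0) v = k0 \<otimes> wval K f v \<otimes> inv k0"
    by (rule K.wval_conj) (use k0F in simp_all)
  moreover have "\<dots> = h" unfolding v(1)[symmetric] using k0F h by (simp add: K.m_assoc)
  ultimately have "h \<in> Hs" by simp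
  then show ?thesis using HsD(1)[of h u] u by (simp add: k0_def)
qed

text \<open>The tuple of units is realised by \<open>\<phi>0\<close> itself; its entries are then
  replaced one after the other.\<close>

lemma reach_all:
  assumes u: "\<And>m. u m \<in> F"
  shows "reach u"
proof -
  note one = subgroup.one_closed[OF F]
  have "n \<le> r \<Longrightarrow> reach (\<lambda>m. if m < n then u m else \<one>)" for n
  proof (induction n)
    case 0
    have "case_sum f (\<lambda>m. if m < 0 then u m else \<one>) l = case_sum f (\<lambda>_. \<one>) l" for l by (simp split: sum.split)
    then show ?case unfolding reach_def using \<phi>0(2) marked_monos_id[OF r] by (intro bexI[of _ "\<lambda>a. a"]) auto
  next
    case (Suc n)
    let ?v = "\<lambda>m. if m < n then u m else \<one>"
    have "reach (?v(n := u n \<otimes> ?v n))"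
      by (rule reach_mult) (use Suc u one in auto)
    moreover have "?v(n := u n \<otimes> ?v n) = (\<lambda>m. if m < Suc n then u m else \<one>)"
      using u F_carrier by (auto simp: less_Suc_eq)
    ultimately show ?case by simp
  qed
  from this[of r] have "reach (\<lambda>m. if m < r then u m else \<one>)" by simp
  then obtain \<tau> where t: "\<tau> \<in> marked_monos r" "\<And>b l. valid_label r l \<Longrightarrow> \<phi>0 (\<tau> (double_gen r b l)) = case_sum f (\<lambda>m. if m < r then u m else \<one>) l"
    unfolding reach_def by blast
  show ?thesis
    unfolding reach_def
  proof (intro bexI[OF _ t(1)] allI impI)
    fix b l assume l: "valid_label r l"
    show "\<phi>0 (\<tau> (double_gen r b l)) = case_sum f u l"
      using t(2)[OF l, of b] l by (cases l) auto
  qed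
qed

end

section \<open>Free bases, and nondiscrete subgroups of topological groups\<close>

text \<open>The isomorphism with the free group sends the value of a word to its reduced form, which
  yields generation and freeness. Beyond the rank the basis is continued by the unit so that it is
  total.\<close>

lemma free_basis:
  fixes G :: "('a, 'b) monoid_scheme" (structure)
  assumes G: "group G" and F: "subgroup F G" and free: "free_of_rank r (subgroup_monoid G F)"
  obtains f where "\<And>m. f m \<in> F" "\<And>h. h \<in> F \<Longrightarrow> \<exists>v. h = wval G f v \<and> (\<forall>x\<in>set v. fst x < r)"
    "\<And>v. \<forall>x\<in>set v. fst x < r \<Longrightarrow> wval G f v = \<one> \<Longrightarrow> red v = []"
proof -
  let ?H = "subgroup_monoid G F" and ?L = "free_group {..<r}"
  interpret G: group G by (rule G)
  interpret H: group ?H by (rule G.subgroup_imp_group[OF F])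
  interpret L: group ?L by (rule group_free_group)
  obtain h where h: "h \<in> iso ?H ?L" using free by (auto simp: free_of_rank_def is_iso_def)
  have hom: "h \<in> hom ?H ?L" and bij: "bij_betw h F (carrier ?L)" using h by (auto simp: iso_def)
  interpret h: group_hom ?H ?L h using hom by unfold_locales
  define f where "f m = (if m < r then inv_into F h [(m, True)] else \<one>)" for m
  have L: "[(m, b)] \<in> carrier ?L" if "m < r" for m b using that by (simp add: free_group_def)
  have fF: "f m \<in> F" for m
    using bij_betw_imp_surj_on[OF bij] L subgroup.one_closed[OF F] by (auto simp: f_def intro: inv_into_into)
  have hf: "h (f m) = [(m, True)]" if "m < r" for m
    using bij_betw_imp_surj_on[OF bij] L[OF that] that by (auto simp: f_def intro: f_inv_into_f)
  have invL: "inv\<^bsub>?L\<^esub> [(m, True)] = [(m, False)]" if "m < r" for m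
    by (rule L.inv_equality) (use L[OF that] in \<open>auto simp: free_group_def inv_letter_def\<close>)
  have litL: "lit ?L (\<lambda>m. h (f m)) x = [x]" if "fst x < r" for x
    using that hf invL by (cases x) (auto simp: lit_def)
  have multL: "\<one>\<^bsub>?L\<^esub> = []" "p \<otimes>\<^bsub>?L\<^esub> q = foldr cancel_cons p q" for p q
    by (simp_all add: free_group_def)
  have val: "wval ?H f v = wval G f v" for v
    by (induction v) (auto simp: wval_Cons lit_def G.m_inv_consistent[OF F] fF)
  have hval: "h (wval G f v) = red v" if "\<forall>x\<in>set v. fst x < r" for v
  proof -
    have "h (wval ?H f v) = wval ?L (\<lambda>m. h (f m)) v"
      by (rule wval_hom[OF H.is_group L.is_group hom]) (simp add: fF)
    also have "\<dots> = red v"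
      using that by (induction v) (auto simp: wval_Cons litL multL red_def)
    finally show ?thesis by (simp add: val)
  qed
  have wF: "wval G f v \<in> F" for v by (rule G.wval_in_subgroup[OF F]) (rule fF)
  show thesis
  proof (rule that[of f, OF fF])
    fix a assume a: "a \<in> F"
    then have "h a \<in> carrier ?L" using h.hom_closed by simp
    then have c: "reduced (h a)" "\<forall>x\<in>set (h a). fst x < r" by (auto simp: free_group_def)
    then have "h (wval G f (h a)) = h a" using hval red_reduced by simp
    then have "wval G f (h a) = a" using bij wF a by (auto simp: bij_betw_def inj_on_def)
    then show "\<exists>v. a = wval G f v \<and> (\<forall>x\<in>set v. fst x < r)" using c by metis
  next
    fix v assume "\<forall>x\<in>set v. fst x < r" "wval G f v = \<one>"
    then have "red v = h \<one>" using hval by metis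
    also have "\<dots> = []" using h.hom_one by (simp add: free_group_def)
    finally show "red v = []" .
  qed
qed

context topological_group
begin

lemma continuous_map_mult:
  "continuous_map X T p \<Longrightarrow> continuous_map X T q \<Longrightarrow> continuous_map X T (\<lambda>z. p z \<otimes> q z)"
  using continuous_map_compose[OF continuous_map_pairedI continuous_mult, of X p q] by (simp add: o_def)

lemma continuous_map_inv: "continuous_map X T p \<Longrightarrow> continuous_map X T (\<lambda>z. inv p z)"
  using continuous_map_compose[OF _ continuous_inv, of X p] by (simp add: o_def)

lemma continuous_map_const_group: "c \<in> carrier G \<Longrightarrow> continuous_map X T (\<lambda>z. c)"
  by (simp add: topspace_eq_carrier)

lemma continuous_map_wval:
  assumes "\<And>x. x \<in> set u \<Longrightarrow> continuous_map X T (\<lambda>z. g z (fst x))"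
  shows "continuous_map X T (\<lambda>z. wval G (g z) u)"
  using assms
proof (induction u)
  case (Cons x u)
  have "continuous_map X T (\<lambda>z. lit G (g z) x)"
    using Cons.prems[of x] continuous_map_inv by (cases "snd x") (simp_all add: lit_def)
  then show ?case
    unfolding wval_Cons using Cons by (intro continuous_map_mult) auto
qed (simp add: topspace_eq_carrier)

text \<open>If some neighbourhood of the unit met \<open>F\<close> in the unit only, translation
  would isolate every point of \<open>F\<close>.\<close>

lemma nondiscrete_near_one:
  assumes F: "subgroup F G" "\<not> discrete_subset T F" and U: "openin T U" "\<one> \<in> U"
  shows "\<exists>v\<in>F. v \<in> U \<and> v \<noteq> \<one>"
proof (rule ccontr)
  assume "\<not> (\<exists>v\<in>F. v \<in> U \<and> v \<noteq> \<one>)"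
  then have U1: "v = \<one>" if "v \<in> F" "v \<in> U" for v using that by blast
  have sub: "F \<subseteq> carrier G" by (rule subgroup.subset[OF F(1)])
  have "openin (subtopology T F) {x}" if x: "x \<in> F" for x
  proof -
    have xc: "x \<in> carrier G" using x sub by blast
    have "continuous_map T T (\<lambda>z. inv x \<otimes> z)"
      by (intro continuous_map_mult continuous_map_const_group continuous_map_id[unfolded id_def]) (use xc in simp)
    then have "openin T {z \<in> topspace T. inv x \<otimes> z \<in> U}" using U(1) by (rule openin_continuous_map_preimage)
    moreover have "{z \<in> topspace T. inv x \<otimes> z \<in> U} \<inter> F = {x}"
    proof (intro equalityI subsetI)
      fix z assume z: "z \<in> {z \<in> topspace T. inv x \<otimes> z \<in> U} \<inter> F"
      then have "inv x \<otimes> z \<in> F" using x F(1) by (simp add: subgroup.m_closed subgroup.m_inv_closed)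
      then have e: "inv x \<otimes> z = \<one>" using z U1 by blast
      have "z = x \<otimes> (inv x \<otimes> z)" using xc z sub by auto
      then show "z \<in> {x}" using e xc by simp
    qed (use x xc U(2) in \<open>auto simp: topspace_eq_carrier\<close>)
    ultimately show ?thesis unfolding openin_subtopology by metis
  qed
  then have "discrete_topology F = subtopology T F"
    unfolding discrete_topology_unique using sub by (auto simp: topspace_eq_carrier)
  then show False using F(2) by simp
qed

text \<open>If the unit is isolated in \<open>F\<close> by an open \<open>V\<close>, then
  \<open>V\<close> without the unit is open and misses a dense set, so it is empty. The unit is then
  isolated in the whole group.\<close>

lemma dense_nondiscrete:
  assumes F: "subgroup F G" "dense_subset T F" and T: "T \<noteq> discrete_topology (carrier G)"
  shows "\<not> discrete_subset T F"
proof
  assume "discrete_subset T F"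
  then have "openin (subtopology T F) {\<one>}" using subgroup.one_closed[OF F(1)] by simp
  then obtain V where V: "openin T V" "{\<one>} = V \<inter> F" by (auto simp: openin_subtopology)
  have "closedin T {\<one>}" using Hausdorff by (simp add: closedin_Hausdorff_singleton topspace_eq_carrier)
  then have o: "openin T (V - {\<one>})" using V(1) by (rule openin_diff[rotated])
  have "(V - {\<one>}) \<inter> F = {}" using V(2) by blast
  then have "(V - {\<one>}) \<inter> topspace T = {}" using openin_Int_closure_of_eq_empty[OF o, of F] F(2) by simp
  then have "V = {\<one>}" using V openin_subset[OF V(1)] by blast
  moreover have "\<not> discrete_subset T (carrier G)" using T by (simp flip: topspace_eq_carrier)
  ultimately show False using nondiscrete_near_one[OF subgroup_self _ V(1)] by auto
qed

end

section \<open>The Baire category argument\<close>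

context
  fixes G :: "('a, 'b) monoid_scheme" (structure) and T :: "'a topology" and r :: nat and F :: "'a set" and f :: "nat \<Rightarrow> 'a"
    and \<phi>0 :: "(real \<Rightarrow> complex set) set \<Rightarrow> 'a"
  assumes tg: "topological_group G T" and r: "r > 1" and F: "subgroup F G" and fF: "\<And>m. f m \<in> F"
    and Fgen: "\<And>h. h \<in> F \<Longrightarrow> \<exists>v. h = wval G f v \<and> (\<forall>x\<in>set v. fst x < r)"
    and Ffree: "\<And>v. \<forall>x\<in>set v. fst x < r \<Longrightarrow> wval G f v = \<one> \<Longrightarrow> red v = []"
    and nd: "\<not> discrete_subset T F"
    and \<phi>0: "\<phi>0 \<in> hom (surf_group r) G" "\<And>b l. valid_label r l \<Longrightarrow> \<phi>0 (double_gen r b l) = case_sum f (\<lambda>_. \<one>) l"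
begin

interpretation topological_group G T by (rule tg)
interpretation P: group "surf_group r" by (rule group_surface)

private abbreviation (input) "P4 \<equiv> surf_group r"
private abbreviation (input) "gn3 \<equiv> double_gen r"

lemma r0: "r > 0" using r by simp

lemma fc [simp]: "f m \<in> carrier G" using fF subgroup.mem_carrier[OF F] by blast

definition labels :: "(bool \<times> (nat + nat)) set" where "labels = {(b, l). valid_label r l}"

lemma finite_labels: "finite labels"
proof (rule finite_subset)
  show "labels \<subseteq> UNIV \<times> (Inl ` {..<r} \<union> Inr ` {..<r})"
  proof
    fix k assume "k \<in> labels"
    then show "k \<in> UNIV \<times> (Inl ` {..<r} \<union> Inr ` {..<r})"
      by (cases k; cases "snd k") (auto simp: labels_def)
  qed
qed auto

definition point :: "((real \<Rightarrow> complex set) set \<Rightarrow> 'a) \<Rightarrow> bool \<times> (nat + nat) \<Rightarrow> 'a"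
  where "point \<psi> = restrict (\<lambda>(b, l). \<psi> (gn3 b l)) labels"

private abbreviation (input) "Y \<equiv> product_topology (\<lambda>_. T) labels"

lemma wval_point:
  assumes "\<psi> \<in> hom P4 G" "\<forall>x\<in>set u. fst x \<in> labels"
  shows "wval G (point \<psi>) u = \<psi> (wval P4 (case_prod gn3) u)"
proof -
  have "wval G (point \<psi>) u = wval G (\<lambda>x. \<psi> (case_prod gn3 x)) u"
    by (rule wval_cong) (use assms(2) in \<open>auto simp: point_def\<close>)
  also have "\<dots> = \<psi> (wval P4 (case_prod gn3) u)"
    by (rule wval_hom[OF group_surface is_group assms(1), symmetric]) (simp add: double_gen(1) split: prod.split)
  finally show ?thesis .
qed

text \<open>With all \<open>y_i\<close> trivial the nested word cancels from the inside out.\<close>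

lemma wval_collapsed: "wval G (case_sum f (\<lambda>_. \<one>)) (nested_word 0 r) = \<one>"
proof -
  let ?s = "case_sum f (\<lambda>_. \<one>)"
  have c: "?s l \<in> carrier G" for l by (simp split: sum.split)
  have "k \<le> r \<Longrightarrow> wval G ?s (nested_word k r) = \<one>" for k
  proof (induction "r - k" arbitrary: k)
    case (Suc n)
    then have k: "k < r" "wval G ?s (nested_word (Suc k) r) = \<one>" by auto
    show ?case using nested_word_val_step[of ?s k r, OF c k(1)] k(2) by simp
  qed simp
  then show ?thesis by simp
qed

text \<open>\<open>\<phi>0\<close> kills the boundary word and with it the conjugating power.
  Arbitrarily high twists are thus free of charge in the topology of representations.\<close>

lemma collapse_twist:
  assumes th: "\<theta> \<in> hom P4 P4" "\<And>b l. valid_label r l \<Longrightarrow> \<theta> (gn3 b l) = twist r n b l" and a: "a \<in> carrier P4"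
  shows "\<phi>0 (\<theta> a) = \<phi>0 a"
proof -
  note [simp] = double_gen(1)
  interpret h: group_hom P4 G \<phi>0 using \<phi>0(1) by unfold_locales
  define c where "c = wval P4 (gn3 True) (word_power (nested_word 0 r) n)"
  have [simp]: "c \<in> carrier P4" by (simp add: c_def P.wval_closed)
  have "\<phi>0 c = wval G (\<lambda>l. \<phi>0 (gn3 True l)) (word_power (nested_word 0 r) n)"
    unfolding c_def by (rule wval_hom[OF group_surface is_group \<phi>0(1)]) simp
  also have "\<dots> = wval G (\<lambda>l. \<phi>0 (gn3 True l)) (nested_word 0 r) [^] n" by (rule wval_power) simp
  also have "wval G (\<lambda>l. \<phi>0 (gn3 True l)) (nested_word 0 r) = wval G (case_sum f (\<lambda>_. \<one>)) (nested_word 0 r)"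
    by (rule wval_cong) (use \<phi>0(2) valid_nested_word in blast)
  finally have c1: "\<phi>0 c = \<one>" by (simp add: wval_collapsed)
  have hom: "(\<lambda>a. \<phi>0 (\<theta> a)) \<in> hom P4 G"
    using Group.hom_compose[OF th(1) \<phi>0(1)] by (simp add: o_def)
  show ?thesis
  proof (rule surface_hom_unique[OF r0 is_group hom \<phi>0(1) _ a])
    fix b l assume "valid_label r l"
    then show "\<phi>0 (\<theta> (gn3 b l)) = \<phi>0 (gn3 b l)"
      using th(2) c1 by (simp add: twist_def[OF r0] Let_def flip: c_def)
  qed
qed

text \<open>The new map is \<open>\<tau>' \<circ> \<theta> \<circ> \<tau>\<close>. The twist
  \<open>\<theta>\<close> leaves the point in place and produces the word \<open>e\<close>;
  \<open>\<tau>'\<close> sends the killed generators to spread words in a small \<open>v\<close>,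
  which moves the point continuously and keeps \<open>e\<close> nontrivial by
  \<open>subst_nontrivial\<close>.\<close>

lemma perturb:
  assumes tau: "\<tau> \<in> marked_monos r" and a: "a \<in> carrier P4" "a \<noteq> \<one>\<^bsub>P4\<^esub>"
    and O: "openin Y V" "point (\<lambda>a. \<phi>0 (\<tau> a)) \<in> V"
  obtains \<tau>' where "\<tau>' \<in> marked_monos r" "point (\<lambda>a. \<phi>0 (\<tau>' a)) \<in> V" "\<phi>0 (\<tau>' a) \<noteq> \<one>"
proof -
  note [simp] = double_gen(1)
  have thom: "\<tau> \<in> hom P4 P4" "inj_on \<tau> (carrier P4)" using tau by (simp_all add: marked_monos_def[OF r0])
  interpret t: group_hom P4 P4 \<tau> using thom(1) by unfold_locales
  have ta: "\<tau> a \<in> carrier P4" "\<tau> a \<noteq> \<one>\<^bsub>P4\<^esub>"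
    using a(1) inj_on_eq_iff[OF thom(2) a(1) P.one_closed] a(2) t.hom_one by simp_all
  show thesis
  proof (rule twist_detects[OF r0 is_group ta])
    fix \<theta> e
    assume th: "\<theta> \<in> marked_monos r"
      and det: "\<And>\<psi> \<sigma>. \<lbrakk>\<psi> \<in> hom P4 G; \<And>l. \<sigma> l \<in> carrier G; \<And>b l. valid_label r l \<Longrightarrow> \<psi> (gn3 b l) = \<sigma> l;
        \<psi> (\<theta> (\<tau> a)) = \<one>\<rbrakk> \<Longrightarrow> wval G \<sigma> e = \<one>"
      and tw: "\<exists>n. \<forall>b l. valid_label r l \<longrightarrow> \<theta> (gn3 b l) = twist r n b l"
      and e: "reduced e" "e \<noteq> []" "\<forall>x\<in>set e. valid_label r (fst x)"
    have thh: "\<theta> \<in> hom P4 P4" using th by (simp add: marked_monos_def[OF r0])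
    interpret th: group_hom P4 P4 \<theta> using thh by unfold_locales
    have "\<exists>w. (\<forall>x\<in>set w. fst x \<in> labels) \<and> \<theta> (\<tau> (case_prod gn3 k)) = wval P4 (case_prod gn3) w" for k
    proof -
      have "\<theta> (\<tau> (case_prod gn3 k)) \<in> carrier P4" by (cases k) simp
      then show ?thesis
      proof (rule surface_words[OF r0])
        fix u assume "\<forall>x\<in>set u. valid_label r (snd (fst x))" "\<theta> (\<tau> (case_prod gn3 k)) = wval P4 (\<lambda>(b, l). gn3 b l) u"
        then show ?thesis by (intro exI[of _ u]) (auto simp: labels_def)
      qed
    qed
    then obtain w where w: "\<And>k. \<forall>x\<in>set (w k). fst x \<in> labels" "\<And>k. \<theta> (\<tau> (case_prod gn3 k)) = wval P4 (case_prod gn3) (w k)"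
      by metis
    define y :: nat where "y = 1"
    have y: "0 \<noteq> y" "y < r" using r by (simp_all add: y_def)
    \<comment> \<open>Depends on \<open>e\<close> only. The conjugators are thus available before
      \<open>v\<close> is chosen, and their effect can be controlled by continuity in
      \<open>v\<close>.\<close>
    define M where "M = Suc (length e)"
    define S where "S t k = wval G f (stem 0 y M t k)" for t k
    have [simp]: "S t k \<in> carrier G" for t k by (simp add: S_def)
    \<comment> \<open>The value of \<open>spread\<close>, with the group element \<open>v\<close> in
      place of a word for it, so that it is defined and continuous on all of the group.\<close>
    define U where "U t v m = S t (2 * m) \<otimes> (v \<otimes> (inv S t (2 * m) \<otimes> (S t (2 * m + 1) \<otimes> (v \<otimes> inv S t (2 * m + 1)))))" for t v m
    define \<Theta> where "\<Theta> t v = restrict (\<lambda>k. wval G (\<lambda>(b, l). case_sum f (U t v) l) (w k)) labels" for t v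
    have cont: "continuous_map T Y (\<Theta> t)" for t
      unfolding continuous_map_componentwise
    proof (intro conjI ballI)
      show "\<Theta> t ` topspace T \<subseteq> extensional labels" by (auto simp: \<Theta>_def)
      fix k assume k: "k \<in> labels"
      have "continuous_map T T (\<lambda>v. wval G (\<lambda>(b, l). case_sum f (U t v) l) (w k))"
      proof (rule continuous_map_wval)
        fix x :: "(bool \<times> (nat + nat)) letter"
        have "continuous_map T T (\<lambda>v. U t v m)" for m
          unfolding U_def
          by (intro continuous_map_mult continuous_map_const_group continuous_map_id[unfolded id_def]) simp_all
        then show "continuous_map T T (\<lambda>v. (\<lambda>(b, l). case_sum f (U t v) l) (fst x))"
          by (cases "fst x"; cases "snd (fst x)") (simp_all add: continuous_map_const_group del: continuous_map_const)
      qed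
      then show "continuous_map T T (\<lambda>v. \<Theta> t v k)" using k by (simp add: \<Theta>_def)
    qed
    have U1: "U t \<one> = (\<lambda>_. \<one>)" for t by (simp add: U_def fun_eq_iff)
    have val: "point (\<lambda>a. \<psi> (\<theta> (\<tau> a))) = restrict (\<lambda>k. wval G (\<lambda>(b, l). case_sum f u l) (w k)) labels"
      if psi: "\<psi> \<in> hom P4 G" "\<And>b l. valid_label r l \<Longrightarrow> \<psi> (gn3 b l) = case_sum f u l" for \<psi> u
    proof -
      have "\<psi> (\<theta> (\<tau> (case_prod gn3 k))) = wval G (\<lambda>(b, l). case_sum f u l) (w k)" for k
      proof -
        have "\<psi> (\<theta> (\<tau> (case_prod gn3 k))) = wval G (\<lambda>x. \<psi> (case_prod gn3 x)) (w k)"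
          unfolding w(2) by (rule wval_hom[OF group_surface is_group psi(1)]) (simp split: prod.split)
        also have "\<dots> = wval G (\<lambda>(b, l). case_sum f u l) (w k)"
          by (rule wval_cong) (use w(1)[of k] psi(2) in \<open>auto simp: labels_def\<close>)
        finally show ?thesis .
      qed
      from this[of "(b, l)" for b l] show ?thesis unfolding point_def by (intro restrict_ext) auto
    qed
    have T1: "\<Theta> t \<one> \<in> V" for t
    proof -
      obtain n where n: "\<And>b l. valid_label r l \<Longrightarrow> \<theta> (gn3 b l) = twist r n b l" using tw by blast
      have "point (\<lambda>a. \<phi>0 (\<theta> (\<tau> a))) = point (\<lambda>a. \<phi>0 (\<tau> a))"
        unfolding point_def by (rule restrict_ext) (auto intro!: collapse_twist[OF thh n])
      then have "\<Theta> t \<one> = point (\<lambda>a. \<phi>0 (\<tau> a))" using val[OF \<phi>0] unfolding \<Theta>_def U1 by simp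
      then show ?thesis using O(2) by simp
    qed
    define N where "N t = {v \<in> topspace T. \<Theta> t v \<in> V}" for t
    have oN: "openin T (N t)" for t unfolding N_def by (rule openin_continuous_map_preimage[OF cont O(1)])
    have N1: "\<one> \<in> N t" for t using T1 by (simp add: N_def topspace_eq_carrier)
    \<comment> \<open>The letter \<open>t\<close> has to fit \<open>v\<close>, which is still to be
      chosen. Three candidates are kept, all different from \<open>(0, False)\<close>; the first and
      last letters of the word for \<open>v\<close> exclude at most two of them.\<close>
    have "openin T (N (0, True) \<inter> N (1, True) \<inter> N (1, False))" "\<one> \<in> N (0, True) \<inter> N (1, True) \<inter> N (1, False)"
      by (intro openin_Int oN) (simp add: N1)
    from nondiscrete_near_one[OF F nd this] obtain v where v: "v \<in> F" "v \<noteq> \<one>" and vN: "v \<in> N (0, True) \<inter> N (1, True) \<inter> N (1, False)"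
      by blast
    obtain v' where v': "v = wval G f v'" "\<forall>x\<in>set v'. fst x < r" using Fgen[OF v(1)] by blast
    define v0 where "v0 = red v'"
    have v0: "v = wval G f v0" "reduced v0" "\<forall>x\<in>set v0. fst x < r"
      using v' set_red[OF r0, of v'] by (auto simp: v0_def wval_red reduced_red)
    have vc [simp]: "v \<in> carrier G" using v(1) subgroup.mem_carrier[OF F] by blast
    have v0ne: "v0 \<noteq> []" using v(2) v0(1) by auto
    obtain t where t: "t \<in> {(0, True), (1, True), (1, False)}" "t \<noteq> inv_letter (hd v0)" "t \<noteq> last v0"
    proof -
      have "\<exists>t\<in>{(0, True), (1, True), (1, False)}. t \<noteq> p \<and> t \<noteq> q" for p q :: "nat letter"
        by (cases p; cases q) auto
      then show thesis using that by blast
    qed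
    have fit: "fits t v0" using t v0 v0ne by (auto simp: fits_def)
    have t0: "t \<noteq> (0, False)" and tr: "fst t < r" using t(1) r by auto
    have UF: "U t v m \<in> F" for m
    proof -
      have "S t k \<in> F" for k unfolding S_def by (rule wval_in_subgroup[OF F]) (rule fF)
      then show ?thesis unfolding U_def using v(1) by (intro subgroup.m_closed[OF F] subgroup.m_inv_closed[OF F])
    qed
    have "\<exists>\<tau>'\<in>marked_monos r. \<forall>b l. valid_label r l \<longrightarrow> \<phi>0 (\<tau>' (gn3 b l)) = case_sum f (U t v) l"
    proof -
      have "reach r f \<phi>0 (U t v)"
        by (rule reach_all[OF r0 is_group F fF Fgen \<phi>0 UF])
      then show ?thesis
        by (simp only: reach_def[OF r0 is_group F fF Fgen \<phi>0])
    qed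
    then obtain \<tau>' where t': "\<tau>' \<in> marked_monos r" "\<And>b l. valid_label r l \<Longrightarrow> \<phi>0 (\<tau>' (gn3 b l)) = case_sum f (U t v) l"
      by blast
    have psi: "(\<lambda>a. \<phi>0 (\<tau>' a)) \<in> hom P4 G"
      using Group.hom_compose[of \<tau>' P4 P4 \<phi>0 G] t'(1) \<phi>0(1) by (simp add: marked_monos_def[OF r0] o_def)
    have sc: "case_sum f (U t v) l \<in> carrier G" for l using UF subgroup.mem_carrier[OF F] by (simp split: sum.split)
    show thesis
    proof (rule that[of "\<lambda>a. \<tau>' (\<theta> (\<tau> a))"])
      show "(\<lambda>a. \<tau>' (\<theta> (\<tau> a))) \<in> marked_monos r"
        by (rule marked_monos_compose[OF r0 t'(1) marked_monos_compose[OF r0 th tau]])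
      have "point (\<lambda>a. \<phi>0 (\<tau>' (\<theta> (\<tau> a)))) = \<Theta> t v" using val[OF psi t'(2)] by (simp add: \<Theta>_def)
      moreover have "\<Theta> t v \<in> V" using vN t(1) by (auto simp: N_def)
      ultimately show "point (\<lambda>a. \<phi>0 (\<tau>' (\<theta> (\<tau> a)))) \<in> V" by simp
      show "\<phi>0 (\<tau>' (\<theta> (\<tau> a))) \<noteq> \<one>"
      proof
        assume triv0: "\<phi>0 (\<tau>' (\<theta> (\<tau> a))) = \<one>"
        have triv: "wval G (case_sum f (U t v)) e = \<one>"
        proof (rule det[where \<psi> = "\<lambda>a. \<phi>0 (\<tau>' a)" and \<sigma> = "case_sum f (U t v)", OF psi sc])
          show "\<phi>0 (\<tau>' (gn3 b l)) = case_sum f (U t v) l" if "valid_label r l" for b l by (rule t'(2)[OF that])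
        qed (rule triv0)
        note spd = spread_def[of 0 y, OF y(1) t0]
        have sp: "wval G f (spread 0 y M t v0 m) = U t v m" for m
          by (simp add: spd wval_append wval_inv_word U_def m_assoc flip: S_def v0(1))
        let ?c = "concat (map (subst_letter (spread 0 y M t v0)) e)"
        have "wval G f ?c = wval G (case_sum f (U t v)) e"
        proof (rule wval_concat[where H = G and f' = "case_sum f (U t v)"])
          fix x assume "x \<in> set e"
          obtain l b where "x = (l, b)" by (cases x)
          then show "wval G f (subst_letter (spread 0 y M t v0) x) = lit G (case_sum f (U t v)) x"
            using sp sc[of "Inr _"] by (cases l) (simp_all add: wval_Cons lit_def wval_inv_word)
        qed (use sc in simp_all)
        then have "wval G f ?c = \<one>" using triv by simp
        moreover have "\<forall>x\<in>set ?c. fst x < r"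
        proof -
          have iw: "fst ` set (inv_word u) = fst ` set u" for u :: "nat letter list"
            by (force simp: inv_word_def inv_letter_def image_iff)
          have "fst ` set (stem 0 y M t k) \<subseteq> {..<r}" for k
            using tr y(2) r0 by (auto simp: stem_def[of 0 y, OF y(1) t0])
          moreover have "fst ` set v0 \<subseteq> {..<r}" using v0(3) by auto
          ultimately have s: "fst ` set (spread 0 y M t v0 m) \<subseteq> {..<r}" for m
            by (simp add: spd image_Un iw)
          have "fst ` set (subst_letter (spread 0 y M t v0) x) \<subseteq> {..<r}" if "x \<in> set e" for x
          proof -
            obtain l b where x: "x = (l, b)" by (cases x)
            show ?thesis
            proof (cases l)
              case (Inl i)
              then have "i < r" using e(3) that x by force
              then show ?thesis by (simp add: x Inl)
            next
              case (Inr i)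
              have "fst ` set (inv_word (spread 0 y M t v0 i)) \<subseteq> {..<r}" unfolding iw by (rule s)
              then show ?thesis using s[of i] by (simp add: x Inr)
            qed
          qed
          then have "fst ` set ?c \<subseteq> {..<r}" unfolding set_concat set_map image_Union image_image by (rule UN_least)
          then show ?thesis by blast
        qed
        ultimately have "red ?c = []" using Ffree by blast
        moreover have "red ?c \<noteq> []"
        proof (rule subst_nontrivial[OF y(1) t0 fit e(1,2)])
          show "length e < M" by (simp add: M_def)
          show "i < r" if "(Inr i, b) \<in> set e" for i b using bspec[OF e(3) that] by simp
        qed
        ultimately show False by simp
      qed
    qed
  qed
qed

lemma marked_hom: "\<tau> \<in> marked_monos r \<Longrightarrow> (\<lambda>a. \<phi>0 (\<tau> a)) \<in> hom P4 G"
  using Group.hom_compose[of \<tau> P4 P4 \<phi>0 G] \<phi>0(1) by (simp add: marked_monos_def[OF r0] o_def)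

lemma faithful_point:
  assumes lc: "locally_compact_space T"
  obtains z where "\<And>k. k \<in> labels \<Longrightarrow> z k \<in> carrier G" "\<And>m. m < r \<Longrightarrow> z (True, Inl m) = f m"
    "wval G (\<lambda>l. z (True, l)) (nested_word 0 r) = wval G (\<lambda>l. z (False, l)) (nested_word 0 r)"
    "\<And>u. \<forall>x\<in>set u. fst x \<in> labels \<Longrightarrow> wval G z u = \<one> \<Longrightarrow> wval P4 (case_prod gn3) u = \<one>\<^bsub>P4\<^esub>"
proof -
  note [simp] = double_gen(1)
  define E where "E = {point (\<lambda>a. \<phi>0 (\<tau> a)) | \<tau>. \<tau> \<in> marked_monos r}"
  define X where "X = Y closure_of E"
  have EI: "point (\<lambda>a. \<phi>0 (\<tau> a)) \<in> E" if "\<tau> \<in> marked_monos r" for \<tau> using that by (auto simp: E_def)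
  have top: "topspace Y = (\<Pi>\<^sub>E k\<in>labels. carrier G)" by (simp add: topspace_eq_carrier)
  have EY: "E \<subseteq> topspace Y"
  proof
    fix p assume "p \<in> E"
    then obtain \<tau> where t: "p = point (\<lambda>a. \<phi>0 (\<tau> a))" "\<tau> \<in> marked_monos r" by (auto simp: E_def)
    have "\<phi>0 (\<tau> (gn3 b l)) \<in> carrier G" for b l by (rule hom_in_carrier[OF marked_hom[OF t(2)]]) simp
    then show "p \<in> topspace Y" unfolding top t(1) point_def by (intro restrict_PiE_iff[THEN iffD2] ballI) auto
  qed
  have EX: "E \<subseteq> X" unfolding X_def by (rule closure_of_subset[OF EY])
  have topX: "topspace (subtopology Y X) = X" unfolding topspace_subtopology X_def by (rule Int_absorb1[OF closure_of_subset_topspace])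
  have "finite {k \<in> labels. \<not> compact_space T}" using finite_labels by simp
  then have lcY: "locally_compact_space Y" unfolding locally_compact_space_product_topology using lc by simp
  have "Hausdorff_space Y" unfolding Hausdorff_space_product_topology using Hausdorff by simp
  then have lcX: "locally_compact_space (subtopology Y X)" and HX: "Hausdorff_space (subtopology Y X)"
    unfolding X_def by (auto intro: locally_compact_space_closed_subset[OF lcY] Hausdorff_space_subtopology)
  have reg: "regular_space (subtopology Y X)" by (rule locally_compact_Hausdorff_imp_regular_space[OF lcX HX])
  have proj: "continuous_map Y T (\<lambda>z. z k)" if "k \<in> labels" for k
    using continuous_map_product_projection[OF that, of "\<lambda>_. T"] .
  have ev: "continuous_map Y T (\<lambda>z. wval G z u)" if "\<forall>x\<in>set u. fst x \<in> labels" for u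
    by (rule continuous_map_wval[of u Y "\<lambda>z. z"]) (use that proj in blast)
  \<comment> \<open>Equations between continuous functions extend from \<open>E\<close> to its
    closure; this gives the values on the basis of \<open>F\<close> and the relation between the
    halves.\<close>
  have lim: "g z = g' z" if "continuous_map Y T g" "continuous_map Y T g'"
    "\<And>\<tau>. \<tau> \<in> marked_monos r \<Longrightarrow> g (point (\<lambda>a. \<phi>0 (\<tau> a))) = g' (point (\<lambda>a. \<phi>0 (\<tau> a)))" "z \<in> X" for g g' z
  proof -
    have "E \<subseteq> {z \<in> topspace Y. g z = g' z}" using EY that(3) by (auto simp: E_def)
    then have "X \<subseteq> {z \<in> topspace Y. g z = g' z}"
      unfolding X_def by (rule closure_of_minimal) (rule closedin_continuous_maps_eq[OF Hausdorff that(1,2)])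
    then show ?thesis using that(4) by blast
  qed
  define W where "W = {u. (\<forall>x\<in>set u. fst x \<in> labels) \<and> wval P4 (case_prod gn3) u \<noteq> \<one>\<^bsub>P4\<^esub>}"
  define C where "C u = {z \<in> topspace (subtopology Y X). wval G z u = \<one>}" for u
  have Ccl: "closedin (subtopology Y X) (C u)" if "u \<in> W" for u
    unfolding C_def
  proof (rule closedin_continuous_maps_eq[OF Hausdorff])
    show "continuous_map (subtopology Y X) T (\<lambda>z. wval G z u)"
      by (rule continuous_map_from_subtopology[OF ev]) (use that in \<open>simp add: W_def\<close>)
  qed (simp add: topspace_eq_carrier)
  have Cint: "subtopology Y X interior_of C u = {}" if u: "u \<in> W" for u
  proof (rule ccontr)
    assume "subtopology Y X interior_of C u \<noteq> {}"
    then obtain p where p: "p \<in> subtopology Y X interior_of C u" by blast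
    obtain V where V: "openin Y V" "subtopology Y X interior_of C u = V \<inter> X"
      using openin_interior_of[of "subtopology Y X" "C u"] unfolding openin_subtopology by blast
    have sub: "V \<inter> X \<subseteq> C u" using interior_of_subset[of "subtopology Y X" "C u"] V(2) by simp
    \<comment> \<open>An open set that meets the closure meets \<open>E\<close> itself, so
      \<open>perturb\<close> can start from a marked monomorphism.\<close>
    have "V \<inter> E \<noteq> {}" using p V openin_Int_closure_of_eq_empty[OF V(1), of E] by (auto simp: X_def)
    then obtain \<tau> where t: "\<tau> \<in> marked_monos r" "point (\<lambda>a. \<phi>0 (\<tau> a)) \<in> V" by (auto simp: E_def)
    have a: "wval P4 (case_prod gn3) u \<in> carrier P4" "wval P4 (case_prod gn3) u \<noteq> \<one>\<^bsub>P4\<^esub>"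
      using u by (auto simp: W_def intro!: P.wval_closed split: prod.split)
    show False
    proof (rule perturb[OF t(1) a V(1) t(2)])
      fix \<tau>' assume t': "\<tau>' \<in> marked_monos r" "point (\<lambda>a. \<phi>0 (\<tau>' a)) \<in> V" "\<phi>0 (\<tau>' (wval P4 (case_prod gn3) u)) \<noteq> \<one>"
      have "point (\<lambda>a. \<phi>0 (\<tau>' a)) \<in> C u" using t'(2) EI[OF t'(1)] EX sub by blast
      then show False using t'(3) wval_point[OF marked_hom[OF t'(1)], of u] u by (simp add: C_def W_def)
    qed
  qed
  have "countable (C ` W)" by (intro countable_image countableI_type)
  then have "subtopology Y X interior_of \<Union> (C ` W) = {}"
    by (rule Baire_category_alt[OF disjI2[OF conjI[OF lcX reg]]]) (use Ccl Cint in blast)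
  moreover have "X \<noteq> {}" using EX EI[OF marked_monos_id[OF r0]] by blast
  ultimately have "\<Union> (C ` W) \<noteq> topspace (subtopology Y X)" using topX interior_of_topspace by metis
  moreover have "\<Union> (C ` W) \<subseteq> topspace (subtopology Y X)" by (auto simp: C_def)
  ultimately obtain z where z: "z \<in> X" "z \<notin> \<Union> (C ` W)" using topX by blast
  have zY: "z \<in> topspace Y" using z(1) closure_of_subset_topspace[of Y E] unfolding X_def by blast
  show thesis
  proof (rule that[of z])
    show "z k \<in> carrier G" if "k \<in> labels" for k using zY that unfolding top by (rule PiE_mem)
    show "z (True, Inl m) = f m" if m: "m < r" for m
    proof (rule lim[OF _ _ _ z(1)])
      have k: "(True, Inl m) \<in> labels" using m by (simp add: labels_def)
      show "continuous_map Y T (\<lambda>z. z (True, Inl m))" by (rule proj[OF k])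
      show "continuous_map Y T (\<lambda>z. f m)" by (rule continuous_map_const_group) simp
      fix \<tau> assume "\<tau> \<in> marked_monos r"
      then show "point (\<lambda>a. \<phi>0 (\<tau> a)) (True, Inl m) = f m"
        using k m \<phi>0(2)[of "Inl m" True] by (simp add: point_def marked_monos_def[OF r0])
    qed
    have vl: "(b, fst x) \<in> labels" if "x \<in> set (nested_word 0 r)" for b x
      using valid_nested_word that by (auto simp: labels_def)
    show "wval G (\<lambda>l. z (True, l)) (nested_word 0 r) = wval G (\<lambda>l. z (False, l)) (nested_word 0 r)"
    proof (rule lim[OF _ _ _ z(1)])
      show "continuous_map Y T (\<lambda>z. wval G (\<lambda>l. z (True, l)) (nested_word 0 r))"
        "continuous_map Y T (\<lambda>z. wval G (\<lambda>l. z (False, l)) (nested_word 0 r))"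
        by (rule continuous_map_wval, rule proj, erule vl)+
      fix \<tau> assume t: "\<tau> \<in> marked_monos r"
      have "wval G (\<lambda>l. point (\<lambda>a. \<phi>0 (\<tau> a)) (b, l)) (nested_word 0 r) = \<phi>0 (\<tau> (wval P4 (gn3 b) (nested_word 0 r)))" for b
      proof -
        have "wval G (\<lambda>l. point (\<lambda>a. \<phi>0 (\<tau> a)) (b, l)) (nested_word 0 r) = wval G (\<lambda>l. \<phi>0 (\<tau> (gn3 b l))) (nested_word 0 r)"
          by (rule wval_cong) (use vl in \<open>simp add: point_def\<close>)
        also have "\<dots> = \<phi>0 (\<tau> (wval P4 (gn3 b) (nested_word 0 r)))"
          by (rule wval_hom[OF group_surface is_group marked_hom[OF t], symmetric]) simp
        finally show ?thesis .
      qed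
      then show "wval G (\<lambda>l. point (\<lambda>a. \<phi>0 (\<tau> a)) (True, l)) (nested_word 0 r) = wval G (\<lambda>l. point (\<lambda>a. \<phi>0 (\<tau> a)) (False, l)) (nested_word 0 r)"
        by (simp add: double_gen_relation[OF r0])
    qed
    fix u assume u: "\<forall>x\<in>set u. fst x \<in> labels" "wval G z u = \<one>"
    show "wval P4 (case_prod gn3) u = \<one>\<^bsub>P4\<^esub>"
    proof (rule ccontr)
      assume "wval P4 (case_prod gn3) u \<noteq> \<one>\<^bsub>P4\<^esub>"
      then have "z \<in> C u" "u \<in> W" using u z(1) topX by (simp_all add: C_def W_def)
      then show False using z(2) by blast
    qed
  qed
qed

text \<open>The relation satisfied by the faithful point makes it a homomorphism, by
  \<open>double_gen_hom\<close>. Every element of the surface group is the value of a word, so the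
  last property of the point says that the kernel is trivial.\<close>

lemma surface_overgroup:
  assumes lc: "locally_compact_space T"
  shows "\<exists>\<Gamma>. subgroup \<Gamma> G \<and> F \<subseteq> \<Gamma> \<and> surface_group_of_genus (2 * r) (subgroup_monoid G \<Gamma>)"
proof (rule faithful_point[OF lc])
  note [simp] = double_gen(1)
  fix z assume z: "\<And>k. k \<in> labels \<Longrightarrow> z k \<in> carrier G" "\<And>m. m < r \<Longrightarrow> z (True, Inl m) = f m"
    "wval G (\<lambda>l. z (True, l)) (nested_word 0 r) = wval G (\<lambda>l. z (False, l)) (nested_word 0 r)"
    "\<And>u. \<forall>x\<in>set u. fst x \<in> labels \<Longrightarrow> wval G z u = \<one> \<Longrightarrow> wval P4 (case_prod gn3) u = \<one>\<^bsub>P4\<^esub>"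
  define \<rho> where "\<rho> b l = (if valid_label r l then z (b, l) else \<one>)" for b l
  have "\<exists>\<psi>\<in>hom P4 G. \<forall>b l. valid_label r l \<longrightarrow> \<psi> (gn3 b l) = \<rho> b l"
  proof (rule double_gen_hom[OF r0 is_group])
    show "\<rho> b l \<in> carrier G" for b l using z(1)[of "(b, l)"] by (simp add: \<rho>_def labels_def)
    have "wval G (\<rho> b) (nested_word 0 r) = wval G (\<lambda>l. z (b, l)) (nested_word 0 r)" for b
      by (rule wval_cong) (simp add: \<rho>_def valid_nested_word)
    then show "wval G (\<rho> True) (nested_word 0 r) = wval G (\<rho> False) (nested_word 0 r)" using z(3) by simp
  qed
  then obtain \<psi> where psi: "\<psi> \<in> hom P4 G" "\<And>b l. valid_label r l \<Longrightarrow> \<psi> (gn3 b l) = z (b, l)"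
    by (auto simp: \<rho>_def)
  interpret psi: group_hom P4 G \<psi> using psi(1) by unfold_locales
  have ker: "a = \<one>\<^bsub>P4\<^esub>" if a: "a \<in> carrier P4" "\<psi> a = \<one>" for a
  proof (rule surface_words[OF r0 a(1)])
    fix u assume u: "\<forall>x\<in>set u. valid_label r (snd (fst x))" "a = wval P4 (\<lambda>(b, l). gn3 b l) u"
    have "wval G z u = wval G (\<lambda>x. \<psi> (case_prod gn3 x)) u"
      by (rule wval_cong) (use u(1) psi(2) in \<open>auto split: prod.split\<close>)
    also have "\<dots> = \<psi> a" unfolding u(2)
      by (rule wval_hom[OF group_surface is_group psi(1), symmetric]) (simp split: prod.split)
    finally have "wval G z u = \<one>" using a(2) by simp
    then show "a = \<one>\<^bsub>P4\<^esub>" unfolding u(2) using u(1) by (intro z(4)) (auto simp: labels_def)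
  qed
  have inj: "inj_on \<psi> (carrier P4)"
  proof (rule inj_onI)
    fix a b assume ab: "a \<in> carrier P4" "b \<in> carrier P4" "\<psi> a = \<psi> b"
    have "a \<otimes>\<^bsub>P4\<^esub> inv\<^bsub>P4\<^esub> b = \<one>\<^bsub>P4\<^esub>" by (rule ker) (use ab in simp_all)
    then show "a = b" using ab P.inv_equality[of a "inv\<^bsub>P4\<^esub> b"] by simp
  qed
  let ?\<Gamma> = "\<psi> ` carrier P4"
  show ?thesis
  proof (intro exI[of _ ?\<Gamma>] conjI)
    show "subgroup ?\<Gamma> G" by (rule psi.img_is_subgroup)
    show "F \<subseteq> ?\<Gamma>"
    proof
      fix h assume "h \<in> F"
      then obtain v where v: "h = wval G f v" "\<forall>x\<in>set v. fst x < r" using Fgen by blast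
      have "h = wval G (\<lambda>m. \<psi> (gn3 True (Inl m))) v"
        unfolding v(1) by (rule wval_cong) (use v(2) psi(2) z(2) in simp)
      also have "\<dots> = \<psi> (wval P4 (\<lambda>m. gn3 True (Inl m)) v)"
        by (rule wval_hom[OF group_surface is_group psi(1), symmetric]) simp
      finally show "h \<in> ?\<Gamma>" by (simp add: P.wval_closed)
    qed
    have "\<psi> \<in> iso P4 (subgroup_monoid G ?\<Gamma>)"
      using inj by (auto simp: iso_def hom_def bij_betw_def)
    then have "subgroup_monoid G ?\<Gamma> \<cong> P4" using P.iso_sym by (auto simp: is_iso_def)
    then show "surface_group_of_genus (2 * r) (subgroup_monoid G ?\<Gamma>)"
      unfolding surface_group_of_genus_def using base_pt_in_surface by blast
  qed
qed

end

lemma (in topological_group) nondiscrete_free_in_surface: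
  assumes lc: "locally_compact_space T" and F: "subgroup F G" and r: "r > 1"
    and free: "free_of_rank r (subgroup_monoid G F)" and nd: "\<not> discrete_subset T F"
  shows "\<exists>\<Gamma>. subgroup \<Gamma> G \<and> F \<subseteq> \<Gamma> \<and> surface_group_of_genus (2 * r) (subgroup_monoid G \<Gamma>)"
proof (rule free_basis[OF is_group F free])
  fix f assume fF: "\<And>m. f m \<in> F"
    and Fgen: "\<And>h. h \<in> F \<Longrightarrow> \<exists>v. h = wval G f v \<and> (\<forall>x\<in>set v. fst x < r)"
    and Ffree: "\<And>v. \<forall>x\<in>set v. fst x < r \<Longrightarrow> wval G f v = \<one> \<Longrightarrow> red v = []"
  have r0: "r > 0" using r by simp
  have "\<exists>\<phi>0\<in>hom (surf_group r) G. \<forall>b l. valid_label r l \<longrightarrow> \<phi>0 (double_gen r b l) = (\<lambda>b. case_sum f (\<lambda>_. \<one>)) b l"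
    by (rule double_gen_hom[OF r0 is_group]) (use fF subgroup.mem_carrier[OF F] in \<open>auto split: sum.split\<close>)
  then obtain \<phi>0 where \<phi>0: "\<phi>0 \<in> hom (surf_group r) G" "\<And>b l. valid_label r l \<Longrightarrow> \<phi>0 (double_gen r b l) = case_sum f (\<lambda>_. \<one>) l"
    by blast
  show ?thesis
    by (rule surface_overgroup[OF topological_group_axioms r F fF Fgen Ffree nd \<phi>0 lc])
qed

theorem theorem1p2:
  fixes G :: "('a, 'b) monoid_scheme" and T :: "'a topology"
  assumes "topological_group G T" and "locally_compact_space T"
  shows
    "(\<forall>F r. subgroup F G \<and> r > 1 \<and> free_of_rank r (subgroup_monoid G F) \<and> \<not> discrete_subset T F
        \<longrightarrow> (\<exists>\<Gamma>. subgroup \<Gamma> G \<and> F \<subseteq> \<Gamma> \<and> surface_group_of_genus (2 * r) (subgroup_monoid G \<Gamma>)))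
     \<and>
     (T \<noteq> discrete_topology (carrier G) \<and>
        (\<exists>F r. subgroup F G \<and> r > 1 \<and> free_of_rank r (subgroup_monoid G F) \<and> dense_subset T F)
        \<longrightarrow> (\<exists>\<Gamma>. subgroup \<Gamma> G \<and> dense_subset T \<Gamma> \<and> surface_group (subgroup_monoid G \<Gamma>)))"
proof (intro conjI allI impI; elim conjE exE)
  interpret topological_group G T by fact
  note surf = nondiscrete_free_in_surface[OF assms(2)]
  show "\<exists>\<Gamma>. subgroup \<Gamma> G \<and> F \<subseteq> \<Gamma> \<and> surface_group_of_genus (2 * r) (subgroup_monoid G \<Gamma>)"
    if "subgroup F G" "r > 1" "free_of_rank r (subgroup_monoid G F)" "\<not> discrete_subset T F" for F r
    by (rule surf[OF that])
  fix F r
  assume T: "T \<noteq> discrete_topology (carrier G)" and F: "subgroup F G" "r > 1" "free_of_rank r (subgroup_monoid G F)" "dense_subset T F"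
  obtain \<Gamma> where \<Gamma>: "subgroup \<Gamma> G" "F \<subseteq> \<Gamma>" "surface_group_of_genus (2 * r) (subgroup_monoid G \<Gamma>)"
    using surf[OF F(1-3) dense_nondiscrete[OF F(1,4) T]] by blast
  have "dense_subset T \<Gamma>"
    using closure_of_mono[OF \<Gamma>(2), of T] closure_of_subset_topspace[of T \<Gamma>] F(4) by blast
  moreover have "surface_group (subgroup_monoid G \<Gamma>)"
    unfolding surface_group_def using \<Gamma>(3) F(2) by (intro exI[of _ "2 * r"]) simp
  ultimately show "\<exists>\<Gamma>. subgroup \<Gamma> G \<and> dense_subset T \<Gamma> \<and> surface_group (subgroup_monoid G \<Gamma>)"
    using \<Gamma>(1) by blast
qed

end
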